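(* Let $P,Q\in \mathbb{C}^n$, let $\lambda\vdash n$ and $\mu\vdash n$ be the partitions recording the multiplicities of the coordinates of $P$ and $Q$ respectively, and let $Y = S_n\langle P,Q\rangle$. Let $\Sigma(P)=\sum_{i=1}^n P_i$ and $\Sigma(Q)=\sum_{i=1}^n Q_i$. If $\lambda\leq \mu$ in dominance order and $\Sigma(P)\neq \Sigma(Q)$, then \[ \widehat A(Y)\cong_{S_n} R_\lambda\oplus R_\mu(-1) \] as graded $S_n$-modules, where $R_\mu(-1)$ denotes $R_\mu$ shifted up in degree by $1$. Equivalently, \[ \mathrm{Frob}_q(\widehat A(Y)) = \widetilde H_\lambda(x;q) + q\,\widetilde H_\mu(x;q). \]
   Context: The symmetric group $S_n$ acts on $\mathbb{C}^n$ and on $\mathbb{C}[x_1,\dots,x_n]$ by permuting coordinates/variables. For a finite set $X\subset\mathbb{C}^n$, $S_n\langle X\rangle$ denotes the union of the $S_n$-orbits of the points of $X$. For a finite set $Y\subset \mathbb{C}^n$, $I(Y)=\bigcap_{y\in Y}(x_1-y_1,\dots,x_n-y_n)$ is the ideal of polynomials vanishing on $Y$. For a nonzero polynomial $f=f_0+f_1+\dots+f_d$ with $f_i$ homogeneous of degree $i$ and $f_d\neq0$, $\mathrm{top}(f)=f_d$. The top degree ideal is $T(Y)=(\mathrm{top}(f): f\in I(Y))$, and $\widehat A(Y)=\mathbb{C}[x_1,\dots,x_n]/T(Y)$, a graded $S_n$-module when $Y$ is $S_n$-stable. The partition recording the multiplicities of the coordinates of a point $P$ is the partition of $n$ whose parts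 are the numbers of coordinates of $P$ equal to each distinct value occurring in $P$. Dominance order: $\lambda\le\mu$ iff $\lambda_1+\dots+\lambda_i\le \mu_1+\dots+\mu_i$ for all $i$. For $\lambda\vdash n$, $R_\lambda = \mathbb{C}[x_1,\dots,x_n]/I_\lambda\cong H^*(\mathcal{B}_\lambda;\mathbb{C})$ is the cohomology ring of the Springer fiber of a nilpotent matrix of Jordan type $\lambda$, where $I_\lambda$ is the Tanisaki ideal; by a theorem of Garsia and Procesi, $I_\lambda = T(S_n\langle P'\rangle)$ for any $P'\in\mathbb{C}^n$ whose coordinate multiplicities are $\lambda$, and $\mathrm{Frob}_q(R_\lambda)=\widetilde H_\lambda(x;q)$, the modified Hall–Littlewood function. For a graded $S_n$-module $V=\bigoplus_i V_i$, $\mathrm{Frob}_q(V)=\sum_i q^i\,\mathrm{Frob}(V_i)$, where $\mathrm{Frob}$ is the Frobenius characteristic. *)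

theory Defs
  imports
    "HOL-Analysis.Finite_Cartesian_Product"
    "HOL-Library.Poly_Mapping"
    "HOL-Library.Multiset"
    "HOL-Combinatorics.Orbits"
    "HOL-Computational_Algebra.Formal_Laurent_Series"
    "HOL-Algebra.Module"
    "HOL-Algebra.QuotRing"
    "HOL-Algebra.Chinese_Remainder"
begin

section \<open>Polynomials\<close>

text \<open>
  Polynomials with variables indexed by \<open>'k\<close>. For a finite type \<open>'n\<close> with n elements,
  \<open>('n, complex) mpoly\<close> is \<open>\<complex>[x\<^sub>1,\<dots>,x\<^sub>n]\<close>, the space \<open>\<complex>\<^sup>n\<close> is \<open>complex ^ 'n\<close>, and \<open>S\<^sub>n\<close>
  consists of the maps \<open>\<pi>\<close> with \<open>\<pi> permutes (UNIV :: 'n set)\<close>.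
\<close>

type_synonym ('k, 'a) mpoly = "('k \<Rightarrow>\<^sub>0 nat) \<Rightarrow>\<^sub>0 'a"

definition var :: "'k \<Rightarrow> ('k, 'a::comm_ring_1) mpoly" where
  "var i = Poly_Mapping.single (Poly_Mapping.single i 1) 1"

definition cnst :: "'a \<Rightarrow> ('k, 'a::comm_ring_1) mpoly" where
  "cnst c = Poly_Mapping.single 0 c"

definition mdeg :: "('k \<Rightarrow>\<^sub>0 nat) \<Rightarrow> nat" where
  "mdeg m = (\<Sum>i\<in>Poly_Mapping.keys m. Poly_Mapping.lookup m i)"

definition hom_component :: "nat \<Rightarrow> ('k, 'a::comm_ring_1) mpoly \<Rightarrow> ('k, 'a) mpoly" where
  "hom_component d f =
     (\<Sum>m\<in>{m \<in> Poly_Mapping.keys f. mdeg m = d}. Poly_Mapping.single m (Poly_Mapping.lookup f m))"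

definition homogeneous :: "nat \<Rightarrow> ('k, 'a::comm_ring_1) mpoly \<Rightarrow> bool" where
  "homogeneous d f \<longleftrightarrow> (\<forall>m\<in>Poly_Mapping.keys f. mdeg m = d)"

text \<open>The top homogeneous component; only meaningful for nonzero polynomials.\<close>

definition top_form :: "('k, 'a::comm_ring_1) mpoly \<Rightarrow> ('k, 'a) mpoly" where
  "top_form f = hom_component (Max (mdeg ` Poly_Mapping.keys f)) f"

definition eval_at :: "('n::finite, complex) mpoly \<Rightarrow> complex ^ 'n \<Rightarrow> complex" where
  "eval_at f P =
     (\<Sum>m\<in>Poly_Mapping.keys f. Poly_Mapping.lookup f m * (\<Prod>i\<in>UNIV. (P $ i) ^ Poly_Mapping.lookup m i))"

text \<open>The action of \<open>S\<^sub>n\<close> on polynomials: the algebra automorphism with \<open>x\<^sub>i \<mapsto> x\<^bsub>\<pi>(i)\<^esub>\<close>.\<close>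

definition perm_poly :: "('n \<Rightarrow> 'n) \<Rightarrow> ('n::finite, complex) mpoly \<Rightarrow> ('n, complex) mpoly" where
  "perm_poly \<pi> f =
     (\<Sum>m\<in>Poly_Mapping.keys f.
        cnst (Poly_Mapping.lookup f m) * (\<Prod>i\<in>UNIV. var (\<pi> i) ^ Poly_Mapping.lookup m i))"

definition poly_ring :: "('n, complex) mpoly ring" where
  "poly_ring = \<lparr>carrier = UNIV, mult = (*), one = 1, zero = 0, add = (+)\<rparr>"


section \<open>Orbits, vanishing ideals and top degree ideals\<close>

definition Sn_orbits :: "(complex ^ 'n::finite) set \<Rightarrow> (complex ^ 'n) set" where
  "Sn_orbits X = {\<chi> i. P $ \<pi> i | P \<pi>. P \<in> X \<and> \<pi> permutes UNIV}"

definition vanishing_ideal :: "(complex ^ 'n::finite) set \<Rightarrow> ('n, complex) mpoly set" where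
  "vanishing_ideal Y = {f. \<forall>y\<in>Y. eval_at f y = 0}"

definition top_ideal :: "(complex ^ 'n::finite) set \<Rightarrow> ('n, complex) mpoly set" where
  "top_ideal Y = Idl\<^bsub>poly_ring\<^esub> {top_form f | f. f \<in> vanishing_ideal Y \<and> f \<noteq> 0}"


section \<open>Partitions and the Tanisaki ideal\<close>

text \<open>Partitions are weakly decreasing lists of positive numbers; list positions start at 0.\<close>

definition coord_partition :: "complex ^ 'n::finite \<Rightarrow> nat list" where
  "coord_partition P =
     rev (sorted_list_of_multiset
            (image_mset (\<lambda>c. card {i. P $ i = c}) (mset_set (range (($) P)))))"

definition dominance_le :: "nat list \<Rightarrow> nat list \<Rightarrow> bool" where
  "dominance_le lam mu \<longleftrightarrow> (\<forall>i. sum_list (take i lam) \<le> sum_list (take i mu))"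

definition conj_part :: "nat list \<Rightarrow> nat \<Rightarrow> nat" where
  "conj_part lam j = length (filter (\<lambda>p. j \<le> p) lam)"

definition elem_sym :: "nat \<Rightarrow> 'k set \<Rightarrow> ('k, 'a::comm_ring_1) mpoly" where
  "elem_sym r S = (\<Sum>A\<in>{A. A \<subseteq> S \<and> card A = r}. \<Prod>i\<in>A. var i)"

text \<open>
  The Tanisaki ideal \<open>I\<^sub>\<lambda>\<close> in the presentation of Garsia and Procesi: with
  \<open>\<lambda>'\<^sub>1 \<ge> \<dots> \<ge> \<lambda>'\<^sub>n \<ge> 0\<close> the conjugate partition padded by zeros and
  \<open>d\<^sub>k(\<lambda>) = \<lambda>'\<^sub>n + \<lambda>'\<^bsub>n-1\<^esub> + \<dots> + \<lambda>'\<^bsub>n-k+1\<^esub>\<close>, it is generated by the elementary symmetric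
  polynomials \<open>e\<^sub>r(S)\<close>, S a set of k variables, \<open>k - d\<^sub>k(\<lambda>) < r \<le> k\<close>.
\<close>

definition tanisaki_d :: "nat \<Rightarrow> nat list \<Rightarrow> nat \<Rightarrow> nat" where
  "tanisaki_d n lam k = (\<Sum>j\<in>{n - k<..n}. conj_part lam j)"

definition tanisaki_ideal :: "nat list \<Rightarrow> ('n::finite, complex) mpoly set" where
  "tanisaki_ideal lam =
     Idl\<^bsub>poly_ring\<^esub> {elem_sym r S | r S.
       card S < r + tanisaki_d CARD('n) lam (card S) \<and> r \<le> card S}"


section \<open>Graded \<open>S\<^sub>n\<close>-modules\<close>

text \<open>
  The ring fields \<open>mult\<close> and \<open>one\<close> inherited from the record of modules play no role below.
  \<open>grade V d\<close> is the homogeneous component of degree d.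
\<close>

record ('n, 'v) graded_rep = "(complex, 'v) module" +
  act :: "('n \<Rightarrow> 'n) \<Rightarrow> 'v \<Rightarrow> 'v"
  grade :: "nat \<Rightarrow> 'v set"

text \<open>The quotient of the polynomial ring by a homogeneous \<open>S\<^sub>n\<close>-stable ideal J.\<close>

definition quotient_rep ::
    "('n::finite, complex) mpoly set \<Rightarrow> ('n, ('n, complex) mpoly set) graded_rep" where
  "quotient_rep J = (let A = poly_ring Quot J in
     \<lparr>carrier = carrier A, mult = mult A, one = one A, zero = zero A, add = add A,
      smult = (\<lambda>c v. (J +>\<^bsub>poly_ring\<^esub> cnst c) \<otimes>\<^bsub>A\<^esub> v),
      act = (\<lambda>\<pi> v. perm_poly \<pi> ` v),
      grade = (\<lambda>d. {J +>\<^bsub>poly_ring\<^esub> f | f. homogeneous d f})\<rparr>)"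

definition direct_sum ::
    "('n, 'v) graded_rep \<Rightarrow> ('n, 'w) graded_rep \<Rightarrow> ('n, 'v \<times> 'w) graded_rep" where
  "direct_sum V W = (let A = RDirProd V W in
     \<lparr>carrier = carrier A, mult = mult A, one = one A, zero = zero A, add = add A,
      smult = (\<lambda>c (v, w). (c \<odot>\<^bsub>V\<^esub> v, c \<odot>\<^bsub>W\<^esub> w)),
      act = (\<lambda>\<pi> (v, w). (act V \<pi> v, act W \<pi> w)),
      grade = (\<lambda>d. grade V d \<times> grade W d)\<rparr>)"

text \<open>\<open>shift_up k V\<close> is \<open>V(-k)\<close>.\<close>

definition shift_up :: "nat \<Rightarrow> ('n, 'v) graded_rep \<Rightarrow> ('n, 'v) graded_rep" where
  "shift_up k V = V\<lparr>grade := (\<lambda>d. if k \<le> d then grade V (d - k) else {\<zero>\<^bsub>V\<^esub>})\<rparr>"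

definition graded_iso :: "('n, 'v) graded_rep \<Rightarrow> ('n, 'w) graded_rep \<Rightarrow> bool" where
  "graded_iso V W \<longleftrightarrow> (\<exists>\<phi> \<in> iso (add_monoid V) (add_monoid W).
     (\<forall>c. \<forall>v\<in>carrier V. \<phi> (c \<odot>\<^bsub>V\<^esub> v) = c \<odot>\<^bsub>W\<^esub> \<phi> v) \<and>
     (\<forall>\<pi>. \<pi> permutes UNIV \<longrightarrow> (\<forall>v\<in>carrier V. \<phi> (act V \<pi> v) = act W \<pi> (\<phi> v))) \<and>
     (\<forall>d. \<phi> ` grade V d = grade W d))"

definition A_hat :: "(complex ^ 'n::finite) set \<Rightarrow> ('n, ('n, complex) mpoly set) graded_rep" where
  "A_hat Y = quotient_rep (top_ideal Y)"

definition springer_R :: "nat list \<Rightarrow> ('n::finite, ('n, complex) mpoly set) graded_rep" where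
  "springer_R lam = quotient_rep (tanisaki_ideal lam)"


section \<open>Graded Frobenius characteristic\<close>

definition is_basis :: "('n, 'v) graded_rep \<Rightarrow> 'v set \<Rightarrow> 'v set \<Rightarrow> bool" where
  "is_basis V U B \<longleftrightarrow> finite B \<and> B \<subseteq> U \<and>
     (\<forall>v\<in>U. \<exists>!c. c \<in> B \<rightarrow>\<^sub>E UNIV \<and> v = (\<Oplus>\<^bsub>V\<^esub>b\<in>B. c b \<odot>\<^bsub>V\<^esub> b))"

definition coords :: "('n, 'v) graded_rep \<Rightarrow> 'v set \<Rightarrow> 'v \<Rightarrow> 'v \<Rightarrow> complex" where
  "coords V B v = (THE c. c \<in> B \<rightarrow>\<^sub>E UNIV \<and> v = (\<Oplus>\<^bsub>V\<^esub>b\<in>B. c b \<odot>\<^bsub>V\<^esub> b))"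

text \<open>The trace of a linear endomorphism T of a finite-dimensional subspace U of V.\<close>

definition trace_on :: "('n, 'v) graded_rep \<Rightarrow> 'v set \<Rightarrow> ('v \<Rightarrow> 'v) \<Rightarrow> complex" where
  "trace_on V U T = (let B = (SOME B. is_basis V U B) in \<Sum>b\<in>B. coords V B (T b) b)"

text \<open>
  A symmetric function with coefficients in \<open>\<complex>[q, q\<^sup>-\<^sup>1]\<close> is represented by its
  specializations to N variables \<open>x\<^sub>0,\<dots>,x\<^bsub>N-1\<^esub>\<close>, for all N: an identity of symmetric functions
  is an identity of these polynomials for every N. The parameter q is \<open>fls_X\<close>.
\<close>

type_synonym sympoly = "(nat, complex fls) mpoly"

definition power_sum :: "nat \<Rightarrow> nat \<Rightarrow> sympoly" where
  "power_sum N k = (\<Sum>i<N. var i ^ k)"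

text \<open>\<open>(1/n!) \<Sum>\<^sub>\<pi> \<chi>(\<pi>) p\<^bsub>cyc(\<pi>)\<^esub>\<close> for the character \<open>\<chi>\<close> of the component of degree d; the cycle
  type of \<open>\<pi>\<close> is given by the sizes of its orbits (fixed points included).\<close>

definition frob :: "nat \<Rightarrow> ('n::finite, 'v) graded_rep \<Rightarrow> nat \<Rightarrow> sympoly" where
  "frob N V d =
     (\<Sum>\<pi>\<in>{\<pi> :: 'n \<Rightarrow> 'n. \<pi> permutes UNIV}.
        cnst (fls_const (trace_on V (grade V d) (act V \<pi>) / fact CARD('n))) *
        (\<Prod>C\<in>range (orbit \<pi>). power_sum N (card C)))"

text \<open>The sum ranges over the nonzero components, finitely many if V is finite-dimensional.\<close>

definition frob_q :: "nat \<Rightarrow> ('n::finite, 'v) graded_rep \<Rightarrow> sympoly" where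
  "frob_q N V = (\<Sum>d\<in>{d. grade V d \<noteq> {\<zero>\<^bsub>V\<^esub>}}. cnst (fls_X ^ d) * frob N V d)"


section \<open>Modified Hall--Littlewood functions\<close>

definition complete_sym :: "nat \<Rightarrow> int \<Rightarrow> sympoly" where
  "complete_sym N r =
     (\<Sum>m\<in>{m. Poly_Mapping.keys m \<subseteq> {..<N} \<and> int (mdeg m) = r}. Poly_Mapping.single m 1)"

text \<open>The coefficient of \<open>x\<^sup>k\<close> in \<open>(1 - x) / (1 - t x)\<close>.\<close>

definition raising_coeff :: "complex fls \<Rightarrow> nat \<Rightarrow> complex fls" where
  "raising_coeff t k = (if k = 0 then 1 else t ^ k - t ^ (k - 1))"

text \<open>
  The transformed Hall--Littlewood function
  \<open>Q'\<^sub>\<lambda>(x;t) = \<Prod>\<^bsub>i<j\<^esub> (1 - R\<^bsub>ij\<^esub>)/(1 - t R\<^bsub>ij\<^esub>) h\<^sub>\<lambda> = \<Sum>\<^sub>\<nu> K\<^bsub>\<nu>\<lambda>\<^esub>(t) s\<^sub>\<nu>\<close>, where the raising operator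
  \<open>R\<^bsub>ij\<^esub>\<close> adds 1 to the i-th index of \<open>h\<^sub>\<lambda>\<close> and subtracts 1 from the j-th, and \<open>h\<^sub>r = 0\<close> for
  \<open>r < 0\<close>. The exponent \<open>a (i,j)\<close> of \<open>R\<^bsub>ij\<^esub>\<close> may be bounded by the size of \<open>\<lambda>\<close>: starting from the
  last index one sees that all larger exponents produce a negative index.
\<close>

definition index_pairs :: "nat \<Rightarrow> (nat \<times> nat) set" where
  "index_pairs l = {(i, j). i < j \<and> j < l}"

definition raised :: "nat list \<Rightarrow> (nat \<times> nat \<Rightarrow> nat) \<Rightarrow> nat \<Rightarrow> int" where
  "raised lam a i =
     int (lam ! i) + (\<Sum>j\<in>{i<..<length lam}. int (a (i, j))) - (\<Sum>j<i. int (a (j, i)))"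

definition hall_littlewood_Q' :: "nat \<Rightarrow> complex fls \<Rightarrow> nat list \<Rightarrow> sympoly" where
  "hall_littlewood_Q' N t lam =
     (\<Sum>a\<in>index_pairs (length lam) \<rightarrow>\<^sub>E {..sum_list lam}.
        cnst (\<Prod>p\<in>index_pairs (length lam). raising_coeff t (a p)) *
        (\<Prod>i<length lam. complete_sym N (raised lam a i)))"

text \<open>\<open>H\<^sub>\<lambda>(x;q) = q\<^bsup>n(\<lambda>)\<^esup> Q'\<^sub>\<lambda>(x;q\<^sup>-\<^sup>1)\<close> (written with a tilde in the literature), where
  \<open>n(\<lambda>) = \<Sum>\<^sub>i (i-1) \<lambda>\<^sub>i\<close>; its Schur coefficients are the cocharge Kostka--Foulkes polynomials.\<close>

definition modified_HL :: "nat \<Rightarrow> nat list \<Rightarrow> sympoly" where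
  "modified_HL N lam =
     cnst (fls_X ^ (\<Sum>i<length lam. i * lam ! i)) * hall_littlewood_Q' N fls_X_inv lam"

end

(*
  Write T for the top degree ideal of Y = S_n<P, Q>, and I_lambda, I_mu for the two Tanisaki ideals.

  Exact sequence.  Multiplication by e_1 induces 0 -> R_mu(-1) -> A/T -> R_lambda -> 0.  A generator
  e_r(S) of I_lambda is the top form of a polynomial vanishing on the orbit of P; since lambda <= mu,
  each generator of I_lambda also lies in I_mu, so it has a second lift vanishing on the orbit of Q.
  The affine function of e_1 that separates the two orbits interpolates between the lifts, whence
  e_1 I_mu <= T <= I_lambda = T + (e_1).  Exactness on the left follows by counting points of Y, and
  averaging over S_n splits the sequence.

  Frobenius characteristic.  It suffices to know the signed sums of a character over all Young
  subgroups, that is, the dimensions of the antisymmetric parts.  For R_lambda these have a basis of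
  antisymmetrized monomials x^e whose exponent lists are admissible: they span by straightening, which
  rests on x_b^e I' <= I_lambda + (x_b^(e+1)) with I' the ideal of lambda with a box removed from row
  e, and they are independent because there are as many of them as points with trivial stabilizer in
  the orbit of P, up to the Young subgroup.  Counting by degree gives a recursion; the raising operator
  formula for Hall-Littlewood functions satisfies the same one, by means of the straightening rule
  Q'_(s, s+1) = t Q'_(s+1, s).
*)
theory Submission
imports Defs "HOL-Library.Function_Algebras"
begin

text \<open>That I_lambda is the top degree ideal of an orbit is not assumed. Spanning is proved
  modulo I_lambda and independence modulo the a priori larger top degree ideal, and the two counts
  agree; this forces equality, and the same comparison serves for two orbits. The count of points is
  the number of 0-1 matrices with given row and column sums, that is, the pairing of h_alpha with a
  product of elementary symmetric functions. These numbers are symmetric in alpha and can replace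
  h_alpha in the raising operator formula. Hence exponent lists, matrices and Hall-Littlewood
  functions obey one abstract recursion by box removal; its delicate point is to move the shortened
  row past rows of equal length. Signed sums over Young subgroups suffice because Frobenius images
  weight a permutation by power sums, which see only its orbits: a triangular induction on orbit
  partitions takes the place of irreducible characters and Schur functions. This uses all colourings
  of the variables; an injective colouring makes antisymmetrization the identity and yields the
  ordinary monomial basis.\<close>

lemma monomial_decomposition:
  "f = (\<Sum>m\<in>Poly_Mapping.keys f. Poly_Mapping.single m (Poly_Mapping.lookup f m))"
  by (rule poly_mapping_eqI)
     (auto simp: lookup_sum lookup_single when_def sum.delta' in_keys_iff)

lemma cnst_simps [simp]:
  "cnst 0 = 0" "cnst 1 = 1"
  by (auto simp: cnst_def)

lemma cnst_add: "cnst (a + b) = cnst a + cnst b"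
  and cnst_mult: "cnst (a * b) = cnst a * cnst b"
  and cnst_minus: "cnst (- a) = - cnst a"
  and cnst_diff: "cnst (a - b) = cnst a - cnst b"
  by (simp_all add: cnst_def single_add mult_single single_uminus single_diff)

lemma cnst_sum: "cnst (sum f A) = (\<Sum>x\<in>A. cnst (f x))"
  by (induction A rule: infinite_finite_induct) (simp_all add: cnst_add)

lemma cnst_mult_single: "cnst c * Poly_Mapping.single m a = Poly_Mapping.single m (c * a)"
  by (simp add: cnst_def mult_single)

lemma lookup_cnst_mult [simp]:
  "Poly_Mapping.lookup (cnst c * f) m = c * Poly_Mapping.lookup f m"
proof -
  have "cnst c * f = (\<Sum>m\<in>Poly_Mapping.keys f. Poly_Mapping.single m (c * Poly_Mapping.lookup f m))"
    by (subst monomial_decomposition[of f]) (simp add: sum_distrib_left cnst_mult_single)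
  thus ?thesis
    by (auto simp: lookup_sum lookup_single when_def sum.delta' in_keys_iff)
qed

text \<open>Evaluation at a point and the action of a permutation are both substitutions for the
  variables along a ring homomorphism \<open>h\<close> of the coefficients: the identity in one
  case, \<open>cnst\<close> in the other. Their algebraic rules are proved once, for
  \<open>msubst\<close>.\<close>

locale coeff_hom =
  fixes h :: "'a::comm_ring_1 \<Rightarrow> 'b::comm_ring_1"
  assumes h_0: "h 0 = 0" and h_1: "h 1 = 1" and h_add: "h (a + b) = h a + h b"
    and h_mult: "h (a * b) = h a * h b"
begin

definition msubst :: "('k::finite \<Rightarrow> 'b) \<Rightarrow> ('k, 'a) mpoly \<Rightarrow> 'b" where
  "msubst g f = (\<Sum>m\<in>Poly_Mapping.keys f. h (Poly_Mapping.lookup f m) * (\<Prod>i\<in>UNIV. g i ^ Poly_Mapping.lookup m i))"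

lemma msubst_superset:
  assumes "finite A" "Poly_Mapping.keys f \<subseteq> A"
  shows "msubst g f = (\<Sum>m\<in>A. h (Poly_Mapping.lookup f m) * (\<Prod>i\<in>UNIV. g i ^ Poly_Mapping.lookup m i))"
  unfolding msubst_def using assms
  by (intro sum.mono_neutral_left) (auto simp: in_keys_iff h_0)

lemma msubst_add: "msubst g (f1 + f2) = msubst g f1 + msubst g f2"
proof -
  let ?A = "Poly_Mapping.keys f1 \<union> Poly_Mapping.keys f2"
  have "Poly_Mapping.keys (f1 + f2) \<subseteq> ?A" by (rule keys_add)
  thus ?thesis
    by (simp add: msubst_superset[of ?A] lookup_add h_add distrib_right sum.distrib)
qed

lemma msubst_0 [simp]: "msubst g 0 = 0"
  by (simp add: msubst_def)

lemma msubst_sum: "msubst g (sum f A) = (\<Sum>x\<in>A. msubst g (f x))"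
  by (induction A rule: infinite_finite_induct) (simp_all add: msubst_add)

lemma msubst_single:
  "msubst g (Poly_Mapping.single m c) = h c * (\<Prod>i\<in>UNIV. g i ^ Poly_Mapping.lookup m i)"
  by (cases "c = 0") (simp_all add: msubst_def h_0)

lemma msubst_mult: "msubst g (f1 * f2) = msubst g f1 * msubst g f2"
proof -
  have "msubst g (f1 * f2) = (\<Sum>m\<in>Poly_Mapping.keys f1. \<Sum>m'\<in>Poly_Mapping.keys f2.
      msubst g (Poly_Mapping.single (m + m') (Poly_Mapping.lookup f1 m * Poly_Mapping.lookup f2 m')))"
    by (subst monomial_decomposition[of f1], subst monomial_decomposition[of f2])
       (simp add: sum_product msubst_sum mult_single)
  also have "\<dots> = msubst g f1 * msubst g f2"
    unfolding msubst_def[of g f1] msubst_def[of g f2] sum_product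
    by (intro sum.cong refl)
       (simp add: msubst_single h_mult lookup_add power_add prod.distrib mult_ac)
  finally show ?thesis .
qed

lemma msubst_1 [simp]: "msubst g 1 = 1"
  using msubst_single[of g 0 1] by (simp add: h_1)

lemma msubst_cnst: "msubst g (cnst c) = h c"
  unfolding cnst_def by (simp add: msubst_single)

lemma msubst_var: "msubst g (var i) = g i"
proof -
  have "(\<Prod>j\<in>UNIV. g j ^ Poly_Mapping.lookup (Poly_Mapping.single i (1::nat)) j)
      = (\<Prod>j\<in>UNIV. if j = i then g j else 1)"
    by (intro prod.cong) (auto simp: lookup_single when_def)
  thus ?thesis unfolding var_def by (simp add: msubst_single h_1 prod.delta)
qed

lemma msubst_minus: "msubst g (- f) = - msubst g f"
  using msubst_add[of g f "- f"] by (simp add: add_eq_0_iff)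

lemma msubst_diff: "msubst g (f1 - f2) = msubst g f1 - msubst g f2"
  using msubst_add[of g f1 "- f2"] by (simp add: msubst_minus)

lemma msubst_power: "msubst g (f ^ k) = msubst g f ^ k"
  by (induction k) (simp_all add: msubst_mult)

lemma msubst_prod: "msubst g (prod f A) = (\<Prod>x\<in>A. msubst g (f x))"
  by (induction A rule: infinite_finite_induct) (simp_all add: msubst_mult)

end

interpretation eval_hom: coeff_hom "\<lambda>c::complex. c"
  by unfold_locales auto

interpretation perm_hom: coeff_hom "cnst :: complex \<Rightarrow> ('n, complex) mpoly"
  by unfold_locales (auto simp: cnst_add cnst_mult)

lemma eval_at_msubst: "eval_at f P = eval_hom.msubst (($) P) f"
  by (simp add: eval_at_def eval_hom.msubst_def)

lemma perm_poly_msubst: "perm_poly \<pi> f = perm_hom.msubst (\<lambda>i. var (\<pi> i)) f"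
  by (simp add: perm_poly_def perm_hom.msubst_def)

lemma eval_at_add: "eval_at (f + g) P = eval_at f P + eval_at g P"
  and eval_at_mult: "eval_at (f * g) P = eval_at f P * eval_at g P"
  and eval_at_minus: "eval_at (- f) P = - eval_at f P"
  and eval_at_diff: "eval_at (f - g) P = eval_at f P - eval_at g P"
  and eval_at_power: "eval_at (f ^ k) P = eval_at f P ^ k"
  and eval_at_sum: "eval_at (sum F A) P = (\<Sum>x\<in>A. eval_at (F x) P)"
  and eval_at_prod: "eval_at (prod F A) P = (\<Prod>x\<in>A. eval_at (F x) P)"
  and eval_at_cnst [simp]: "eval_at (cnst c) P = c"
  and eval_at_var [simp]: "eval_at (var i) P = P $ i"
  and eval_at_0 [simp]: "eval_at 0 P = 0"
  and eval_at_1 [simp]: "eval_at 1 P = 1"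
  by (simp_all add: eval_at_msubst eval_hom.msubst_add eval_hom.msubst_mult eval_hom.msubst_minus
      eval_hom.msubst_diff eval_hom.msubst_power eval_hom.msubst_sum eval_hom.msubst_prod
      eval_hom.msubst_cnst eval_hom.msubst_var)

lemma perm_poly_add: "perm_poly \<pi> (f + g) = perm_poly \<pi> f + perm_poly \<pi> g"
  and perm_poly_mult: "perm_poly \<pi> (f * g) = perm_poly \<pi> f * perm_poly \<pi> g"
  and perm_poly_minus: "perm_poly \<pi> (- f) = - perm_poly \<pi> f"
  and perm_poly_diff: "perm_poly \<pi> (f - g) = perm_poly \<pi> f - perm_poly \<pi> g"
  and perm_poly_power: "perm_poly \<pi> (f ^ k) = perm_poly \<pi> f ^ k"
  and perm_poly_sum: "perm_poly \<pi> (sum F A) = (\<Sum>x\<in>A. perm_poly \<pi> (F x))"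
  and perm_poly_prod: "perm_poly \<pi> (prod F A) = (\<Prod>x\<in>A. perm_poly \<pi> (F x))"
  and perm_poly_cnst [simp]: "perm_poly \<pi> (cnst c) = cnst c"
  and perm_poly_var [simp]: "perm_poly \<pi> (var i) = var (\<pi> i)"
  and perm_poly_0 [simp]: "perm_poly \<pi> 0 = 0"
  and perm_poly_1 [simp]: "perm_poly \<pi> 1 = 1"
  by (simp_all add: perm_poly_msubst perm_hom.msubst_add perm_hom.msubst_mult perm_hom.msubst_minus
      perm_hom.msubst_diff perm_hom.msubst_power perm_hom.msubst_sum perm_hom.msubst_prod
      perm_hom.msubst_cnst perm_hom.msubst_var)

lemma single_eq_prod_var:
  fixes m :: "'n::finite \<Rightarrow>\<^sub>0 nat"
  shows "Poly_Mapping.single m (c::'a::comm_ring_1) = cnst c * (\<Prod>i\<in>UNIV. var i ^ Poly_Mapping.lookup m i)"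
proof -
  have pow: "(var i :: ('n, 'a) mpoly) ^ k = Poly_Mapping.single (Poly_Mapping.single i k) 1" for i k
    by (induction k) (simp_all add: var_def mult_single single_add[symmetric] add.commute)
  have prod: "(\<Prod>i\<in>A. (var i :: ('n, 'a) mpoly) ^ Poly_Mapping.lookup m i)
      = Poly_Mapping.single (\<Sum>i\<in>A. Poly_Mapping.single i (Poly_Mapping.lookup m i)) 1" if "finite A" for A
    using that by induction (simp_all add: pow mult_single)
  have "(\<Sum>i\<in>UNIV. Poly_Mapping.single i (Poly_Mapping.lookup m i)) = m"
    by (rule poly_mapping_eqI) (simp add: lookup_sum lookup_single when_def sum.delta')
  thus ?thesis by (simp add: prod cnst_def mult_single)
qed

lemma mpoly_induct [case_names monom add]:
  fixes f :: "('n::finite, 'a::comm_ring_1) mpoly"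
  assumes "\<And>m c. Q (Poly_Mapping.single m c)" "\<And>f g. Q f \<Longrightarrow> Q g \<Longrightarrow> Q (f + g)"
  shows "Q f"
proof -
  have "Q (\<Sum>m\<in>A. Poly_Mapping.single m (Poly_Mapping.lookup f m))" if "finite A" for A
    using that
  proof induction
    case empty
    thus ?case using assms(1)[of 0 0] by simp
  qed (auto intro: assms)
  thus ?thesis by (subst monomial_decomposition) simp
qed

lemma perm_poly_comp: "perm_poly \<pi> (perm_poly \<sigma> f) = perm_poly (\<pi> \<circ> \<sigma>) f"
  by (induction f rule: mpoly_induct)
     (simp_all add: single_eq_prod_var perm_poly_add perm_poly_mult perm_poly_prod perm_poly_power)

lemma perm_poly_id [simp]: "perm_poly id f = f" "perm_poly (\<lambda>x. x) f = f"
  by (induction f rule: mpoly_induct)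
     (simp_all add: single_eq_prod_var perm_poly_add perm_poly_mult perm_poly_prod perm_poly_power)

text \<open>The substitution of x_(pi i) for x_i becomes precomposition of the coordinate vector
  with pi, which is how \<open>Sn_orbits\<close> is defined; this is why vanishing ideals of orbits
  are stable.\<close>

lemma eval_at_perm_poly: "eval_at (perm_poly \<pi> f) P = eval_at f (\<chi> i. P $ \<pi> i)"
  by (induction f rule: mpoly_induct)
     (simp_all add: single_eq_prod_var perm_poly_add perm_poly_mult perm_poly_prod perm_poly_power
       eval_at_add eval_at_mult eval_at_prod eval_at_power)

lemma perm_poly_inv:
  assumes "\<pi> permutes UNIV"
  shows "perm_poly \<pi> (perm_poly (inv_into UNIV \<pi>) f) = f" "perm_poly (inv_into UNIV \<pi>) (perm_poly \<pi> f) = f"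
  using assms by (simp_all add: perm_poly_comp permutes_inv_o)

subsection \<open>Homogeneous components\<close>

lemma mdeg_eq_sum:
  assumes "finite A" "Poly_Mapping.keys m \<subseteq> A"
  shows "mdeg m = (\<Sum>i\<in>A. Poly_Mapping.lookup m i)"
  unfolding mdeg_def using assms by (intro sum.mono_neutral_left) (auto simp: in_keys_iff)

lemma mdeg_add: "mdeg (m + m') = mdeg m + mdeg m'"
proof -
  let ?A = "Poly_Mapping.keys m \<union> Poly_Mapping.keys m'"
  have "Poly_Mapping.keys (m + m') \<subseteq> ?A" by (rule keys_add)
  thus ?thesis
    by (simp add: mdeg_eq_sum[of ?A] lookup_add sum.distrib)
qed

lemma mdeg_0 [simp]: "mdeg 0 = 0"
  by (simp add: mdeg_def)

lemma mdeg_single [simp]: "mdeg (Poly_Mapping.single i k) = k"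
  by (cases "k = 0") (simp_all add: mdeg_def)

lemma lookup_hom_component:
  "Poly_Mapping.lookup (hom_component d f) m = (if mdeg m = d then Poly_Mapping.lookup f m else 0)"
  unfolding hom_component_def
  by (auto simp: lookup_sum lookup_single when_def sum.delta' in_keys_iff)

lemma hom_component_add: "hom_component d (f + g) = hom_component d f + hom_component d g"
  and hom_component_minus: "hom_component d (- f) = - hom_component d f"
  and hom_component_0 [simp]: "hom_component d 0 = 0"
  and hom_component_cnst_mult: "hom_component d (cnst c * f) = cnst c * hom_component d f"
  by (rule poly_mapping_eqI, simp add: lookup_hom_component lookup_add)+

lemma hom_component_diff: "hom_component d (f - g) = hom_component d f - hom_component d g"
  using hom_component_add[of d f "- g"] by (simp add: hom_component_minus)

lemma hom_component_sum: "hom_component d (sum F A) = (\<Sum>x\<in>A. hom_component d (F x))"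
  by (induction A rule: infinite_finite_induct) (simp_all add: hom_component_add)

lemma hom_component_single:
  "hom_component d (Poly_Mapping.single m c) = (if mdeg m = d then Poly_Mapping.single m c else 0)"
  by (rule poly_mapping_eqI) (auto simp: lookup_hom_component lookup_single when_def)

lemma homogeneous_iff: "homogeneous d f \<longleftrightarrow> hom_component d f = f"
proof
  assume "homogeneous d f"
  thus "hom_component d f = f"
    by (intro poly_mapping_eqI) (auto simp: lookup_hom_component homogeneous_def in_keys_iff)
next
  assume "hom_component d f = f"
  hence "Poly_Mapping.lookup f m = (if mdeg m = d then Poly_Mapping.lookup f m else 0)" for m
    using lookup_hom_component[of d f m] by simp
  thus "homogeneous d f" by (metis homogeneous_def in_keys_iff)
qed

lemma hom_component_hom_component:
  "hom_component d (hom_component e f) = (if d = e then hom_component d f else 0)"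
  by (rule poly_mapping_eqI) (auto simp: lookup_hom_component)

lemma homogeneous_hom_component [simp]: "homogeneous d (hom_component d f)"
  by (simp add: homogeneous_iff hom_component_hom_component)

lemma hom_component_homogeneous:
  "homogeneous e f \<Longrightarrow> hom_component d f = (if d = e then f else 0)"
  using hom_component_hom_component[of d e f] by (auto simp: homogeneous_iff)

lemma homogeneous_0 [simp]: "homogeneous d 0"
  by (simp add: homogeneous_iff)

lemma homogeneous_add: "homogeneous d f \<Longrightarrow> homogeneous d g \<Longrightarrow> homogeneous d (f + g)"
  and homogeneous_diff: "homogeneous d f \<Longrightarrow> homogeneous d g \<Longrightarrow> homogeneous d (f - g)"
  and homogeneous_cnst_mult: "homogeneous d f \<Longrightarrow> homogeneous d (cnst c * f)"
  by (simp_all add: homogeneous_iff hom_component_add hom_component_diff hom_component_cnst_mult)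

lemma homogeneous_sum: "(\<And>x. x \<in> A \<Longrightarrow> homogeneous d (F x)) \<Longrightarrow> homogeneous d (sum F A)"
  by (simp add: homogeneous_iff hom_component_sum)

lemma hom_component_mult:
  fixes f g :: "('n::finite, 'a::comm_ring_1) mpoly"
  shows "hom_component d (f * g) = (\<Sum>i\<le>d. hom_component i f * hom_component (d - i) g)"
proof (induction f rule: mpoly_induct)
  case (monom m c)
  show ?case
  proof (induction g rule: mpoly_induct)
    case (monom m' c')
    have "(\<Sum>i\<le>d. hom_component i (Poly_Mapping.single m c) * hom_component (d - i) (Poly_Mapping.single m' c'))
        = (\<Sum>i\<le>d. if i = mdeg m then (if mdeg m + mdeg m' = d then Poly_Mapping.single (m + m') (c * c') else 0) else 0)"
      by (intro sum.cong) (auto simp: hom_component_single mult_single)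
    thus ?case by (auto simp: mult_single hom_component_single mdeg_add)
  qed (simp add: distrib_left hom_component_add sum.distrib)
qed (simp add: distrib_right hom_component_add sum.distrib)

lemma homogeneous_mult:
  fixes f g :: "('n::finite, 'a::comm_ring_1) mpoly"
  assumes "homogeneous d f" "homogeneous e g"
  shows "homogeneous (d + e) (f * g)"
proof -
  have "hom_component (d + e) (f * g) = (\<Sum>i\<le>d+e. if i = d then f * g else 0)"
    unfolding hom_component_mult using assms
    by (intro sum.cong) (auto simp: hom_component_homogeneous)
  thus ?thesis by (simp add: homogeneous_iff)
qed

lemma hom_component_mult_homogeneous:
  fixes f g :: "('n::finite, 'a::comm_ring_1) mpoly"
  assumes "homogeneous e f"
  shows "hom_component d (f * g) = (if e \<le> d then f * hom_component (d - e) g else 0)"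
proof -
  have "hom_component d (f * g) = (\<Sum>i\<le>d. if i = e then f * hom_component (d - e) g else 0)"
    unfolding hom_component_mult using assms
    by (intro sum.cong) (auto simp: hom_component_homogeneous)
  thus ?thesis by simp
qed

lemma homogeneous_cnst [simp]: "homogeneous 0 (cnst c)"
  by (simp add: homogeneous_iff cnst_def hom_component_single)

lemma homogeneous_1 [simp]: "homogeneous 0 1"
  using homogeneous_cnst[of 1] by simp

lemma homogeneous_var [simp]: "homogeneous 1 (var i)"
  by (simp add: homogeneous_iff var_def hom_component_single)

lemma homogeneous_var' [simp]: "homogeneous (Suc 0) (var i)"
  using homogeneous_var by simp

lemma homogeneous_power:
  fixes f :: "('n::finite, 'a::comm_ring_1) mpoly"
  shows "homogeneous d f \<Longrightarrow> homogeneous (d * k) (f ^ k)"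
  by (induction k) (auto intro!: homogeneous_mult)

lemma homogeneous_prod_var:
  fixes A :: "'n::finite set"
  shows "homogeneous (\<Sum>i\<in>A. e i) (\<Prod>i\<in>A. (var i :: ('n, 'a::comm_ring_1) mpoly) ^ e i)"
proof (induction A rule: infinite_finite_induct)
  case (insert x A)
  have "homogeneous (1 * e x + sum e A) ((var x :: ('n, 'a) mpoly) ^ e x * (\<Prod>i\<in>A. var i ^ e i))"
    by (intro homogeneous_mult homogeneous_power insert homogeneous_var)
  with insert show ?case by simp
qed auto

lemma homogeneous_perm_poly:
  assumes "homogeneous d f"
  shows "homogeneous d (perm_poly \<pi> f)"
  unfolding perm_poly_def
proof (intro homogeneous_sum homogeneous_cnst_mult)
  fix m assume "m \<in> Poly_Mapping.keys f"
  hence "mdeg m = d" using assms by (simp add: homogeneous_def)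
  hence "d = (\<Sum>i\<in>UNIV. 1 * Poly_Mapping.lookup m i)" by (simp add: mdeg_eq_sum[of UNIV])
  moreover have "homogeneous (\<Sum>i\<in>A. 1 * Poly_Mapping.lookup m i)
      (\<Prod>i\<in>A. (var (\<pi> i) :: ('a, complex) mpoly) ^ Poly_Mapping.lookup m i)" for A
    by (induction A rule: infinite_finite_induct)
       (auto intro!: homogeneous_mult homogeneous_power[of 1, simplified])
  ultimately show "homogeneous d (\<Prod>i\<in>UNIV. (var (\<pi> i) :: ('a, complex) mpoly) ^ Poly_Mapping.lookup m i)"
    by metis
qed

lemma hom_component_bound: "\<exists>D. \<forall>d>D. hom_component d f = 0"
proof (intro exI allI impI)
  \<comment> \<open>Inserting 0 keeps the maximum meaningful when f = 0.\<close>
  fix d assume d: "d > Max (insert 0 (mdeg ` Poly_Mapping.keys f))"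
  have "mdeg m \<noteq> d" if "m \<in> Poly_Mapping.keys f" for m
    using d that by (metis Max_ge finite.insertI finite_imageI finite_keys imageI insertCI not_less)
  thus "hom_component d f = 0"
    by (intro poly_mapping_eqI) (auto simp: lookup_hom_component in_keys_iff)
qed

lemma sum_hom_components:
  assumes "\<And>d. d > D \<Longrightarrow> hom_component d f = 0"
  shows "f = (\<Sum>d\<le>D. hom_component d f)"
proof (rule poly_mapping_eqI)
  fix m
  have "Poly_Mapping.lookup f m = 0" if "mdeg m > D"
    using assms[OF that] lookup_hom_component[of "mdeg m" f m] by simp
  thus "Poly_Mapping.lookup f m = Poly_Mapping.lookup (\<Sum>d\<le>D. hom_component d f) m"
    by (cases "mdeg m > D") (auto simp: lookup_sum lookup_hom_component sum.delta)
qed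

lemma hom_component_perm_poly:
  "hom_component d (perm_poly \<pi> f) = perm_poly \<pi> (hom_component d f)"
proof -
  obtain D where D: "\<And>d. d > D \<Longrightarrow> hom_component d f = 0" using hom_component_bound by blast
  have "hom_component d (perm_poly \<pi> f) = (\<Sum>e\<le>D. hom_component d (perm_poly \<pi> (hom_component e f)))"
    by (subst sum_hom_components[OF D]) (simp_all add: perm_poly_sum hom_component_sum)
  also have "\<dots> = (\<Sum>e\<le>D. if e = d then perm_poly \<pi> (hom_component d f) else 0)"
    by (intro sum.cong refl)
       (simp add: hom_component_homogeneous[OF homogeneous_perm_poly[OF homogeneous_hom_component]])
  finally show ?thesis using D[of d] by (auto simp: not_le)
qed

lemma top_form_eqI:
  assumes "hom_component d f \<noteq> 0" "\<And>e. e > d \<Longrightarrow> hom_component e f = 0"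
  shows "top_form f = hom_component d f"
proof -
  obtain m where m: "Poly_Mapping.lookup (hom_component d f) m \<noteq> 0"
    using assms(1) by (metis lookup_zero poly_mapping_eqI)
  hence m: "m \<in> Poly_Mapping.keys f" "mdeg m = d"
    by (auto simp: lookup_hom_component in_keys_iff split: if_splits)
  have "mdeg m' \<le> d" if "m' \<in> Poly_Mapping.keys f" for m'
  proof (rule ccontr)
    assume "\<not> mdeg m' \<le> d"
    hence "Poly_Mapping.lookup (hom_component (mdeg m') f) m' = 0" using assms(2) by simp
    thus False using that by (simp add: lookup_hom_component in_keys_iff)
  qed
  hence "Max (mdeg ` Poly_Mapping.keys f) = d"
    using m by (intro Max_eqI) auto
  thus ?thesis by (simp add: top_form_def)
qed

lemma top_formE:
  assumes "f \<noteq> 0"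
  obtains d where "top_form f = hom_component d f" "hom_component d f \<noteq> 0"
    "\<And>e. e > d \<Longrightarrow> hom_component e f = 0"
proof -
  obtain D where D: "\<And>d. d > D \<Longrightarrow> hom_component d f = 0" using hom_component_bound by blast
  have "\<exists>d. hom_component d f \<noteq> 0"
    using sum_hom_components[of D f] D assms by (metis sum.neutral)
  then obtain d0 where d0: "hom_component d0 f \<noteq> 0" by blast
  have bd: "\<And>d. hom_component d f \<noteq> 0 \<Longrightarrow> d \<le> D" using D by (meson not_le)
  have "hom_component (GREATEST d. hom_component d f \<noteq> 0) f \<noteq> 0"
    using GreatestI_nat[of "\<lambda>d. hom_component d f \<noteq> 0" d0 D] d0 bd by blast
  moreover have "hom_component e f = 0" if "e > (GREATEST d. hom_component d f \<noteq> 0)" for e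
    using Greatest_le_nat[of "\<lambda>d. hom_component d f \<noteq> 0" e D] bd that by fastforce
  ultimately show ?thesis using that top_form_eqI by blast
qed

subsection \<open>Ideals\<close>

text \<open>The set-level counterpart of the record-based \<open>ideal\<close> over
  \<open>poly_ring\<close>. After the translation \<open>ideal_iff_is_ideal\<close>, generated
  ideals are used only through the three facts in \<open>Idl_props\<close>.\<close>

definition is_ideal :: "'a::comm_ring_1 set \<Rightarrow> bool" where
  "is_ideal J \<longleftrightarrow> 0 \<in> J \<and> (\<forall>a\<in>J. \<forall>b\<in>J. a + b \<in> J) \<and> (\<forall>r. \<forall>a\<in>J. r * a \<in> J)"

lemma is_ideal_0: "is_ideal J \<Longrightarrow> 0 \<in> J"
  and is_ideal_add: "is_ideal J \<Longrightarrow> a \<in> J \<Longrightarrow> b \<in> J \<Longrightarrow> a + b \<in> J"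
  and is_ideal_mult: "is_ideal J \<Longrightarrow> a \<in> J \<Longrightarrow> r * a \<in> J"
  by (auto simp: is_ideal_def)

lemma is_ideal_mult_right: "is_ideal J \<Longrightarrow> a \<in> J \<Longrightarrow> a * r \<in> J"
  by (metis is_ideal_mult mult.commute)

lemma is_ideal_minus: "is_ideal J \<Longrightarrow> a \<in> J \<Longrightarrow> - a \<in> J"
  using is_ideal_mult[of J a "- 1"] by simp

lemma is_ideal_diff: "is_ideal J \<Longrightarrow> a \<in> J \<Longrightarrow> b \<in> J \<Longrightarrow> a - b \<in> J"
  using is_ideal_add[of J a "- b"] is_ideal_minus[of J b] by simp

lemma is_ideal_sum: "is_ideal J \<Longrightarrow> (\<And>x. x \<in> A \<Longrightarrow> F x \<in> J) \<Longrightarrow> sum F A \<in> J"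
  by (induction A rule: infinite_finite_induct) (auto simp: is_ideal_0 is_ideal_add)

lemma cring_poly_ring: "cring (poly_ring :: ('n, complex) mpoly ring)"
proof (rule cringI)
  show "abelian_group (poly_ring :: ('n, complex) mpoly ring)"
  proof (rule abelian_groupI)
    fix x :: "('n, complex) mpoly" assume "x \<in> carrier poly_ring"
    show "\<exists>y\<in>carrier poly_ring. y \<oplus>\<^bsub>poly_ring\<^esub> x = \<zero>\<^bsub>poly_ring\<^esub>"
      by (rule bexI[of _ "- x"]) (auto simp: poly_ring_def)
  qed (auto simp: poly_ring_def add_ac)
  show "Group.comm_monoid (poly_ring :: ('n, complex) mpoly ring)"
    by unfold_locales (auto simp: poly_ring_def mult_ac)
qed (auto simp: poly_ring_def distrib_right)

lemma poly_ring_simps [simp]: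
  "carrier poly_ring = UNIV" "(\<otimes>\<^bsub>poly_ring\<^esub>) = (*)" "(\<oplus>\<^bsub>poly_ring\<^esub>) = (+)"
  "\<zero>\<^bsub>poly_ring\<^esub> = 0" "\<one>\<^bsub>poly_ring\<^esub> = 1"
  by (simp_all add: poly_ring_def)

lemma a_inv_poly_ring [simp]: "\<ominus>\<^bsub>poly_ring\<^esub> x = - x"
proof -
  interpret cring "poly_ring :: ('a, complex) mpoly ring" by (rule cring_poly_ring)
  show ?thesis using minus_equality[of "- x" x] by simp
qed

lemma ideal_iff_is_ideal: "ideal J (poly_ring :: ('n, complex) mpoly ring) \<longleftrightarrow> is_ideal J"
proof
  assume "ideal J (poly_ring :: ('n, complex) mpoly ring)"
  then interpret ideal J "poly_ring :: ('n, complex) mpoly ring" .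
  show "is_ideal J" unfolding is_ideal_def
    using additive_subgroup.zero_closed[OF is_additive_subgroup]
      additive_subgroup.a_closed[OF is_additive_subgroup] I_l_closed by auto
next
  assume J: "is_ideal J"
  interpret cring "poly_ring :: ('n, complex) mpoly ring" by (rule cring_poly_ring)
  show "ideal J (poly_ring :: ('n, complex) mpoly ring)"
  proof (rule idealI)
    show "subgroup J (add_monoid (poly_ring :: ('n, complex) mpoly ring))"
    proof (rule subgroup.intro)
      fix x assume "x \<in> J"
      hence "\<ominus>\<^bsub>poly_ring\<^esub> x \<in> J" using J by (simp add: is_ideal_minus)
      thus "inv\<^bsub>add_monoid poly_ring\<^esub> x \<in> J" unfolding a_inv_def .
    qed (use J in \<open>auto simp: is_ideal_def\<close>)
  qed (use J in \<open>auto simp: is_ideal_mult is_ideal_mult_right ring_axioms\<close>)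
qed

lemma Idl_props:
  fixes S :: "('n, complex) mpoly set"
  shows is_ideal_Idl: "is_ideal (Idl\<^bsub>poly_ring\<^esub> S)"
    and Idl_superset: "S \<subseteq> Idl\<^bsub>poly_ring\<^esub> S"
    and Idl_least: "is_ideal J \<Longrightarrow> S \<subseteq> J \<Longrightarrow> Idl\<^bsub>poly_ring\<^esub> S \<subseteq> J"
proof -
  interpret cring "poly_ring :: ('n, complex) mpoly ring" by (rule cring_poly_ring)
  show "is_ideal (Idl\<^bsub>poly_ring\<^esub> S)"
    using genideal_ideal[of S] by (simp add: ideal_iff_is_ideal)
  show "S \<subseteq> Idl\<^bsub>poly_ring\<^esub> S" using genideal_self[of S] by simp
  show "Idl\<^bsub>poly_ring\<^esub> S \<subseteq> J" if "is_ideal J" "S \<subseteq> J"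
    using genideal_minimal[of J S] that by (simp add: ideal_iff_is_ideal)
qed

definition homogeneous_ideal :: "('n, complex) mpoly set \<Rightarrow> bool" where
  "homogeneous_ideal J \<longleftrightarrow> is_ideal J \<and> (\<forall>f\<in>J. \<forall>d. hom_component d f \<in> J)"

text \<open>The polynomials all of whose components lie in the generated ideal form an ideal
  themselves, because components of a product are convolutions, and homogeneous generators belong to
  it.\<close>

lemma homogeneous_ideal_Idl:
  fixes S :: "('n::finite, complex) mpoly set"
  assumes "\<And>f. f \<in> S \<Longrightarrow> \<exists>d. homogeneous d f"
  shows "homogeneous_ideal (Idl\<^bsub>poly_ring\<^esub> S)"
proof -
  let ?I = "Idl\<^bsub>poly_ring\<^esub> S"
  note I = is_ideal_Idl[of S]
  have "is_ideal {f. \<forall>d. hom_component d f \<in> ?I}"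
    unfolding is_ideal_def using I
    by (auto simp: hom_component_add hom_component_mult is_ideal_0 is_ideal_add
        intro!: is_ideal_sum is_ideal_mult)
  moreover have "S \<subseteq> {f. \<forall>d. hom_component d f \<in> ?I}"
  proof (intro subsetI CollectI allI)
    fix f d assume f: "f \<in> S"
    then obtain e where "homogeneous e f" using assms by blast
    thus "hom_component d f \<in> ?I"
      using f Idl_superset[of S] I by (auto simp: hom_component_homogeneous is_ideal_0)
  qed
  ultimately have "?I \<subseteq> {f. \<forall>d. hom_component d f \<in> ?I}" by (rule Idl_least)
  thus ?thesis using I by (auto simp: homogeneous_ideal_def)
qed

lemma perm_stable_Idl:
  assumes "\<And>f. f \<in> S \<Longrightarrow> perm_poly \<pi> f \<in> S" and "\<pi> permutes UNIV"
    and "f \<in> Idl\<^bsub>poly_ring\<^esub> S"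
  shows "perm_poly \<pi> f \<in> Idl\<^bsub>poly_ring\<^esub> S"
proof -
  let ?I = "Idl\<^bsub>poly_ring\<^esub> S"
  note I = is_ideal_Idl[of S]
  have "is_ideal {f. perm_poly \<pi> f \<in> ?I}"
    unfolding is_ideal_def using I
    by (auto simp: perm_poly_add perm_poly_mult is_ideal_0 is_ideal_add is_ideal_mult)
  moreover have "S \<subseteq> {f. perm_poly \<pi> f \<in> ?I}"
    using assms(1) Idl_superset[of S] by auto
  ultimately have "?I \<subseteq> {f. perm_poly \<pi> f \<in> ?I}" by (rule Idl_least)
  thus ?thesis using assms by auto
qed

subsection \<open>Elementary symmetric polynomials\<close>

lemma elem_sym_0 [simp]: "finite S \<Longrightarrow> elem_sym 0 S = 1"
proof -
  assume "finite S"
  hence "{A. A \<subseteq> S \<and> card A = 0} = {{}}" by (auto dest: finite_subset)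
  thus ?thesis by (simp add: elem_sym_def)
qed

lemma elem_sym_eq_0: "finite S \<Longrightarrow> card S < r \<Longrightarrow> elem_sym r S = 0"
proof -
  assume "finite S" "card S < r"
  hence "{A. A \<subseteq> S \<and> card A = r} = {}" by (auto dest: card_mono)
  thus ?thesis by (simp only: elem_sym_def sum.empty)
qed

lemma elem_sym_insert:
  fixes S :: "'k set"
  assumes "finite S" "b \<notin> S"
  shows "(elem_sym (Suc r) (insert b S) :: ('k, 'a::comm_ring_1) mpoly) = elem_sym (Suc r) S + var b * elem_sym r S"
proof -
  have split: "{A. A \<subseteq> insert b S \<and> card A = Suc r}
     = {A. A \<subseteq> S \<and> card A = Suc r} \<union> insert b ` {A. A \<subseteq> S \<and> card A = r}" (is "?L = ?R1 \<union> ?R2")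
  proof (intro equalityI subsetI)
    fix A assume A: "A \<in> ?L"
    show "A \<in> ?R1 \<union> ?R2"
    proof (cases "b \<in> A")
      case True
      have "finite A" using A assms by (auto dest: finite_subset)
      hence "card (A - {b}) = r" "A - {b} \<subseteq> S" "A = insert b (A - {b})"
        using A True by auto
      thus ?thesis by blast
    qed (use A in auto)
  next
    fix A assume "A \<in> ?R1 \<union> ?R2"
    thus "A \<in> ?L" using assms finite_subset[OF _ assms(1)] by (fastforce simp: card_insert_if)
  qed
  have inj: "inj_on (insert b) {A. A \<subseteq> S \<and> card A = r}"
    using assms by (intro inj_onI) (metis (no_types, lifting) insert_ident mem_Collect_eq subset_iff)
  have "(\<Sum>A\<in>?R2. \<Prod>i\<in>A. var i :: ('k, 'a) mpoly) = (\<Sum>A | A \<subseteq> S \<and> card A = r. \<Prod>i\<in>insert b A. var i)"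
    by (subst sum.reindex[OF inj]) simp
  also have "\<dots> = (\<Sum>A | A \<subseteq> S \<and> card A = r. var b * (\<Prod>i\<in>A. var i))"
    using assms by (intro sum.cong refl prod.insert) (auto dest: finite_subset)
  finally have "(\<Sum>A\<in>?R2. \<Prod>i\<in>A. var i :: ('k, 'a) mpoly) = var b * elem_sym r S"
    by (simp add: elem_sym_def sum_distrib_left)
  moreover have "(\<Sum>A\<in>?R1 \<union> ?R2. \<Prod>i\<in>A. var i :: ('k, 'a) mpoly) = (\<Sum>A\<in>?R1. \<Prod>i\<in>A. var i) + (\<Sum>A\<in>?R2. \<Prod>i\<in>A. var i)"
    using assms by (intro sum.union_disjoint) auto
  ultimately show ?thesis by (simp add: elem_sym_def split)
qed

lemma homogeneous_elem_sym: "homogeneous r (elem_sym r (S :: 'n::finite set) :: ('n, 'a::comm_ring_1) mpoly)"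
  unfolding elem_sym_def
proof (rule homogeneous_sum)
  fix A assume "A \<in> {A. A \<subseteq> S \<and> card A = r}"
  thus "homogeneous r (\<Prod>i\<in>A. var i :: ('n, 'a) mpoly)"
    using homogeneous_prod_var[where A = A and e = "\<lambda>_. 1"] by simp
qed

lemma perm_poly_elem_sym:
  assumes "\<pi> permutes UNIV"
  shows "perm_poly \<pi> (elem_sym r S) = elem_sym r (\<pi> ` S)"
proof -
  have inj: "inj \<pi>" using assms by (rule permutes_inj)
  have "{A. A \<subseteq> \<pi> ` S \<and> card A = r} = (`) \<pi> ` {A. A \<subseteq> S \<and> card A = r}"
    using inj by (auto simp: subset_image_iff card_image inj_on_subset)
  moreover have "inj_on ((`) \<pi>) {A. A \<subseteq> S \<and> card A = r}"
    using inj by (simp add: inj_on_def inj_image_eq_iff)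
  ultimately show ?thesis unfolding elem_sym_def
    using inj by (simp add: sum.reindex perm_poly_sum perm_poly_prod prod.reindex inj_on_subset o_def)
qed

section \<open>Spanning modulo the Tanisaki ideal\<close>

subsection \<open>Removing a box from a partition\<close>

text \<open>Zero rows are allowed: \<open>remove_box\<close> keeps the length of the list, so row
  indices, which serve as exponents, keep their range throughout the recursion.\<close>

definition desc :: "nat list \<Rightarrow> bool" where
  "desc lam \<longleftrightarrow> (\<forall>i j. i \<le> j \<and> j < length lam \<longrightarrow> lam ! j \<le> lam ! i)"

text \<open>Removing a box from row \<open>e\<close> and sorting amounts to removing it from the last row of the
  same length.\<close>

definition last_row :: "nat \<Rightarrow> nat list \<Rightarrow> nat" where
  "last_row e lam = Max {j. j < length lam \<and> lam ! j = lam ! e}"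

definition remove_box :: "nat \<Rightarrow> nat list \<Rightarrow> nat list" where
  "remove_box e lam = lam[last_row e lam := lam ! e - 1]"

lemma last_row:
  assumes "e < length lam"
  shows "last_row e lam < length lam" "lam ! last_row e lam = lam ! e" "e \<le> last_row e lam"
    "\<And>j. j < length lam \<Longrightarrow> lam ! j = lam ! e \<Longrightarrow> j \<le> last_row e lam"
proof -
  let ?M = "{j. j < length lam \<and> lam ! j = lam ! e}"
  have "last_row e lam \<in> ?M"
    unfolding last_row_def using assms by (intro Max_in) auto
  thus "last_row e lam < length lam" "lam ! last_row e lam = lam ! e" by auto
  show "j \<le> last_row e lam" if "j < length lam" "lam ! j = lam ! e" for j
    unfolding last_row_def using that by (intro Max_ge) auto
  thus "e \<le> last_row e lam" using assms by auto
qed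

lemma length_remove_box [simp]: "length (remove_box e lam) = length lam"
  by (simp add: remove_box_def)

text \<open>All rows after the last one of a given length are strictly shorter, so shortening that
  one by a box keeps the order.\<close>

lemma desc_remove_box:
  assumes "desc lam" "e < length lam"
  shows "desc (remove_box e lam)"
  unfolding desc_def
proof (intro allI impI)
  fix i j assume ij: "i \<le> j \<and> j < length (remove_box e lam)"
  note l = last_row[OF assms(2)]
  have "lam ! j \<le> lam ! i" using assms(1) ij by (auto simp: desc_def)
  moreover have "lam ! j < lam ! e" if "j > last_row e lam"
  proof -
    have "lam ! j \<le> lam ! last_row e lam" using that assms(1) ij by (auto simp: desc_def)
    moreover have "lam ! j \<noteq> lam ! e" using l(4)[of j] that ij by auto
    ultimately show ?thesis using l(2) by simp
  qed
  ultimately show "remove_box e lam ! j \<le> remove_box e lam ! i"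
    using ij l by (auto simp: remove_box_def nth_list_update)
qed

text \<open>Used with f the identity for the size of the partition and with f p = p - (n - k) for
  \<open>tanisaki_d\<close>. Adding terms on both sides avoids truncated subtraction.\<close>

lemma sum_list_map_remove_box:
  fixes f :: "nat \<Rightarrow> nat"
  assumes "e < length lam"
  shows "sum_list (map f (remove_box e lam)) + f (lam ! e) = sum_list (map f lam) + f (lam ! e - 1)"
proof -
  note l = last_row[OF assms]
  have "f (lam ! e) \<le> sum_list (map f lam)"
    by (rule member_le_sum_list) (use assms in auto)
  thus ?thesis
    using l by (simp add: remove_box_def map_update sum_list_update)
qed

lemma sum_list_remove_box:
  assumes "e < length lam" "lam ! e > 0"
  shows "Suc (sum_list (remove_box e lam)) = sum_list lam"
  using sum_list_map_remove_box[of e lam id] assms by simp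

text \<open>Double counting of the boxes in columns beyond n - k: by columns on the left, by rows on
  the right, where truncated subtraction discards the short rows.\<close>

lemma tanisaki_d_eq:
  assumes "\<And>p. p \<in> set lam \<Longrightarrow> p \<le> n" "k \<le> n"
  shows "tanisaki_d n lam k = (\<Sum>p\<leftarrow>lam. p - (n - k))"
  using assms
proof (induction lam)
  case (Cons p lam)
  have "conj_part (p # lam) j = (if j \<le> p then 1 else 0) + conj_part lam j" for j
    by (simp add: conj_part_def)
  hence "tanisaki_d n (p # lam) k = (\<Sum>j\<in>{n - k<..n}. if j \<le> p then 1 else 0) + tanisaki_d n lam k"
    by (simp add: tanisaki_d_def sum.distrib)
  also have "(\<Sum>j\<in>{n - k<..n}. if j \<le> p then 1 else 0) = card {j\<in>{n - k<..n}. j \<le> p}"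
    by (simp add: sum.inter_filter[symmetric])
  also have "{j\<in>{n - k<..n}. j \<le> p} = {n - k<..p}" using Cons.prems(1)[of p] by auto
  finally show ?case using Cons by simp
qed (simp add: tanisaki_d_def conj_part_def)

lemma member_le_sum_list_nat: "p \<in> set lam \<Longrightarrow> p \<le> sum_list (lam :: nat list)"
  by (rule member_le_sum_list) auto

text \<open>Both numbers count boxes beyond column n - k, since (n + 1) - (k + 1) = n - k. They
  differ exactly when the removed box, which sits in column \<open>lam ! e\<close>, is
  counted.\<close>

lemma tanisaki_d_remove_box:
  assumes "e < length lam" "lam ! e > 0" "sum_list lam = Suc n" "k \<le> n"
  shows "tanisaki_d n (remove_box e lam) k + (if n - k < lam ! e then 1 else 0) = tanisaki_d (Suc n) lam (Suc k)"
proof -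
  have "sum_list (remove_box e lam) = n" using sum_list_remove_box[OF assms(1,2)] assms(3) by simp
  hence "tanisaki_d n (remove_box e lam) k = (\<Sum>p\<leftarrow>remove_box e lam. p - (n - k))"
    using assms(4) by (intro tanisaki_d_eq) (auto dest: member_le_sum_list_nat)
  moreover have "tanisaki_d (Suc n) lam (Suc k) = (\<Sum>p\<leftarrow>lam. p - (Suc n - Suc k))"
    using assms(3,4) by (intro tanisaki_d_eq) (auto dest: member_le_sum_list_nat)
  ultimately show ?thesis
    using sum_list_map_remove_box[OF assms(1), of "\<lambda>p. p - (n - k)"] assms(2)
    by (cases "n - k < lam ! e") (simp_all only: if_True if_False diff_Suc_Suc, linarith+)
qed

lemma tanisaki_d_Suc:
  assumes "k < n"
  shows "tanisaki_d n lam (Suc k) = conj_part lam (n - k) + tanisaki_d n lam k"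
proof -
  have "{n - Suc k<..n} = insert (n - k) {n - k<..n}" using assms by auto
  thus ?thesis by (simp add: tanisaki_d_def)
qed

lemma tanisaki_d_full: "sum_list lam = n \<Longrightarrow> tanisaki_d n lam n = n"
  by (subst tanisaki_d_eq) (auto dest: member_le_sum_list_nat)

text \<open>In a decreasing list the rows of length at least m form an initial segment, which stops
  before row e.\<close>

lemma conj_part_le:
  assumes "desc lam" "e \<ge> length lam \<or> lam ! e < m"
  shows "conj_part lam m \<le> e"
proof -
  have "{i. i < length lam \<and> m \<le> lam ! i} \<subseteq> {..<e}"
  proof
    fix i assume i: "i \<in> {i. i < length lam \<and> m \<le> lam ! i}"
    show "i \<in> {..<e}"
    proof (rule ccontr)
      assume "i \<notin> {..<e}"
      hence "e \<le> i" by simp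
      hence "lam ! i \<le> lam ! e" "e < length lam" using assms(1) i by (auto simp: desc_def)
      thus False using assms(2) i by auto
    qed
  qed
  hence "card {i. i < length lam \<and> m \<le> lam ! i} \<le> card {..<e}" by (intro card_mono) auto
  thus ?thesis by (simp add: conj_part_def length_filter_conv_card)
qed

subsection \<open>The Tanisaki ideal on a set of variables\<close>

text \<open>The Tanisaki ideal of a subset V of the variables, extended to the full ring, so that an
  induction can drop one variable at a time without changing the type.\<close>

definition tanisaki_on :: "'n::finite set \<Rightarrow> nat list \<Rightarrow> ('n, complex) mpoly set" where
  "tanisaki_on V lam = Idl\<^bsub>poly_ring\<^esub> {elem_sym r S | r S.
     S \<subseteq> V \<and> card S < r + tanisaki_d (card V) lam (card S) \<and> r \<le> card S}"

lemma tanisaki_on_UNIV: "tanisaki_on UNIV lam = tanisaki_ideal lam"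
  by (simp add: tanisaki_on_def tanisaki_ideal_def)

lemma is_ideal_tanisaki_on: "is_ideal (tanisaki_on V lam)"
  unfolding tanisaki_on_def by (rule is_ideal_Idl)

lemma elem_sym_in_tanisaki_on:
  assumes "S \<subseteq> V" "card S < r + tanisaki_d (card V) lam (card S)"
  shows "elem_sym r S \<in> tanisaki_on V lam"
proof (cases "r \<le> card S")
  case True
  thus ?thesis unfolding tanisaki_on_def using assms by (intro subsetD[OF Idl_superset]) auto
qed (simp add: elem_sym_eq_0 is_ideal_0[OF is_ideal_tanisaki_on])

text \<open>Modulo \<open>J\<close> the polynomial e_(s+1)(S) equals -x_b e_s(S) for s at least r.
  Iterating h times trades the power of x_b for a higher index.\<close>

lemma var_power_elem_sym:
  assumes J: "is_ideal J" and "finite S" "b \<notin> S"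
    and e: "\<And>s. s > r \<Longrightarrow> elem_sym s (insert b S) \<in> J"
  shows "var b ^ h * elem_sym r S - (- 1) ^ h * elem_sym (r + h) S \<in> J"
proof (induction h)
  case 0
  thus ?case by (simp add: is_ideal_0[OF J])
next
  case (Suc h)
  have "elem_sym (Suc (r + h)) S + var b * elem_sym (r + h) S \<in> J"
    using e[of "Suc (r + h)"] assms by (simp add: elem_sym_insert)
  hence "var b * (var b ^ h * elem_sym r S - (- 1) ^ h * elem_sym (r + h) S)
      + (- 1) ^ h * (elem_sym (Suc (r + h)) S + var b * elem_sym (r + h) S) \<in> J"
    by (rule is_ideal_add[OF J is_ideal_mult[OF J Suc] is_ideal_mult[OF J]])
  thus ?case by (simp add: algebra_simps)
qed

context
  fixes V :: "'n::finite set" and lam :: "nat list" and b :: 'n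
  assumes lam: "desc lam" "sum_list lam = card V" and b: "b \<in> V"
begin

lemma card_V: "card V = Suc (card (V - {b}))"
  by (metis b card.remove finite)

text \<open>At the border r + d_(k+1) = k + 1 all e_s(S + b) with s > r lie in the ideal, so x_b^h
  e_r(S) is congruent to e_(r+h)(S) up to sign. For h = lambda'_(n-k) the identity d_(k+1) = h + d_k
  puts r + h just past the threshold for S.\<close>

lemma var_power_elem_sym_mem:
  assumes S: "S \<subseteq> V - {b}" and r: "r + tanisaki_d (card V) lam (Suc (card S)) = Suc (card S)"
    and e: "e \<ge> conj_part lam (card V - card S)"
  shows "var b ^ e * elem_sym r S \<in> tanisaki_on V lam"
proof -
  let ?J = "tanisaki_on V lam" and ?h = "conj_part lam (card V - card S)"
  note J = is_ideal_tanisaki_on[of V lam]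
  have bS: "b \<notin> S" "insert b S \<subseteq> V" using S b by auto
  have kV: "card S < card V" using card_mono[OF _ S] card_V by simp
  have "elem_sym s (insert b S) \<in> ?J" if "s > r" for s
    using bS r that by (intro elem_sym_in_tanisaki_on) auto
  hence "var b ^ ?h * elem_sym r S - (- 1) ^ ?h * elem_sym (r + ?h) S \<in> ?J"
    by (intro var_power_elem_sym[OF J]) (use bS in auto)
  moreover have "elem_sym (r + ?h) S \<in> ?J"
    using bS r tanisaki_d_Suc[OF kV, of lam] by (intro elem_sym_in_tanisaki_on) auto
  hence "(- 1) ^ ?h * elem_sym (r + ?h) S \<in> ?J" by (rule is_ideal_mult[OF J])
  ultimately have "var b ^ ?h * elem_sym r S \<in> ?J"
    using is_ideal_add[OF J] by fastforce
  hence "var b ^ (e - ?h) * (var b ^ ?h * elem_sym r S) \<in> ?J" by (rule is_ideal_mult[OF J])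
  thus ?thesis using e by (simp add: mult.assoc[symmetric] power_add[symmetric])
qed

text \<open>The border case r = 0 with S = V - {b}: there d_n = n, and the power required is the
  number of nonzero rows.\<close>

lemma var_power_in_tanisaki_on:
  assumes "e \<ge> length lam \<or> lam ! e = 0"
  shows "var b ^ e \<in> tanisaki_on V lam"
proof -
  have "var b ^ e * elem_sym 0 (V - {b}) \<in> tanisaki_on V lam"
  proof (rule var_power_elem_sym_mem)
    show "0 + tanisaki_d (card V) lam (Suc (card (V - {b}))) = Suc (card (V - {b}))"
      using tanisaki_d_full[OF lam(2)] card_V by simp
    show "conj_part lam (card V - card (V - {b})) \<le> e"
      using assms lam(1) card_V by (intro conj_part_le) auto
  qed auto
  thus ?thesis by simp
qed

text \<open>Checked on a generator e_r(S) of the smaller ideal. If e_r(S + b) belongs to the larger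
  partition's ideal, use e_r(S) = e_r(S + b) - x_b e_(r-1)(S). Otherwise the removed box lies in
  none of the counted columns, so at most e rows reach column n - k and the border case
  applies.\<close>

lemma var_power_mult_tanisaki_on:
  assumes e: "e < length lam" "lam ! e > 0" and f: "f \<in> tanisaki_on (V - {b}) (remove_box e lam)"
  shows "\<exists>t\<in>tanisaki_on V lam. \<exists>g. var b ^ e * f = t + var b ^ Suc e * g"
proof -
  let ?J = "tanisaki_on V lam"
  let ?K = "{f. \<exists>t\<in>?J. \<exists>g. var b ^ e * f = t + var b ^ Suc e * g}"
  note J = is_ideal_tanisaki_on[of V lam]
  have "is_ideal ?K"
    unfolding is_ideal_def
  proof (intro conjI ballI allI)
    have "var b ^ e * 0 = 0 + var b ^ Suc e * 0" by simp
    thus "0 \<in> ?K" using is_ideal_0[OF J] by blast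
  next
    fix f g assume "f \<in> ?K" "g \<in> ?K"
    then obtain t1 g1 t2 g2 where "t1 \<in> ?J" "t2 \<in> ?J"
      "var b ^ e * f = t1 + var b ^ Suc e * g1" "var b ^ e * g = t2 + var b ^ Suc e * g2" by blast
    hence "t1 + t2 \<in> ?J" "var b ^ e * (f + g) = (t1 + t2) + var b ^ Suc e * (g1 + g2)"
      by (auto simp: is_ideal_add[OF J] distrib_left)
    thus "f + g \<in> ?K" by blast
  next
    fix r f assume "f \<in> ?K"
    then obtain t g where t: "t \<in> ?J" "var b ^ e * f = t + var b ^ Suc e * g" by blast
    have "var b ^ e * (r * f) = r * (var b ^ e * f)" by (simp add: mult_ac)
    also have "\<dots> = r * t + var b ^ Suc e * (r * g)" unfolding t by (simp add: algebra_simps)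
    finally show "r * f \<in> ?K" using is_ideal_mult[OF J t(1)] by blast
  qed
  moreover have "elem_sym r S \<in> ?K" if S: "S \<subseteq> V - {b}"
    and r: "card S < r + tanisaki_d (card (V - {b})) (remove_box e lam) (card S)" for r S
  proof -
    let ?k = "card S" and ?n = "card (V - {b})"
    have bS: "b \<notin> S" "insert b S \<subseteq> V" using S b by auto
    have k: "?k \<le> ?n" using card_mono[OF _ S] by simp
    have d: "tanisaki_d ?n (remove_box e lam) ?k + (if ?n - ?k < lam ! e then 1 else 0)
        = tanisaki_d (card V) lam (Suc ?k)"
      unfolding card_V using e lam(2) k card_V by (intro tanisaki_d_remove_box) auto
    show ?thesis
    proof (cases "Suc ?k < r + tanisaki_d (card V) lam (Suc ?k)")
      case True
      have mem: "elem_sym r (insert b S) \<in> ?J"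
        using bS True by (intro elem_sym_in_tanisaki_on) auto
      show ?thesis
      proof (cases r)
        case 0
        hence "var b ^ e * elem_sym r S = var b ^ e * elem_sym r (insert b S) + var b ^ Suc e * 0" by simp
        thus ?thesis using is_ideal_mult[OF J mem] by blast
      next
        case (Suc r')
        have "var b ^ e * elem_sym r S = var b ^ e * elem_sym r (insert b S) + var b ^ Suc e * (- elem_sym r' S)"
          using bS by (simp add: Suc elem_sym_insert algebra_simps)
        thus ?thesis using is_ideal_mult[OF J mem] by blast
      qed
    next
      case False
      hence "\<not> ?n - ?k < lam ! e" and eq: "r + tanisaki_d (card V) lam (Suc ?k) = Suc ?k"
        using d r by (auto split: if_splits)
      hence "lam ! e < card V - ?k" using k card_V by linarith
      hence "var b ^ e * elem_sym r S \<in> ?J"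
        using lam(1) S eq by (intro var_power_elem_sym_mem conj_part_le) auto
      moreover have "var b ^ e * elem_sym r S = var b ^ e * elem_sym r S + var b ^ Suc e * 0" by simp
      ultimately show ?thesis by blast
    qed
  qed
  ultimately have "tanisaki_on (V - {b}) (remove_box e lam) \<subseteq> ?K"
    unfolding tanisaki_on_def[of "V - {b}"] by (intro Idl_least) auto
  thus ?thesis using f by blast
qed

end

subsection \<open>Standard monomials\<close>

definition monl :: "'n list \<Rightarrow> nat list \<Rightarrow> ('n::finite, complex) mpoly" where
  "monl xs es = (\<Prod>i<length xs. var (xs ! i) ^ (es ! i))"

lemma monl_Nil [simp]: "monl [] es = 1"
  by (simp add: monl_def)

lemma monl_Cons [simp]: "monl (x # xs) (e # es) = var x ^ e * monl xs es"
  by (simp add: monl_def prod.lessThan_Suc_shift del: prod.lessThan_Suc)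

fun lex_less :: "nat list \<Rightarrow> nat list \<Rightarrow> bool" where
  "lex_less (x # xs) (y # ys) \<longleftrightarrow> x < y \<or> x = y \<and> lex_less xs ys"
| "lex_less _ _ \<longleftrightarrow> False"

text \<open>The exponents of the recursively built Garsia-Procesi basis: after the exponent e of the
  first variable, the rest must be allowable for the partition with a box removed from row
  e.\<close>

fun allowable :: "nat list \<Rightarrow> nat list \<Rightarrow> bool" where
  "allowable lam [] \<longleftrightarrow> True"
| "allowable lam (e # es) \<longleftrightarrow> e < length lam \<and> lam ! e > 0 \<and> allowable (remove_box e lam) es"

text \<open>Induction on the variables. If row e is missing or empty, the power of the first
  variable already lies in the ideal. Otherwise the relation for the remaining variables is
  multiplied by x_b^e, and the error terms carry x_b^(e+1).\<close>

lemma not_allowable_monl: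
  assumes "distinct xs" "length es = length xs" "desc lam" "sum_list lam = length xs"
    "\<not> allowable lam es"
  shows "monl xs es \<in> Idl\<^bsub>poly_ring\<^esub> (tanisaki_on (set xs) lam \<union>
    {monl xs fs | fs. length fs = length xs \<and> lex_less es fs})"
  using assms
proof (induction xs arbitrary: es lam)
  case Nil
  thus ?case by simp
next
  case (Cons b xs)
  then obtain e es' where es: "es = e # es'" "length es' = length xs" by (cases es) auto
  let ?V = "insert b (set xs)"
  let ?L = "{monl (b # xs) fs | fs. length fs = length (b # xs) \<and> lex_less es fs}"
  let ?I = "Idl\<^bsub>poly_ring\<^esub> (tanisaki_on ?V lam \<union> ?L)"
  note I = is_ideal_Idl[of "tanisaki_on ?V lam \<union> ?L"]
  have sup: "tanisaki_on ?V lam \<subseteq> ?I" "?L \<subseteq> ?I"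
    using Idl_superset[of "tanisaki_on ?V lam \<union> ?L"] by auto
  have V: "?V - {b} = set xs" "card ?V = Suc (length xs)"
    using Cons.prems(1) by (auto simp: distinct_card)
  show ?case
  proof (cases "e < length lam \<and> lam ! e > 0")
    case False
    hence "var b ^ e \<in> tanisaki_on ?V lam"
      using Cons.prems V by (intro var_power_in_tanisaki_on) auto
    hence "monl xs es' * var b ^ e \<in> ?I"
      using sup by (intro is_ideal_mult[OF I]) auto
    thus ?thesis by (simp add: es mult.commute)
  next
    case True
    let ?M = "{f. var b ^ e * f \<in> ?I}"
    have na: "\<not> allowable (remove_box e lam) es'" using Cons.prems True es by simp
    have "monl xs es' \<in> Idl\<^bsub>poly_ring\<^esub> (tanisaki_on (set xs) (remove_box e lam) \<union>
       {monl xs fs | fs. length fs = length xs \<and> lex_less es' fs})"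
      using Cons.prems True es na sum_list_remove_box[of e lam]
      by (intro Cons.IH desc_remove_box) auto
    also have "\<dots> \<subseteq> ?M"
    proof (rule Idl_least)
      show "is_ideal ?M"
        unfolding is_ideal_def using I
        by (auto simp: is_ideal_0 is_ideal_add distrib_left mult.left_commute[of "var b ^ e"] is_ideal_mult)
      \<comment> \<open>A larger first exponent is lexicographically larger whatever follows, so the
        remaining exponents may be 0 and every multiple of x_b^(e+1) is covered.\<close>
      have pow: "var b ^ Suc e \<in> ?I"
      proof -
        have "monl (b # xs) (Suc e # replicate (length xs) 0) \<in> ?L" using es by (intro CollectI exI[of _ "Suc e # replicate (length xs) 0"]) auto
        moreover have "monl xs (replicate (length xs) 0) = 1" unfolding monl_def by simp
        ultimately show ?thesis using sup by auto
      qed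
      have "f \<in> ?M" if f: "f \<in> tanisaki_on (set xs) (remove_box e lam)" for f
      proof -
        obtain t g where t: "t \<in> tanisaki_on ?V lam" "var b ^ e * f = t + var b ^ Suc e * g"
          using var_power_mult_tanisaki_on[of lam ?V b e f] f True Cons.prems V by auto
        have "t + g * var b ^ Suc e \<in> ?I"
          using sup t pow by (intro is_ideal_add[OF I] is_ideal_mult[OF I]) auto
        thus ?thesis using t(2) by (simp add: mult.commute)
      qed
      moreover have "monl xs fs \<in> ?M" if "length fs = length xs" "lex_less es' fs" for fs
      proof -
        have "monl (b # xs) (e # fs) \<in> ?L"
          using that es by (intro CollectI exI[of _ "e # fs"]) auto
        thus ?thesis using sup by auto
      qed
      ultimately show "tanisaki_on (set xs) (remove_box e lam) \<union>
        {monl xs fs | fs. length fs = length xs \<and> lex_less es' fs} \<subseteq> ?M" by blast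
    qed
    finally show ?thesis by (simp add: es)
  qed
qed

interpretation mp: vector_space "\<lambda>(c::complex) (f::('n, complex) mpoly). cnst c * f"
  by unfold_locales (auto simp: cnst_add cnst_mult algebra_simps)

declare mp.scale_scale [simp del]

subsection \<open>Antisymmetrization over a Young subgroup\<close>

text \<open>The Young subgroup of the colouring: trivial for an injective \<open>kap\<close>, all of
  S_n for a constant one. Both extremes are used later.\<close>

definition color_perms :: "('n::finite \<Rightarrow> nat) \<Rightarrow> ('n \<Rightarrow> 'n) set" where
  "color_perms kap = {\<sigma>. \<sigma> permutes UNIV \<and> (\<forall>x. kap (\<sigma> x) = kap x)}"

text \<open>Not divided by the order of the subgroup, hence a projection only up to that factor; see
  \<open>antisym_antisym\<close>.\<close>

definition antisymmetrize :: "('n::finite \<Rightarrow> nat) \<Rightarrow> ('n, complex) mpoly \<Rightarrow> ('n, complex) mpoly" where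
  "antisymmetrize kap f = (\<Sum>\<sigma>\<in>color_perms kap. cnst (of_int (sign \<sigma>)) * perm_poly \<sigma> f)"

lemma color_perms_id: "id \<in> color_perms kap"
  by (simp add: color_perms_def permutes_id)

lemma color_perms_comp: "\<sigma> \<in> color_perms kap \<Longrightarrow> \<tau> \<in> color_perms kap \<Longrightarrow> \<sigma> \<circ> \<tau> \<in> color_perms kap"
  by (auto simp: color_perms_def intro: permutes_compose)

lemma color_perms_inv: "\<sigma> \<in> color_perms kap \<Longrightarrow> inv_into UNIV \<sigma> \<in> color_perms kap"
  unfolding color_perms_def
  by (auto simp: permutes_inv) (metis permutes_inverses(1))

lemma color_perms_comp_bij:
  assumes "\<tau> \<in> color_perms kap"
  shows "bij_betw (\<lambda>\<sigma>. \<sigma> \<circ> \<tau>) (color_perms kap) (color_perms kap)"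
    and "bij_betw (\<lambda>\<sigma>. \<tau> \<circ> \<sigma>) (color_perms kap) (color_perms kap)"
proof -
  have "\<tau> permutes UNIV" using assms by (simp add: color_perms_def)
  hence *: "\<tau> \<circ> inv_into UNIV \<tau> = id" "inv_into UNIV \<tau> \<circ> \<tau> = id" by (simp_all add: permutes_inv_o)
  note i = color_perms_inv[OF assms]
  show "bij_betw (\<lambda>\<sigma>. \<sigma> \<circ> \<tau>) (color_perms kap) (color_perms kap)"
    by (rule bij_betw_byWitness[where f' = "\<lambda>\<sigma>. \<sigma> \<circ> inv_into UNIV \<tau>"])
       (use assms i * in \<open>auto simp: color_perms_comp comp_assoc\<close>)
  show "bij_betw (\<lambda>\<sigma>. \<tau> \<circ> \<sigma>) (color_perms kap) (color_perms kap)"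
    by (rule bij_betw_byWitness[where f' = "\<lambda>\<sigma>. inv_into UNIV \<tau> \<circ> \<sigma>"])
       (use assms i * in \<open>auto simp: color_perms_comp comp_assoc[symmetric]\<close>)
qed

lemma sign_comp_UNIV:
  fixes \<sigma> \<tau> :: "'n::finite \<Rightarrow> 'n"
  shows "\<sigma> permutes UNIV \<Longrightarrow> \<tau> permutes UNIV \<Longrightarrow> sign (\<sigma> \<circ> \<tau>) = sign \<sigma> * sign \<tau>"
  by (rule sign_compose) (auto simp: permutation_permutes)

lemma sign_square: "sign \<sigma> * sign \<sigma> = 1"
  by (simp add: sign_def)

text \<open>Reindexing by right multiplication; the companion below uses left multiplication. This
  version relates monomials that differ by a permutation within colours, the other one shows that
  the image is antisymmetric.\<close>

lemma antisym_perm_poly: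
  assumes "\<tau> \<in> color_perms kap"
  shows "antisymmetrize kap (perm_poly \<tau> f) = cnst (of_int (sign \<tau>)) * antisymmetrize kap f"
proof -
  have p: "\<tau> permutes UNIV" using assms by (simp add: color_perms_def)
  have "cnst (of_int (sign \<tau>)) * antisymmetrize kap f
      = (\<Sum>\<sigma>\<in>color_perms kap. cnst (of_int (sign \<tau> * sign \<sigma>)) * perm_poly \<sigma> f)"
    by (simp add: antisymmetrize_def sum_distrib_left cnst_mult mult.assoc)
  also have "\<dots> = (\<Sum>\<sigma>\<in>color_perms kap. cnst (of_int (sign \<tau> * sign (\<sigma> \<circ> \<tau>))) * perm_poly (\<sigma> \<circ> \<tau>) f)"
    by (rule sum.reindex_bij_betw[OF color_perms_comp_bij(1)[OF assms], symmetric])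
  also have "\<dots> = antisymmetrize kap (perm_poly \<tau> f)"
    unfolding antisymmetrize_def
  proof (intro sum.cong refl)
    fix \<sigma> assume "\<sigma> \<in> color_perms kap"
    hence "\<sigma> permutes UNIV" by (simp add: color_perms_def)
    hence "sign \<tau> * sign (\<sigma> \<circ> \<tau>) = sign \<tau> * sign \<tau> * sign \<sigma>"
      by (simp only: sign_comp_UNIV[OF _ p] mult_ac)
    hence "sign \<tau> * sign (\<sigma> \<circ> \<tau>) = sign \<sigma>" by (simp only: sign_square mult_1)
    thus "cnst (of_int (sign \<tau> * sign (\<sigma> \<circ> \<tau>))) * perm_poly (\<sigma> \<circ> \<tau>) f
        = cnst (of_int (sign \<sigma>)) * perm_poly \<sigma> (perm_poly \<tau> f)"
      by (simp add: perm_poly_comp)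
  qed
  finally show ?thesis by simp
qed

lemma perm_poly_antisym:
  assumes "\<tau> \<in> color_perms kap"
  shows "perm_poly \<tau> (antisymmetrize kap f) = cnst (of_int (sign \<tau>)) * antisymmetrize kap f"
proof -
  have p: "\<tau> permutes UNIV" using assms by (simp add: color_perms_def)
  have "cnst (of_int (sign \<tau>)) * antisymmetrize kap f
      = (\<Sum>\<sigma>\<in>color_perms kap. cnst (of_int (sign \<tau> * sign \<sigma>)) * perm_poly \<sigma> f)"
    by (simp add: antisymmetrize_def sum_distrib_left cnst_mult mult.assoc)
  also have "\<dots> = (\<Sum>\<sigma>\<in>color_perms kap. cnst (of_int (sign \<tau> * sign (\<tau> \<circ> \<sigma>))) * perm_poly (\<tau> \<circ> \<sigma>) f)"
    by (rule sum.reindex_bij_betw[OF color_perms_comp_bij(2)[OF assms], symmetric])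
  also have "\<dots> = perm_poly \<tau> (antisymmetrize kap f)"
    unfolding antisymmetrize_def perm_poly_sum
  proof (intro sum.cong refl)
    fix \<sigma> assume "\<sigma> \<in> color_perms kap"
    hence "\<sigma> permutes UNIV" by (simp add: color_perms_def)
    hence "sign \<tau> * sign (\<tau> \<circ> \<sigma>) = sign \<tau> * sign \<tau> * sign \<sigma>"
      by (simp only: sign_comp_UNIV[OF p] mult_ac)
    hence "sign \<tau> * sign (\<tau> \<circ> \<sigma>) = sign \<sigma>" by (simp only: sign_square mult_1)
    thus "cnst (of_int (sign \<tau> * sign (\<tau> \<circ> \<sigma>))) * perm_poly (\<tau> \<circ> \<sigma>) f
        = perm_poly \<tau> (cnst (of_int (sign \<sigma>)) * perm_poly \<sigma> f)"
      by (simp add: perm_poly_comp perm_poly_mult)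
  qed
  finally show ?thesis by simp
qed

lemma antisym_add: "antisymmetrize kap (f + g) = antisymmetrize kap f + antisymmetrize kap g"
  and antisym_cnst_mult: "antisymmetrize kap (cnst c * f) = cnst c * antisymmetrize kap f"
  and antisym_0 [simp]: "antisymmetrize kap 0 = 0"
  by (simp_all add: antisymmetrize_def perm_poly_add perm_poly_mult distrib_left sum.distrib
      sum_distrib_left mult.left_commute)

lemma antisym_minus: "antisymmetrize kap (- f) = - antisymmetrize kap f"
  using antisym_add[of kap f "- f"] by (simp add: add_eq_0_iff)

lemma antisym_diff: "antisymmetrize kap (f - g) = antisymmetrize kap f - antisymmetrize kap g"
  using antisym_add[of kap f "- g"] by (simp add: antisym_minus)

lemma antisym_sum: "antisymmetrize kap (sum F A) = (\<Sum>x\<in>A. antisymmetrize kap (F x))"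
  by (induction A rule: infinite_finite_induct) (simp_all add: antisym_add)

lemma homogeneous_antisym: "homogeneous d f \<Longrightarrow> homogeneous d (antisymmetrize kap f)"
  unfolding antisymmetrize_def
  by (intro homogeneous_sum homogeneous_cnst_mult homogeneous_perm_poly)

lemma antisym_antisym: "antisymmetrize kap (antisymmetrize kap f) = cnst (of_nat (card (color_perms kap))) * antisymmetrize kap f"
proof -
  have "antisymmetrize kap (antisymmetrize kap f)
     = (\<Sum>\<sigma>\<in>color_perms kap. cnst (of_int (sign \<sigma>)) * (cnst (of_int (sign \<sigma>)) * antisymmetrize kap f))"
    unfolding antisymmetrize_def[of kap "antisymmetrize kap f"] by (intro sum.cong refl) (simp add: perm_poly_antisym)
  also have "\<dots> = (\<Sum>\<sigma>\<in>color_perms kap. antisymmetrize kap f)"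
    by (intro sum.cong refl)
       (simp add: mult.assoc[symmetric] cnst_mult[symmetric] of_int_mult[symmetric] sign_square del: of_int_mult)
  also have "\<dots> = cnst (of_nat (card (color_perms kap))) * antisymmetrize kap f"
  proof -
    have "cnst (of_nat k) * g = of_nat k * g" for k and g :: "('a, complex) mpoly"
      by (induction k) (simp_all add: cnst_add distrib_right)
    thus ?thesis by simp
  qed
  finally show ?thesis .
qed

lemma antisym_mem:
  assumes "is_ideal J" "\<And>\<pi> g. \<pi> permutes UNIV \<Longrightarrow> g \<in> J \<Longrightarrow> perm_poly \<pi> g \<in> J" "f \<in> J"
  shows "antisymmetrize kap f \<in> J"
  unfolding antisymmetrize_def using assms
  by (intro is_ideal_sum is_ideal_mult) (auto simp: color_perms_def)

lemma is_ideal_tanisaki: "is_ideal (tanisaki_ideal lam)"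
  using is_ideal_tanisaki_on[of UNIV] by (simp add: tanisaki_on_UNIV)

lemma homogeneous_ideal_tanisaki:
  "homogeneous_ideal (tanisaki_ideal lam :: ('n::finite, complex) mpoly set)"
  unfolding tanisaki_ideal_def by (rule homogeneous_ideal_Idl) (use homogeneous_elem_sym in blast)

lemma perm_stable_tanisaki:
  assumes "\<pi> permutes UNIV" "f \<in> tanisaki_ideal lam"
  shows "perm_poly \<pi> f \<in> tanisaki_ideal lam"
  using assms(2) unfolding tanisaki_ideal_def
proof (rule perm_stable_Idl[OF _ assms(1), rotated])
  fix f :: "('a, complex) mpoly"
  assume "f \<in> {elem_sym r S | r S. card S < r + tanisaki_d CARD('a) lam (card S) \<and> r \<le> card S}"
  then obtain r S where f: "f = elem_sym r S" and *: "card S < r + tanisaki_d CARD('a) lam (card S)" "r \<le> card S"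
    by blast
  have "perm_poly \<pi> f = elem_sym r (\<pi> ` S)" unfolding f by (rule perm_poly_elem_sym[OF assms(1)])
  moreover have "card (\<pi> ` S) = card S"
    using permutes_inj[OF assms(1)] by (intro card_image) (auto intro: inj_on_subset)
  ultimately show "perm_poly \<pi> f \<in> {elem_sym r S | r S. card S < r + tanisaki_d CARD('a) lam (card S) \<and> r \<le> card S}"
    using * by (intro CollectI exI[of _ r] exI[of _ "\<pi> ` S"]) auto
qed

subsection \<open>Monomials as exponent lists\<close>

lemma homogeneous_monl: "length es = length xs \<Longrightarrow> homogeneous (sum_list es) (monl xs es)"
proof (induction es xs rule: list_induct2)
  case (Cons e es x xs)
  thus ?case using homogeneous_mult[OF homogeneous_power[of 1 "var x" e] Cons.IH] by simp
qed simp

lemma monl_mult: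
  "length es = length xs \<Longrightarrow> length fs = length xs \<Longrightarrow> monl xs es * monl xs fs = monl xs (map2 (+) es fs)"
  unfolding monl_def prod.distrib[symmetric] by (intro prod.cong) (auto simp: power_add)

lemma lex_less_add:
  "length gs = length fs \<Longrightarrow> lex_less es fs \<Longrightarrow> lex_less es (map2 (+) gs fs)"
proof (induction es fs arbitrary: gs rule: lex_less.induct)
  case (1 x xs y ys)
  then obtain g gs' where "gs = g # gs'" "length gs' = length ys" by (cases gs) auto
  thus ?case using 1 by (cases g) auto
qed auto

lemma lex_less_trans: "lex_less xs ys \<Longrightarrow> lex_less ys zs \<Longrightarrow> lex_less xs zs"
proof (induction xs ys arbitrary: zs rule: lex_less.induct)
  case (1 x xs y ys)
  thus ?case by (cases zs) auto
qed auto

lemma lex_less_irrefl: "\<not> lex_less xs xs"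
  by (induction xs) auto

lemma single_eq_monl:
  fixes m :: "'n::finite \<Rightarrow>\<^sub>0 nat"
  assumes "distinct bs" "set bs = UNIV"
  shows "Poly_Mapping.single m c = cnst c * monl bs (map (Poly_Mapping.lookup m) bs)"
proof -
  have "bij_betw ((!) bs) {..<length bs} UNIV" using assms by (intro bij_betw_nth) auto
  hence "(\<Prod>i\<in>UNIV. (var i :: ('n, complex) mpoly) ^ Poly_Mapping.lookup m i) =
      (\<Prod>j<length bs. var (bs ! j) ^ Poly_Mapping.lookup m (bs ! j))"
    by (rule prod.reindex_bij_betw[symmetric])
  thus ?thesis by (simp add: single_eq_prod_var monl_def)
qed

lemma finite_exponent_lists: "finite {gs :: nat list. length gs = n \<and> sum_list gs = d}"
proof (rule finite_subset)
  show "{gs :: nat list. length gs = n \<and> sum_list gs = d} \<subseteq> {gs. set gs \<subseteq> {..d} \<and> length gs = n}"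
    by (auto dest: member_le_sum_list_nat)
qed (simp add: finite_lists_length_eq)

text \<open>The vector space sum of I_lambda and a span. Antisymmetrization is linear over the
  complex numbers but not over the polynomial ring, so straightening relations must be available in
  linear form.\<close>

definition modspan :: "nat list \<Rightarrow> ('n::finite, complex) mpoly set \<Rightarrow> ('n, complex) mpoly set" where
  "modspan lam L = {f. \<exists>t\<in>tanisaki_ideal lam. f - t \<in> mp.span L}"

lemma modspan_subspace: "mp.subspace (modspan lam L)"
proof (rule mp.subspaceI)
  note I = is_ideal_tanisaki[of lam]
  show "0 \<in> modspan lam L" unfolding modspan_def
    using is_ideal_0[OF I] mp.span_zero by force
  fix f g assume "f \<in> modspan lam L" "g \<in> modspan lam L"
  then obtain t u where "t \<in> tanisaki_ideal lam" "u \<in> tanisaki_ideal lam"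
    "f - t \<in> mp.span L" "g - u \<in> mp.span L" by (auto simp: modspan_def)
  hence "t + u \<in> tanisaki_ideal lam" "(f + g) - (t + u) \<in> mp.span L"
    using mp.span_add[of "f - t" L "g - u"] by (auto simp: is_ideal_add[OF I] algebra_simps)
  thus "f + g \<in> modspan lam L" by (auto simp: modspan_def)
next
  note I = is_ideal_tanisaki[of lam]
  fix c f assume "f \<in> modspan lam L"
  then obtain t where "t \<in> tanisaki_ideal lam" "f - t \<in> mp.span L" by (auto simp: modspan_def)
  hence "cnst c * t \<in> tanisaki_ideal lam" "cnst c * f - cnst c * t \<in> mp.span L"
    using mp.span_scale[of "f - t" L c] by (auto simp: is_ideal_mult[OF I] right_diff_distrib)
  thus "cnst c * f \<in> modspan lam L" by (auto simp: modspan_def)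
qed

lemma span_subset_modspan: "mp.span L \<subseteq> modspan lam L"
  using is_ideal_0[OF is_ideal_tanisaki[of lam]] by (force simp: modspan_def)

lemma tanisaki_subset_modspan: "tanisaki_ideal lam \<subseteq> modspan lam L"
  using mp.span_zero[of L] by (force simp: modspan_def)

context
  fixes bs :: "'n::finite list" and lam :: "nat list"
  assumes bs: "distinct bs" "set bs = UNIV" and lam: "desc lam" "sum_list lam = CARD('n)"
begin

lemma length_bs: "length bs = CARD('n)"
  using distinct_card[OF bs(1)] bs(2) by simp



text \<open>Multiplication by a monomial keeps exponents lexicographically larger than es, so the
  span of these monomials is closed under multiplication and ideal membership becomes linear. The
  component of degree \<open>sum_list es\<close> then isolates the terms of the right
  degree.\<close>

lemma not_allowable_monl_modspan:
  assumes "length es = length bs" "\<not> allowable lam es"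
  shows "monl bs es \<in> modspan lam {monl bs fs | fs. length fs = length bs \<and> lex_less es fs \<and> sum_list fs = sum_list es}"
proof -
  let ?L = "{monl bs fs | fs. length fs = length bs \<and> lex_less es fs}"
  let ?L' = "{monl bs fs | fs. length fs = length bs \<and> lex_less es fs \<and> sum_list fs = sum_list es}"
  note I = is_ideal_tanisaki[of lam]
  have mono: "monl bs gs * s \<in> mp.span ?L" if gs: "length gs = length bs" and s: "s \<in> mp.span ?L" for gs s
    using s
  proof (induction rule: mp.span_induct_alt)
    case base
    thus ?case by (simp add: mp.span_zero)
  next
    case (step c x y)
    then obtain fs where fs: "x = monl bs fs" "length fs = length bs" "lex_less es fs" by blast
    have "monl bs gs * x = monl bs (map2 (+) gs fs)" using fs gs by (simp add: monl_mult)
    hence "monl bs gs * x \<in> ?L"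
      using fs gs lex_less_add[of gs fs es] by (intro CollectI exI[of _ "map2 (+) gs fs"]) auto
    hence "cnst c * (monl bs gs * x) + monl bs gs * y \<in> mp.span ?L"
      using step(2) by (rule mp.span_add[OF mp.span_scale[OF mp.span_base]])
    thus ?case by (simp add: algebra_simps)
  qed
  have mult: "r * s \<in> mp.span ?L" if s: "s \<in> mp.span ?L" for r s
  proof (induction r rule: mpoly_induct)
    case (monom m c)
    have "cnst c * (monl bs (map (Poly_Mapping.lookup m) bs) * s) \<in> mp.span ?L"
      using s by (intro mp.span_scale mono) auto
    thus ?case by (simp add: single_eq_monl[OF bs] mult.assoc)
  next
    case (add f g)
    thus ?case by (simp add: distrib_right mp.span_add)
  qed
  have "is_ideal (modspan lam ?L)"
    unfolding is_ideal_def
  proof (intro conjI ballI allI)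
    fix r a assume "a \<in> modspan lam ?L"
    then obtain t where t: "t \<in> tanisaki_ideal lam" "a - t \<in> mp.span ?L" by (auto simp: modspan_def)
    have "r * a - r * t \<in> mp.span ?L" using mult[OF t(2), of r] by (simp add: right_diff_distrib)
    thus "r * a \<in> modspan lam ?L" using is_ideal_mult[OF I t(1)] by (auto simp: modspan_def)
  qed (use modspan_subspace in \<open>auto simp: mp.subspace_def\<close>)
  moreover have "tanisaki_on (set bs) lam \<union> ?L \<subseteq> modspan lam ?L"
    using tanisaki_subset_modspan[of lam ?L] span_subset_modspan[of ?L lam] mp.span_superset[of ?L]
    by (auto simp: bs tanisaki_on_UNIV)
  ultimately have "Idl\<^bsub>poly_ring\<^esub> (tanisaki_on (set bs) lam \<union> ?L) \<subseteq> modspan lam ?L"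
    by (rule Idl_least)
  hence "monl bs es \<in> modspan lam ?L"
    by (rule subsetD[OF _ not_allowable_monl[OF bs(1) assms(1) lam(1) _ assms(2)]])
       (use lam(2) length_bs in auto)
  then obtain t where t: "t \<in> tanisaki_ideal lam" "monl bs es - t \<in> mp.span ?L" by (auto simp: modspan_def)
  have comp: "hom_component (sum_list es) s \<in> mp.span ?L'" if "s \<in> mp.span ?L" for s
    using that
  proof (induction rule: mp.span_induct_alt)
    case base
    thus ?case by (simp add: mp.span_zero)
  next
    case (step c x y)
    then obtain fs where fs: "x = monl bs fs" "length fs = length bs" "lex_less es fs" by blast
    have "hom_component (sum_list es) x = (if sum_list fs = sum_list es then x else 0)"
      using hom_component_homogeneous[OF homogeneous_monl[OF fs(2)], of "sum_list es"] fs by auto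
    hence "hom_component (sum_list es) x \<in> mp.span ?L'"
      using fs by (auto simp: mp.span_zero intro!: mp.span_base)
    thus ?case using step
      by (simp add: hom_component_add hom_component_cnst_mult mp.span_add mp.span_scale)
  qed
  have "hom_component (sum_list es) (monl bs es) = monl bs es"
    using homogeneous_monl[OF assms(1)] by (simp add: homogeneous_iff)
  hence "monl bs es - hom_component (sum_list es) t \<in> mp.span ?L'"
    using comp[OF t(2)] by (simp add: hom_component_diff)
  moreover have "hom_component (sum_list es) t \<in> tanisaki_ideal lam"
    using homogeneous_ideal_tanisaki[of lam] t(1) by (auto simp: homogeneous_ideal_def)
  ultimately show ?thesis by (auto simp: modspan_def)
qed

end

text \<open>The exponent lists that are allowable and strictly decreasing along runs of equal colour;
  \<open>c\<close> and \<open>b\<close> are the colour and the exponent of the preceding variable.\<close>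

fun admissible :: "('n \<Rightarrow> nat) \<Rightarrow> nat list \<Rightarrow> nat \<Rightarrow> nat \<Rightarrow> 'n list \<Rightarrow> nat list \<Rightarrow> bool" where
  "admissible kap lam c b [] es \<longleftrightarrow> es = []"
| "admissible kap lam c b (x # xs) [] \<longleftrightarrow> False"
| "admissible kap lam c b (x # xs) (e # es) \<longleftrightarrow> (kap x = c \<longrightarrow> e < b) \<and> e < length lam \<and> lam ! e > 0 \<and>
     admissible kap (remove_box e lam) (kap x) e xs es"

lemma admissible_length: "admissible kap lam c b xs es \<Longrightarrow> length es = length xs"
  by (induction kap lam c b xs es rule: admissible.induct) auto

lemma not_admissible:
  assumes "length es = length xs" "allowable lam es" "xs \<noteq> [] \<Longrightarrow> kap (hd xs) = c \<Longrightarrow> hd es < b"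
    "\<not> admissible kap lam c b xs es"
  shows "\<exists>i. Suc i < length xs \<and> kap (xs ! i) = kap (xs ! Suc i) \<and> es ! i \<le> es ! Suc i"
  using assms
proof (induction kap lam c b xs es rule: admissible.induct)
  case (3 kap lam c b x xs e es)
  show ?case
  proof (cases "xs \<noteq> [] \<and> kap (hd xs) = kap x \<and> \<not> hd es < e")
    case True
    hence "es \<noteq> []" using 3 by auto
    thus ?thesis using True by (intro exI[of _ 0]) (auto simp: hd_conv_nth)
  next
    case False
    then obtain i where "Suc i < length xs \<and> kap (xs ! i) = kap (xs ! Suc i) \<and> es ! i \<le> es ! Suc i"
      using 3 by auto
    thus ?thesis by (intro exI[of _ "Suc i"]) auto
  qed
qed auto

lemma lex_less_swap:
  assumes "Suc i < length es" "es ! i < es ! Suc i"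
  shows "lex_less es (es[i := es ! Suc i, Suc i := es ! i])"
  using assms
proof (induction es arbitrary: i)
  case (Cons e es)
  show ?case
  proof (cases i)
    case 0
    then obtain e' es' where "es = e' # es'" using Cons.prems by (cases es) auto
    thus ?thesis using 0 Cons.prems by simp
  qed (use Cons in auto)
qed simp

lemma sum_list_swap:
  assumes "Suc i < length es"
  shows "sum_list (es[i := es ! Suc i, Suc i := es ! i]) = sum_list (es :: nat list)"
proof -
  have "mset (es[i := es ! Suc i, Suc i := es ! i]) = mset es"
    using assms by (intro mset_swap) auto
  thus ?thesis by (metis sum_mset_sum_list)
qed

lemma monl_swap:
  assumes "distinct xs" "length es = length xs" "Suc i < length xs"
  shows "monl xs (es[i := es ! Suc i, Suc i := es ! i])
    = perm_poly (Transposition.transpose (xs ! i) (xs ! Suc i)) (monl xs es)"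
proof -
  let ?s = "Transposition.transpose i (Suc i)" and ?t = "Transposition.transpose (xs ! i) (xs ! Suc i)"
  have t: "?t (xs ! j) = xs ! ?s j" if "j < length xs" for j
    using that assms by (auto simp: transpose_def nth_eq_iff_index_eq)
  have bij: "bij_betw ?s {..<length xs} {..<length xs}"
    by (rule bij_betw_byWitness[where f' = ?s]) (use assms in \<open>auto simp: transpose_def\<close>)
  have "perm_poly ?t (monl xs es) = (\<Prod>j<length xs. var (xs ! ?s j) ^ (es ! j))"
    unfolding monl_def perm_poly_prod by (intro prod.cong) (auto simp: perm_poly_power t)
  also have "\<dots> = (\<Prod>j<length xs. var (xs ! ?s (?s j)) ^ (es ! ?s j))"
    by (rule prod.reindex_bij_betw[OF bij, symmetric])
  also have "\<dots> = monl xs (es[i := es ! Suc i, Suc i := es ! i])"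
    unfolding monl_def using assms
    by (intro prod.cong) (auto simp: nth_list_update transpose_def)
  finally show ?thesis by simp
qed

lemma transpose_color_perms:
  assumes "kap x = kap y"
  shows "Transposition.transpose x y \<in> color_perms kap"
  using assms by (auto simp: color_perms_def transpose_def permutes_swap_id)

context
  fixes bs :: "'n::finite list" and lam :: "nat list"
  assumes bs: "distinct bs" "set bs = UNIV" and lam: "desc lam" "sum_list lam = CARD('n)"
begin

lemma antisym_modspan:
  assumes "f \<in> modspan lam L" "\<And>g. g \<in> L \<Longrightarrow> antisymmetrize kap g \<in> modspan lam M"
  shows "antisymmetrize kap f \<in> modspan lam M"
proof -
  obtain t where t: "t \<in> tanisaki_ideal lam" "f - t \<in> mp.span L"
    using assms(1) by (auto simp: modspan_def)
  note sub = modspan_subspace[of lam M]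
  have "antisymmetrize kap (f - t) \<in> modspan lam M"
    using t(2)
  proof (induction rule: mp.span_induct_alt)
    case base
    thus ?case using mp.subspace_0[OF sub] by simp
  next
    case (step c x y)
    thus ?case using assms(2) mp.subspace_add[OF sub] mp.subspace_scale[OF sub]
      by (simp add: antisym_add antisym_cnst_mult)
  qed
  moreover have "antisymmetrize kap t \<in> tanisaki_ideal lam"
    using t(1) by (intro antisym_mem is_ideal_tanisaki perm_stable_tanisaki)
  hence "antisymmetrize kap t \<in> modspan lam M" using tanisaki_subset_modspan by blast
  ultimately show ?thesis
    using mp.subspace_add[OF sub, of "antisymmetrize kap (f - t)" "antisymmetrize kap t"] by (simp add: antisym_diff)
qed

text \<open>Induction on the number of lexicographically larger lists of the same degree. A list
  that is not allowable straightens upwards. In an allowable but not admissible list, swapping two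
  neighbouring exponents of equal colour only changes the sign: equal exponents give 0, an ascent
  becomes a larger list.\<close>

lemma antisym_monl_modspan:
  assumes "length es = length bs"
  shows "antisymmetrize kap (monl bs es) \<in> modspan lam
    {antisymmetrize kap (monl bs fs) | fs. admissible kap lam c (length lam) bs fs \<and> sum_list fs = sum_list es}"
  using assms
proof (induction "card {gs. length gs = length bs \<and> sum_list gs = sum_list es \<and> lex_less es gs}"
    arbitrary: es rule: less_induct)
  case less
  let ?M = "{antisymmetrize kap (monl bs fs) | fs. admissible kap lam c (length lam) bs fs \<and> sum_list fs = sum_list es}"
  have IH: "antisymmetrize kap (monl bs fs) \<in> modspan lam ?M"
    if fs: "length fs = length bs" "sum_list fs = sum_list es" "lex_less es fs" for fs
  proof -
    let ?G = "\<lambda>es. {gs. length gs = length bs \<and> sum_list gs = sum_list es \<and> lex_less es gs}"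
    have "?G fs \<subset> ?G es"
    proof
      show "?G fs \<subseteq> ?G es" using fs lex_less_trans by auto
      show "?G fs \<noteq> ?G es" using fs lex_less_irrefl[of fs] by blast
    qed
    moreover have "finite (?G es)"
      by (rule finite_subset[OF _ finite_exponent_lists[of "length bs" "sum_list es"]]) auto
    ultimately have "card (?G fs) < card (?G es)" by (rule psubset_card_mono[rotated])
    thus ?thesis using less(1)[of fs] fs by simp
  qed
  consider "\<not> allowable lam es" | "admissible kap lam c (length lam) bs es"
    | "allowable lam es" "\<not> admissible kap lam c (length lam) bs es" by blast
  thus ?case
  proof cases
    case 1
    show ?thesis
      by (rule antisym_modspan[OF not_allowable_monl_modspan[OF bs lam less(2) 1]]) (use IH in auto)
  next
    case 2
    hence "antisymmetrize kap (monl bs es) \<in> mp.span ?M" by (intro mp.span_base) auto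
    thus ?thesis using span_subset_modspan by blast
  next
    case 3
    have "\<exists>i. Suc i < length bs \<and> kap (bs ! i) = kap (bs ! Suc i) \<and> es ! i \<le> es ! Suc i"
    proof (rule not_admissible[OF less(2) 3(1) _ 3(2)])
      \<comment> \<open>The bound \<open>length lam\<close> imposes nothing on the first exponent
        beyond what allowability says.\<close>
      assume "bs \<noteq> []"
      thus "hd es < length lam" using 3(1) less(2) by (cases es) auto
    qed
    then obtain i where i: "Suc i < length bs" "kap (bs ! i) = kap (bs ! Suc i)" "es ! i \<le> es ! Suc i" by blast
    let ?fs = "es[i := es ! Suc i, Suc i := es ! i]"
    have "bs ! i \<noteq> bs ! Suc i" using bs(1) i(1) by (simp add: nth_eq_iff_index_eq)
    hence swap: "antisymmetrize kap (monl bs ?fs) = - antisymmetrize kap (monl bs es)"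
      using monl_swap[OF bs(1) less(2) i(1)] antisym_perm_poly[OF transpose_color_perms[OF i(2)]]
      by (simp add: sign_swap_id cnst_minus)
    show ?thesis
    proof (cases "es ! i = es ! Suc i")
      case True
      hence "?fs = es" using i less(2) by (intro nth_equalityI) (auto simp: nth_list_update)
      hence "antisymmetrize kap (monl bs es) = - antisymmetrize kap (monl bs es)" using swap by simp
      hence "2 * antisymmetrize kap (monl bs es) = 0"
        by (simp only: eq_neg_iff_add_eq_0 mult_2)
      hence "cnst (1 / 2) * (cnst 2 * antisymmetrize kap (monl bs es)) = 0"
        by (simp add: cnst_def)
      hence "antisymmetrize kap (monl bs es) = 0"
        by (simp add: mult.assoc[symmetric] cnst_mult[symmetric])
      thus ?thesis using mp.subspace_0[OF modspan_subspace] by simp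
    next
      case False
      hence "antisymmetrize kap (monl bs ?fs) \<in> modspan lam ?M"
        using i less(2) by (intro IH lex_less_swap sum_list_swap) auto
      hence "cnst (- 1) * antisymmetrize kap (monl bs ?fs) \<in> modspan lam ?M"
        by (rule mp.subspace_scale[OF modspan_subspace])
      thus ?thesis using swap by (simp add: cnst_minus)
    qed
  qed
qed

theorem antisym_spanning:
  assumes "homogeneous d f"
  shows "antisymmetrize kap f \<in> modspan lam
    {antisymmetrize kap (monl bs fs) | fs. admissible kap lam c (length lam) bs fs \<and> sum_list fs = d}"
proof -
  let ?M = "{antisymmetrize kap (monl bs fs) | fs. admissible kap lam c (length lam) bs fs \<and> sum_list fs = d}"
  note sub = modspan_subspace[of lam ?M]
  have *: "antisymmetrize kap (Poly_Mapping.single m a) \<in> modspan lam ?M" if "m \<in> Poly_Mapping.keys f" for m a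
  proof -
    let ?es = "map (Poly_Mapping.lookup m) bs"
    have "sum_list ?es = (\<Sum>i\<in>UNIV. Poly_Mapping.lookup m i)"
      using sum.distinct_set_conv_list[OF bs(1), of "Poly_Mapping.lookup m"] bs(2) by simp
    also have "\<dots> = d" using assms that by (simp add: homogeneous_def mdeg_eq_sum[of UNIV])
    finally have "antisymmetrize kap (monl bs ?es) \<in> modspan lam ?M"
      using antisym_monl_modspan[of ?es kap c] by simp
    hence "cnst a * antisymmetrize kap (monl bs ?es) \<in> modspan lam ?M" by (rule mp.subspace_scale[OF sub])
    thus ?thesis by (simp add: single_eq_monl[OF bs] antisym_cnst_mult)
  qed
  have "antisymmetrize kap f = (\<Sum>m\<in>Poly_Mapping.keys f. antisymmetrize kap (Poly_Mapping.single m (Poly_Mapping.lookup f m)))"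
    by (subst monomial_decomposition) (simp add: antisym_sum)
  also have "\<dots> \<in> modspan lam ?M" by (rule mp.subspace_sum[OF sub *])
  finally show ?thesis .
qed

end

section \<open>Counting exponent lists and straightening raising operators\<close>

subsection \<open>Families of sets with prescribed content\<close>

text \<open>Set families \<open>T\<close> with one set of row indices for each colour, the size of which is the number of
  variables of that colour in \<open>xs\<close>; the indices for colour \<open>c\<close> are bounded by \<open>b\<close>.\<close>

definition families :: "('n \<Rightarrow> nat) \<Rightarrow> nat \<Rightarrow> 'n list \<Rightarrow> nat \<Rightarrow> nat \<Rightarrow> (nat \<Rightarrow> nat set) set" where
  "families kap l xs c b =
    {T. (\<forall>k. T k \<subseteq> {..<l} \<and> card (T k) = count_list (map kap xs) k) \<and> T c \<subseteq> {..<b}}"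

definition content :: "(nat \<Rightarrow> nat set) \<Rightarrow> nat \<Rightarrow> nat" where
  "content T i = card {k. i \<in> T k}"

text \<open>When b = l these are 0-1 matrices with prescribed row and column sums, counted by the
  pairing of h_al with a product of elementary symmetric functions. The row sums are integers
  because raising operators produce negative ones, for which there are no families.\<close>

definition families_of :: "('n \<Rightarrow> nat) \<Rightarrow> nat \<Rightarrow> 'n list \<Rightarrow> nat \<Rightarrow> nat \<Rightarrow> (nat \<Rightarrow> int) \<Rightarrow> (nat \<Rightarrow> nat set) set" where
  "families_of kap l xs c b al = {T \<in> families kap l xs c b. \<forall>i<l. int (content T i) = al i}"

lemma families_empty:
  assumes "T \<in> families kap l xs c b" "k \<notin> kap ` set xs"
  shows "T k = {}"
proof -
  have "card (T k) = 0" using assms by (auto simp: families_def count_list_0_iff)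
  moreover have "finite (T k)" using assms(1) by (auto simp: families_def intro: finite_subset)
  ultimately show ?thesis by simp
qed

lemma families_finite: "T \<in> families kap l xs c b \<Longrightarrow> finite (T k)"
  by (auto simp: families_def intro: finite_subset)

lemma finite_content: "T \<in> families kap l xs c b \<Longrightarrow> finite {k. i \<in> T k}"
  by (rule finite_subset[of _ "kap ` set xs"]) (use families_empty in fastforce)+

lemma finite_families [simp]: "finite (families kap l xs c b)"
proof (rule finite_subset)
  show "families kap l xs c b \<subseteq> {T. \<forall>k. (k \<in> kap ` set xs \<longrightarrow> T k \<in> Pow {..<l}) \<and> (k \<notin> kap ` set xs \<longrightarrow> T k = {})}"
    using families_empty[of _ kap l xs c b] by (auto simp: families_def)
qed (rule finite_set_of_finite_funs, auto)

lemma finite_families_of [simp]: "finite (families_of kap l xs c b al)"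
  unfolding families_of_def by simp

lemma families_of_cong: "(\<And>i. i < l \<Longrightarrow> al i = be i) \<Longrightarrow> families_of kap l xs c b al = families_of kap l xs c b be"
  by (auto simp: families_of_def)

lemma families_of_neg: "i < l \<Longrightarrow> al i < 0 \<Longrightarrow> families_of kap l xs c b al = {}"
  by (fastforce simp: families_of_def)

lemma families_of_Nil:
  "families_of kap l [] c b al = (if \<forall>i<l. al i = 0 then {\<lambda>_. {}} else {})"
proof -
  have "families kap l [] c b = {\<lambda>_. {}}"
  proof (intro equalityI subsetI)
    fix T assume "T \<in> families kap l [] c b"
    hence "T k = {}" for k by (rule families_empty) simp
    thus "T \<in> {\<lambda>_. {}}" by auto
  qed (auto simp: families_def)
  thus ?thesis by (auto simp: families_of_def content_def)
qed

lemma content_insert: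
  assumes "T \<in> families kap l xs c b" "i \<notin> T k"
  shows "content (T(k := insert i (T k))) j = content T j + (if j = i then 1 else 0)"
proof -
  have "{k'. j \<in> (T(k := insert i (T k))) k'} = (if j = i then insert k {k'. j \<in> T k'} else {k'. j \<in> T k'})"
    by auto
  thus ?thesis using assms finite_content[OF assms(1), of j] by (auto simp: content_def)
qed

text \<open>Split off the largest element of the set belonging to the colour of the first variable.\<close>

lemma card_families_of_Cons:
  assumes "sorted (c # map kap (x # xs))"
  shows "card (families_of kap l (x # xs) c b al)
    = (\<Sum>i | i < l \<and> (kap x = c \<longrightarrow> i < b). card (families_of kap l xs (kap x) i (al(i := al i - 1))))"
proof -
  let ?k = "kap x" and ?I = "{i. i < l \<and> (kap x = c \<longrightarrow> i < b)}"
  let ?F = "\<lambda>i T. T(?k := insert i (T ?k))"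
  let ?G = "\<lambda>i. families_of kap l xs ?k i (al(i := al i - 1))"
  have notin: "i \<notin> T ?k" "\<And>j. j \<in> T ?k \<Longrightarrow> j < i" if "T \<in> ?G i" for i T
    using that by (auto simp: families_of_def families_def)
  \<comment> \<open>By sortedness, a first colour other than c exceeds c, so c does not recur and
    its bound b becomes void.\<close>
  have c: "count_list (map kap xs) c = 0" "c \<noteq> kap x" if "kap x \<noteq> c"
    using assms that by (auto simp: count_list_0_iff)
  have eq: "families_of kap l (x # xs) c b al = (\<Union>i\<in>?I. ?F i ` ?G i)" (is "?L = ?R")
  proof (intro equalityI subsetI)
    fix T assume T: "T \<in> ?L"
    let ?i = "Max (T ?k)"
    have fin: "finite (T ?k)" using T by (auto simp: families_of_def dest: families_finite)
    have "card (T ?k) > 0" using T by (auto simp: families_of_def families_def)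
    hence ne: "T ?k \<noteq> {}" by auto
    have i: "?i \<in> T ?k" using fin ne by (rule Max_in)
    have iI: "?i \<in> ?I" using T i by (auto simp: families_of_def families_def)
    define T' where "T' = T(?k := T ?k - {?i})"
    have TT': "T = ?F ?i T'" using i by (simp add: T'_def insert_absorb)
    have "j < ?i" if "j \<in> T ?k - {?i}" for j
      using that Max_ge[OF fin, of j] by force
    hence T'f: "T' \<in> families kap l xs ?k ?i"
      using T i fin by (auto simp: T'_def families_of_def families_def)
    have "content T j = content T' j + (if j = ?i then 1 else 0)" for j
      using content_insert[OF T'f, of ?i ?k j] TT' by (simp add: T'_def)
    hence "T' \<in> ?G ?i" using T T'f by (auto simp: families_of_def)
    thus "T \<in> ?R" using iI TT' by blast
  next
    fix T assume "T \<in> ?R"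
    then obtain i T' where i: "i \<in> ?I" and T': "T' \<in> ?G i" and T: "T = ?F i T'" by blast
    have T'f: "T' \<in> families kap l xs ?k i" using T' by (simp add: families_of_def)
    have "T k \<subseteq> {..<l} \<and> card (T k) = count_list (map kap (x # xs)) k" for k
      using T'f i notin[OF T'] families_finite[OF T'f, of ?k] by (auto simp: T families_def)
    moreover have "T c \<subseteq> {..<b}"
    proof (cases "kap x = c")
      case True
      thus ?thesis using i T'f notin(2)[OF T'] by (auto simp: T intro: less_trans)
    next
      case False
      hence "T' c = {}" using c[OF False] families_empty[OF T'f, of c] by (auto simp: count_list_0_iff)
      thus ?thesis using False by (simp add: T)
    qed
    moreover have "content T j = content T' j + (if j = i then 1 else 0)" for j
      unfolding T by (rule content_insert[OF T'f notin(1)[OF T']])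
    ultimately show "T \<in> ?L" using T' by (auto simp: families_of_def families_def)
  qed
  have "?F i ` ?G i \<inter> ?F j ` ?G j = {}" if "i \<noteq> j" for i j
  proof -
    have max: "Max (T ?k) = i" if TF: "T \<in> ?F i ` ?G i" for i T
    proof -
      obtain T' where T': "T' \<in> ?G i" and T: "T = ?F i T'" using TF by blast
      have "T' \<in> families kap l xs ?k i" using T' by (simp add: families_of_def)
      hence "finite (T' ?k)" by (rule families_finite)
      thus ?thesis unfolding T using notin[OF T'] by (auto intro!: Max_eqI intro: less_imp_le)
    qed
    show ?thesis
    proof (rule equals0I)
      fix T assume T: "T \<in> ?F i ` ?G i \<inter> ?F j ` ?G j"
      have "i = j" using max[OF IntD1[OF T]] max[OF IntD2[OF T]] by (rule trans[OF sym])
      thus False using that by simp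
    qed
  qed
  hence "card (families_of kap l (x # xs) c b al) = (\<Sum>i\<in>?I. card (?F i ` ?G i))"
    unfolding eq by (intro card_UN_disjoint) auto
  also have "\<dots> = (\<Sum>i\<in>?I. card (?G i))"
  proof (intro sum.cong refl card_image inj_onI)
    fix i T T' assume T: "T \<in> ?G i" "T' \<in> ?G i" and eq: "?F i T = ?F i T'"
    show "T = T'"
    proof
      fix k
      show "T k = T' k"
      proof (cases "k = ?k")
        case True
        have "insert i (T ?k) = insert i (T' ?k)" using fun_cong[OF eq, of ?k] by simp
        thus ?thesis unfolding True by (rule insert_ident[OF notin(1)[OF T(1)] notin(1)[OF T(2)], THEN iffD1])
      qed (use fun_cong[OF eq, of k] in simp)
    qed
  qed
  finally show ?thesis .
qed

text \<open>Exchanging the row labels j and j + 1 in every set is a bijection; both labels are at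
  least b, so the bound on the colour c is respected.\<close>

lemma card_families_of_transpose:
  assumes "b \<le> j" "Suc j < l"
  shows "card (families_of kap l xs c b (al \<circ> Transposition.transpose j (Suc j))) = card (families_of kap l xs c b al)"
proof -
  let ?s = "Transposition.transpose j (Suc j)"
  let ?F = "\<lambda>T k. ?s ` T k"
  have ss: "?s (?s i) = i" for i by simp
  have s_less: "?s i < l \<longleftrightarrow> i < l" for i using assms by (auto simp: transpose_def)
  have s_b: "i < b \<Longrightarrow> ?s i = i" for i using assms by (auto simp: transpose_def)
  have cont: "content (?F T) i = content T (?s i)" for T i
  proof -
    have "i \<in> ?s ` T k \<longleftrightarrow> ?s i \<in> T k" for k by (metis image_iff ss)
    thus ?thesis by (simp add: content_def)
  qed
  have maps: "?F T \<in> families_of kap l xs c b (al \<circ> ?s)" if T: "T \<in> families_of kap l xs c b al" for T al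
  proof -
    have f: "T \<in> families kap l xs c b" using T by (simp add: families_of_def)
    have "?s ` T k \<subseteq> {..<l}" for k using f s_less by (auto simp: families_def)
    moreover have "card (?s ` T k) = card (T k)" for k
      by (intro card_image inj_onI) (metis ss)
    moreover have "?s ` T c \<subseteq> {..<b}" using f s_b by (auto simp: families_def)
    ultimately show ?thesis using T s_less by (auto simp: families_of_def families_def cont)
  qed
  have "bij_betw ?F (families_of kap l xs c b al) (families_of kap l xs c b (al \<circ> ?s))"
  proof (rule bij_betw_byWitness[where f' = ?F])
    have "(al \<circ> ?s) \<circ> ?s = al" by (simp add: fun_eq_iff)
    thus "?F ` families_of kap l xs c b (al \<circ> ?s) \<subseteq> families_of kap l xs c b al"
      using maps[of _ "al \<circ> ?s"] by auto
  qed (use maps in \<open>auto simp: image_image\<close>)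
  thus ?thesis by (simp add: bij_betw_same_card)
qed

subsection \<open>The recursion for admissible exponent lists\<close>

definition parts :: "nat list \<Rightarrow> nat \<Rightarrow> int" where
  "parts lam k = (if k < length lam then int (lam ! k) else 0)"

lemma sum_list_parts: "length lam = l \<Longrightarrow> (\<Sum>i<l. parts lam i) = int (sum_list lam)"
  by (simp add: parts_def sum_list_sum_nth atLeast0LessThan)

lemma finite_admissible: "finite {es. admissible kap lam c b xs es}"
proof (rule finite_subset)
  show "{es. admissible kap lam c b xs es} \<subseteq> {es. set es \<subseteq> {..<length lam} \<and> length es = length xs}"
  proof
    fix es assume "es \<in> {es. admissible kap lam c b xs es}"
    hence "admissible kap lam c b xs es" by simp
    hence "set es \<subseteq> {..<length lam} \<and> length es = length xs"
      by (induction kap lam c b xs es rule: admissible.induct) auto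
    thus "es \<in> {es. set es \<subseteq> {..<length lam} \<and> length es = length xs}" by simp
  qed
qed (simp add: finite_lists_length_eq)

text \<open>Instances of H are the number of families, with weight 1, and the normalized raising
  sum, with weight q^i. Splitting off row i leaves a composition that need not be decreasing;
  \<open>H_swap\<close> carries the missing box to the last row of the same length, and
  \<open>H_neg\<close> disposes of empty rows.\<close>

lemma sum_admissible_recursion:
  fixes H :: "'n list \<Rightarrow> nat \<Rightarrow> nat \<Rightarrow> (nat \<Rightarrow> int) \<Rightarrow> 'a::comm_ring_1" and w :: "nat \<Rightarrow> 'a"
  assumes H_Nil: "\<And>c b. H [] c b (\<lambda>_. 0) = 1"
    and H_Cons: "\<And>x xs c b al. sorted (c # map kap (x # xs)) \<Longrightarrow>
      H (x # xs) c b al = (\<Sum>i | i < l \<and> (kap x = c \<longrightarrow> i < b). w i * H xs (kap x) i (al(i := al i - 1)))"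
    and H_swap: "\<And>xs c b lam j. length lam = l \<Longrightarrow> sum_list lam \<le> M \<Longrightarrow> b \<le> j \<Longrightarrow> Suc j < l \<Longrightarrow>
      lam ! j = lam ! Suc j \<Longrightarrow> H xs c b ((parts lam)(j := parts lam j - 1)) = H xs c b ((parts lam)(Suc j := parts lam (Suc j) - 1))"
    and H_neg: "\<And>xs c b lam j. length lam = l \<Longrightarrow> Suc j = l \<Longrightarrow> lam ! j = 0 \<Longrightarrow>
      H xs c b ((parts lam)(j := parts lam j - 1)) = 0"
    and "desc lam" "length lam = l" "sum_list lam = length xs" "length xs \<le> M" "sorted (c # map kap xs)"
  shows "H xs c b (parts lam) = (\<Sum>es | admissible kap lam c b xs es. prod_list (map w es))"
  using assms(5-9)
proof (induction xs arbitrary: lam c b)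
  case Nil
  have "parts lam = (\<lambda>_. 0)" using Nil by (auto simp: parts_def fun_eq_iff)
  moreover have "{es. admissible kap lam c b [] es} = {[]}" by auto
  ultimately show ?case by (simp add: H_Nil)
next
  case (Cons x xs)
  note lam = Cons.prems(1,2)
  let ?I = "{i. i < l \<and> (kap x = c \<longrightarrow> i < b)}"
  let ?A = "\<lambda>i. {es. admissible kap (remove_box i lam) (kap x) i xs es}"
  \<comment> \<open>The next bound is i itself, so all swaps take place at positions j with i at
    most j, as \<open>H_swap\<close> demands.\<close>
  have move: "H xs (kap x) i ((parts lam)(i := parts lam i - 1))
      = H xs (kap x) i ((parts lam)(last_row i lam := parts lam (last_row i lam) - 1))" if i: "i < l" for i
  proof -
    note lr = last_row[of i lam]
    have il: "i < length lam" using i lam by simp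
    have eq: "lam ! j = lam ! i" if "i \<le> j" "j \<le> last_row i lam" for j
    proof (rule antisym)
      show "lam ! j \<le> lam ! i" using that lam lr(1)[OF il] by (auto simp: desc_def)
      show "lam ! i \<le> lam ! j" using that lam lr(1)[OF il] lr(2)[OF il] unfolding desc_def by metis
    qed
    have "j \<le> last_row i lam \<longrightarrow> H xs (kap x) i ((parts lam)(i := parts lam i - 1))
      = H xs (kap x) i ((parts lam)(j := parts lam j - 1))" if "i \<le> j" for j
      using that
    proof (induction j rule: dec_induct)
      case (step j)
      show ?case
      proof
        assume j: "Suc j \<le> last_row i lam"
        hence "Suc j < l" using lr(1)[OF il] lam by simp
        moreover have "lam ! j = lam ! Suc j" using eq[of j] eq[of "Suc j"] j step by simp
        ultimately have "H xs (kap x) i ((parts lam)(j := parts lam j - 1))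
            = H xs (kap x) i ((parts lam)(Suc j := parts lam (Suc j) - 1))"
          using H_swap[of lam i j xs "kap x"] step lam Cons.prems by (simp del: fun_upd_apply)
        thus "H xs (kap x) i ((parts lam)(i := parts lam i - 1))
            = H xs (kap x) i ((parts lam)(Suc j := parts lam (Suc j) - 1))"
          using step j by (simp del: fun_upd_apply)
      qed
    qed simp
    thus ?thesis using lr(3)[OF il] by simp
  qed
  have single: "H xs (kap x) i ((parts lam)(i := parts lam i - 1))
      = (if lam ! i > 0 then (\<Sum>es\<in>?A i. prod_list (map w es)) else 0)" if i: "i < l" for i
  proof (cases "lam ! i > 0")
    case True
    have il: "i < length lam" using i lam by simp
    note lr = last_row[OF il]
    have "(parts lam)(last_row i lam := parts lam (last_row i lam) - 1) = parts (remove_box i lam)"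
      using lr(1,2) True by (auto simp: fun_eq_iff parts_def remove_box_def nth_list_update)
    moreover have "Suc (sum_list (remove_box i lam)) = sum_list lam"
      using il True by (rule sum_list_remove_box)
    ultimately show ?thesis
      using True Cons.prems il move[OF i] Cons.IH[of "remove_box i lam" "kap x" i] desc_remove_box[OF lam(1) il]
      by simp
  next
    case False
    have il: "i < length lam" using i lam by simp
    note lr = last_row[OF il]
    \<comment> \<open>If row i is empty, so are all later rows; the last row of its length is then
      row l - 1, where \<open>H_neg\<close> applies.\<close>
    have "lam ! (l - 1) \<le> lam ! i" using lam i by (auto simp: desc_def)
    hence "l - 1 \<le> last_row i lam" using lr(4)[of "l - 1"] False lam i by simp
    hence "Suc (last_row i lam) = l" using lr(1) lam by simp
    thus ?thesis using H_neg[of lam "last_row i lam"] move[OF i] False lr(2) lam by simp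
  qed
  have set_eq: "{es. admissible kap lam c b (x # xs) es} = (\<Union>i\<in>{i\<in>?I. lam ! i > 0}. (#) i ` ?A i)"
    (is "?L = ?R")
  proof (intro equalityI subsetI)
    fix es assume "es \<in> ?L"
    thus "es \<in> ?R" using lam by (cases es) auto
  next
    fix es assume "es \<in> ?R"
    thus "es \<in> ?L" using lam by auto
  qed
  have "(\<Sum>es | admissible kap lam c b (x # xs) es. prod_list (map w es))
      = (\<Sum>i\<in>{i\<in>?I. lam ! i > 0}. \<Sum>es\<in>(#) i ` ?A i. prod_list (map w es))"
    unfolding set_eq by (rule sum.UNION_disjoint) (auto simp: finite_admissible)
  also have "\<dots> = (\<Sum>i\<in>{i\<in>?I. lam ! i > 0}. w i * (\<Sum>es\<in>?A i. prod_list (map w es)))"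
    by (intro sum.cong refl) (simp add: sum.reindex sum_distrib_left)
  also have "\<dots> = (\<Sum>i\<in>?I. if lam ! i > 0 then w i * (\<Sum>es\<in>?A i. prod_list (map w es)) else 0)"
    by (rule sum.inter_filter) auto
  also have "\<dots> = (\<Sum>i\<in>?I. w i * H xs (kap x) i ((parts lam)(i := parts lam i - 1)))"
    by (intro sum.cong refl) (simp add: single)
  also have "\<dots> = H (x # xs) c b (parts lam)"
    using Cons.prems(5) by (rule H_Cons[symmetric])
  finally show ?case by simp
qed

lemma card_admissible:
  assumes "desc lam" "length lam = l" "sum_list lam = length xs" "sorted (c # map kap xs)"
  shows "card {es. admissible kap lam c b xs es} = card (families_of kap l xs c b (parts lam))"
proof -
  have "int (card (families_of kap l xs c b (parts lam)))
      = (\<Sum>es | admissible kap lam c b xs es. prod_list (map (\<lambda>_. 1) es))"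
  proof (rule sum_admissible_recursion[where l = l and M = "length xs"])
    fix xs :: "'a list" and c b :: nat and lam :: "nat list" and j
    assume *: "length lam = l" "b \<le> j" "Suc j < l" "lam ! j = lam ! Suc j"
    have "(parts lam)(j := parts lam j - 1) \<circ> Transposition.transpose j (Suc j)
        = (parts lam)(Suc j := parts lam (Suc j) - 1)"
      using * by (auto simp: fun_eq_iff transpose_def parts_def)
    thus "int (card (families_of kap l xs c b ((parts lam)(j := parts lam j - 1))))
      = int (card (families_of kap l xs c b ((parts lam)(Suc j := parts lam (Suc j) - 1))))"
      using card_families_of_transpose[OF *(2,3), of kap xs c "(parts lam)(j := parts lam j - 1)"] by simp
  next
    fix xs :: "'a list" and c b :: nat and lam :: "nat list" and j
    assume "length lam = l" "Suc j = l" "lam ! j = 0"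
    thus "int (card (families_of kap l xs c b ((parts lam)(j := parts lam j - 1)))) = 0"
      using families_of_neg[of j l "(parts lam)(j := parts lam j - 1)"] by (simp add: parts_def)
  qed (use assms in \<open>auto simp: families_of_Nil card_families_of_Cons simp del: fun_upd_apply\<close>)
  also have "\<dots> = int (card {es. admissible kap lam c b xs es})"
    by (simp add: map_replicate_const)
  finally show ?thesis by simp
qed

subsection \<open>Straightening of raising operators\<close>

lemma finite_index_pairs [simp]: "finite (index_pairs l)"
  by (rule finite_subset[of _ "{..<l} \<times> {..<l}"]) (auto simp: index_pairs_def)

lemma finite_pairs [simp]: "finite {(i, j). i < j \<and> j < (l::nat)}"
  using finite_index_pairs[of l] by (simp add: index_pairs_def)

text \<open>Unlike \<open>raised\<close>, this allows an arbitrary composition and an arbitrary set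
  of index pairs, so that the factor of a single pair can be split off.\<close>

definition raise :: "(nat \<times> nat) set \<Rightarrow> (nat \<Rightarrow> int) \<Rightarrow> (nat \<times> nat \<Rightarrow> nat) \<Rightarrow> nat \<Rightarrow> int" where
  "raise I al a i = al i + (\<Sum>p\<in>I. int (a p) * ((if fst p = i then 1 else 0) - (if snd p = i then 1 else 0)))"

lemma raised_eq_raise:
  assumes "i < length lam"
  shows "raised lam a i = raise (index_pairs (length lam)) (parts lam) a i"
proof -
  let ?l = "length lam"
  have fst: "(\<Sum>p\<in>index_pairs ?l. if fst p = i then int (a p) else 0) = (\<Sum>j\<in>{i<..<?l}. int (a (i, j)))"
  proof -
    have "(\<Sum>p\<in>index_pairs ?l. if fst p = i then int (a p) else 0) = (\<Sum>p\<in>Pair i ` {i<..<?l}. int (a p))"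
      by (rule sum.mono_neutral_cong_right) (auto simp: index_pairs_def)
    thus ?thesis by (simp add: sum.reindex inj_on_def)
  qed
  have snd: "(\<Sum>p\<in>index_pairs ?l. if snd p = i then int (a p) else 0) = (\<Sum>j<i. int (a (j, i)))"
  proof -
    have "(\<Sum>p\<in>index_pairs ?l. if snd p = i then int (a p) else 0) = (\<Sum>p\<in>(\<lambda>j. (j, i)) ` {..<i}. int (a p))"
      using assms by (intro sum.mono_neutral_cong_right) (auto simp: index_pairs_def)
    thus ?thesis by (simp add: sum.reindex inj_on_def)
  qed
  have "(\<Sum>p\<in>index_pairs ?l. int (a p) * ((if fst p = i then 1 else 0) - (if snd p = i then 1 else 0)))
     = (\<Sum>p\<in>index_pairs ?l. if fst p = i then int (a p) else 0) - (\<Sum>p\<in>index_pairs ?l. if snd p = i then int (a p) else 0)"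
    unfolding sum_subtractf[symmetric] by (intro sum.cong) auto
  thus ?thesis unfolding raise_def raised_def fst snd using assms by (simp add: parts_def)
qed

lemma raise_upd: "raise I (al(i := al i - 1)) a = (raise I al a)(i := raise I al a i - 1)"
  by (auto simp: raise_def fun_eq_iff)

lemma raising_coeff_0 [simp]: "raising_coeff t 0 = 1"
  by (simp add: raising_coeff_def)

text \<open>With c_k the coefficients of (1 - x)/(1 - t x), one has t c_k = c_(k+1) for k at least
  1, but t c_0 = c_0 + c_1. The equality of g at 0 and 1 absorbs the extra term.\<close>

lemma raising_telescope:
  fixes g :: "nat \<Rightarrow> complex fls"
  assumes "g 0 = g 1"
  shows "t * (\<Sum>k\<le>M. raising_coeff t k * g (Suc k)) = (\<Sum>k\<le>Suc M. raising_coeff t k * g k)"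
proof (induction M)
  case 0
  show ?case using assms by (simp add: raising_coeff_def algebra_simps)
next
  case (Suc M)
  have "t * (raising_coeff t (Suc M) * g (Suc (Suc M))) = raising_coeff t (Suc (Suc M)) * g (Suc (Suc M))"
    by (simp add: raising_coeff_def algebra_simps)
  thus ?case using Suc by (simp add: distrib_left)
qed

text \<open>The raising operator applied to a numerical function N of the composition in place of
  h_al, with exponents bounded by M.\<close>

definition raising_sum :: "(nat \<times> nat) set \<Rightarrow> complex fls \<Rightarrow> nat \<Rightarrow> ((nat \<Rightarrow> int) \<Rightarrow> nat) \<Rightarrow> (nat \<Rightarrow> int) \<Rightarrow> complex fls" where
  "raising_sum I t M N al = (\<Sum>a\<in>I \<rightarrow>\<^sub>E {..M}. (\<Prod>p\<in>I. raising_coeff t (a p)) * of_nat (N (raise I al a)))"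

lemma raising_sum_insert:
  assumes "finite I" "(i, j) \<notin> I"
  shows "raising_sum (insert (i, j) I) t M N al
    = (\<Sum>k\<le>M. raising_coeff t k * raising_sum I t M N
        (\<lambda>r. al r + int k * ((if i = r then 1 else 0) - (if j = r then 1 else 0))))"
proof -
  let ?p = "(i, j)"
  let ?al = "\<lambda>k r. al r + int k * ((if i = r then 1 else 0) - (if j = r then 1 else 0))"
  have raise: "raise (insert ?p I) al (g(?p := k)) = raise I (?al k) g" for g k
  proof
    fix r
    have "(\<Sum>p\<in>I. int ((g(?p := k)) p) * ((if fst p = r then 1 else 0) - (if snd p = r then 1 else 0)))
        = (\<Sum>p\<in>I. int (g p) * ((if fst p = r then 1 else 0) - (if snd p = r then 1 else 0)))"
      using assms by (intro sum.cong) auto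
    thus "raise (insert ?p I) al (g(?p := k)) r = raise I (?al k) g r"
      using assms by (simp add: raise_def)
  qed
  have prod: "(\<Prod>p\<in>insert ?p I. raising_coeff t ((g(?p := k)) p)) = raising_coeff t k * (\<Prod>p\<in>I. raising_coeff t (g p))" for g k
  proof -
    have "(\<Prod>p\<in>I. raising_coeff t ((g(?p := k)) p)) = (\<Prod>p\<in>I. raising_coeff t (g p))"
      using assms by (intro prod.cong) auto
    thus ?thesis using assms by simp
  qed
  have "raising_sum (insert ?p I) t M N al
      = (\<Sum>(k, g)\<in>{..M} \<times> (I \<rightarrow>\<^sub>E {..M}). (\<Prod>p\<in>insert ?p I. raising_coeff t ((g(?p := k)) p)) * of_nat (N (raise (insert ?p I) al (g(?p := k)))))"
    unfolding raising_sum_def PiE_insert_eq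
    by (subst sum.reindex) (use inj_combinator[OF assms(2), of "\<lambda>_. {..M}"] in \<open>auto simp: case_prod_unfold o_def\<close>)
  also have "\<dots> = (\<Sum>k\<le>M. \<Sum>g\<in>I \<rightarrow>\<^sub>E {..M}. raising_coeff t k * ((\<Prod>p\<in>I. raising_coeff t (g p)) * of_nat (N (raise I (?al k) g))))"
    unfolding sum.cartesian_product[symmetric] by (intro sum.cong refl) (simp only: prod raise mult.assoc)
  finally show ?thesis by (simp add: raising_sum_def sum_distrib_left)
qed

text \<open>As for positive roots, (j, j + 1) is the only pair whose order the transposition
  reverses; the remaining pairs are permuted among themselves.\<close>

lemma raising_sum_transpose:
  assumes I: "I = index_pairs l - {(j, Suc j)}" and j: "Suc j < l"
    and N: "\<And>al. N (al \<circ> Transposition.transpose j (Suc j)) = N al"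
  shows "raising_sum I t M N (al \<circ> Transposition.transpose j (Suc j)) = raising_sum I t M N al"
proof -
  let ?s = "Transposition.transpose j (Suc j)"
  let ?S = "map_prod ?s ?s"
  have SS: "?S (?S p) = p" for p by (cases p) simp
  have SI: "?S p \<in> I" if "p \<in> I" for p
    using that j unfolding I by (cases p) (auto simp: index_pairs_def transpose_def split: if_splits)
  have bijS: "bij_betw ?S I I"
    by (rule bij_betw_byWitness[where f' = ?S]) (use SS SI in auto)
  let ?F = "\<lambda>a p. if p \<in> I then a (?S p) else undefined"
  have bijF: "bij_betw ?F (I \<rightarrow>\<^sub>E {..M}) (I \<rightarrow>\<^sub>E {..M})"
    by (rule bij_betw_byWitness[where f' = ?F])
       (use SS SI in \<open>auto simp: fun_eq_iff PiE_def Pi_def extensional_def\<close>)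
  have raise: "raise I (al \<circ> ?s) (?F a) = raise I al a \<circ> ?s" for a
  proof
    fix i
    have "(\<Sum>p\<in>I. int (?F a p) * ((if fst p = i then 1 else 0) - (if snd p = i then 1 else 0)))
        = (\<Sum>p\<in>I. int (a (?S p)) * ((if fst p = i then 1 else 0) - (if snd p = i then 1 else 0)))"
      by (intro sum.cong) auto
    also have "\<dots> = (\<Sum>p\<in>I. int (a (?S (?S p))) * ((if fst (?S p) = i then 1 else 0) - (if snd (?S p) = i then 1 else 0)))"
      by (rule sum.reindex_bij_betw[OF bijS, symmetric])
    also have "\<dots> = (\<Sum>p\<in>I. int (a p) * ((if fst p = ?s i then 1 else 0) - (if snd p = ?s i then 1 else 0)))"
    proof -
      have "?s x = i \<longleftrightarrow> x = ?s i" for x by (metis transpose_involutory)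
      thus ?thesis unfolding SS by (intro sum.cong refl) (simp only: fst_map_prod snd_map_prod)
    qed
    finally show "raise I (al \<circ> ?s) (?F a) i = (raise I al a \<circ> ?s) i"
      by (simp add: raise_def)
  qed
  have prod: "(\<Prod>p\<in>I. raising_coeff t (?F a p)) = (\<Prod>p\<in>I. raising_coeff t (a p))" for a
  proof -
    have "(\<Prod>p\<in>I. raising_coeff t (?F a p)) = (\<Prod>p\<in>I. raising_coeff t (a (?S p)))" by (intro prod.cong) auto
    also have "\<dots> = (\<Prod>p\<in>I. raising_coeff t (a p))" by (rule prod.reindex_bij_betw[OF bijS])
    finally show ?thesis .
  qed
  have "raising_sum I t M N (al \<circ> ?s)
     = (\<Sum>a\<in>I \<rightarrow>\<^sub>E {..M}. (\<Prod>p\<in>I. raising_coeff t (?F a p)) * of_nat (N (raise I (al \<circ> ?s) (?F a))))"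
    unfolding raising_sum_def by (rule sum.reindex_bij_betw[OF bijF, symmetric])
  thus ?thesis unfolding raise prod N raising_sum_def .
qed

text \<open>Raising moves weight towards smaller indices, so the sum over a tail never grows. A
  negative tail sum stays negative and contains a negative entry, where N vanishes.\<close>

lemma raising_sum_tail_neg:
  assumes I: "I = index_pairs l - {(j, Suc j)}"
    and neg: "(\<Sum>i\<in>{Suc j..<l}. al i) < 0"
    and N: "\<And>i al. i < l \<Longrightarrow> al i < 0 \<Longrightarrow> N al = 0"
  shows "raising_sum I t M N al = 0"
proof -
  have "N (raise I al a) = 0" for a
  proof -
    have "(\<Sum>i\<in>{Suc j..<l}. raise I al a i) = (\<Sum>i\<in>{Suc j..<l}. al i)
       + (\<Sum>p\<in>I. int (a p) * (\<Sum>i\<in>{Suc j..<l}. (if fst p = i then 1 else 0) - (if snd p = i then 1 else 0)))"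
      unfolding raise_def sum.distrib by (subst sum.swap) (simp add: sum_distrib_left)
    also have "(\<Sum>p\<in>I. int (a p) * (\<Sum>i\<in>{Suc j..<l}. (if fst p = i then 1 else 0) - (if snd p = i then 1 else 0))) \<le> 0"
    proof (rule sum_nonpos, rule mult_nonneg_nonpos)
      fix p assume "p \<in> I"
      thus "(\<Sum>i\<in>{Suc j..<l}. (if fst p = i then 1 else 0) - (if snd p = i then 1 else 0)) \<le> (0::int)"
        unfolding I sum_subtractf by (auto simp: index_pairs_def)
    qed simp
    finally have "(\<Sum>i\<in>{Suc j..<l}. raise I al a i) < 0" using neg by linarith
    hence "\<exists>i\<in>{Suc j..<l}. raise I al a i < 0" by (meson not_le sum_nonneg)
    thus ?thesis using N by auto
  qed
  thus ?thesis by (simp add: raising_sum_def)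
qed

text \<open>The straightening rule for adjacent entries (s - 1, s) and (s, s - 1). Expanding only
  the factor of the pair (j, j + 1) gives two series in the same sequence g, shifted by one; g 0 = g
  1 by symmetry in the two entries, and the series telescope.\<close>

lemma raising_sum_swap:
  assumes N: "\<And>al. N (al \<circ> Transposition.transpose j (Suc j)) = N al"
    and neg: "\<And>i al. i < l \<Longrightarrow> al i < 0 \<Longrightarrow> N al = 0"
    and lam: "length lam = l" "sum_list lam \<le> M" "Suc j < l" "lam ! j = lam ! Suc j"
  shows "raising_sum (index_pairs l) t M N ((parts lam)(j := parts lam j - 1))
    = t * raising_sum (index_pairs l) t M N ((parts lam)(Suc j := parts lam (Suc j) - 1))"
proof -
  let ?al = "(parts lam)(j := parts lam j - 1)" and ?be = "(parts lam)(Suc j := parts lam (Suc j) - 1)"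
  define I where "I = index_pairs l - {(j, Suc j)}"
  have ins: "index_pairs l = insert (j, Suc j) I" "(j, Suc j) \<notin> I" "finite I"
    using lam by (auto simp: I_def index_pairs_def)
  define sh where "sh = (\<lambda>k::nat. \<lambda>r. ?al r + int k * ((if j = r then 1 else 0) - (if Suc j = r then 1 else 0)))"
  define g where "g = (\<lambda>k. raising_sum I t M N (sh k))"
  have al: "raising_sum (index_pairs l) t M N ?al = (\<Sum>k\<le>M. raising_coeff t k * g k)"
    unfolding ins(1) raising_sum_insert[OF ins(3,2)] g_def sh_def ..
  have "(\<lambda>r. ?be r + int k * ((if j = r then 1 else 0) - (if Suc j = r then 1 else 0))) = sh (Suc k)" for k
    by (auto simp: sh_def fun_eq_iff)
  hence be: "raising_sum (index_pairs l) t M N ?be = (\<Sum>k\<le>M. raising_coeff t k * g (Suc k))"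
    unfolding ins(1) raising_sum_insert[OF ins(3,2)] g_def by simp
  have "sh 0 = sh 1 \<circ> Transposition.transpose j (Suc j)"
    using lam by (auto simp: sh_def fun_eq_iff transpose_def parts_def)
  hence "g 0 = g 1" unfolding g_def using raising_sum_transpose[where N = N and j = j, OF I_def lam(3) N] by simp
  \<comment> \<open>The single surplus term of the telescoped sum: after M + 1 raisings the tail
    from j + 1 on has sum at most M - (M + 1).\<close>
  moreover have "g (Suc M) = 0"
    unfolding g_def
  proof (rule raising_sum_tail_neg[OF I_def _ neg])
    have "(\<Sum>i\<in>{Suc j..<l}. sh (Suc M) i) = (\<Sum>i\<in>{Suc j..<l}. parts lam i - (if i = Suc j then int (Suc M) else 0))"
      by (intro sum.cong) (auto simp: sh_def)
    also have "\<dots> = (\<Sum>i\<in>{Suc j..<l}. parts lam i) - int (Suc M)"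
      using lam by (simp add: sum_subtractf)
    also have "(\<Sum>i\<in>{Suc j..<l}. parts lam i) \<le> (\<Sum>i<l. parts lam i)"
      by (intro sum_mono2) (auto simp: parts_def)
    finally show "(\<Sum>i\<in>{Suc j..<l}. sh (Suc M) i) < 0" using lam sum_list_parts[OF lam(1)] by simp
  qed
  ultimately show ?thesis unfolding al be raising_telescope[of g, OF \<open>g 0 = g 1\<close>] by simp
qed

lemma raising_sum_zero:
  assumes "\<And>al. (\<exists>i<l. al i \<noteq> 0) \<Longrightarrow> N al = 0" "N (\<lambda>_. 0) = 1"
  shows "raising_sum (index_pairs l) t M N (\<lambda>_. 0) = 1"
proof -
  let ?I = "index_pairs l" and ?z = "\<lambda>p. if p \<in> index_pairs l then 0 else undefined"
  have zero: "a = ?z" if a: "a \<in> ?I \<rightarrow>\<^sub>E {..M}" and r: "\<And>i. i < l \<Longrightarrow> raise ?I (\<lambda>_. 0) a i = 0" for a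
  proof -
    \<comment> \<open>The functional that sums i times the i-th entry drops by j - i with each
      raising of the pair (i, j), so only the zero exponents return to the zero composition.\<close>
    have "0 = (\<Sum>i<l. int i * raise ?I (\<lambda>_. 0) a i)" using r by simp
    also have "\<dots> = (\<Sum>p\<in>?I. int (a p) * (\<Sum>i<l. int i * ((if fst p = i then 1 else 0) - (if snd p = i then 1 else 0))))"
      unfolding raise_def by (simp add: sum_distrib_left mult.left_commute, subst sum.swap, simp)
    also have "\<dots> = (\<Sum>p\<in>?I. - (int (a p) * (int (snd p) - int (fst p))))"
      by (intro sum.cong refl) (auto simp: index_pairs_def right_diff_distrib sum_subtractf if_distrib[of "\<lambda>x. _ * x"] cong: if_cong)
    finally have s0: "(\<Sum>p\<in>?I. int (a p) * (int (snd p) - int (fst p))) = 0" by (simp add: sum_negf)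
    have "\<forall>p\<in>?I. int (a p) * (int (snd p) - int (fst p)) = 0"
      using s0 by (subst (asm) sum_nonneg_eq_0_iff) (auto simp: index_pairs_def)
    hence "a p = 0" if "p \<in> ?I" for p using that by (fastforce simp: index_pairs_def)
    thus ?thesis using a by (auto simp: fun_eq_iff PiE_def extensional_def)
  qed
  have "raising_sum ?I t M N (\<lambda>_. 0) = (\<Sum>a\<in>{?z}. (\<Prod>p\<in>?I. raising_coeff t (a p)) * of_nat (N (raise ?I (\<lambda>_. 0) a)))"
    unfolding raising_sum_def
  proof (rule sum.mono_neutral_right)
    show "\<forall>a\<in>(?I \<rightarrow>\<^sub>E {..M}) - {?z}. (\<Prod>p\<in>?I. raising_coeff t (a p)) * of_nat (N (raise ?I (\<lambda>_. 0) a)) = 0"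
    proof
      fix a assume a: "a \<in> (?I \<rightarrow>\<^sub>E {..M}) - {?z}"
      hence "\<exists>i<l. raise ?I (\<lambda>_. 0) a i \<noteq> 0" using zero[of a] by blast
      thus "(\<Prod>p\<in>?I. raising_coeff t (a p)) * of_nat (N (raise ?I (\<lambda>_. 0) a)) = 0" using assms(1) by simp
    qed
  qed (auto intro: finite_PiE)
  moreover have "raise ?I (\<lambda>_. 0) ?z = (\<lambda>_. 0)" by (auto simp: raise_def fun_eq_iff)
  moreover have "(\<Prod>p\<in>?I. raising_coeff t (?z p)) = 1" by (intro prod.neutral) auto
  ultimately show ?thesis using assms(2) by simp
qed

text \<open>The power of q attached to a composition cancels the factor q^-1 of the straightening
  rule, because moving the missing box from row j to row j + 1 changes its exponent by one.
  Splitting off row i then produces the weight q^i.\<close>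

theorem raising_sum_families:
  assumes "desc lam" "length lam = l" "sum_list lam = length xs" "sorted (c # map kap xs)"
  shows "fls_X ^ (\<Sum>i<l. i * lam ! i) *
      raising_sum (index_pairs l) fls_X_inv (length xs) (\<lambda>al. card (families_of kap l xs c b al)) (parts lam)
    = (\<Sum>es | admissible kap lam c b xs es. fls_X ^ sum_list es)"
proof -
  let ?q = "fls_X :: complex fls" and ?t = "fls_X_inv :: complex fls" and ?M = "length xs"
  have q: "?q \<noteq> 0" "?q * ?t = 1" by (simp_all add: fls_X_conv_shift_1 fls_inverse_X[symmetric])
  \<comment> \<open>The bound \<open>?M\<close> is the length of the whole list and stays fixed
    while the list of variables shrinks.\<close>
  define S where "S = (\<lambda>xs c b al. raising_sum (index_pairs l) ?t ?M (\<lambda>al. card (families_of kap l xs c b al)) al)"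
  \<comment> \<open>Integer powers of q, since shortening an empty row gives the entry -1.\<close>
  define H where "H = (\<lambda>xs c b al. ?q powi (\<Sum>i<l. int i * al i) * S xs c b al)"
  have "H xs c b (parts lam) = (\<Sum>es | admissible kap lam c b xs es. prod_list (map (\<lambda>e. ?q ^ e) es))"
  proof (rule sum_admissible_recursion[where l = l and M = ?M])
    fix c b
    show "H [] c b (\<lambda>_. 0) = 1"
      unfolding H_def S_def by (subst raising_sum_zero) (auto simp: families_of_Nil)
  next
    fix x :: 'a and xs c b al
    assume so: "sorted (c # map kap (x # xs))"
    let ?J = "{i. i < l \<and> (kap x = c \<longrightarrow> i < b)}"
    have S: "S (x # xs) c b al = (\<Sum>i\<in>?J. S xs (kap x) i (al(i := al i - 1)))"
      unfolding S_def raising_sum_def card_families_of_Cons[OF so] raise_upd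
      by (subst sum.swap) (simp add: sum_distrib_left)
    have Q: "?q powi (\<Sum>k<l. int k * al k) = ?q ^ i * ?q powi (\<Sum>k<l. int k * (al(i := al i - 1)) k)"
      if "i < l" for i
    proof -
      have "(\<Sum>k<l. int k * al k) = (\<Sum>k<l. int k * (al(i := al i - 1)) k + (if k = i then int i else 0))"
        by (intro sum.cong) (auto simp: algebra_simps)
      also have "\<dots> = int i + (\<Sum>k<l. int k * (al(i := al i - 1)) k)"
        using that by (simp add: sum.distrib del: fun_upd_apply)
      finally have "(\<Sum>k<l. int k * al k) = int i + (\<Sum>k<l. int k * (al(i := al i - 1)) k)" .
      thus ?thesis by (simp only: power_int_add[OF disjI1[OF q(1)]] power_int_of_nat)
    qed
    have "H (x # xs) c b al = (\<Sum>i\<in>?J. ?q powi (\<Sum>k<l. int k * al k) * S xs (kap x) i (al(i := al i - 1)))"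
      by (simp only: H_def S sum_distrib_left)
    also have "\<dots> = (\<Sum>i\<in>?J. ?q ^ i * H xs (kap x) i (al(i := al i - 1)))"
    proof (intro sum.cong refl)
      fix i assume "i \<in> ?J"
      hence "i < l" by simp
      show "?q powi (\<Sum>k<l. int k * al k) * S xs (kap x) i (al(i := al i - 1))
          = ?q ^ i * H xs (kap x) i (al(i := al i - 1))"
        unfolding H_def by (simp only: Q[OF \<open>i < l\<close>] mult.assoc)
    qed
    finally show "H (x # xs) c b al = (\<Sum>i\<in>?J. ?q ^ i * H xs (kap x) i (al(i := al i - 1)))" .
  next
    fix xs c b and lam :: "nat list" and j
    assume lam: "length lam = l" "sum_list lam \<le> ?M" "b \<le> j" "Suc j < l" "lam ! j = lam ! Suc j"
    let ?al = "(parts lam)(j := parts lam j - 1)" and ?be = "(parts lam)(Suc j := parts lam (Suc j) - 1)"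
    have S: "S xs c b ?al = ?t * S xs c b ?be"
      unfolding S_def using lam
      by (intro raising_sum_swap) (auto simp: card_families_of_transpose families_of_neg)
    have "(\<Sum>k<l. int k * ?al k) = (\<Sum>k<l. int k * ?be k + ((if k = Suc j then int (Suc j) else 0) - (if k = j then int j else 0)))"
      by (intro sum.cong) (auto simp: algebra_simps)
    also have "\<dots> = (\<Sum>k<l. int k * ?be k) + 1"
      using lam by (simp add: sum.distrib sum_subtractf del: fun_upd_apply)
    finally have "(\<Sum>k<l. int k * ?al k) = (\<Sum>k<l. int k * ?be k) + 1" .
    hence "H xs c b ?al = ?q powi (\<Sum>k<l. int k * ?be k) * ((?q * ?t) * S xs c b ?be)"
      unfolding H_def S by (simp only: power_int_add[OF disjI1[OF q(1)]] power_int_1_right mult.assoc)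
    thus "H xs c b ?al = H xs c b ?be"
      by (simp only: q(2) mult_1 H_def)
  next
    fix xs c b and lam :: "nat list" and j
    assume lam: "length lam = l" "Suc j = l" "lam ! j = 0"
    have "families_of kap l xs c b (raise (index_pairs l) ((parts lam)(j := parts lam j - 1)) a) = {}" for a
    proof (rule families_of_neg)
      have "(\<Sum>p\<in>index_pairs l. int (a p) * ((if fst p = j then 1 else 0) - (if snd p = j then 1 else 0))) \<le> 0"
        using lam by (intro sum_nonpos mult_nonneg_nonpos) (auto simp: index_pairs_def)
      thus "raise (index_pairs l) ((parts lam)(j := parts lam j - 1)) a j < 0"
        using lam by (simp add: raise_def parts_def)
    qed (use lam in simp)
    thus "H xs c b ((parts lam)(j := parts lam j - 1)) = 0"
      by (simp add: H_def S_def raising_sum_def del: fun_upd_apply)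
  qed (use assms in auto)
  moreover have "(\<Sum>i<l. int i * parts lam i) = int (\<Sum>i<l. i * lam ! i)"
    using assms(2) by (simp add: parts_def)
  moreover have "prod_list (map (\<lambda>e. ?q ^ e) es) = ?q ^ sum_list es" for es
    by (induction es) (simp_all add: power_add)
  ultimately show ?thesis unfolding H_def S_def by (simp only: power_int_of_nat)
qed

section \<open>Permutation characters, Young subgroups and symmetric polynomials\<close>

subsection \<open>Words and set families\<close>

text \<open>S_n permutes these words, and their fixed points give the permutation character with
  Frobenius image the product of the h_(r i).\<close>

definition words :: "nat \<Rightarrow> (nat \<Rightarrow> int) \<Rightarrow> ('n::finite \<Rightarrow> nat) set" where
  "words l r = {w. (\<forall>x. w x < l) \<and> (\<forall>i<l. int (card {x. w x = i}) = r i)}"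

lemma finite_bounded_funs [simp]: "finite {w :: 'n::finite \<Rightarrow> nat. \<forall>x. w x < l}"
proof -
  have "finite {w :: 'n \<Rightarrow> nat. \<forall>x. (x \<in> UNIV \<longrightarrow> w x \<in> {..<l}) \<and> (x \<notin> UNIV \<longrightarrow> w x = 0)}"
    by (rule finite_set_of_finite_funs) auto
  thus ?thesis by simp
qed

lemma finite_words [simp]: "finite (words l r :: ('n::finite \<Rightarrow> nat) set)"
  by (rule finite_subset[OF _ finite_bounded_funs[of l]]) (auto simp: words_def)

text \<open>Precisely the words with trivial stabilizer in the Young subgroup
  \<open>color_perms kap\<close>.\<close>

definition injective_words :: "('n::finite \<Rightarrow> nat) \<Rightarrow> nat \<Rightarrow> (nat \<Rightarrow> int) \<Rightarrow> ('n \<Rightarrow> nat) set" where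
  "injective_words kap l r = {w \<in> words l r. inj (\<lambda>x. (kap x, w x))}"

definition word_family :: "('n::finite \<Rightarrow> nat) \<Rightarrow> ('n \<Rightarrow> nat) \<Rightarrow> nat \<Rightarrow> nat set" where
  "word_family kap w k = w ` {x. kap x = k}"

lemma content_word_family:
  assumes "inj (\<lambda>x. (kap x, w x))"
  shows "content (word_family kap w) i = card {x. w x = i}"
proof -
  have "{k. i \<in> word_family kap w k} = kap ` {x. w x = i}" by (auto simp: word_family_def)
  moreover have "inj_on kap {x. w x = i}" using assms by (auto simp: inj_on_def)
  ultimately show ?thesis by (simp add: content_def card_image)
qed

lemma count_list_colors:
  assumes "distinct bs" "set bs = (UNIV :: 'n::finite set)"
  shows "count_list (map kap bs) k = card {x. kap x = k}"
proof -
  have "count_list (map kap xs) k = card {x \<in> set xs. kap x = k}" if "distinct xs" for xs :: "'n list"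
    using that
  proof (induction xs)
    case (Cons x xs)
    have "{y \<in> set (x # xs). kap y = k} = (if kap x = k then insert x {y \<in> set xs. kap y = k} else {y \<in> set xs. kap y = k})"
      by auto
    thus ?case using Cons by simp
  qed simp
  thus ?thesis using assms by simp
qed

lemma image_preimage: "surj f \<Longrightarrow> f ` {x. Q (f x)} = {y. Q y}"
  using surj_image_vimage_eq[of f "{y. Q y}"] by (simp add: vimage_def)

lemma inj_on_color:
  "inj (\<lambda>x. (kap x, w x)) \<Longrightarrow> inj_on w {x. kap x = k}"
  by (auto simp: inj_on_def)

context
  fixes bs :: "'n::finite list" and kap :: "'n \<Rightarrow> nat" and l c :: nat and r :: "nat \<Rightarrow> int"
  assumes bs: "distinct bs" "set bs = UNIV"
begin

lemma word_family_mem: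
  assumes "w \<in> injective_words kap l r"
  shows "word_family kap w \<in> families_of kap l bs c l r"
  using assms
  by (auto simp: injective_words_def words_def families_of_def families_def count_list_colors[OF bs]
      content_word_family) (auto simp: word_family_def card_image[OF inj_on_color])

lemma word_family_surj:
  assumes T: "T \<in> families_of kap l bs c l r"
  shows "\<exists>w\<in>injective_words kap l r. word_family kap w = T"
proof -
  have f: "T k \<subseteq> {..<l}" "card (T k) = card {x. kap x = k}" "finite (T k)" for k
    using T families_finite[of T kap l bs c l] by (auto simp: families_of_def families_def count_list_colors[OF bs])
  have "\<exists>h. bij_betw h {x. kap x = k} (T k)" for k
    by (rule finite_same_card_bij) (use f in auto)
  then obtain h where h: "\<And>k. bij_betw (h k) {x. kap x = k} (T k)" by metis
  define w where "w = (\<lambda>x. h (kap x) x)"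
  have fam: "word_family kap w k = T k" for k
  proof -
    have "word_family kap w k = h k ` {x. kap x = k}" by (auto simp: word_family_def w_def)
    thus ?thesis using h[of k] by (simp add: bij_betw_def)
  qed
  have inj: "inj (\<lambda>x. (kap x, w x))"
  proof (rule injI)
    fix x y assume "(kap x, w x) = (kap y, w y)"
    thus "x = y" using h[of "kap x"] by (auto simp: w_def bij_betw_def inj_on_def)
  qed
  have "w x < l" for x using fam[of "kap x"] f(1)[of "kap x"] by (auto simp: word_family_def)
  moreover have "content T i = card {x. w x = i}" for i
    using content_word_family[OF inj, of i] fam by (simp add: content_def)
  ultimately have "w \<in> injective_words kap l r"
    using T inj by (auto simp: injective_words_def words_def families_of_def)
  thus ?thesis using fam by blast
qed

lemma word_family_eqE:
  assumes "inj (\<lambda>x. (kap x, w x))" "inj (\<lambda>x. (kap x, w0 x))" "word_family kap w = word_family kap w0"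
  obtains \<sigma> where "\<sigma> \<in> color_perms kap" "w = w0 \<circ> \<sigma>"
proof -
  have "\<exists>y. kap y = kap x \<and> w0 y = w x" for x
  proof -
    have "w x \<in> word_family kap w0 (kap x)" unfolding assms(3)[symmetric] by (auto simp: word_family_def)
    thus ?thesis by (auto simp: word_family_def)
  qed
  then obtain \<sigma> where \<sigma>: "\<And>x. kap (\<sigma> x) = kap x" "\<And>x. w0 (\<sigma> x) = w x" by metis
  have "inj \<sigma>"
  proof (rule injI)
    fix x y assume "\<sigma> x = \<sigma> y"
    hence "kap x = kap y" "w x = w y" using \<sigma>[of x] \<sigma>[of y] by auto
    thus "x = y" using assms(1) by (auto simp: inj_on_def)
  qed
  hence "bij \<sigma>" using finite_UNIV_inj_surj[of \<sigma>] by (simp add: bij_def)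
  hence "\<sigma> permutes UNIV" by (intro bij_imp_permutes) auto
  hence "\<sigma> \<in> color_perms kap" using \<sigma>(1) by (simp add: color_perms_def)
  moreover have "w = w0 \<circ> \<sigma>" by (simp add: fun_eq_iff \<sigma>(2))
  ultimately show ?thesis by (rule that)
qed

text \<open>The Young subgroup acts freely on these words, and \<open>word_family\<close> separates
  and exhausts its orbits.\<close>

lemma card_injective_words:
  "card (injective_words kap l r) = card (color_perms kap) * card (families_of kap l bs c l r)"
proof -
  let ?W = "injective_words kap l r" and ?F = "families_of kap l bs c l r"
  have fin: "finite ?W" by (simp add: injective_words_def)
  have "card ?W = (\<Sum>T\<in>?F. card {w\<in>?W. word_family kap w = T})"
    using word_family_mem fin
    by (subst card_eq_sum, subst sum.group[symmetric, where g = "word_family kap" and T = ?F]) auto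
  also have "\<dots> = (\<Sum>T\<in>?F. card (color_perms kap))"
  proof (intro sum.cong refl)
    fix T assume "T \<in> ?F"
    then obtain w0 where w0: "w0 \<in> ?W" "word_family kap w0 = T" using word_family_surj by blast
    have inj0: "inj (\<lambda>x. (kap x, w0 x))" using w0 by (simp add: injective_words_def)
    have "{w\<in>?W. word_family kap w = T} = (\<lambda>\<sigma>. w0 \<circ> \<sigma>) ` color_perms kap"
    proof (intro equalityI subsetI)
      fix w assume w: "w \<in> {w\<in>?W. word_family kap w = T}"
      hence "inj (\<lambda>x. (kap x, w x))" by (simp add: injective_words_def)
      from word_family_eqE[OF this inj0] w w0 obtain \<sigma> where "\<sigma> \<in> color_perms kap" "w = w0 \<circ> \<sigma>" by auto
      thus "w \<in> (\<lambda>\<sigma>. w0 \<circ> \<sigma>) ` color_perms kap" by blast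
    next
      fix w assume "w \<in> (\<lambda>\<sigma>. w0 \<circ> \<sigma>) ` color_perms kap"
      then obtain \<sigma> where \<sigma>: "\<sigma> permutes UNIV" "\<And>x. kap (\<sigma> x) = kap x" and w: "w = w0 \<circ> \<sigma>"
        by (auto simp: color_perms_def)
      have bij: "bij \<sigma>" using \<sigma>(1) by (rule permutes_bij)
      have "inj (\<lambda>x. (kap x, w x))"
        using inj0 bij_is_inj[OF bij] \<sigma>(2) by (auto simp: inj_on_def w)
      moreover have "card {x. w x = i} = card {x. w0 x = i}" for i
        using card_image[OF inj_on_subset[OF bij_is_inj[OF bij] subset_UNIV], of "{x. w x = i}"]
          image_preimage[OF bij_is_surj[OF bij], of "\<lambda>x. w0 x = i"] by (simp add: w)
      moreover have "word_family kap w k = word_family kap w0 k" for k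
      proof -
        have "word_family kap w k = w0 ` \<sigma> ` {x. kap (\<sigma> x) = k}"
          by (simp add: word_family_def w \<sigma>(2) image_comp)
        thus ?thesis
          by (simp only: image_preimage[OF bij_is_surj[OF bij], of "\<lambda>x. kap x = k"] word_family_def)
      qed
      ultimately show "w \<in> {w\<in>?W. word_family kap w = T}"
        using w0 by (auto simp: injective_words_def words_def w)
    qed
    moreover have "inj_on (\<lambda>\<sigma>. w0 \<circ> \<sigma>) (color_perms kap)"
    proof (rule inj_onI)
      fix \<sigma> \<tau> assume st: "\<sigma> \<in> color_perms kap" "\<tau> \<in> color_perms kap" and eq: "w0 \<circ> \<sigma> = w0 \<circ> \<tau>"
      have "w0 (\<sigma> x) = w0 (\<tau> x)" for x using fun_cong[OF eq, of x] by (simp only: o_apply)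
      moreover have "kap (\<sigma> x) = kap (\<tau> x)" for x using st by (simp add: color_perms_def)
      ultimately show "\<sigma> = \<tau>" using inj0 by (auto simp: inj_on_def fun_eq_iff)
    qed
    ultimately show "card {w\<in>?W. word_family kap w = T} = card (color_perms kap)"
      by (simp add: card_image)
  qed
  finally show ?thesis by simp
qed

end

text \<open>After exchanging the sums, each word contributes the sum of signs over its stabilizer.
  If two places agree in colour and letter, their transposition lies in the stabilizer and the signs
  cancel in pairs; otherwise only the identity remains.\<close>

lemma sum_sign_fixed:
  "(\<Sum>\<sigma>\<in>color_perms kap. sign \<sigma> * int (card {w \<in> words l r. w \<circ> \<sigma> = w})) = int (card (injective_words kap l r))"
proof -
  have stab: "(\<Sum>\<sigma>\<in>{\<sigma>\<in>color_perms kap. w \<circ> \<sigma> = w}. sign \<sigma>) = (if inj (\<lambda>x. (kap x, w x)) then 1 else 0)" for w :: "'a \<Rightarrow> nat"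
  proof (cases "inj (\<lambda>x. (kap x, w x))")
    case True
    have "{\<sigma>\<in>color_perms kap. w \<circ> \<sigma> = w} = {id}"
    proof (intro equalityI subsetI)
      fix \<sigma> assume \<sigma>: "\<sigma> \<in> {\<sigma>\<in>color_perms kap. w \<circ> \<sigma> = w}"
      hence "(kap (\<sigma> x), w (\<sigma> x)) = (kap x, w x)" for x by (auto simp: color_perms_def fun_eq_iff)
      hence "\<sigma> x = x" for x using True by (auto simp: inj_on_def)
      thus "\<sigma> \<in> {id}" by (auto simp: fun_eq_iff)
    qed (auto simp: color_perms_id)
    thus ?thesis using True by simp
  next
    case False
    then obtain x y where xy: "x \<noteq> y" "kap x = kap y" "w x = w y" by (auto simp: inj_on_def)
    let ?t = "Transposition.transpose x y" and ?S = "{\<sigma>\<in>color_perms kap. w \<circ> \<sigma> = w}"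
    have t: "?t \<in> color_perms kap" using xy by (intro transpose_color_perms)
    have wt: "w \<circ> ?t = w" using xy by (auto simp: fun_eq_iff transpose_def)
    have "bij_betw (\<lambda>\<sigma>. ?t \<circ> \<sigma>) ?S ?S"
      by (rule bij_betw_byWitness[where f' = "\<lambda>\<sigma>. ?t \<circ> \<sigma>"])
         (use t wt in \<open>auto simp: color_perms_comp comp_assoc[symmetric]\<close>)
    hence "(\<Sum>\<sigma>\<in>?S. sign \<sigma>) = (\<Sum>\<sigma>\<in>?S. sign (?t \<circ> \<sigma>))" by (rule sum.reindex_bij_betw[symmetric])
    also have "\<dots> = (\<Sum>\<sigma>\<in>?S. - sign \<sigma>)"
      using t xy by (intro sum.cong refl) (auto simp: sign_comp_UNIV color_perms_def sign_swap_id)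
    finally show ?thesis using False by (simp add: sum_negf)
  qed
  have "(\<Sum>\<sigma>\<in>color_perms kap. sign \<sigma> * int (card {w \<in> words l r. w \<circ> \<sigma> = w}))
      = (\<Sum>\<sigma>\<in>color_perms kap. \<Sum>w\<in>words l r. if w \<circ> \<sigma> = w then sign \<sigma> else 0)"
    by (intro sum.cong refl) (simp add: sum.inter_filter[symmetric])
  also have "\<dots> = (\<Sum>w\<in>words l r. \<Sum>\<sigma>\<in>{\<sigma>\<in>color_perms kap. w \<circ> \<sigma> = w}. sign \<sigma>)"
    by (subst sum.swap) (simp add: sum.inter_filter)
  also have "\<dots> = (\<Sum>w\<in>words l r. if inj (\<lambda>x. (kap x, w x)) then 1 else 0)" by (simp add: stab)
  also have "\<dots> = int (card (injective_words kap l r))"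
    by (simp add: injective_words_def sum.inter_filter[symmetric])
  finally show ?thesis .
qed

subsection \<open>Orbits of permutations\<close>

text \<open>The orbits as an equivalence relation: inclusion expresses refinement, and the
  cardinality is a measure for inductions.\<close>

definition orbit_rel :: "('n \<Rightarrow> 'n) \<Rightarrow> ('n \<times> 'n) set" where
  "orbit_rel \<sigma> = {(x, y). y \<in> orbit \<sigma> x}"

lemma orbit_eq_Image: "orbit \<sigma> x = orbit_rel \<sigma> `` {x}"
  by (auto simp: orbit_rel_def)

lemma permutes_self_in_orbit:
  fixes \<sigma> :: "'n::finite \<Rightarrow> 'n"
  shows "\<sigma> permutes UNIV \<Longrightarrow> x \<in> orbit \<sigma> x"
  by (rule permutation_self_in_orbit) (auto simp: permutation_permutes)

lemma orbit_eq_iff: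
  fixes \<sigma> :: "'n::finite \<Rightarrow> 'n"
  assumes "\<sigma> permutes UNIV"
  shows "orbit \<sigma> x = orbit \<sigma> y \<longleftrightarrow> y \<in> orbit \<sigma> x"
  using permutes_self_in_orbit[OF assms] orbit_trans orbit_swap by (metis subsetI subset_antisym)

text \<open>Composing with the transposition of a and its image cuts a out of its cycle. The new
  orbits are expressed through a and the old orbits alone, without the image of a.\<close>

lemma orbit_transpose:
  fixes \<sigma> :: "'n::finite \<Rightarrow> 'n"
  assumes p: "\<sigma> permutes UNIV" and a: "\<sigma> a \<noteq> a"
  defines "\<tau> \<equiv> Transposition.transpose a (\<sigma> a) \<circ> \<sigma>"
  shows "orbit_rel \<tau> = insert (a, a) {(x, y) \<in> orbit_rel \<sigma>. x \<noteq> a \<and> y \<noteq> a}"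
proof -
  have inj: "inj \<sigma>" using p by (rule permutes_inj)
  have \<tau>: "\<tau> x = (if x = a then a else if \<sigma> x = a then \<sigma> a else \<sigma> x)" for x
    using a inj_eq[OF inj, of x a] by (auto simp: \<tau>_def transpose_def)
  have sub: "y \<in> orbit \<sigma> x \<and> y \<noteq> a" if "x \<noteq> a" "y \<in> orbit \<tau> x" for x y
    using that(2)
  proof induction
    case base
    have "\<sigma> x \<in> orbit \<sigma> x" "\<sigma> (\<sigma> x) \<in> orbit \<sigma> x" by (auto intro: orbit.intros)
    thus ?case using that(1) a by (auto simp: \<tau>)
  next
    case (step y)
    hence "\<sigma> y \<in> orbit \<sigma> x" "\<sigma> (\<sigma> y) \<in> orbit \<sigma> x" by (auto intro: orbit.intros)
    thus ?case using step a by (auto simp: \<tau>)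
  qed
  have sup: "(y \<noteq> a \<longrightarrow> y \<in> orbit \<tau> x) \<and> (y = a \<longrightarrow> \<sigma> a \<in> orbit \<tau> x)" if "x \<noteq> a" "y \<in> orbit \<sigma> x" for x y
    using that(2)
  proof induction
    case base
    show ?case using orbit.base[of \<tau> x] \<tau>[of x] that(1) by (auto split: if_splits)
  next
    case (step y)
    show ?case
    proof (cases "y = a")
      case False
      hence "\<tau> y \<in> orbit \<tau> x" using step by (auto intro: orbit.intros)
      thus ?thesis using False \<tau>[of y] by (auto split: if_splits)
    qed (use step a in auto)
  qed
  have only_a: "y = a" if "y \<in> orbit \<tau> a" for y
    using that by induction (auto simp: \<tau>)
  have a_in: "a \<in> orbit \<tau> a" using orbit.base[of \<tau> a] \<tau>[of a] by simp
  have "y \<in> orbit \<tau> x \<longleftrightarrow> x = a \<and> y = a \<or> y \<in> orbit \<sigma> x \<and> x \<noteq> a \<and> y \<noteq> a" for x y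
  proof (cases "x = a")
    case True
    thus ?thesis using only_a[of y] a_in by blast
  next
    case False
    thus ?thesis using sub[OF False, of y] sup[OF False, of y] by blast
  qed
  thus ?thesis by (auto simp only: orbit_rel_def)
qed

text \<open>Cutting the same point out of both permutations leaves equal orbits again and flips both
  signs.\<close>

lemma sign_orbit_rel:
  fixes \<sigma> \<sigma>' :: "'n::finite \<Rightarrow> 'n"
  assumes "\<sigma> permutes UNIV" "\<sigma>' permutes UNIV" "orbit_rel \<sigma> = orbit_rel \<sigma>'"
  shows "sign \<sigma> = sign \<sigma>'"
  using assms
proof (induction "card (orbit_rel \<sigma>)" arbitrary: \<sigma> \<sigma>' rule: less_induct)
  case less
  have fixed: "\<rho> a = a \<longleftrightarrow> orbit_rel \<rho> `` {a} = {a}" for \<rho> :: "'n \<Rightarrow> 'n" and a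
    using orbit_eq_singleton_iff[of \<rho> a] by (simp add: orbit_eq_Image)
  show ?case
  proof (cases "\<sigma> = id")
    case True
    hence "\<sigma>' x = x" for x using fixed[of \<sigma> x] fixed[of \<sigma>' x] less(4) by simp
    thus ?thesis using True by (metis eq_id_iff)
  next
    case False
    then obtain a where a: "\<sigma> a \<noteq> a" by (auto simp: fun_eq_iff)
    hence a': "\<sigma>' a \<noteq> a" using fixed[of \<sigma> a] fixed[of \<sigma>' a] less(4) by simp
    let ?t = "Transposition.transpose a (\<sigma> a)" and ?t' = "Transposition.transpose a (\<sigma>' a)"
    have p: "?t permutes UNIV" "?t' permutes UNIV" by (simp_all add: permutes_swap_id)
    have eq: "orbit_rel (?t \<circ> \<sigma>) = orbit_rel (?t' \<circ> \<sigma>')"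
      unfolding orbit_transpose[OF less(2) a] orbit_transpose[OF less(3) a'] less(4) ..
    have "(a, \<sigma> a) \<in> orbit_rel \<sigma>" "(a, a) \<in> orbit_rel \<sigma>"
      using permutes_self_in_orbit[OF less(2)] by (auto simp: orbit_rel_def orbit.base)
    hence "orbit_rel (?t \<circ> \<sigma>) \<subset> orbit_rel \<sigma>"
      unfolding orbit_transpose[OF less(2) a] using a by auto
    hence "card (orbit_rel (?t \<circ> \<sigma>)) < card (orbit_rel \<sigma>)" by (intro psubset_card_mono) auto
    hence "sign (?t \<circ> \<sigma>) = sign (?t' \<circ> \<sigma>')"
      using less p eq by (intro less(1) permutes_compose) auto
    moreover have "sign (?t \<circ> \<sigma>) = - sign \<sigma>" "sign (?t' \<circ> \<sigma>') = - sign \<sigma>'"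
      using a a' by (simp_all add: sign_comp_UNIV less p sign_swap_id)
    ultimately show ?thesis by simp
  qed
qed

text \<open>A function on the symmetric group whose signed sums over all Young subgroups vanish has
  vanishing sums over permutations with given orbits: induct on the coarseness of the orbits.\<close>

lemma sum_orbit_rel_zero:
  fixes h :: "('n::finite \<Rightarrow> 'n) \<Rightarrow> 'a::comm_ring_1"
  assumes "\<And>kap. (\<Sum>\<sigma>\<in>color_perms kap. of_int (sign \<sigma>) * h \<sigma>) = 0"
    and "\<pi> permutes UNIV"
  shows "(\<Sum>\<sigma> | \<sigma> permutes UNIV \<and> orbit_rel \<sigma> = orbit_rel \<pi>. h \<sigma>) = 0"
  using assms(2)
proof (induction "card (orbit_rel \<pi>)" arbitrary: \<pi> rule: less_induct)
  case less
  let ?f = "\<lambda>\<sigma>. of_int (sign \<sigma>) * h \<sigma>"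
  let ?P = "\<lambda>R. {\<sigma>. \<sigma> permutes (UNIV :: 'n set) \<and> orbit_rel \<sigma> = R}"
  obtain idx :: "'n set \<Rightarrow> nat" where idx: "inj idx"
    using finite_imp_inj_to_nat_seg[of "UNIV :: 'n set set"] by auto
  \<comment> \<open>Colouring points by their orbit makes the Young subgroup the set of permutations
    whose orbits refine those of pi.\<close>
  define kap where "kap = (\<lambda>x. idx (orbit \<pi> x))"
  have kap: "kap x = kap y \<longleftrightarrow> (x, y) \<in> orbit_rel \<pi>" for x y
    using idx by (auto simp: kap_def inj_eq orbit_eq_iff[OF less(2)] orbit_rel_def)
  have mem: "\<sigma> \<in> color_perms kap \<longleftrightarrow> \<sigma> permutes UNIV \<and> orbit_rel \<sigma> \<subseteq> orbit_rel \<pi>" for \<sigma>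
  proof
    assume \<sigma>: "\<sigma> \<in> color_perms kap"
    have "kap y = kap x" if "y \<in> orbit \<sigma> x" for x y
      using that \<sigma> by induction (auto simp: color_perms_def)
    thus "\<sigma> permutes UNIV \<and> orbit_rel \<sigma> \<subseteq> orbit_rel \<pi>"
      using \<sigma> kap by (fastforce simp: color_perms_def orbit_rel_def)
  next
    assume \<sigma>: "\<sigma> permutes UNIV \<and> orbit_rel \<sigma> \<subseteq> orbit_rel \<pi>"
    have "(x, \<sigma> x) \<in> orbit_rel \<pi>" for x using \<sigma> orbit.base[of \<sigma> x] by (auto simp: orbit_rel_def)
    hence "kap x = kap (\<sigma> x)" for x by (simp add: kap)
    thus "\<sigma> \<in> color_perms kap" using \<sigma> by (simp add: color_perms_def)
  qed
  have group: "(\<Sum>\<sigma>\<in>color_perms kap. ?f \<sigma>) = (\<Sum>R\<in>orbit_rel ` color_perms kap. \<Sum>\<sigma>\<in>?P R. ?f \<sigma>)"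
  proof (subst sum.group[symmetric, where g = orbit_rel and T = "orbit_rel ` color_perms kap"])
    show "(\<Sum>y\<in>orbit_rel ` color_perms kap. \<Sum>x\<in>{x \<in> color_perms kap. orbit_rel x = y}. ?f x)
        = (\<Sum>R\<in>orbit_rel ` color_perms kap. \<Sum>\<sigma>\<in>?P R. ?f \<sigma>)"
      by (intro sum.cong) (auto simp: mem)
  qed auto
  have sgn: "(\<Sum>\<sigma>\<in>?P (orbit_rel \<rho>). ?f \<sigma>) = of_int (sign \<rho>) * (\<Sum>\<sigma>\<in>?P (orbit_rel \<rho>). h \<sigma>)"
    if "\<rho> permutes UNIV" for \<rho>
  proof -
    have "sign \<sigma> = sign \<rho>" if "\<sigma> \<in> ?P (orbit_rel \<rho>)" for \<sigma>
      using sign_orbit_rel[of \<sigma> \<rho>] that \<open>\<rho> permutes UNIV\<close> by simp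
    thus ?thesis unfolding sum_distrib_left by (intro sum.cong) auto
  qed
  have zero: "(\<Sum>\<sigma>\<in>?P R. ?f \<sigma>) = 0" if R: "R \<in> orbit_rel ` color_perms kap - {orbit_rel \<pi>}" for R
  proof -
    obtain \<rho> where R': "R = orbit_rel \<rho>" "\<rho> \<in> color_perms kap" using R by blast
    have \<rho>: "R = orbit_rel \<rho>" "\<rho> permutes UNIV" "orbit_rel \<rho> \<subset> orbit_rel \<pi>"
      using R R' by (auto simp only: mem)
    have "card (orbit_rel \<rho>) < card (orbit_rel \<pi>)" by (rule psubset_card_mono[OF _ \<rho>(3)]) simp
    hence "(\<Sum>\<sigma>\<in>?P (orbit_rel \<rho>). h \<sigma>) = 0" using less(1) \<rho>(2) by blast
    thus ?thesis using sgn[OF \<rho>(2)] \<rho>(1) by simp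
  qed
  have "\<pi> \<in> color_perms kap" using less(2) by (simp add: mem)
  hence "(\<Sum>R\<in>orbit_rel ` color_perms kap. \<Sum>\<sigma>\<in>?P R. ?f \<sigma>)
      = (\<Sum>\<sigma>\<in>?P (orbit_rel \<pi>). ?f \<sigma>) + (\<Sum>R\<in>orbit_rel ` color_perms kap - {orbit_rel \<pi>}. \<Sum>\<sigma>\<in>?P R. ?f \<sigma>)"
    by (intro sum.remove) auto
  also have "\<dots> = of_int (sign \<pi>) * (\<Sum>\<sigma>\<in>?P (orbit_rel \<pi>). h \<sigma>)"
    by (simp add: zero sgn[OF less(2)])
  finally have zero': "of_int (sign \<pi>) * (\<Sum>\<sigma>\<in>?P (orbit_rel \<pi>). h \<sigma>) = 0"
    using group assms(1)[of kap] by simp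
  \<comment> \<open>The sign is its own inverse, so it cancels in any commutative ring.\<close>
  have "(\<Sum>\<sigma>\<in>?P (orbit_rel \<pi>). h \<sigma>)
      = of_int (sign \<pi>) * (of_int (sign \<pi>) * (\<Sum>\<sigma>\<in>?P (orbit_rel \<pi>). h \<sigma>))"
    by (simp only: mult.assoc[symmetric] of_int_mult[symmetric] sign_square of_int_1 mult_1)
  thus ?case by (simp only: zero' mult_zero_right)
qed

text \<open>The weight sees only the orbits, so after grouping by \<open>orbit_rel\<close> it
  suffices that f - g sums to 0 over each group. In particular f and g may be arbitrary functions,
  not only class functions.\<close>

lemma sum_perms_eq:
  fixes f g :: "('n::finite \<Rightarrow> 'n) \<Rightarrow> 'a::comm_ring_1" and F :: "'a \<Rightarrow> 'b::comm_ring_1"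
  assumes "\<And>kap. (\<Sum>\<sigma>\<in>color_perms kap. of_int (sign \<sigma>) * f \<sigma>) = (\<Sum>\<sigma>\<in>color_perms kap. of_int (sign \<sigma>) * g \<sigma>)"
    and F: "F 0 = 0" "\<And>a b. F (a + b) = F a + F b"
  shows "(\<Sum>\<pi> | \<pi> permutes UNIV. F (f \<pi>) * p (range (orbit \<pi>))) = (\<Sum>\<pi> | \<pi> permutes UNIV. F (g \<pi>) * p (range (orbit \<pi>)))"
proof -
  let ?A = "{\<pi> :: 'n \<Rightarrow> 'n. \<pi> permutes UNIV}"
  let ?P = "\<lambda>R. {\<sigma> \<in> ?A. orbit_rel \<sigma> = R}"
  have Fsum: "F (sum k B) = (\<Sum>x\<in>B. F (k x))" for k and B :: "('n \<Rightarrow> 'n) set"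
    by (induction B rule: infinite_finite_induct) (simp_all add: F)
  have eq: "(\<Sum>\<sigma>\<in>?P R. f \<sigma>) = (\<Sum>\<sigma>\<in>?P R. g \<sigma>)" if R: "R \<in> orbit_rel ` ?A" for R
  proof -
    obtain \<pi> where \<pi>: "\<pi> permutes UNIV" "R = orbit_rel \<pi>" using R by auto
    have "(\<Sum>\<sigma>\<in>?P R. f \<sigma> - g \<sigma>) = 0"
      using sum_orbit_rel_zero[of "\<lambda>\<sigma>. f \<sigma> - g \<sigma>" \<pi>] assms(1) \<pi>
      by (simp add: right_diff_distrib sum_subtractf)
    thus ?thesis by (simp add: sum_subtractf)
  qed
  have regroup: "(\<Sum>\<pi>\<in>?A. F (k \<pi>) * p (range (orbit \<pi>)))
      = (\<Sum>R\<in>orbit_rel ` ?A. F (\<Sum>\<sigma>\<in>?P R. k \<sigma>) * p (range (\<lambda>x. R `` {x})))" for k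
  proof (subst sum.group[symmetric, where g = orbit_rel and T = "orbit_rel ` ?A"])
    show "(\<Sum>y\<in>orbit_rel ` ?A. \<Sum>x\<in>{x \<in> ?A. orbit_rel x = y}. F (k x) * p (range (orbit x)))
        = (\<Sum>R\<in>orbit_rel ` ?A. F (\<Sum>\<sigma>\<in>?P R. k \<sigma>) * p (range (\<lambda>x. R `` {x})))"
      unfolding Fsum sum_distrib_right
      by (intro sum.cong refl) (auto simp: orbit_eq_Image[abs_def])
  qed auto
  show ?thesis unfolding regroup by (intro sum.cong refl) (simp only: eq)
qed

subsection \<open>Power sums and complete symmetric polynomials\<close>

definition word_monom :: "('n::finite \<Rightarrow> nat) \<Rightarrow> sympoly" where
  "word_monom u = Poly_Mapping.single (\<Sum>x\<in>UNIV. Poly_Mapping.single (u x) 1) 1"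

lemma word_monom_eq_prod: "word_monom u = (\<Prod>x\<in>UNIV. var (u x))"
proof -
  have "(\<Prod>x\<in>A. var (u x) :: sympoly) = Poly_Mapping.single (\<Sum>x\<in>A. Poly_Mapping.single (u x) 1) 1" for A
    by (induction A rule: infinite_finite_induct) (simp_all add: var_def mult_single)
  thus ?thesis by (simp add: word_monom_def)
qed

lemma orbits_disjoint:
  fixes \<pi> :: "'n::finite \<Rightarrow> 'n"
  assumes "\<pi> permutes UNIV" "C \<in> range (orbit \<pi>)" "x \<in> C"
  shows "C = orbit \<pi> x"
  using assms orbit_eq_iff[OF assms(1)] by auto

text \<open>Expanding the product chooses one variable for each orbit, which amounts to a word that
  is constant on orbits.\<close>

lemma prod_power_sum:
  fixes \<pi> :: "'n::finite \<Rightarrow> 'n"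
  assumes \<pi>: "\<pi> permutes UNIV"
  shows "(\<Prod>C\<in>range (orbit \<pi>). power_sum N (card C)) = (\<Sum>u | (\<forall>x. u x < N) \<and> u \<circ> \<pi> = u. word_monom u)"
proof -
  let ?O = "range (orbit \<pi>)" and ?U = "{u :: 'n \<Rightarrow> nat. (\<forall>x. u x < N) \<and> u \<circ> \<pi> = u}"
  have self: "x \<in> orbit \<pi> x" for x by (rule permutes_self_in_orbit[OF \<pi>])
  have "(\<Prod>C\<in>?O. power_sum N (card C)) = (\<Sum>g\<in>?O \<rightarrow>\<^sub>E {..<N}. \<Prod>C\<in>?O. var (g C) ^ card C)"
    unfolding power_sum_def by (rule prod_sum_PiE) auto
  also have "\<dots> = (\<Sum>g\<in>?O \<rightarrow>\<^sub>E {..<N}. word_monom (\<lambda>x. g (orbit \<pi> x)))"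
  proof (intro sum.cong refl)
    fix g :: "'n set \<Rightarrow> nat"
    have "word_monom (\<lambda>x. g (orbit \<pi> x)) = (\<Prod>C\<in>?O. \<Prod>x | x \<in> UNIV \<and> orbit \<pi> x = C. var (g (orbit \<pi> x)))"
      unfolding word_monom_eq_prod by (rule prod.group[symmetric]) auto
    also have "\<dots> = (\<Prod>C\<in>?O. var (g C) ^ card C)"
    proof (intro prod.cong refl)
      fix C assume C: "C \<in> ?O"
      have "{x. orbit \<pi> x = C} = C" using C orbits_disjoint[OF \<pi> C] self by auto
      moreover have "(\<Prod>x | x \<in> UNIV \<and> orbit \<pi> x = C. var (g (orbit \<pi> x))) = (\<Prod>x | orbit \<pi> x = C. (var (g C) :: sympoly))"
        by (intro prod.cong) auto
      ultimately show "(\<Prod>x | x \<in> UNIV \<and> orbit \<pi> x = C. var (g (orbit \<pi> x))) = (var (g C) ^ card C :: sympoly)"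
        by simp
    qed
    finally show "(\<Prod>C\<in>?O. var (g C) ^ card C) = word_monom (\<lambda>x. g (orbit \<pi> x))" by simp
  qed
  also have "\<dots> = (\<Sum>u\<in>?U. word_monom u)"
  proof (rule sum.reindex_bij_betw)
    let ?h = "\<lambda>u C. if C \<in> ?O then u (SOME x. x \<in> C) else undefined"
    have const: "u y = u x" if u: "u \<circ> \<pi> = u" and y: "y \<in> orbit \<pi> x" for u :: "'n \<Rightarrow> nat" and x y
    proof -
      have step: "u (\<pi> z) = u z" for z using fun_cong[OF u, of z] by simp
      show ?thesis using y by induction (simp_all add: step)
    qed
    show "bij_betw (\<lambda>g x. g (orbit \<pi> x)) (?O \<rightarrow>\<^sub>E {..<N}) ?U"
    proof (rule bij_betw_byWitness[where f' = ?h])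
      show "\<forall>g\<in>?O \<rightarrow>\<^sub>E {..<N}. ?h (\<lambda>x. g (orbit \<pi> x)) = g"
      proof
        fix g assume g: "g \<in> ?O \<rightarrow>\<^sub>E {..<N}"
        show "?h (\<lambda>x. g (orbit \<pi> x)) = g"
        proof
          fix C
          show "?h (\<lambda>x. g (orbit \<pi> x)) C = g C"
          proof (cases "C \<in> ?O")
            case True
            then obtain x where "x \<in> C" using self by auto
            hence "(SOME x. x \<in> C) \<in> C" by (rule someI)
            thus ?thesis using True orbits_disjoint[OF \<pi> True] by simp
          qed (use g in \<open>auto simp: PiE_def extensional_def\<close>)
        qed
      qed
      show "\<forall>u\<in>?U. (\<lambda>x. ?h u (orbit \<pi> x)) = u"
      proof
        fix u assume u: "u \<in> ?U"
        have "u (SOME y. y \<in> orbit \<pi> x) = u x" for x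
          using const[of u "SOME y. y \<in> orbit \<pi> x" x] u someI[of "\<lambda>y. y \<in> orbit \<pi> x", OF self] by simp
        thus "(\<lambda>x. ?h u (orbit \<pi> x)) = u" by auto
      qed
      show "(\<lambda>g x. g (orbit \<pi> x)) ` (?O \<rightarrow>\<^sub>E {..<N}) \<subseteq> ?U"
      proof
        fix u assume "u \<in> (\<lambda>g x. g (orbit \<pi> x)) ` (?O \<rightarrow>\<^sub>E {..<N})"
        then obtain g where g: "g \<in> ?O \<rightarrow>\<^sub>E {..<N}" and u: "u = (\<lambda>x. g (orbit \<pi> x))" by blast
        have "orbit \<pi> (\<pi> x) = orbit \<pi> x" for x
          using orbit_eq_iff[OF \<pi>, of x "\<pi> x"] orbit.base[of \<pi> x] by simp
        thus "u \<in> ?U" using g by (auto simp: u fun_eq_iff)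
      qed
    qed auto
  qed
  finally show ?thesis .
qed

lemma finite_monomials: "finite {m :: nat \<Rightarrow>\<^sub>0 nat. Poly_Mapping.keys m \<subseteq> {..<N} \<and> int (mdeg m) = r}"
proof (rule finite_imageD)
  let ?M = "{m :: nat \<Rightarrow>\<^sub>0 nat. Poly_Mapping.keys m \<subseteq> {..<N} \<and> int (mdeg m) = r}"
  have "Poly_Mapping.lookup m i \<le> nat r" if "m \<in> ?M" for m i
  proof -
    have "Poly_Mapping.lookup m i \<le> mdeg m"
    proof (cases "i \<in> Poly_Mapping.keys m")
      case True
      thus ?thesis unfolding mdeg_def by (intro member_le_sum) auto
    qed (simp add: in_keys_iff)
    thus ?thesis using that by auto
  qed
  hence "Poly_Mapping.lookup ` ?M \<subseteq> {f. \<forall>i. (i \<in> {..<N} \<longrightarrow> f i \<in> {..nat r}) \<and> (i \<notin> {..<N} \<longrightarrow> f i = 0)}"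
    by (auto simp: in_keys_iff subset_iff)
  moreover have "finite {f. \<forall>i. (i \<in> {..<N} \<longrightarrow> f i \<in> {..nat r}) \<and> (i \<notin> {..<N} \<longrightarrow> f i = (0::nat))}"
    by (rule finite_set_of_finite_funs) auto
  ultimately show "finite (Poly_Mapping.lookup ` ?M)" by (rule finite_subset)
qed (auto simp: inj_on_def poly_mapping_eqI)

lemma ex_image_mset_UNIV:
  assumes "size M = CARD('n)"
  shows "\<exists>g :: 'n::finite \<Rightarrow> 'a. image_mset g (mset_set UNIV) = M"
proof -
  obtain xs where xs: "mset xs = M" using ex_mset by blast
  obtain ys :: "'n list" where ys: "distinct ys" "set ys = UNIV" using finite_distinct_list[of "UNIV :: 'n set"] by auto
  have len: "length xs = length ys" using xs assms ys distinct_card[of ys] by (metis size_mset)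
  define g where "g = (\<lambda>y. the (map_of (zip ys xs) y))"
  have "map g ys = xs"
    using len ys(1) by (intro nth_equalityI) (auto simp: g_def map_of_zip_nth)
  moreover have "mset_set UNIV = mset ys" using ys by (metis mset_set_set)
  ultimately show ?thesis using xs by (metis mset_map)
qed

text \<open>Orbit-stabilizer: the functions with a given multiset of values form one orbit.\<close>

lemma sum_card_stabilizers:
  assumes "size M = CARD('n)"
  shows "(\<Sum>g | image_mset g (mset_set UNIV) = M. card {\<pi> :: 'n::finite \<Rightarrow> 'n. \<pi> permutes UNIV \<and> g \<circ> \<pi> = g}) = fact CARD('n)"
proof -
  let ?P = "{\<pi> :: 'n \<Rightarrow> 'n. \<pi> permutes UNIV}" and ?G = "{g :: 'n \<Rightarrow> 'a. image_mset g (mset_set UNIV) = M}"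
  obtain g0 where g0: "image_mset g0 (mset_set (UNIV :: 'n set)) = M" using ex_image_mset_UNIV[OF assms] by blast
  have perm: "image_mset (g \<circ> \<pi>) (mset_set UNIV) = image_mset g (mset_set UNIV)" if "\<pi> permutes UNIV" for g :: "'n \<Rightarrow> 'a" and \<pi>
  proof -
    have "image_mset g (mset_set UNIV) = image_mset g (image_mset \<pi> (mset_set UNIV))"
      using that by (simp add: image_mset_mset_set permutes_inj permutes_image)
    thus ?thesis by (simp add: image_mset.compositionality)
  qed
  have G: "?G = (\<lambda>\<pi>. g0 \<circ> \<pi>) ` ?P"
  proof (intro equalityI subsetI)
    fix g assume "g \<in> ?G"
    hence "image_mset g (mset_set UNIV) = image_mset g0 (mset_set UNIV)" using g0 by simp
    from image_mset_eq_implies_permutes[OF _ this] obtain p where "p permutes UNIV" "\<forall>x\<in>UNIV. g x = g0 (p x)"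
      by auto
    thus "g \<in> (\<lambda>\<pi>. g0 \<circ> \<pi>) ` ?P" by (intro image_eqI[of _ _ p]) (auto simp: fun_eq_iff)
  qed (use perm g0 in auto)
  have "fact CARD('n) = card ?P" by (simp add: card_permutations)
  also have "\<dots> = (\<Sum>g\<in>?G. card {\<pi>\<in>?P. g0 \<circ> \<pi> = g})"
    unfolding G by (subst card_eq_sum, subst sum.group[symmetric, where g = "\<lambda>\<pi>. g0 \<circ> \<pi>" and T = "(\<lambda>\<pi>. g0 \<circ> \<pi>) ` ?P"]) auto
  also have "\<dots> = (\<Sum>g\<in>?G. card {\<pi>. \<pi> permutes UNIV \<and> g \<circ> \<pi> = g})"
  proof (intro sum.cong refl)
    fix g assume "g \<in> ?G"
    then obtain \<tau> where \<tau>: "\<tau> permutes UNIV" "g = g0 \<circ> \<tau>" using G by auto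
    have inv: "\<tau> \<circ> inv_into UNIV \<tau> = id" "inv_into UNIV \<tau> \<circ> \<tau> = id" using \<tau>(1) by (simp_all add: permutes_inv_o)
    have "bij_betw (\<lambda>\<rho>. \<tau> \<circ> \<rho>) {\<pi>. \<pi> permutes UNIV \<and> g \<circ> \<pi> = g} {\<pi>\<in>?P. g0 \<circ> \<pi> = g}"
    proof (rule bij_betw_byWitness[where f' = "\<lambda>\<pi>. inv_into UNIV \<tau> \<circ> \<pi>"])
      have "g \<circ> (inv_into UNIV \<tau> \<circ> \<pi>) = g0 \<circ> \<pi>" for \<pi>
        unfolding \<tau>(2) comp_assoc by (simp add: comp_assoc[symmetric] inv)
      thus "(\<lambda>\<pi>. inv_into UNIV \<tau> \<circ> \<pi>) ` {\<pi>\<in>?P. g0 \<circ> \<pi> = g} \<subseteq> {\<pi>. \<pi> permutes UNIV \<and> g \<circ> \<pi> = g}"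
        using \<tau>(1) by (auto intro: permutes_compose permutes_inv)
    qed (use \<tau> inv in \<open>auto simp: comp_assoc[symmetric] intro: permutes_compose\<close>)
    thus "card {\<pi>\<in>?P. g0 \<circ> \<pi> = g} = card {\<pi>. \<pi> permutes UNIV \<and> g \<circ> \<pi> = g}"
      by (simp add: bij_betw_same_card)
  qed
  finally show ?thesis by simp
qed

text \<open>Pairs of words are sorted by the monomials \<open>K i\<close> recording the letters of \<open>u\<close> at the places
  where \<open>w\<close> has letter \<open>i\<close>.\<close>

lemma prod_complete_sym:
  assumes r: "(\<Sum>i<l. r i) = int CARD('n)"
  shows "of_nat (fact CARD('n)) * (\<Prod>i<l. complete_sym N (r i))
    = (\<Sum>\<pi> | \<pi> permutes (UNIV :: 'n::finite set). of_nat (card {w \<in> words l r. w \<circ> \<pi> = w}) * (\<Prod>C\<in>range (orbit \<pi>). power_sum N (card C)))"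
proof -
  let ?P = "{\<pi> :: 'n \<Rightarrow> 'n. \<pi> permutes UNIV}" and ?W = "words l r :: ('n \<Rightarrow> nat) set"
  let ?U = "{u :: 'n \<Rightarrow> nat. \<forall>x. u x < N}"
  let ?M = "\<lambda>i. {m :: nat \<Rightarrow>\<^sub>0 nat. Poly_Mapping.keys m \<subseteq> {..<N} \<and> int (mdeg m) = r i}"
  let ?KK = "PiE {..<l} ?M"
  let ?st = "\<lambda>w u. card {\<pi>\<in>?P. w \<circ> \<pi> = w \<and> u \<circ> \<pi> = u}"
  define K where "K = (\<lambda>(w :: 'n \<Rightarrow> nat, u :: 'n \<Rightarrow> nat). restrict (\<lambda>i. \<Sum>x | w x = i. Poly_Mapping.single (u x) (1::nat)) {..<l})"
  have lookupK: "Poly_Mapping.lookup (K (w, u) i) j = card {x. w x = i \<and> u x = j}" if "i < l" for w u i j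
  proof -
    have "(\<Sum>x | w x = i. Poly_Mapping.lookup (Poly_Mapping.single (u x) (1::nat)) j) = (\<Sum>x\<in>{x. w x = i}. if u x = j then 1 else 0)"
      by (intro sum.cong) (auto simp: lookup_single when_def)
    also have "\<dots> = card {x \<in> {x. w x = i}. u x = j}" by (simp add: sum.inter_filter[symmetric])
    finally show ?thesis using that by (simp add: K_def lookup_sum)
  qed
  have mdeg_sum: "mdeg (\<Sum>x\<in>A. f x) = (\<Sum>x\<in>A. mdeg (f x))" for A :: "'n set" and f :: "'n \<Rightarrow> nat \<Rightarrow>\<^sub>0 nat"
    by (induction A rule: infinite_finite_induct) (simp_all add: mdeg_add)
  have K_mem: "K (w, u) \<in> ?KK" if "w \<in> ?W" "u \<in> ?U" for w u
  proof (rule PiE_I)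
    fix i assume "i \<in> {..<l}"
    hence i: "i < l" by simp
    have "Poly_Mapping.keys (K (w, u) i) \<subseteq> {..<N}"
      using that by (auto simp: in_keys_iff lookupK[OF i] card_gt_0_iff)
    moreover have "mdeg (K (w, u) i) = card {x. w x = i}" using i by (simp add: K_def mdeg_sum)
    ultimately show "K (w, u) i \<in> ?M i" using that i by (simp add: words_def)
  qed (simp add: K_def)
  have monom: "(\<Prod>i<l. Poly_Mapping.single (K (w, u) i) 1) = word_monom u" if "w \<in> ?W" for w u
  proof -
    have "(\<Prod>i\<in>A. Poly_Mapping.single (f i) (1 :: complex fls)) = Poly_Mapping.single (\<Sum>i\<in>A. f i) 1" if "finite A" for A and f :: "nat \<Rightarrow> nat \<Rightarrow>\<^sub>0 nat"
      using that by induction (simp_all add: mult_single)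
    hence "(\<Prod>i<l. Poly_Mapping.single (K (w, u) i) (1 :: complex fls)) = Poly_Mapping.single (\<Sum>i<l. K (w, u) i) 1" by simp
    also have "(\<Sum>i<l. K (w, u) i) = (\<Sum>i<l. \<Sum>x | x \<in> UNIV \<and> w x = i. Poly_Mapping.single (u x) 1)"
      by (simp add: K_def)
    also have "\<dots> = (\<Sum>x\<in>UNIV. Poly_Mapping.single (u x) 1)"
      using that by (intro sum.group) (auto simp: words_def)
    finally show ?thesis by (simp add: word_monom_def)
  qed
  have fibre: "(\<Sum>(w, u) | (w, u) \<in> ?W \<times> ?U \<and> K (w, u) = k. ?st w u) = fact CARD('n)" if k: "k \<in> ?KK" for k
  proof -
    \<comment> \<open>The multiset of pairs (i, j) prescribed by the monomials k. A pair of words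
      lies over k iff its values form this multiset, so a fibre is one orbit of S_n and its
      stabilizers add up to n!.\<close>
    define M where "M = (\<Sum>i<l. \<Sum>j\<in>Poly_Mapping.keys (k i). replicate_mset (Poly_Mapping.lookup (k i) j) (i, j))"
    have cnt: "count M (i, j) = (if i < l then Poly_Mapping.lookup (k i) j else 0)" for i j
    proof -
      have "count M (i, j) = (\<Sum>i'<l. if i' = i then (\<Sum>j'\<in>Poly_Mapping.keys (k i). if j' = j then Poly_Mapping.lookup (k i) j else 0) else 0)"
        unfolding M_def count_sum by (intro sum.cong refl) (auto intro!: sum.cong sum.neutral)
      also have "\<dots> = (if i < l then Poly_Mapping.lookup (k i) j else 0)" by (auto simp: in_keys_iff)
      finally show ?thesis .
    qed
    have "int (size M) = (\<Sum>i<l. int (mdeg (k i)))"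
      by (simp add: M_def size_multiset_sum mdeg_def)
    also have "\<dots> = (\<Sum>i<l. r i)" using k by (intro sum.cong) (auto simp: PiE_def Pi_def)
    finally have size: "size M = CARD('n)" using r by simp
    have iff: "(\<lambda>x. (w x, u x)) \<in> {g. image_mset g (mset_set UNIV) = M} \<longleftrightarrow> (w, u) \<in> ?W \<times> ?U \<and> K (w, u) = k" for w u
    proof -
      have count: "count (image_mset (\<lambda>x. (w x, u x)) (mset_set UNIV)) (i, j) = card {x. w x = i \<and> u x = j}" for i j
      proof -
        have "(\<lambda>x. (w x, u x)) -` {(i, j)} \<inter> UNIV = {x. w x = i \<and> u x = j}" by auto
        thus ?thesis by (simp add: count_image_mset)
      qed
      show ?thesis
      proof
        assume "(\<lambda>x. (w x, u x)) \<in> {g. image_mset g (mset_set UNIV) = M}"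
        hence c: "card {x. w x = i \<and> u x = j} = (if i < l then Poly_Mapping.lookup (k i) j else 0)" for i j
          using count[of i j] cnt[of i j] by simp
        have pos: "card {y. w y = w x \<and> u y = u x} > 0" for x by (auto simp: card_gt_0_iff)
        have wl: "w x < l" for x using pos[of x] c[of "w x" "u x"] by (auto split: if_splits)
        have uN: "u x < N" for x
        proof -
          have "u x \<in> Poly_Mapping.keys (k (w x))" using pos[of x] c[of "w x" "u x"] wl[of x] by (simp add: in_keys_iff)
          thus ?thesis using k wl[of x] by (auto simp: PiE_def Pi_def)
        qed
        have Kk: "K (w, u) = k"
        proof
          fix i
          show "K (w, u) i = k i"
          proof (cases "i < l")
            case True
            thus ?thesis by (intro poly_mapping_eqI) (simp add: lookupK c)
          qed (use k in \<open>auto simp: K_def PiE_def extensional_def\<close>)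
        qed
        have "int (card {x. w x = i}) = r i" if "i < l" for i
        proof -
          have "mdeg (K (w, u) i) = card {x. w x = i}" using that by (simp add: K_def mdeg_sum)
          thus ?thesis using k that by (auto simp: Kk PiE_def Pi_def)
        qed
        thus "(w, u) \<in> ?W \<times> ?U \<and> K (w, u) = k" using wl uN Kk by (simp add: words_def)
      next
        assume wu: "(w, u) \<in> ?W \<times> ?U \<and> K (w, u) = k"
        have "count (image_mset (\<lambda>x. (w x, u x)) (mset_set UNIV)) (i, j) = count M (i, j)" for i j
        proof (cases "i < l")
          case True
          thus ?thesis using wu lookupK[OF True, of w u j] by (simp add: count cnt)
        next
          case False
          hence "{x. w x = i \<and> u x = j} = {}" using wu by (auto simp: words_def)
          thus ?thesis using False by (simp add: count cnt)
        qed
        thus "(\<lambda>x. (w x, u x)) \<in> {g. image_mset g (mset_set UNIV) = M}"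
          by (auto intro!: multiset_eqI)
      qed
    qed
    let ?Q = "{g :: 'n \<Rightarrow> nat \<times> nat. image_mset g (mset_set UNIV) = M}"
    have "(\<Sum>(w, u) | (w, u) \<in> ?W \<times> ?U \<and> K (w, u) = k. ?st w u)
        = (\<Sum>g\<in>?Q. card {\<pi>. \<pi> permutes UNIV \<and> g \<circ> \<pi> = g})"
    proof (rule sum.reindex_bij_witness[where j = "\<lambda>(w, u) x. (w x, u x)" and i = "\<lambda>g. (fst \<circ> g, snd \<circ> g)"])
      fix g assume g: "g \<in> ?Q"
      have "g = (\<lambda>x. ((fst \<circ> g) x, (snd \<circ> g) x))" by auto
      thus "(fst \<circ> g, snd \<circ> g) \<in> {(w, u). (w, u) \<in> ?W \<times> ?U \<and> K (w, u) = k}"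
        using iff[of "fst \<circ> g" "snd \<circ> g"] g by (simp only: mem_Collect_eq case_prod_conv)
    next
      fix p assume p: "p \<in> {(w, u). (w, u) \<in> ?W \<times> ?U \<and> K (w, u) = k}"
      obtain w u where wu: "p = (w, u)" by (cases p)
      show "(case p of (w, u) \<Rightarrow> \<lambda>x. (w x, u x)) \<in> ?Q"
        using iff[of w u] p unfolding wu by (simp only: mem_Collect_eq case_prod_conv)
      have "{\<pi>\<in>?P. w \<circ> \<pi> = w \<and> u \<circ> \<pi> = u} = {\<pi>. \<pi> permutes UNIV \<and> (\<lambda>x. (w x, u x)) \<circ> \<pi> = (\<lambda>x. (w x, u x))}"
        by (auto simp: fun_eq_iff)
      thus "card {\<pi>. \<pi> permutes UNIV \<and> (case p of (w, u) \<Rightarrow> \<lambda>x. (w x, u x)) \<circ> \<pi> = (case p of (w, u) \<Rightarrow> \<lambda>x. (w x, u x))}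
         = (case p of (w, u) \<Rightarrow> ?st w u)" unfolding wu by simp
    qed auto
    thus ?thesis using sum_card_stabilizers[OF size] by simp
  qed
  have finU: "finite ?U" by simp
  have fin: "finite (?W \<times> ?U)" by simp
  \<comment> \<open>Double counting as in Burnside's lemma: pairs of words fixed by a permutation
    are counted by stabilizers instead.\<close>
  have "(\<Sum>\<pi>\<in>?P. of_nat (card {w \<in> ?W. w \<circ> \<pi> = w}) * (\<Prod>C\<in>range (orbit \<pi>). power_sum N (card C)))
     = (\<Sum>\<pi>\<in>?P. \<Sum>(w, u)\<in>?W \<times> ?U. if w \<circ> \<pi> = w \<and> u \<circ> \<pi> = u then word_monom u else 0)"
  proof (intro sum.cong refl)
    fix \<pi> assume "\<pi> \<in> ?P"
    hence "\<pi> permutes UNIV" by simp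
    have "(\<Sum>(w, u)\<in>?W \<times> ?U. if w \<circ> \<pi> = w \<and> u \<circ> \<pi> = u then word_monom u else 0)
       = (\<Sum>w\<in>?W. \<Sum>u\<in>?U. if w \<circ> \<pi> = w then (if u \<circ> \<pi> = u then word_monom u else 0) else 0)"
      unfolding sum.cartesian_product[symmetric] by (intro sum.cong refl) simp
    also have "\<dots> = (\<Sum>w\<in>?W. if w \<circ> \<pi> = w then (\<Sum>u\<in>?U. if u \<circ> \<pi> = u then word_monom u else 0) else 0)"
      by (intro sum.cong refl) simp
    also have "\<dots> = of_nat (card {w \<in> ?W. w \<circ> \<pi> = w}) * (\<Sum>u | u \<in> ?U \<and> u \<circ> \<pi> = u. word_monom u)"
      using finU by (simp add: sum.inter_filter[symmetric])
    finally show "of_nat (card {w \<in> ?W. w \<circ> \<pi> = w}) * (\<Prod>C\<in>range (orbit \<pi>). power_sum N (card C))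
       = (\<Sum>(w, u)\<in>?W \<times> ?U. if w \<circ> \<pi> = w \<and> u \<circ> \<pi> = u then word_monom u else 0)"
      unfolding prod_power_sum[OF \<open>\<pi> permutes UNIV\<close>] by simp
  qed
  also have "\<dots> = (\<Sum>(w, u)\<in>?W \<times> ?U. of_nat (?st w u) * word_monom u)"
    by (subst sum.swap) (intro sum.cong refl, auto simp: sum.inter_filter[symmetric])
  also have "\<dots> = (\<Sum>k\<in>?KK. \<Sum>p | p \<in> ?W \<times> ?U \<and> K p = k. case p of (w, u) \<Rightarrow> of_nat (?st w u) * word_monom u)"
    by (rule sum.group[symmetric]) (use fin K_mem in \<open>auto intro!: finite_PiE finite_monomials\<close>)
  also have "\<dots> = (\<Sum>k\<in>?KK. of_nat (fact CARD('n)) * (\<Prod>i<l. Poly_Mapping.single (k i) 1))"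
  proof (intro sum.cong refl)
    fix k assume k: "k \<in> ?KK"
    have "(\<Sum>p | p \<in> ?W \<times> ?U \<and> K p = k. case p of (w, u) \<Rightarrow> of_nat (?st w u) * word_monom u)
       = (\<Sum>p | p \<in> ?W \<times> ?U \<and> K p = k. of_nat (case p of (w, u) \<Rightarrow> ?st w u) * (\<Prod>i<l. Poly_Mapping.single (k i) (1 :: complex fls)))"
      by (intro sum.cong refl) (auto simp: monom[symmetric])
    also have "\<dots> = of_nat (\<Sum>p | p \<in> ?W \<times> ?U \<and> K p = k. case p of (w, u) \<Rightarrow> ?st w u) * (\<Prod>i<l. Poly_Mapping.single (k i) 1)"
      by (simp only: of_nat_sum sum_distrib_right)
    also have "(\<Sum>p | p \<in> ?W \<times> ?U \<and> K p = k. case p of (w, u) \<Rightarrow> ?st w u) = fact CARD('n)"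
      by (rule trans[OF sum.cong fibre[OF k]]) auto
    finally show "(\<Sum>p | p \<in> ?W \<times> ?U \<and> K p = k. case p of (w, u) \<Rightarrow> of_nat (?st w u) * word_monom u)
       = of_nat (fact CARD('n)) * (\<Prod>i<l. Poly_Mapping.single (k i) (1 :: complex fls))" .
  qed
  also have "\<dots> = of_nat (fact CARD('n)) * (\<Prod>i<l. complete_sym N (r i))"
    unfolding complete_sym_def by (subst prod_sum_PiE) (simp_all add: finite_monomials sum_distrib_left)
  finally show ?thesis by simp
qed

subsection \<open>The Frobenius expansion of Hall--Littlewood functions\<close>

lemma sum_raise: "(\<Sum>i<l. raise (index_pairs l) al a i) = (\<Sum>i<l. al i)"
proof -
  have "(\<Sum>i<l. raise (index_pairs l) al a i) = (\<Sum>i<l. al i)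
     + (\<Sum>p\<in>index_pairs l. int (a p) * (\<Sum>i<l. (if fst p = i then 1 else 0) - (if snd p = i then 1 else 0)))"
    unfolding raise_def sum.distrib by (subst sum.swap) (simp add: sum_distrib_left)
  also have "(\<Sum>p\<in>index_pairs l. int (a p) * (\<Sum>i<l. (if fst p = i then 1 else 0) - (if snd p = i then 1 else 0))) = 0"
    by (rule sum.neutral) (auto simp: index_pairs_def sum_subtractf)
  finally show ?thesis by simp
qed

lemma of_nat_eq_cnst: "of_nat k = cnst (of_nat k)"
  by (induction k) (simp_all add: cnst_add)

text \<open>Replacing each product of complete symmetric polynomials by a permutation character
  turns the raising operator formula into a function g on S_n. The hypothesis says that f has the
  same signed Young sums as g, and \<open>sum_perms_eq\<close> concludes.\<close>

theorem modified_HL_eq_sum_perms: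
  fixes f :: "('n::finite \<Rightarrow> 'n) \<Rightarrow> complex fls"
  assumes lam: "desc lam" "sum_list lam = CARD('n)"
    and f: "\<And>kap bs. distinct bs \<Longrightarrow> set bs = UNIV \<Longrightarrow> sorted (map kap bs) \<Longrightarrow>
      (\<Sum>\<sigma>\<in>color_perms kap. of_int (sign \<sigma>) * f \<sigma>)
      = of_nat (card (color_perms kap)) * (\<Sum>es | admissible kap lam 0 (length lam) bs es. fls_X ^ sum_list es)"
  shows "(\<Sum>\<pi> | \<pi> permutes UNIV. cnst (f \<pi>) * (\<Prod>C\<in>range (orbit \<pi>). power_sum N (card C)))
    = of_nat (fact CARD('n)) * modified_HL N lam"
proof -
  let ?l = "length lam" and ?t = "fls_X_inv :: complex fls" and ?n = "sum_list lam"
  let ?A = "index_pairs ?l \<rightarrow>\<^sub>E {..?n}"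
  let ?q = "fls_X ^ (\<Sum>i<?l. i * lam ! i) :: complex fls"
  let ?co = "\<lambda>a. \<Prod>p\<in>index_pairs ?l. raising_coeff ?t (a p)"
  \<comment> \<open>By \<open>prod_complete_sym\<close> its power sum expansion is n! times
    \<open>modified_HL\<close>.\<close>
  define g where "g = (\<lambda>\<pi> :: 'n \<Rightarrow> 'n. ?q * (\<Sum>a\<in>?A. ?co a * of_nat (card {w \<in> words ?l (raised lam a). w \<circ> \<pi> = w})))"
  have rsum: "(\<Sum>i<?l. raised lam a i) = int CARD('n)" for a
    using sum_raise[of ?l "parts lam" a] sum_list_parts[of lam ?l] lam(2)
    by (simp add: raised_eq_raise)
  have pairing: "(\<Sum>\<sigma>\<in>color_perms kap. of_int (sign \<sigma>) * g \<sigma>) = (\<Sum>\<sigma>\<in>color_perms kap. of_int (sign \<sigma>) * f \<sigma>)" for kap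
  proof -
    obtain ys :: "'n list" where ys: "distinct ys" "set ys = UNIV" using finite_distinct_list[of "UNIV :: 'n set"] by auto
    \<comment> \<open>The recursion requires variables of equal colour to be consecutive.\<close>
    define bs where "bs = sort_key kap ys"
    have bs: "distinct bs" "set bs = UNIV" "sorted (map kap bs)" using ys by (simp_all add: bs_def)
    have len: "length bs = sum_list lam" using distinct_card[OF bs(1)] bs(2) lam(2) by simp
    have "(\<Sum>\<sigma>\<in>color_perms kap. of_int (sign \<sigma>) * g \<sigma>)
       = ?q * (\<Sum>a\<in>?A. ?co a * of_int (\<Sum>\<sigma>\<in>color_perms kap. sign \<sigma> * int (card {w \<in> words ?l (raised lam a). w \<circ> \<sigma> = w})))"
      unfolding g_def by (simp add: sum_distrib_left mult_ac, subst sum.swap, simp)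
    also have "\<dots> = ?q * (\<Sum>a\<in>?A. ?co a * of_nat (card (color_perms kap) * card (families_of kap ?l bs 0 ?l (raised lam a))))"
      by (simp only: sum_sign_fixed card_injective_words[where c = 0, OF bs(1,2)] of_int_of_nat_eq)
    also have "\<dots> = of_nat (card (color_perms kap)) * (?q * raising_sum (index_pairs ?l) ?t (length bs) (\<lambda>al. card (families_of kap ?l bs 0 ?l al)) (parts lam))"
    proof -
      have "families_of kap ?l bs 0 ?l (raised lam a) = families_of kap ?l bs 0 ?l (raise (index_pairs ?l) (parts lam) a)" for a
        by (rule families_of_cong) (rule raised_eq_raise)
      thus ?thesis by (simp add: raising_sum_def len sum_distrib_left mult_ac)
    qed
    also have "\<dots> = of_nat (card (color_perms kap)) * (\<Sum>es | admissible kap lam 0 ?l bs es. fls_X ^ sum_list es)"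
      using raising_sum_families[of lam ?l bs 0 kap ?l] lam(1) bs len by simp
    finally show ?thesis using f[OF bs] by simp
  qed
  have "(\<Sum>\<pi> | \<pi> permutes UNIV. cnst (f \<pi>) * (\<Prod>C\<in>range (orbit \<pi>). power_sum N (card C)))
     = (\<Sum>\<pi> | \<pi> permutes UNIV. cnst (g \<pi>) * (\<Prod>C\<in>range (orbit \<pi>). power_sum N (card C)))"
    by (rule sum_perms_eq[where F = cnst and p = "\<lambda>Q. \<Prod>C\<in>Q. power_sum N (card C)"])
       (simp_all add: pairing cnst_add)
  also have "\<dots> = cnst ?q * (\<Sum>a\<in>?A. cnst (?co a) * (\<Sum>\<pi> | \<pi> permutes (UNIV :: 'n set). of_nat (card {w \<in> words ?l (raised lam a). w \<circ> \<pi> = w}) * (\<Prod>C\<in>range (orbit \<pi>). power_sum N (card C))))"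
    unfolding g_def by (simp add: cnst_mult cnst_sum of_nat_eq_cnst sum_distrib_left sum_distrib_right mult.assoc, subst sum.swap, simp)
  also have "\<dots> = of_nat (fact CARD('n)) * modified_HL N lam"
    unfolding prod_complete_sym[OF rsum, symmetric] modified_HL_def hall_littlewood_Q'_def
    by (simp add: sum_distrib_left mult_ac)
  finally show ?thesis .
qed

section \<open>Top degree ideals of orbits and independence of the admissible monomials\<close>

subsection \<open>Coordinate partitions\<close>

definition mult_of :: "complex ^ 'n::finite \<Rightarrow> complex \<Rightarrow> nat" where
  "mult_of P c = card {i. P $ i = c}"

text \<open>The list attaches to row j the coordinate value whose multiplicity is the j-th part, so
  that words in row indices can be read as points of the orbit.\<close>

lemma coord_partition_values:
  fixes P :: "complex ^ 'n::finite"
  obtains cs where "distinct cs" "set cs = range (($) P)" "coord_partition P = map (mult_of P) cs"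
proof -
  obtain cs0 where cs0: "distinct cs0" "set cs0 = range (($) P)"
    using finite_distinct_list[of "range (($) P)"] by auto
  let ?cs = "sort_key (mult_of P) cs0"
  have "sorted_list_of_multiset (mset (map (mult_of P) ?cs)) = map (mult_of P) ?cs"
    by (simp only: sorted_list_of_multiset_mset sorted_sort_key sort_key_id_if_sorted sorted_sort_id)
  moreover have "mset (map (mult_of P) ?cs) = image_mset (mult_of P) (mset_set (range (($) P)))"
    using cs0 by (metis mset_map mset_set_set mset_sort)
  ultimately have "coord_partition P = map (mult_of P) (rev ?cs)"
    by (simp add: coord_partition_def mult_of_def[abs_def] rev_map)
  thus ?thesis using that[of "rev ?cs"] cs0 by simp
qed

lemma sum_list_coord_partition:
  "(\<Sum>p\<leftarrow>coord_partition P. f p) = (\<Sum>c\<in>range (($) P). f (mult_of P c))"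
proof -
  obtain cs where "distinct cs" "set cs = range (($) P)" "coord_partition P = map (mult_of P) cs"
    by (rule coord_partition_values)
  thus ?thesis using sum.distinct_set_conv_list[of cs "\<lambda>c. f (mult_of P c)"] by (simp add: o_def)
qed

lemma sum_mult_of: "(\<Sum>c\<in>range (($) P). mult_of (P :: complex ^ 'n::finite) c) = CARD('n)"
proof -
  have "(\<Sum>c\<in>range (($) P). mult_of P c) = (\<Sum>c\<in>range (($) P). \<Sum>i | i \<in> UNIV \<and> P $ i = c. 1)"
    by (simp add: mult_of_def)
  also have "\<dots> = (\<Sum>i\<in>(UNIV :: 'n set). 1)" by (rule sum.group) auto
  finally show ?thesis by simp
qed

lemma sum_coord_partition: "sum_list (coord_partition (P :: complex ^ 'n::finite)) = CARD('n)"
  using sum_list_coord_partition[of "\<lambda>x. x" P] sum_mult_of[of P] by simp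

lemma desc_coord_partition: "desc (coord_partition P)"
proof -
  have "sorted (rev (coord_partition P))" by (simp add: coord_partition_def)
  thus ?thesis unfolding desc_def using sorted_rev_nth_mono by blast
qed

lemma coord_partition_le: "p \<in> set (coord_partition P) \<Longrightarrow> p \<le> CARD('n)" for P :: "complex ^ 'n::finite"
  using member_le_sum_list_nat[of p "coord_partition P"] by (simp add: sum_coord_partition)

subsection \<open>Top degree ideals\<close>

lemma is_ideal_vanishing: "is_ideal (vanishing_ideal Y)"
  by (auto simp: is_ideal_def vanishing_ideal_def eval_at_add eval_at_mult)

lemma homogeneous_ideal_top: "homogeneous_ideal (top_ideal Y)"
  unfolding top_ideal_def
proof (rule homogeneous_ideal_Idl)
  fix t assume "t \<in> {top_form f | f. f \<in> vanishing_ideal Y \<and> f \<noteq> 0}"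
  then obtain f where "t = top_form f" "f \<noteq> 0" by blast
  thus "\<exists>d. homogeneous d t" by (metis top_formE homogeneous_hom_component)
qed

lemma is_ideal_top: "is_ideal (top_ideal Y)"
  using homogeneous_ideal_top[of Y] by (simp add: homogeneous_ideal_def)

text \<open>The component may vanish, so that degrees of combined lifts need only be bounded from
  above.\<close>

lemma hom_component_in_top_ideal:
  assumes "f \<in> vanishing_ideal Y" "\<And>e. e > d \<Longrightarrow> hom_component e f = 0"
  shows "hom_component d f \<in> top_ideal Y"
proof (cases "hom_component d f = 0")
  case True
  thus ?thesis by (simp add: is_ideal_0[OF is_ideal_top])
next
  case False
  hence "top_form f = hom_component d f" using assms(2) by (rule top_form_eqI)
  moreover have "f \<noteq> 0" using False by auto
  ultimately have "hom_component d f \<in> {top_form f | f. f \<in> vanishing_ideal Y \<and> f \<noteq> 0}"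
    using assms(1) by force
  thus ?thesis unfolding top_ideal_def by (rule subsetD[OF Idl_superset])
qed

text \<open>Top forms of one degree, together with 0, are closed under addition and under
  multiplication by forms. Hence the polynomials all of whose components lift form an ideal, and
  generating an ideal adds no new homogeneous elements.\<close>

lemma top_ideal_lift:
  assumes "t \<in> top_ideal Y" "homogeneous d t"
  obtains h where "h \<in> vanishing_ideal Y" "hom_component d h = t" "\<And>e. e > d \<Longrightarrow> hom_component e h = 0"
proof -
  let ?L = "\<lambda>d t. \<exists>h\<in>vanishing_ideal Y. hom_component d h = t \<and> (\<forall>e>d. hom_component e h = 0)"
  let ?K = "{t. \<forall>d. ?L d (hom_component d t)}"
  note I = is_ideal_vanishing[of Y]
  have zero: "?L d 0" for d using is_ideal_0[OF I] by (intro bexI[of _ 0]) auto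
  have add: "?L d (s + t)" if "?L d s" "?L d t" for d s t
  proof -
    from that obtain h k where "h \<in> vanishing_ideal Y" "k \<in> vanishing_ideal Y"
      "hom_component d h = s \<and> (\<forall>e>d. hom_component e h = 0)" "hom_component d k = t \<and> (\<forall>e>d. hom_component e k = 0)" by blast
    thus ?thesis by (intro bexI[of _ "h + k"]) (auto simp: hom_component_add is_ideal_add[OF I])
  qed
  have mult: "?L (i + j) (hom_component i r * s)" if "?L j s" for i j r s
  proof -
    from that obtain h where h: "h \<in> vanishing_ideal Y" "hom_component j h = s" "\<forall>e>j. hom_component e h = 0" by blast
    have "hom_component i r * h \<in> vanishing_ideal Y" using h by (simp add: is_ideal_mult[OF I])
    thus ?thesis using h
      by (intro bexI[of _ "hom_component i r * h"]) (auto simp: hom_component_mult_homogeneous[of i])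
  qed
  have sum: "?L d (sum F A)" if "finite A" "\<And>x. x \<in> A \<Longrightarrow> ?L d (F x)" for d A and F :: "nat \<Rightarrow> ('a, complex) mpoly"
    using that
  proof induction
    case empty
    show ?case using zero by simp
  next
    case (insert x A)
    show ?case unfolding sum.insert[OF insert(1,2)] by (rule add) (use insert in auto)
  qed
  have "is_ideal ?K"
    unfolding is_ideal_def
  proof (intro conjI ballI allI)
    show "0 \<in> ?K" using zero by simp
  next
    fix s t assume "s \<in> ?K" "t \<in> ?K"
    thus "s + t \<in> ?K" unfolding mem_Collect_eq hom_component_add using add by blast
  next
    fix r t assume t: "t \<in> ?K"
    have "?L d (hom_component d (r * t))" for d
      unfolding hom_component_mult
    proof (rule sum)
      fix i assume "i \<in> {..d}"
      thus "?L d (hom_component i r * hom_component (d - i) t)"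
        using mult[of "d - i" "hom_component (d - i) t" i r] t by simp
    qed simp
    thus "r * t \<in> ?K" by simp
  qed
  moreover have "{top_form f | f. f \<in> vanishing_ideal Y \<and> f \<noteq> 0} \<subseteq> ?K"
  proof clarify
    fix f d assume f: "f \<in> vanishing_ideal Y" "f \<noteq> 0"
    obtain e where e: "top_form f = hom_component e f" "\<And>e'. e' > e \<Longrightarrow> hom_component e' f = 0"
      using f(2) by (rule top_formE) blast
    show "?L d (hom_component d (top_form f))"
    proof (cases "d = e")
      case True
      thus ?thesis using f e by (intro bexI[of _ f]) (auto simp: hom_component_hom_component)
    next
      case False
      thus ?thesis using zero e by (simp add: hom_component_hom_component)
    qed
  qed
  ultimately have "top_ideal Y \<subseteq> ?K" unfolding top_ideal_def by (rule Idl_least)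
  hence "?L d (hom_component d t)" using assms(1) by blast
  hence "?L d t" using assms(2) by (simp add: homogeneous_iff)
  thus ?thesis using that by blast
qed

lemma Sn_orbits_stable:
  fixes y :: "complex ^ 'n::finite"
  assumes "y \<in> Sn_orbits X" "\<pi> permutes UNIV"
  shows "(\<chi> i. y $ \<pi> i) \<in> Sn_orbits X"
proof -
  obtain P :: "complex ^ 'n" and \<rho> where "y = (\<chi> i. P $ \<rho> i)" "P \<in> X" "\<rho> permutes UNIV"
    using assms(1) by (auto simp: Sn_orbits_def)
  hence "(\<chi> i. y $ \<pi> i) = (\<chi> i. P $ (\<rho> \<circ> \<pi>) i)" "P \<in> X" "(\<rho> \<circ> \<pi>) permutes UNIV"
    using assms(2) by (auto intro: permutes_compose)
  thus ?thesis unfolding Sn_orbits_def by blast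
qed

lemma finite_Sn_orbits: "finite X \<Longrightarrow> finite (Sn_orbits (X :: (complex ^ 'a::finite) set))"
proof -
  assume "finite X"
  have "Sn_orbits X = (\<lambda>(P :: complex ^ 'a, \<pi>). \<chi> i. P $ \<pi> i) ` (X \<times> {\<pi>. \<pi> permutes UNIV})"
    by (auto simp: Sn_orbits_def image_def)
  thus ?thesis using \<open>finite X\<close> by simp
qed

lemma perm_stable_vanishing:
  assumes "\<pi> permutes UNIV" "f \<in> vanishing_ideal (Sn_orbits X)"
  shows "perm_poly \<pi> f \<in> vanishing_ideal (Sn_orbits X)"
  using assms Sn_orbits_stable by (auto simp: vanishing_ideal_def eval_at_perm_poly)

lemma perm_stable_top:
  assumes "\<pi> permutes UNIV" "f \<in> top_ideal (Sn_orbits X)"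
  shows "perm_poly \<pi> f \<in> top_ideal (Sn_orbits X)"
  using assms(2) unfolding top_ideal_def
proof (rule perm_stable_Idl[OF _ assms(1), rotated])
  fix t assume "t \<in> {top_form f | f. f \<in> vanishing_ideal (Sn_orbits X) \<and> f \<noteq> 0}"
  then obtain f where f: "t = top_form f" "f \<in> vanishing_ideal (Sn_orbits X)" "f \<noteq> 0" by blast
  obtain d where d: "top_form f = hom_component d f" "hom_component d f \<noteq> 0" "\<And>e. e > d \<Longrightarrow> hom_component e f = 0"
    using f(3) by (rule top_formE) blast
  have nz: "perm_poly \<pi> g \<noteq> 0" if "g \<noteq> 0" for g :: "('a, complex) mpoly"
    using that perm_poly_inv(2)[OF assms(1), of g] by auto
  have "top_form (perm_poly \<pi> f) = hom_component d (perm_poly \<pi> f)"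
    by (rule top_form_eqI) (use d nz in \<open>auto simp: hom_component_perm_poly\<close>)
  hence "perm_poly \<pi> t = top_form (perm_poly \<pi> f)" using d f by (simp add: hom_component_perm_poly)
  thus "perm_poly \<pi> t \<in> {top_form f | f. f \<in> vanishing_ideal (Sn_orbits X) \<and> f \<noteq> 0}"
    using perm_stable_vanishing[OF assms(1) f(2)] nz[OF f(3)] by blast
qed

subsection \<open>The Tanisaki generators vanish to top order\<close>

lemma coeff_prod_linear:
  assumes "finite S" "r \<le> card S"
  shows "poly.coeff (\<Prod>i\<in>S. [:- (y $ i), 1:]) (card S - r) = (- 1) ^ r * eval_at (elem_sym r S) (y :: complex ^ 'n::finite)"
  using assms
proof (induction S arbitrary: r rule: finite_induct)
  case (insert b S)
  let ?q = "\<Prod>i\<in>S. [:- (y $ i), 1:]"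
  have deg: "degree ?q \<le> card S" using degree_prod_sum_le[OF insert(1), of "\<lambda>i. [:- (y $ i), 1:]"] by simp
  have q: "(\<Prod>i\<in>insert b S. [:- (y $ i), 1:]) = [:- (y $ b), 1:] * ?q" using insert by simp
  have c: "card (insert b S) = Suc (card S)" using insert by simp
  show ?case
  proof (cases r)
    case 0
    hence "poly.coeff (\<Prod>i\<in>insert b S. [:- (y $ i), 1:]) (card (insert b S) - r) = poly.coeff ?q (card S)"
      unfolding q c using deg by (simp add: coeff_eq_0)
    thus ?thesis using insert.IH[of 0] 0 insert(1) by simp
  next
    case (Suc r')
    have e: "eval_at (elem_sym r (insert b S)) y = eval_at (elem_sym r S) y + y $ b * eval_at (elem_sym r' S) y"
      unfolding Suc elem_sym_insert[OF insert(1,2)] by (simp add: eval_at_add eval_at_mult)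
    show ?thesis
    proof (cases "r \<le> card S")
      case True
      hence m: "card (insert b S) - r = Suc (card S - r)" "card S - r' = Suc (card S - r)" using c Suc by auto
      have "poly.coeff (\<Prod>i\<in>insert b S. [:- (y $ i), 1:]) (card (insert b S) - r)
          = poly.coeff ?q (card S - r) - y $ b * poly.coeff ?q (card S - r')"
        unfolding q m by simp
      thus ?thesis using insert.IH[of r] insert.IH[of r'] True Suc e by (simp add: algebra_simps)
    next
      case False
      hence m: "card (insert b S) - r = 0" "r' = card S" using insert.prems c Suc by auto
      have "poly.coeff (\<Prod>i\<in>insert b S. [:- (y $ i), 1:]) (card (insert b S) - r) = - (y $ b) * poly.coeff ?q 0"
        unfolding q m by simp
      moreover have "elem_sym r S = (0 :: ('n, complex) mpoly)" using False insert(1) by (intro elem_sym_eq_0) auto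
      ultimately show ?thesis using insert.IH[of r'] m Suc e by simp
    qed
  qed
qed simp

lemma tanisaki_d_coord_partition:
  fixes P :: "complex ^ 'n::finite"
  assumes "k \<le> CARD('n)"
  shows "tanisaki_d CARD('n) (coord_partition P) k = (\<Sum>c\<in>range (($) P). mult_of P c - (CARD('n) - k))"
  using assms by (subst tanisaki_d_eq) (auto simp: coord_partition_le sum_list_coord_partition)

lemma mult_of_perm:
  fixes P :: "complex ^ 'n::finite"
  assumes "\<pi> permutes UNIV"
  shows "mult_of (\<chi> i. P $ \<pi> i) c = mult_of P c"
proof -
  have "card (\<pi> ` {i. P $ \<pi> i = c}) = card {i. P $ \<pi> i = c}"
    using permutes_inj[OF assms] by (intro card_image) (rule inj_on_subset, auto)
  moreover have "\<pi> ` {i. P $ \<pi> i = c} = {i. P $ i = c}"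
    by (rule image_preimage[OF permutes_surj[OF assms]])
  ultimately show ?thesis by (simp add: mult_of_def)
qed

text \<open>The polynomial \<open>\<Prod>\<^bsub>i\<in>S\<^esub> (t - x\<^sub>i)\<close> is divisible by \<open>\<Prod>\<^sub>c (t - c)\<^bsup>m(c) - (n - k)\<^esup>\<close> at every point
  of the orbit, so the coefficients of the remainder vanish there.\<close>

lemma elem_sym_lift:
  fixes P :: "complex ^ 'n::finite" and S :: "'n set"
  assumes r: "r \<le> card S" "card S < r + tanisaki_d CARD('n) (coord_partition P) (card S)"
  obtains f where "f \<in> vanishing_ideal (Sn_orbits {P})" "hom_component r f = elem_sym r S"
    "\<And>d. d > r \<Longrightarrow> hom_component d f = 0"
proof -
  let ?n = "CARD('n)" and ?k = "card S"
  let ?j = "?k - r"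
  have kn: "?k \<le> ?n" by (simp add: card_mono)
  \<comment> \<open>Its degree is d_k(lambda) by the row formula, and k - r is smaller, so the
    coefficient at k - r of a remainder modulo D is a genuine condition.\<close>
  define D where "D = (\<Prod>c\<in>range (($) P). [:- c, 1:] ^ (mult_of P c - (?n - ?k)))"
  have "degree D = (\<Sum>c\<in>range (($) P). degree ([:- c, 1:] ^ (mult_of P c - (?n - ?k))))"
    unfolding D_def by (rule degree_prod_eq_sum_degree) simp
  also have "\<dots> = tanisaki_d ?n (coord_partition P) ?k"
    unfolding tanisaki_d_coord_partition[OF kn] by (simp add: degree_power_eq)
  finally have j: "?j < degree D" using r by simp
  \<comment> \<open>The linear functional that takes the coefficient of degree k - r of the
    remainder modulo D. On powers up to k - r it is a Kronecker delta: by Vieta, elementary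
    symmetric polynomials of index above r drop out of f and e_r(S) gets coefficient 1.\<close>
  define \<rho> where "\<rho> = (\<lambda>m. poly.coeff (Polynomial.monom 1 m mod D) ?j)"
  have \<rho>_small: "\<rho> m = (if m = ?j then 1 else 0)" if "m \<le> ?j" for m
  proof -
    have "Polynomial.monom (1 :: complex) m mod D = Polynomial.monom 1 m"
      using that j by (intro mod_poly_less) (simp add: degree_monom_eq)
    thus ?thesis by (simp add: \<rho>_def)
  qed
  define f where "f = (\<Sum>m\<le>?k. cnst ((- 1) ^ r * \<rho> m * (- 1) ^ (?k - m)) * elem_sym (?k - m) S)"
  have "f \<in> vanishing_ideal (Sn_orbits {P})"
    unfolding vanishing_ideal_def
  proof (intro CollectI ballI)
    fix y assume "y \<in> Sn_orbits {P}"
    then obtain \<pi> where \<pi>: "\<pi> permutes UNIV" "y = (\<chi> i. P $ \<pi> i)" by (auto simp: Sn_orbits_def)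
    define q where "q = (\<Prod>i\<in>S. [:- (y $ i), 1:])"
    \<comment> \<open>At most n - k of the coordinates equal to c lie outside S, so c is a root of q
      at least as often as of D.\<close>
    have m: "mult_of P c \<le> card {i\<in>S. y $ i = c} + (?n - ?k)" for c
    proof -
      have "mult_of P c = card {i. y $ i = c}" using mult_of_perm[OF \<pi>(1), of P c] \<pi>(2) by (simp add: mult_of_def)
      also have "\<dots> \<le> card ({i\<in>S. y $ i = c} \<union> (UNIV - S))" by (intro card_mono) auto
      also have "\<dots> \<le> card {i\<in>S. y $ i = c} + card (UNIV - S)" by (rule card_Un_le)
      finally show ?thesis by (simp add: card_Diff_subset)
    qed
    have ry: "y $ i \<in> range (($) P)" for i using \<pi>(2) by simp
    have "q = (\<Prod>c\<in>range (($) P). \<Prod>i | i \<in> S \<and> y $ i = c. [:- (y $ i), 1:])"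
      unfolding q_def by (rule prod.group[symmetric]) (use ry in auto)
    also have "\<dots> = (\<Prod>c\<in>range (($) P). [:- c, 1:] ^ card {i\<in>S. y $ i = c})" by (intro prod.cong) auto
    finally have "D dvd q"
      unfolding D_def using m by (auto intro!: prod_dvd_prod le_imp_power_dvd simp: le_diff_conv)
    have "degree q \<le> ?k"
      unfolding q_def using degree_prod_sum_le[of S "\<lambda>i. [:- (y $ i), 1:]"] by simp
    have modsum: "(\<Sum>m\<in>A. g m) mod D = (\<Sum>m\<in>A. g m mod D)" if "finite A" for A and g :: "nat \<Rightarrow> complex poly"
      using that by induction (simp_all add: poly_mod_add_left)
    have q: "q = (\<Sum>m\<le>?k. Polynomial.smult (poly.coeff q m) (Polynomial.monom 1 m))"
      using poly_as_sum_of_monoms'[OF \<open>degree q \<le> ?k\<close>] by (simp add: smult_monom)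
    have "q mod D = (\<Sum>m\<le>?k. Polynomial.smult (poly.coeff q m) (Polynomial.monom 1 m)) mod D"
      by (rule arg_cong[OF q])
    also have "\<dots> = (\<Sum>m\<le>?k. Polynomial.smult (poly.coeff q m) (Polynomial.monom 1 m mod D))"
      by (simp only: modsum[OF finite_atMost] mod_smult_left)
    finally have "(\<Sum>m\<le>?k. poly.coeff q m * \<rho> m) = poly.coeff (q mod D) ?j"
      by (simp add: coeff_sum \<rho>_def)
    also have "\<dots> = 0" using \<open>D dvd q\<close> by (simp add: dvd_imp_mod_0)
    finally have z: "(\<Sum>m\<le>?k. poly.coeff q m * \<rho> m) = 0" .
    have "poly.coeff q m = (- 1) ^ (?k - m) * eval_at (elem_sym (?k - m) S) y" if "m \<le> ?k" for m
      unfolding q_def using coeff_prod_linear[of S "?k - m" y] that by simp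
    hence "eval_at f y = (- 1) ^ r * (\<Sum>m\<le>?k. poly.coeff q m * \<rho> m)"
      unfolding f_def eval_at_sum eval_at_mult sum_distrib_left by (intro sum.cong) auto
    thus "eval_at f y = 0" using z by simp
  qed
  moreover have comp: "hom_component d f = (if d \<le> ?k then cnst ((- 1) ^ r * \<rho> (?k - d) * (- 1) ^ d) * elem_sym d S else 0)" for d
  proof -
    have "hom_component d f = (\<Sum>m\<le>?k. if m = ?k - d \<and> d \<le> ?k then cnst ((- 1) ^ r * \<rho> (?k - d) * (- 1) ^ d) * elem_sym d S else 0)"
      unfolding f_def hom_component_sum hom_component_cnst_mult
      by (intro sum.cong) (auto simp: hom_component_homogeneous[OF homogeneous_elem_sym])
    thus ?thesis by (cases "d \<le> ?k") auto
  qed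
  have "hom_component r f = elem_sym r S"
    using r(1) \<rho>_small[of ?j] by (simp add: comp power_add[symmetric] mult_2[symmetric] power_mult)
  moreover have "hom_component d f = 0" if "d > r" for d
    using that r(1) \<rho>_small[of "?k - d"] by (auto simp: comp)
  ultimately show ?thesis by (intro that[of f])
qed

lemma tanisaki_subset_top:
  fixes P :: "complex ^ 'n::finite"
  shows "tanisaki_ideal (coord_partition P) \<subseteq> top_ideal (Sn_orbits {P})"
  unfolding tanisaki_ideal_def
proof (rule Idl_least[OF is_ideal_top], clarify)
  fix r and S :: "'n set"
  assume "card S < r + tanisaki_d CARD('n) (coord_partition P) (card S)" "r \<le> card S"
  then obtain f where "f \<in> vanishing_ideal (Sn_orbits {P})" "hom_component r f = elem_sym r S"
    "\<And>d. d > r \<Longrightarrow> hom_component d f = 0" using elem_sym_lift by metis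
  thus "elem_sym r S \<in> top_ideal (Sn_orbits {P})" using hom_component_in_top_ideal by metis
qed

subsection \<open>Interpolation and linear independence\<close>

lemma interpolation:
  fixes X :: "(complex ^ 'n::finite) set"
  assumes "finite X"
  obtains p where "\<And>x. x \<in> X \<Longrightarrow> eval_at p x = (if x = z then 1 else 0)"
proof -
  have "\<exists>p. \<forall>x\<in>X. eval_at p x = (if x = z then 1 else 0)"
    using assms
  proof induction
    case (insert y X)
    then obtain p where p: "\<And>x. x \<in> X \<Longrightarrow> eval_at p x = (if x = z then 1 else 0)" by blast
    have sep: "\<exists>s. eval_at s y = 0 \<and> eval_at s z = 1" if yz: "y \<noteq> z"
    proof -
      obtain i where i: "y $ i \<noteq> z $ i" using yz by (metis vec_eq_iff)
      let ?s = "cnst (1 / (z $ i - y $ i)) * (var i - cnst (y $ i))"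
      have "eval_at ?s y = 0" "eval_at ?s z = 1" using i by (simp_all add: eval_at_mult eval_at_diff)
      thus ?thesis by blast
    qed
    show ?case
    proof (cases "y = z")
      case False
      then obtain s where "eval_at s y = 0" "eval_at s z = 1" using sep by blast
      thus ?thesis using p False by (intro exI[of _ "s * p"]) (auto simp: eval_at_mult)
    next
      case True
      have "\<exists>s. eval_at s z = 1 \<and> (\<forall>x\<in>A. eval_at s x = 0)" if "finite A" "z \<notin> A" for A :: "(complex ^ 'n) set"
        using that
      proof induction
        case empty
        show ?case by (intro exI[of _ 1]) simp
      next
        case (insert x A)
        then obtain s where s: "eval_at s z = 1" "\<forall>x\<in>A. eval_at s x = 0" by blast
        obtain i where i: "x $ i \<noteq> z $ i" using insert by (metis insertI1 vec_eq_iff)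
        let ?s = "cnst (1 / (z $ i - x $ i)) * (var i - cnst (x $ i)) * s"
        have "eval_at ?s z = 1" "\<forall>x\<in>insert x A. eval_at ?s x = 0"
          using i s by (auto simp: eval_at_mult eval_at_diff)
        thus ?case by blast
      qed
      from this[of X] show ?thesis using insert True by auto
    qed
  qed simp
  thus ?thesis using that by blast
qed

interpretation fs: vector_space "\<lambda>(c::complex) (f::'a \<Rightarrow> complex). \<lambda>x. c * f x"
  by unfold_locales (auto simp: fun_eq_iff algebra_simps)

text \<open>Set to 0 off Z, so that functions on Z live in the vector space of all
  functions.\<close>

definition restricted_eval :: "(complex ^ 'n::finite) set \<Rightarrow> ('n, complex) mpoly \<Rightarrow> complex ^ 'n \<Rightarrow> complex" where
  "restricted_eval Z f z = (if z \<in> Z then eval_at f z else 0)"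

text \<open>The delta functions of the points of Z are independent and lie in the span of the
  restrictions of the polynomials g.\<close>

lemma card_le_of_span:
  fixes Z :: "(complex ^ 'n::finite) set" and g :: "'i \<Rightarrow> ('n, complex) mpoly"
  assumes "finite E" "finite Z"
    and span: "\<And>z. z \<in> Z \<Longrightarrow> \<exists>c. \<forall>z'\<in>Z. (\<Sum>\<iota>\<in>E. c \<iota> * eval_at (g \<iota>) z') = (if z' = z then 1 else 0)"
  shows "card Z \<le> card E"
proof -
  let ?d = "\<lambda>z z'. if z' = z then 1 else (0::complex)"
  have inj: "inj_on ?d Z" by (auto simp: inj_on_def fun_eq_iff split: if_splits)
  have "fs.independent (?d ` Z)"
  proof (rule fs.independent_if_scalars_zero)
    show "finite (?d ` Z)" using assms by simp
    fix u x assume u: "(\<Sum>x\<in>?d ` Z. (\<lambda>z'. u x * x z')) = 0" and "x \<in> ?d ` Z"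
    then obtain z where z: "z \<in> Z" "x = ?d z" by blast
    have "0 = (\<Sum>y\<in>Z. (\<lambda>z'. u (?d y) * ?d y z')) z"
      using u by (subst (asm) sum.reindex[OF inj]) (simp add: o_def)
    also have "\<dots> = (\<Sum>y\<in>Z. u (?d y) * ?d y z)"
      using assms(2) by (induction Z rule: finite_induct) auto
    also have "\<dots> = (\<Sum>y\<in>Z. if y = z then u (?d z) else 0)" by (intro sum.cong) auto
    also have "\<dots> = u x" using z assms by simp
    finally show "u x = 0" by simp
  qed
  moreover have "?d ` Z \<subseteq> fs.span ((\<lambda>\<iota>. restricted_eval Z (g \<iota>)) ` E)"
  proof
    fix x assume "x \<in> ?d ` Z"
    then obtain z where z: "z \<in> Z" "x = ?d z" by blast
    obtain c where c: "\<And>z'. z' \<in> Z \<Longrightarrow> (\<Sum>\<iota>\<in>E. c \<iota> * eval_at (g \<iota>) z') = ?d z z'" using span[OF z(1)] by blast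
    have ev: "(\<Sum>\<iota>\<in>A. (\<lambda>z'. c \<iota> * restricted_eval Z (g \<iota>) z')) z' = (\<Sum>\<iota>\<in>A. c \<iota> * restricted_eval Z (g \<iota>) z')" for A z'
      by (induction A rule: infinite_finite_induct) auto
    have "(\<Sum>\<iota>\<in>E. (\<lambda>z'. c \<iota> * restricted_eval Z (g \<iota>) z')) = x"
    proof
      fix z'
      show "(\<Sum>\<iota>\<in>E. (\<lambda>z'. c \<iota> * restricted_eval Z (g \<iota>) z')) z' = x z'"
        unfolding ev using c[of z'] z by (cases "z' \<in> Z") (auto simp: restricted_eval_def)
    qed
    moreover have "(\<Sum>\<iota>\<in>E. (\<lambda>z'. c \<iota> * restricted_eval Z (g \<iota>) z')) \<in> fs.span ((\<lambda>\<iota>. restricted_eval Z (g \<iota>)) ` E)"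
      by (intro fs.span_sum fs.span_scale fs.span_base) auto
    ultimately show "x \<in> fs.span ((\<lambda>\<iota>. restricted_eval Z (g \<iota>)) ` E)" by simp
  qed
  ultimately have "card (?d ` Z) \<le> card ((\<lambda>\<iota>. restricted_eval Z (g \<iota>)) ` E)"
    using fs.independent_span_bound[of "(\<lambda>\<iota>. restricted_eval Z (g \<iota>)) ` E" "?d ` Z"] assms by simp
  also have "\<dots> \<le> card E" using assms by (intro card_image_le)
  finally show ?thesis using card_image[OF inj] by simp
qed

text \<open>Spanning modulo the top degree ideal lifts to the vanishing ideal by descending through the
  degrees.\<close>

context
  fixes X :: "(complex ^ 'n::finite) set" and kap :: "'n \<Rightarrow> nat" and h :: "'i \<Rightarrow> ('n, complex) mpoly" and dg :: "'i \<Rightarrow> nat"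
begin

definition spans_mod_top :: "'i set \<Rightarrow> bool" where
  "spans_mod_top E \<longleftrightarrow> (\<forall>d f. homogeneous d f \<longrightarrow>
    (\<exists>c. antisymmetrize kap f - (\<Sum>\<iota>\<in>{\<iota>\<in>E. dg \<iota> = d}. cnst (c \<iota>) * antisymmetrize kap (h \<iota>)) \<in> top_ideal (Sn_orbits X)))"

lemma spans_mod_vanishing:
  assumes E: "finite E" "spans_mod_top E" and h: "\<And>\<iota>. \<iota> \<in> E \<Longrightarrow> homogeneous (dg \<iota>) (h \<iota>)"
  shows "\<exists>c. antisymmetrize kap f - (\<Sum>\<iota>\<in>E. cnst (c \<iota>) * antisymmetrize kap (h \<iota>)) \<in> vanishing_ideal (Sn_orbits X)"
proof -
  let ?N = "antisymmetrize kap" and ?I = "vanishing_ideal (Sn_orbits X)"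
  let ?k = "of_nat (card (color_perms kap)) :: complex"
  have k: "?k \<noteq> 0" using color_perms_id[of kap] by auto
  note I = is_ideal_vanishing[of "Sn_orbits X"]
  obtain D0 where D0: "\<And>d. d \<ge> Suc D0 \<Longrightarrow> hom_component d f = 0"
    using hom_component_bound[of f] by (auto simp: Suc_le_eq)
  have "\<exists>c. ?N f - (\<Sum>\<iota>\<in>E. cnst (c \<iota>) * ?N (h \<iota>)) \<in> ?I" if "\<And>d. d \<ge> D \<Longrightarrow> hom_component d f = 0" for D f
    using that
  proof (induction D arbitrary: f)
    case 0
    have "f = 0" using sum_hom_components[of 0 f] 0 by simp
    thus ?case by (intro exI[of _ "\<lambda>_. 0"]) (simp add: is_ideal_0[OF I])
  next
    case (Suc D)
    let ?fD = "hom_component D f" and ?ED = "{\<iota>\<in>E. dg \<iota> = D}"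
    obtain c1 where t: "?N ?fD - (\<Sum>\<iota>\<in>?ED. cnst (c1 \<iota>) * ?N (h \<iota>)) \<in> top_ideal (Sn_orbits X)"
      using E(2) homogeneous_hom_component[of D f] unfolding spans_mod_top_def by blast
    let ?t = "?N ?fD - (\<Sum>\<iota>\<in>?ED. cnst (c1 \<iota>) * ?N (h \<iota>))"
    have "homogeneous D ?t"
      using h by (intro homogeneous_diff homogeneous_sum homogeneous_cnst_mult homogeneous_antisym) auto
    with t obtain u where u: "u \<in> ?I" "hom_component D u = ?t" "\<And>e. e > D \<Longrightarrow> hom_component e u = 0"
      by (rule top_ideal_lift) blast
    \<comment> \<open>Both ?t and its lift u have the same component of degree D, so f' has degree
      below D. Antisymmetrizing ?t once more multiplies it by the order of the Young subgroup, which
      the factor compensates.\<close>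
    define f' where "f' = (f - ?fD) + cnst (1 / ?k) * (?t - u)"
    have "hom_component d f' = 0" if "d \<ge> D" for d
      using that Suc.prems[of d] u(2) u(3)[of d] hom_component_homogeneous[OF \<open>homogeneous D ?t\<close>, of d]
      by (cases "d = D") (auto simp: f'_def hom_component_add hom_component_diff hom_component_cnst_mult hom_component_hom_component)
    then obtain c2 where c2: "?N f' - (\<Sum>\<iota>\<in>E. cnst (c2 \<iota>) * ?N (h \<iota>)) \<in> ?I" using Suc.IH by blast
    have kk: "cnst (1 / ?k) * (cnst ?k * x) = x" for x :: "('n, complex) mpoly"
      using k by (simp add: mult.assoc[symmetric] cnst_mult[symmetric])
    have "cnst (1 / ?k) * ?N (cnst (c1 \<iota>) * ?N (h \<iota>)) = cnst (c1 \<iota>) * ?N (h \<iota>)" for \<iota>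
      unfolding antisym_cnst_mult antisym_antisym
      using kk[of "cnst (c1 \<iota>) * ?N (h \<iota>)"] by (simp add: mult.left_commute)
    hence "cnst (1 / ?k) * ?N ?t = ?N ?fD - (\<Sum>\<iota>\<in>?ED. cnst (c1 \<iota>) * ?N (h \<iota>))"
      by (simp add: antisym_diff antisym_sum antisym_antisym kk right_diff_distrib sum_distrib_left)
    hence Nf': "?N f' = ?N f - (\<Sum>\<iota>\<in>?ED. cnst (c1 \<iota>) * ?N (h \<iota>)) - cnst (1 / ?k) * ?N u"
      by (simp add: f'_def antisym_add antisym_diff antisym_cnst_mult right_diff_distrib)
    define c where "c = (\<lambda>\<iota>. c2 \<iota> + (if dg \<iota> = D then c1 \<iota> else 0))"
    have "(\<Sum>\<iota>\<in>E. cnst (c \<iota>) * ?N (h \<iota>)) = (\<Sum>\<iota>\<in>E. cnst (c2 \<iota>) * ?N (h \<iota>)) + (\<Sum>\<iota>\<in>E. if dg \<iota> = D then cnst (c1 \<iota>) * ?N (h \<iota>) else 0)"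
      unfolding sum.distrib[symmetric] by (intro sum.cong) (auto simp: c_def cnst_add distrib_right)
    also have "(\<Sum>\<iota>\<in>E. if dg \<iota> = D then cnst (c1 \<iota>) * ?N (h \<iota>) else 0) = (\<Sum>\<iota>\<in>?ED. cnst (c1 \<iota>) * ?N (h \<iota>))"
      using E(1) by (rule sum.inter_filter[symmetric])
    finally have "?N f - (\<Sum>\<iota>\<in>E. cnst (c \<iota>) * ?N (h \<iota>)) = (?N f' - (\<Sum>\<iota>\<in>E. cnst (c2 \<iota>) * ?N (h \<iota>))) + cnst (1 / ?k) * ?N u"
      unfolding Nf' by simp
    moreover have "?N u \<in> ?I" using I _ u(1) by (rule antisym_mem) (rule perm_stable_vanishing)
    ultimately have "?N f - (\<Sum>\<iota>\<in>E. cnst (c \<iota>) * ?N (h \<iota>)) \<in> ?I"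
      using c2 by (simp add: is_ideal_add[OF I] is_ideal_mult[OF I])
    thus ?case by blast
  qed
  from this[of "Suc D0" f] D0 show ?thesis by blast
qed

lemma card_le_of_spans:
  assumes E: "finite E" "spans_mod_top E" and h: "\<And>\<iota>. \<iota> \<in> E \<Longrightarrow> homogeneous (dg \<iota>) (h \<iota>)"
    and Z: "finite Z" "Z \<subseteq> Sn_orbits X"
    and delta: "\<And>z. z \<in> Z \<Longrightarrow> \<exists>p. \<forall>z'\<in>Z. eval_at (antisymmetrize kap p) z' = (if z' = z then 1 else 0)"
  shows "card Z \<le> card E"
proof (rule card_le_of_span[OF E(1) Z(1)])
  fix z assume "z \<in> Z"
  then obtain p where p: "\<forall>z'\<in>Z. eval_at (antisymmetrize kap p) z' = (if z' = z then 1 else 0)" using delta by blast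
  obtain c where "antisymmetrize kap p - (\<Sum>\<iota>\<in>E. cnst (c \<iota>) * antisymmetrize kap (h \<iota>)) \<in> vanishing_ideal (Sn_orbits X)"
    using spans_mod_vanishing[OF E h] by blast
  hence "eval_at (antisymmetrize kap p) z' = (\<Sum>\<iota>\<in>E. c \<iota> * eval_at (antisymmetrize kap (h \<iota>)) z')" if "z' \<in> Z" for z'
    using that Z(2) by (auto simp: vanishing_ideal_def eval_at_diff eval_at_sum eval_at_mult)
  thus "\<exists>c. \<forall>z'\<in>Z. (\<Sum>\<iota>\<in>E. c \<iota> * eval_at (antisymmetrize kap (h \<iota>)) z') = (if z' = z then 1 else 0)"
    using p by (intro exI[of _ c]) auto
qed

text \<open>A relation with nonzero coefficient at the given index, cut down to one degree,
  expresses that element by the others. The rest would still span, with fewer elements than Z has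
  points.\<close>

lemma independent_mod_top:
  assumes E: "finite E" "spans_mod_top E" and h: "\<And>\<iota>. \<iota> \<in> E \<Longrightarrow> homogeneous (dg \<iota>) (h \<iota>)"
    and Z: "finite Z" "Z \<subseteq> Sn_orbits X" "card E \<le> card Z"
    and delta: "\<And>z. z \<in> Z \<Longrightarrow> \<exists>p. \<forall>z'\<in>Z. eval_at (antisymmetrize kap p) z' = (if z' = z then 1 else 0)"
    and rel: "(\<Sum>\<iota>\<in>E. cnst (c \<iota>) * antisymmetrize kap (h \<iota>)) \<in> top_ideal (Sn_orbits X)"
    and \<iota>0: "\<iota>0 \<in> E"
  shows "c \<iota>0 = 0"
proof (rule ccontr)
  assume c0: "c \<iota>0 \<noteq> 0"
  let ?N = "antisymmetrize kap" and ?T = "top_ideal (Sn_orbits X)" and ?d = "dg \<iota>0"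
  let ?E' = "E - {\<iota>0}" and ?Ed = "{\<iota>\<in>E. dg \<iota> = dg \<iota>0}"
  note T = is_ideal_top[of "Sn_orbits X"]
  have "hom_component ?d (\<Sum>\<iota>\<in>E. cnst (c \<iota>) * ?N (h \<iota>)) \<in> ?T"
    using rel homogeneous_ideal_top[of "Sn_orbits X"] by (auto simp: homogeneous_ideal_def)
  also have "hom_component ?d (\<Sum>\<iota>\<in>E. cnst (c \<iota>) * ?N (h \<iota>)) = (\<Sum>\<iota>\<in>E. if dg \<iota> = ?d then cnst (c \<iota>) * ?N (h \<iota>) else 0)"
    unfolding hom_component_sum hom_component_cnst_mult
  proof (intro sum.cong refl)
    fix \<iota> assume "\<iota> \<in> E"
    hence "hom_component ?d (?N (h \<iota>)) = (if ?d = dg \<iota> then ?N (h \<iota>) else 0)"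
      by (intro hom_component_homogeneous homogeneous_antisym h)
    thus "cnst (c \<iota>) * hom_component ?d (?N (h \<iota>)) = (if dg \<iota> = ?d then cnst (c \<iota>) * ?N (h \<iota>) else 0)"
      by simp
  qed
  also have "\<dots> = (\<Sum>\<iota>\<in>?Ed. cnst (c \<iota>) * ?N (h \<iota>))" using E(1) by (rule sum.inter_filter[symmetric])
  finally have reld: "(\<Sum>\<iota>\<in>?Ed. cnst (c \<iota>) * ?N (h \<iota>)) \<in> ?T" .
  have "spans_mod_top ?E'"
    unfolding spans_mod_top_def
  proof (intro allI impI)
    fix d f assume "homogeneous d (f :: ('n, complex) mpoly)"
    then obtain b where b: "?N f - (\<Sum>\<iota>\<in>{\<iota>\<in>E. dg \<iota> = d}. cnst (b \<iota>) * ?N (h \<iota>)) \<in> ?T"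
      using E(2) unfolding spans_mod_top_def by blast
    show "\<exists>b. ?N f - (\<Sum>\<iota>\<in>{\<iota>\<in>?E'. dg \<iota> = d}. cnst (b \<iota>) * ?N (h \<iota>)) \<in> ?T"
    proof (cases "d = ?d")
      case False
      hence "{\<iota>\<in>?E'. dg \<iota> = d} = {\<iota>\<in>E. dg \<iota> = d}" by auto
      thus ?thesis using b by auto
    next
      case True
      \<comment> \<open>Chosen so that subtracting a times the relation removes the coefficient at
        the discarded index.\<close>
      define a where "a = b \<iota>0 / c \<iota>0"
      have e1: "(\<Sum>\<iota>\<in>?Ed. cnst (b \<iota> - a * c \<iota>) * ?N (h \<iota>)) = (\<Sum>\<iota>\<in>?Ed. cnst (b \<iota>) * ?N (h \<iota>)) - cnst a * (\<Sum>\<iota>\<in>?Ed. cnst (c \<iota>) * ?N (h \<iota>))"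
        by (simp add: cnst_diff cnst_mult left_diff_distrib sum_subtractf sum_distrib_left mult.assoc)
      have e2: "(\<Sum>\<iota>\<in>?Ed. cnst (b \<iota> - a * c \<iota>) * ?N (h \<iota>)) = (\<Sum>\<iota>\<in>{\<iota>\<in>?E'. dg \<iota> = d}. cnst (b \<iota> - a * c \<iota>) * ?N (h \<iota>))"
        using E(1) c0 True by (intro sum.mono_neutral_right) (auto simp: a_def)
      have "(?N f - (\<Sum>\<iota>\<in>?Ed. cnst (b \<iota>) * ?N (h \<iota>))) + cnst a * (\<Sum>\<iota>\<in>?Ed. cnst (c \<iota>) * ?N (h \<iota>)) \<in> ?T"
        using b reld True by (intro is_ideal_add[OF T] is_ideal_mult[OF T]) auto
      hence "?N f - (\<Sum>\<iota>\<in>{\<iota>\<in>?E'. dg \<iota> = d}. cnst (b \<iota> - a * c \<iota>) * ?N (h \<iota>)) \<in> ?T"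
        unfolding e2[symmetric] e1 by (simp only: diff_diff_eq2 diff_add_eq)
      thus ?thesis by (rule exI[of _ "\<lambda>\<iota>. b \<iota> - a * c \<iota>"])
    qed
  qed
  hence "card Z \<le> card ?E'" using E(1) h Z delta by (intro card_le_of_spans) auto
  also have "\<dots> < card E" using E(1) \<iota>0 by (rule card_Diff1_less)
  finally show False using Z(3) by simp
qed

end

subsection \<open>Bases of the antisymmetric parts\<close>

text \<open>Coefficients are indexed by E and not by the image, since g need not be
  injective.\<close>

lemma span_image_coeffs:
  assumes "f \<in> mp.span (g ` E)" "finite E"
  shows "\<exists>c. f = (\<Sum>\<iota>\<in>E. cnst (c \<iota>) * g \<iota>)"
  using assms(1)
proof (induction rule: mp.span_induct_alt)
  case base
  show ?case by (intro exI[of _ "\<lambda>_. 0"]) simp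
next
  case (step a x y)
  then obtain c \<iota>0 where c: "y = (\<Sum>\<iota>\<in>E. cnst (c \<iota>) * g \<iota>)" "\<iota>0 \<in> E" "x = g \<iota>0" by auto
  have "(\<Sum>\<iota>\<in>E. cnst (c \<iota> + (if \<iota> = \<iota>0 then a else 0)) * g \<iota>)
      = y + (\<Sum>\<iota>\<in>E. if \<iota> = \<iota>0 then cnst a * g \<iota>0 else 0)"
    unfolding c(1) sum.distrib[symmetric] by (intro sum.cong) (auto simp: cnst_add distrib_right)
  also have "\<dots> = cnst a * x + y" using assms(2) c by simp
  finally show ?case by metis
qed

lemma antisym_spanning_coeffs:
  fixes bs :: "'n::finite list" and kap :: "'n \<Rightarrow> nat" and c :: nat
  assumes "distinct bs" "set bs = UNIV" "desc lam" "sum_list lam = CARD('n)" "homogeneous d f"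
  defines "E \<equiv> {es. admissible kap lam c (length lam) bs es}"
  shows "\<exists>a. antisymmetrize kap f - (\<Sum>es\<in>{es\<in>E. sum_list es = d}. cnst (a es) * antisymmetrize kap (monl bs es)) \<in> tanisaki_ideal lam"
proof -
  let ?g = "\<lambda>es. antisymmetrize kap (monl bs es)"
  have "{?g fs | fs. admissible kap lam c (length lam) bs fs \<and> sum_list fs = d} = ?g ` {es\<in>E. sum_list es = d}"
    by (auto simp: E_def)
  with antisym_spanning[OF assms(1-5), of kap c]
  obtain t where t: "t \<in> tanisaki_ideal lam" "antisymmetrize kap f - t \<in> mp.span (?g ` {es\<in>E. sum_list es = d})"
    by (auto simp: modspan_def)
  have "finite {es\<in>E. sum_list es = d}" unfolding E_def by (simp add: finite_admissible)
  from span_image_coeffs[OF t(2) this] obtain a where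
    "antisymmetrize kap f - t = (\<Sum>es\<in>{es\<in>E. sum_list es = d}. cnst (a es) * ?g es)" by blast
  hence "antisymmetrize kap f - (\<Sum>es\<in>{es\<in>E. sum_list es = d}. cnst (a es) * ?g es) = t" by (simp add: algebra_simps)
  thus ?thesis by (intro exI[of _ a]) (simp only: t(1))
qed

text \<open>A word becomes a point by writing the value of multiplicity \<open>lam ! j\<close> for
  the letter j. Different families give points in different orbits of the Young subgroup, all with
  trivial stabilizer; so antisymmetrizing a polynomial that is 1 at one of them and 0 on the rest of
  the S_n-orbit gives a delta function on Z.\<close>

lemma orbit_representatives:
  fixes P :: "complex ^ 'n::finite" and bs :: "'n list"
  assumes bs: "distinct bs" "set bs = UNIV"
  defines "lam \<equiv> coord_partition P"
  obtains Z where "finite Z" "Z \<subseteq> Sn_orbits {P}"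
    "card Z = card (families_of kap (length lam) bs c (length lam) (parts lam))"
    "\<And>z. z \<in> Z \<Longrightarrow> \<exists>p. \<forall>z'\<in>Z. eval_at (antisymmetrize kap p) z' = (if z' = z then 1 else 0)"
proof -
  let ?l = "length lam"
  let ?F = "families_of kap ?l bs c ?l (parts lam)"
  obtain cs where cs: "distinct cs" "set cs = range (($) P)" "lam = map (mult_of P) cs"
    unfolding lam_def by (rule coord_partition_values)
  have lcs: "length cs = ?l" by (simp add: cs(3))
  have "\<forall>T\<in>?F. \<exists>w\<in>injective_words kap ?l (parts lam). word_family kap w = T"
    using word_family_surj[OF bs] by blast
  then obtain w where w: "\<And>T. T \<in> ?F \<Longrightarrow> w T \<in> injective_words kap ?l (parts lam)"
    "\<And>T. T \<in> ?F \<Longrightarrow> word_family kap (w T) = T" by metis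
  define z where "z = (\<lambda>T. (\<chi> i. cs ! w T i) :: complex ^ 'n)"
  have wl: "w T i < length cs" if "T \<in> ?F" for T i
    using w(1)[OF that] by (simp add: injective_words_def words_def lcs)
  have z_orbit: "z T \<in> Sn_orbits {P}" if T: "T \<in> ?F" for T
  proof -
    have "card {i. z T $ i = v} = card {i. P $ i = v}" for v
    proof (cases "v \<in> set cs")
      case True
      then obtain j where j: "j < ?l" "v = cs ! j" by (auto simp: in_set_conv_nth lcs)
      hence "{i. z T $ i = v} = {i. w T i = j}"
        using wl[OF T] cs(1) lcs by (auto simp: z_def nth_eq_iff_index_eq)
      moreover have "int (card {i. w T i = j}) = parts lam j"
        using w(1)[OF T] j by (simp add: injective_words_def words_def)
      ultimately show ?thesis using j by (simp add: parts_def cs(3) mult_of_def)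
    next
      case False
      hence "{i. z T $ i = v} = {}" "{i. P $ i = v} = {}" using wl[OF T] cs(2) by (auto simp: z_def)
      thus ?thesis by simp
    qed
    hence "image_mset (($) (z T)) (mset_set UNIV) = image_mset (($) P) (mset_set UNIV)"
      by (intro multiset_eqI) (simp add: count_image_mset vimage_def)
    from image_mset_eq_implies_permutes[OF _ this] obtain p where "p permutes UNIV" "\<forall>x. z T $ x = P $ p x"
      by auto
    hence "z T = (\<chi> i. P $ p i)" "p permutes UNIV" by (simp_all add: vec_eq_iff)
    thus ?thesis unfolding Sn_orbits_def by blast
  qed
  \<comment> \<open>A family does not change when its word is permuted within colours, and letters
    distinct on each colour leave only the trivial stabilizer.\<close>
  have z_eq: "T = T' \<and> \<sigma> = id" if T: "T \<in> ?F" "T' \<in> ?F" and \<sigma>: "\<sigma> \<in> color_perms kap"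
    and eq: "(\<chi> i. z T' $ \<sigma> i) = z T" for T T' \<sigma>
  proof -
    have "cs ! w T' (\<sigma> i) = cs ! w T i" for i using arg_cong[OF eq, of "\<lambda>v. v $ i"] by (simp add: z_def)
    hence ww: "w T' (\<sigma> i) = w T i" for i using wl[OF T(1)] wl[OF T(2)] cs(1) by (simp add: nth_eq_iff_index_eq)
    have sp: "\<sigma> permutes UNIV" and sk: "\<And>i. kap (\<sigma> i) = kap i" using \<sigma> by (auto simp: color_perms_def)
    have "word_family kap (w T) k = word_family kap (w T') k" for k
    proof -
      have "word_family kap (w T) k = w T' ` \<sigma> ` {x. kap (\<sigma> x) = k}"
        by (simp add: word_family_def sk ww[symmetric] image_image)
      thus ?thesis
        by (simp only: image_preimage[OF permutes_surj[OF sp], of "\<lambda>x. kap x = k"] word_family_def)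
    qed
    hence TT: "T = T'" using w(2)[OF T(1)] w(2)[OF T(2)] by (metis ext)
    have "inj (\<lambda>x. (kap x, w T x))" using w(1)[OF T(1)] by (simp add: injective_words_def)
    hence "\<sigma> i = i" for i using ww[of i] sk[of i] TT by (auto simp: inj_on_def)
    thus ?thesis using TT by (auto simp: fun_eq_iff)
  qed
  have inj: "inj_on z ?F"
  proof (rule inj_onI)
    fix T T' assume "T \<in> ?F" "T' \<in> ?F" "z T = z T'"
    thus "T = T'" using z_eq[of T T' id] color_perms_id[of kap] by simp
  qed
  show ?thesis
  proof (rule that[of "z ` ?F"])
    show "card (z ` ?F) = card ?F" using inj by (rule card_image)
    fix y assume "y \<in> z ` ?F"
    then obtain T where T: "T \<in> ?F" "y = z T" by blast
    obtain p where p: "\<And>x. x \<in> Sn_orbits {P} \<Longrightarrow> eval_at p x = (if x = y then 1 else 0)"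
      using interpolation[OF finite_Sn_orbits[of "{P}"]] by auto
    have "eval_at (antisymmetrize kap p) (z T') = (if z T' = y then 1 else 0)" if T': "T' \<in> ?F" for T'
    proof -
      have "eval_at (antisymmetrize kap p) (z T') = (\<Sum>\<sigma>\<in>color_perms kap. of_int (sign \<sigma>) * eval_at p (\<chi> i. z T' $ \<sigma> i))"
        by (simp add: antisymmetrize_def eval_at_sum eval_at_mult eval_at_perm_poly)
      also have "\<dots> = (\<Sum>\<sigma>\<in>color_perms kap. if \<sigma> = id then (if z T' = y then 1 else 0) else 0)"
      proof (intro sum.cong refl)
        fix \<sigma> assume \<sigma>: "\<sigma> \<in> color_perms kap"
        hence "(\<chi> i. z T' $ \<sigma> i) \<in> Sn_orbits {P}"
          using z_orbit[OF T'] by (intro Sn_orbits_stable) (auto simp: color_perms_def)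
        hence "eval_at p (\<chi> i. z T' $ \<sigma> i) = (if (\<chi> i. z T' $ \<sigma> i) = y then 1 else 0)" by (rule p)
        thus "of_int (sign \<sigma>) * eval_at p (\<chi> i. z T' $ \<sigma> i) = (if \<sigma> = id then (if z T' = y then 1 else 0) else 0)"
          using z_eq[OF T(1) T' \<sigma>] T(2) by (cases "\<sigma> = id") (auto simp: sign_id)
      qed
      also have "\<dots> = (if z T' = y then 1 else 0)" by (simp add: color_perms_id)
      finally show ?thesis .
    qed
    thus "\<exists>p. \<forall>z'\<in>z ` ?F. eval_at (antisymmetrize kap p) z' = (if z' = y then 1 else 0)" by blast
  qed (use z_orbit in auto)
qed

text \<open>There are as many lists as points in Z, and they span modulo I_lambda, hence modulo the
  top degree ideal that contains it. Independence modulo this possibly larger ideal is what later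
  makes the two ideals equal.\<close>

theorem admissible_independent:
  fixes P :: "complex ^ 'n::finite" and bs :: "'n list" and kap :: "'n \<Rightarrow> nat"
  assumes bs: "distinct bs" "set bs = UNIV" "sorted (map kap bs)"
  defines "lam \<equiv> coord_partition P"
  defines "E \<equiv> {es. admissible kap lam 0 (length lam) bs es}"
  assumes rel: "(\<Sum>es\<in>E. cnst (c es) * antisymmetrize kap (monl bs es)) \<in> top_ideal (Sn_orbits {P})" and "es \<in> E"
  shows "c es = 0"
proof -
  have lam: "desc lam" "sum_list lam = CARD('n)" unfolding lam_def by (simp_all add: desc_coord_partition sum_coord_partition)
  have len: "length bs = CARD('n)" using distinct_card[OF bs(1)] bs(2) by simp
  obtain Z where Z: "finite Z" "Z \<subseteq> Sn_orbits {P}"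
    "card Z = card (families_of kap (length lam) bs 0 (length lam) (parts lam))"
    "\<And>z. z \<in> Z \<Longrightarrow> \<exists>p. \<forall>z'\<in>Z. eval_at (antisymmetrize kap p) z' = (if z' = z then 1 else 0)"
    using orbit_representatives[OF bs(1,2), of P kap 0] unfolding lam_def by blast
  have cardE: "card E = card Z"
    unfolding E_def Z(3) using lam len bs(3) by (intro card_admissible) auto
  have fin: "finite E" unfolding E_def by (rule finite_admissible)
  have "spans_mod_top {P} kap (monl bs) sum_list E"
    unfolding spans_mod_top_def
  proof (intro allI impI)
    fix d f assume "homogeneous d (f :: ('n, complex) mpoly)"
    from antisym_spanning_coeffs[OF bs(1,2) lam this, of kap 0] obtain a where
      "antisymmetrize kap f - (\<Sum>es\<in>{es\<in>E. sum_list es = d}. cnst (a es) * antisymmetrize kap (monl bs es)) \<in> tanisaki_ideal lam"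
      unfolding E_def by blast
    thus "\<exists>a. antisymmetrize kap f - (\<Sum>es\<in>{es\<in>E. sum_list es = d}. cnst (a es) * antisymmetrize kap (monl bs es)) \<in> top_ideal (Sn_orbits {P})"
      using tanisaki_subset_top[of P] unfolding lam_def by blast
  qed
  moreover have "homogeneous (sum_list es) (monl bs es)" if "es \<in> E" for es
    using that unfolding E_def by (intro homogeneous_monl) (auto dest: admissible_length)
  ultimately show ?thesis
    using independent_mod_top[of E "{P}" kap "monl bs" sum_list Z c es] fin Z(1,2,4) cardE rel \<open>es \<in> E\<close> by simp
qed

section \<open>Graded characters of quotients of the polynomial ring\<close>

subsection \<open>Traces on quotients of the polynomial ring\<close>

definition lincomb :: "'i set \<Rightarrow> ('i \<Rightarrow> ('n::finite, complex) mpoly) \<Rightarrow> ('i \<Rightarrow> complex) \<Rightarrow> ('n, complex) mpoly" where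
  "lincomb E g c = (\<Sum>\<iota>\<in>E. cnst (c \<iota>) * g \<iota>)"

text \<open>Representatives in the polynomial ring of a basis of the image of W modulo J, as an
  indexed family; traces can then be computed without cosets.\<close>

definition quot_basis :: "('n::finite, complex) mpoly set \<Rightarrow> ('n, complex) mpoly set \<Rightarrow> 'i set \<Rightarrow> ('i \<Rightarrow> ('n, complex) mpoly) \<Rightarrow> bool" where
  "quot_basis J W E g \<longleftrightarrow> finite E \<and> g ` E \<subseteq> W \<and> (\<forall>f\<in>W. \<exists>c. f - lincomb E g c \<in> J) \<and>
    (\<forall>c. lincomb E g c \<in> J \<longrightarrow> (\<forall>\<iota>\<in>E. c \<iota> = 0))"

text \<open>Only the values on E are meaningful; \<open>quot_coeff_eqI\<close> determines
  them.\<close>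

definition quot_coeff :: "('n::finite, complex) mpoly set \<Rightarrow> 'i set \<Rightarrow> ('i \<Rightarrow> ('n, complex) mpoly) \<Rightarrow> ('n, complex) mpoly \<Rightarrow> 'i \<Rightarrow> complex" where
  "quot_coeff J E g f = (SOME c. f - lincomb E g c \<in> J)"

definition quot_trace :: "('n::finite, complex) mpoly set \<Rightarrow> 'i set \<Rightarrow> ('i \<Rightarrow> ('n, complex) mpoly) \<Rightarrow> (('n, complex) mpoly \<Rightarrow> ('n, complex) mpoly) \<Rightarrow> complex" where
  "quot_trace J E g T = (\<Sum>\<iota>\<in>E. quot_coeff J E g (T (g \<iota>)) \<iota>)"

lemma lincomb_add: "lincomb E g (\<lambda>\<iota>. a \<iota> + b \<iota>) = lincomb E g a + lincomb E g b"
  and lincomb_diff: "lincomb E g (\<lambda>\<iota>. a \<iota> - b \<iota>) = lincomb E g a - lincomb E g b"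
  and lincomb_scale: "lincomb E g (\<lambda>\<iota>. x * a \<iota>) = cnst x * lincomb E g a"
  and lincomb_0: "lincomb E g (\<lambda>_. 0) = 0"
  by (simp_all add: lincomb_def cnst_add cnst_diff cnst_mult distrib_right left_diff_distrib
      sum.distrib sum_subtractf sum_distrib_left mult.assoc)

lemma lincomb_sum: "lincomb E g (\<lambda>\<iota>. \<Sum>k\<in>A. x k * a k \<iota>) = (\<Sum>k\<in>A. cnst (x k) * lincomb E g (a k))"
  by (induction A rule: infinite_finite_induct) (simp_all add: lincomb_add lincomb_scale lincomb_0)

lemma lincomb_cong: "(\<And>\<iota>. \<iota> \<in> E \<Longrightarrow> a \<iota> = b \<iota>) \<Longrightarrow> lincomb E g a = lincomb E g b"
  unfolding lincomb_def by (intro sum.cong) auto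

context
  fixes J W :: "('n::finite, complex) mpoly set" and E :: "'i set" and g :: "'i \<Rightarrow> ('n, complex) mpoly"
  assumes J: "is_ideal J" and E: "quot_basis J W E g"
begin

lemma quot_coeff: "f \<in> W \<Longrightarrow> f - lincomb E g (quot_coeff J E g f) \<in> J"
  unfolding quot_coeff_def using E by (intro someI_ex[of "\<lambda>c. f - lincomb E g c \<in> J"]) (auto simp: quot_basis_def)

lemma quot_coeff_eqI:
  assumes "f - lincomb E g c \<in> J" "\<iota> \<in> E"
  shows "quot_coeff J E g f \<iota> = c \<iota>"
proof -
  have "f - lincomb E g (quot_coeff J E g f) \<in> J"
    unfolding quot_coeff_def by (rule someI[of "\<lambda>c. f - lincomb E g c \<in> J", OF assms(1)])
  with assms(1) have "(f - lincomb E g c) - (f - lincomb E g (quot_coeff J E g f)) \<in> J" by (rule is_ideal_diff[OF J])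
  hence "lincomb E g (\<lambda>\<iota>. quot_coeff J E g f \<iota> - c \<iota>) \<in> J" by (simp add: lincomb_diff)
  thus ?thesis using E assms(2) by (fastforce simp: quot_basis_def)
qed

lemma quot_trace_eqI:
  assumes "\<And>\<iota>. \<iota> \<in> E \<Longrightarrow> T (g \<iota>) - lincomb E g (M \<iota>) \<in> J"
  shows "quot_trace J E g T = (\<Sum>\<iota>\<in>E. M \<iota> \<iota>)"
  unfolding quot_trace_def using assms by (intro sum.cong refl quot_coeff_eqI)

lemma quot_trace_sum:
  assumes "\<And>\<sigma> \<iota>. \<sigma> \<in> S \<Longrightarrow> \<iota> \<in> E \<Longrightarrow> T \<sigma> (g \<iota>) \<in> W"
  shows "quot_trace J E g (\<lambda>f. \<Sum>\<sigma>\<in>S. cnst (a \<sigma>) * T \<sigma> f) = (\<Sum>\<sigma>\<in>S. a \<sigma> * quot_trace J E g (T \<sigma>))"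
proof -
  have "quot_trace J E g (\<lambda>f. \<Sum>\<sigma>\<in>S. cnst (a \<sigma>) * T \<sigma> f) = (\<Sum>\<iota>\<in>E. \<Sum>\<sigma>\<in>S. a \<sigma> * quot_coeff J E g (T \<sigma> (g \<iota>)) \<iota>)"
  proof (rule quot_trace_eqI[where M = "\<lambda>\<iota> \<kappa>. \<Sum>\<sigma>\<in>S. a \<sigma> * quot_coeff J E g (T \<sigma> (g \<iota>)) \<kappa>"])
    fix \<iota> assume "\<iota> \<in> E"
    hence "(\<Sum>\<sigma>\<in>S. cnst (a \<sigma>) * (T \<sigma> (g \<iota>) - lincomb E g (quot_coeff J E g (T \<sigma> (g \<iota>))))) \<in> J"
      using assms by (intro is_ideal_sum[OF J] is_ideal_mult[OF J] quot_coeff)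
    thus "(\<Sum>\<sigma>\<in>S. cnst (a \<sigma>) * T \<sigma> (g \<iota>)) - lincomb E g (\<lambda>\<kappa>. \<Sum>\<sigma>\<in>S. a \<sigma> * quot_coeff J E g (T \<sigma> (g \<iota>)) \<kappa>) \<in> J"
      by (simp add: lincomb_sum right_diff_distrib sum_subtractf)
  qed
  also have "\<dots> = (\<Sum>\<sigma>\<in>S. a \<sigma> * quot_trace J E g (T \<sigma>))"
    by (subst sum.swap) (simp add: quot_trace_def sum_distrib_left)
  finally show ?thesis .
qed

end

text \<open>The trace of \<open>T\<close> can be computed on any subspace containing its image: \<open>tr (A B) = tr (B A)\<close>.\<close>

lemma quot_trace_cyclic:
  assumes J: "is_ideal J" and E: "quot_basis J W E g" and G: "quot_basis J W' G h" "h ` G \<subseteq> W"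
    and T: "\<And>f f'. T (f + f') = T f + T f'" "\<And>c f. T (cnst c * f) = cnst c * T f" "\<And>f. f \<in> J \<Longrightarrow> T f \<in> J"
    and TW: "\<And>f. f \<in> W \<Longrightarrow> \<exists>c. T f - lincomb G h c \<in> J"
  shows "quot_trace J E g T = quot_trace J G h T"
proof -
  have T0: "T 0 = 0" using T(2)[of 0 0] by simp
  have Tdiff: "T (f - f') = T f - T f'" for f f'
    using T(1)[of f "cnst (- 1) * f'"] T(2)[of "- 1" f'] by (simp add: cnst_minus)
  have Tlin: "T (lincomb S k c) = (\<Sum>\<iota>\<in>S. cnst (c \<iota>) * T (k \<iota>))" for S c and k :: "'x \<Rightarrow> ('a, complex) mpoly"
    unfolding lincomb_def by (induction S rule: infinite_finite_induct) (simp_all add: T T0)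
  \<comment> \<open>A is the matrix of T from the first family to the second, B expresses the second
    family in the first; both traces are the sum of A \<iota> k B k \<iota> over all index
    pairs.\<close>
  define A where "A = (\<lambda>\<iota>. SOME c. T (g \<iota>) - lincomb G h c \<in> J)"
  define B where "B = (\<lambda>k. SOME c. h k - lincomb E g c \<in> J)"
  have A: "T (g \<iota>) - lincomb G h (A \<iota>) \<in> J" if "\<iota> \<in> E" for \<iota>
    unfolding A_def by (rule someI_ex[of "\<lambda>c. T (g \<iota>) - lincomb G h c \<in> J"]) (use TW E that in \<open>auto simp: quot_basis_def\<close>)
  have B: "h k - lincomb E g (B k) \<in> J" if "k \<in> G" for k
    unfolding B_def by (rule someI_ex[of "\<lambda>c. h k - lincomb E g c \<in> J"]) (use E G that in \<open>auto simp: quot_basis_def\<close>)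
  have "quot_trace J E g T = (\<Sum>\<iota>\<in>E. \<Sum>k\<in>G. A \<iota> k * B k \<iota>)"
  proof (rule quot_trace_eqI[OF J E, where M = "\<lambda>\<iota> \<iota>'. \<Sum>k\<in>G. A \<iota> k * B k \<iota>'"])
    fix \<iota> assume \<iota>: "\<iota> \<in> E"
    have "(T (g \<iota>) - lincomb G h (A \<iota>)) + (\<Sum>k\<in>G. cnst (A \<iota> k) * (h k - lincomb E g (B k))) \<in> J"
      using A[OF \<iota>] B by (intro is_ideal_add[OF J] is_ideal_sum[OF J] is_ideal_mult[OF J])
    moreover have "lincomb G h (A \<iota>) = (\<Sum>k\<in>G. cnst (A \<iota> k) * h k)" by (simp add: lincomb_def)
    ultimately show "T (g \<iota>) - lincomb E g (\<lambda>\<iota>'. \<Sum>k\<in>G. A \<iota> k * B k \<iota>') \<in> J"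
      by (simp add: lincomb_sum right_diff_distrib sum_subtractf)
  qed
  also have "\<dots> = (\<Sum>k\<in>G. \<Sum>\<iota>\<in>E. B k \<iota> * A \<iota> k)" by (subst sum.swap) (simp add: mult.commute)
  also have "\<dots> = quot_trace J G h T"
  proof (rule quot_trace_eqI[OF J G(1), where M = "\<lambda>k k'. \<Sum>\<iota>\<in>E. B k \<iota> * A \<iota> k'", symmetric])
    fix k assume k: "k \<in> G"
    have "T (h k - lincomb E g (B k)) + (\<Sum>\<iota>\<in>E. cnst (B k \<iota>) * (T (g \<iota>) - lincomb G h (A \<iota>))) \<in> J"
      using A B[OF k] by (intro is_ideal_add[OF J] is_ideal_sum[OF J] is_ideal_mult[OF J] T(3))
    thus "T (h k) - lincomb G h (\<lambda>k'. \<Sum>\<iota>\<in>E. B k \<iota> * A \<iota> k') \<in> J"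
      by (simp add: lincomb_sum right_diff_distrib sum_subtractf Tdiff Tlin)
  qed
  finally show ?thesis .
qed

subsection \<open>The quotient representation\<close>

definition coset :: "('n::finite, complex) mpoly set \<Rightarrow> ('n, complex) mpoly \<Rightarrow> ('n, complex) mpoly set" where
  "coset J f = J +>\<^bsub>poly_ring\<^esub> f"

context
  fixes J :: "('n::finite, complex) mpoly set"
  assumes J: "is_ideal J"
begin

interpretation pr: ideal J "poly_ring :: ('n, complex) mpoly ring"
  using J by (simp add: ideal_iff_is_ideal)

lemma coset_eq_image: "coset J f = (\<lambda>h. h + f) ` J"
  by (auto simp: coset_def a_r_coset_def')

lemma coset_eq_iff: "coset J f = coset J g \<longleftrightarrow> f - g \<in> J"
proof
  assume "coset J f = coset J g"
  moreover have "f \<in> coset J f" using is_ideal_0[OF J] by (force simp: coset_eq_image)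
  ultimately have "f \<in> coset J g" by simp
  then obtain h where "h \<in> J" "f = h + g" by (auto simp: coset_eq_image)
  thus "f - g \<in> J" by simp
next
  have sub: "coset J f \<subseteq> coset J g" if "f - g \<in> J" for f g
  proof
    fix x assume "x \<in> coset J f"
    then obtain h where h: "h \<in> J" "x = h + f" by (auto simp: coset_eq_image)
    have "x = (h + (f - g)) + g" using h by simp
    thus "x \<in> coset J g" using is_ideal_add[OF J h(1) that] unfolding coset_eq_image by blast
  qed
  assume fg: "f - g \<in> J"
  hence "g - f \<in> J" using is_ideal_minus[OF J, of "f - g"] by simp
  thus "coset J f = coset J g" using sub[OF fg] sub by blast
qed

lemma quotient_rep_simps:
  "carrier (quotient_rep J) = range (coset J)"
  "zero (quotient_rep J) = coset J 0"
  "add (quotient_rep J) (coset J f) (coset J g) = coset J (f + g)"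
  "smult (quotient_rep J) c (coset J f) = coset J (cnst c * f)"
  "grade (quotient_rep J) d = {coset J f | f. homogeneous d f}"
proof -
  show "carrier (quotient_rep J) = range (coset J)"
    by (auto simp: quotient_rep_def Let_def FactRing_def A_RCOSETS_def' coset_def)
  show "zero (quotient_rep J) = coset J 0"
    by (auto simp: quotient_rep_def Let_def FactRing_def coset_eq_image)
  show "add (quotient_rep J) (coset J f) (coset J g) = coset J (f + g)"
    using pr.a_rcos_sum[of f g] by (simp add: quotient_rep_def Let_def FactRing_def coset_def)
  show "smult (quotient_rep J) c (coset J f) = coset J (cnst c * f)"
    using pr.rcoset_mult_add[of "cnst c" f] by (simp add: quotient_rep_def Let_def FactRing_def coset_def)
  show "grade (quotient_rep J) d = {coset J f | f. homogeneous d f}"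
    by (simp add: quotient_rep_def Let_def coset_def)
qed

lemma comm_group_quotient_rep: "comm_group (add_monoid (quotient_rep J))"
proof (rule comm_groupI)
  fix x assume "x \<in> carrier (add_monoid (quotient_rep J))"
  then obtain f where "x = coset J f" by (auto simp: quotient_rep_simps)
  thus "\<exists>y\<in>carrier (add_monoid (quotient_rep J)). y \<otimes>\<^bsub>add_monoid (quotient_rep J)\<^esub> x = \<one>\<^bsub>add_monoid (quotient_rep J)\<^esub>"
    by (intro bexI[of _ "coset J (- f)"]) (auto simp: quotient_rep_simps)
qed (auto simp: quotient_rep_simps add_ac)

lemma abelian_monoid_quotient_rep: "abelian_monoid (quotient_rep J)"
  using comm_group_quotient_rep by (intro abelian_monoid.intro) (rule comm_group.axioms(1))

lemma finsum_quotient_rep: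
  assumes "finite B"
  shows "(\<Oplus>\<^bsub>quotient_rep J\<^esub>b\<in>B. c b \<odot>\<^bsub>quotient_rep J\<^esub> coset J (r b)) = coset J (lincomb B r c)"
  using assms
proof induction
  case empty
  thus ?case
    by (simp add: abelian_monoid.finsum_empty[OF abelian_monoid_quotient_rep] quotient_rep_simps lincomb_def)
next
  case (insert b B)
  have "(\<Oplus>\<^bsub>quotient_rep J\<^esub>b\<in>insert b B. c b \<odot>\<^bsub>quotient_rep J\<^esub> coset J (r b))
      = (c b \<odot>\<^bsub>quotient_rep J\<^esub> coset J (r b)) \<oplus>\<^bsub>quotient_rep J\<^esub> (\<Oplus>\<^bsub>quotient_rep J\<^esub>b\<in>B. c b \<odot>\<^bsub>quotient_rep J\<^esub> coset J (r b))"
    by (rule abelian_monoid.finsum_insert[OF abelian_monoid_quotient_rep])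
       (use insert in \<open>auto simp: quotient_rep_simps\<close>)
  thus ?case using insert by (simp add: quotient_rep_simps lincomb_def)
qed

lemma finsum_basis:
  assumes "finite B" "\<And>b. b \<in> B \<Longrightarrow> coset J (r b) = b"
  shows "(\<Oplus>\<^bsub>quotient_rep J\<^esub>b\<in>B. c b \<odot>\<^bsub>quotient_rep J\<^esub> b) = coset J (lincomb B r c)"
proof -
  have "(\<Oplus>\<^bsub>quotient_rep J\<^esub>b\<in>B. c b \<odot>\<^bsub>quotient_rep J\<^esub> b) = (\<Oplus>\<^bsub>quotient_rep J\<^esub>b\<in>B. c b \<odot>\<^bsub>quotient_rep J\<^esub> coset J (r b))"
    by (rule abelian_monoid.finsum_cong'[OF abelian_monoid_quotient_rep])
       (use assms(2) in \<open>auto simp: quotient_rep_simps Pi_def\<close>)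
  thus ?thesis using finsum_quotient_rep[OF assms(1)] by simp
qed

text \<open>Uniqueness of extensional coefficient functions is equivalent to independence: compare
  the coefficients of 0 with the zero function.\<close>

lemma is_basis_iff:
  assumes "finite B" and r: "\<And>b. b \<in> B \<Longrightarrow> coset J (r b) = b" "\<And>b. b \<in> B \<Longrightarrow> homogeneous d (r b)"
  shows "is_basis (quotient_rep J) (grade (quotient_rep J) d) B \<longleftrightarrow> quot_basis J {f. homogeneous d f} B r"
proof -
  let ?V = "quotient_rep J"
  have ex: "is_basis ?V (grade ?V d) B \<longleftrightarrow> (\<forall>f. homogeneous d f \<longrightarrow> (\<exists>!c. c \<in> B \<rightarrow>\<^sub>E UNIV \<and> f - lincomb B r c \<in> J))"
  proof -
    have "B \<subseteq> grade ?V d" using r by (force simp: quotient_rep_simps)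
    moreover have fb: "(\<Oplus>\<^bsub>?V\<^esub>b\<in>B. c b \<odot>\<^bsub>?V\<^esub> b) = coset J (lincomb B r c)" for c
      by (rule finsum_basis) (use assms(1) r(1) in auto)
    have "(\<forall>v\<in>grade ?V d. Q v) \<longleftrightarrow> (\<forall>f. homogeneous d f \<longrightarrow> Q (coset J f))" for Q
      unfolding quotient_rep_simps by blast
    ultimately show ?thesis unfolding is_basis_def fb by (simp only: assms(1) coset_eq_iff simp_thms)
  qed
  show ?thesis
  proof
    assume L: "is_basis ?V (grade ?V d) B"
    have "c b = 0" if "lincomb B r c \<in> J" "b \<in> B" for c b
    proof -
      have "\<exists>!c. c \<in> B \<rightarrow>\<^sub>E UNIV \<and> 0 - lincomb B r c \<in> J" by (rule L[unfolded ex, rule_format, OF homogeneous_0])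
      moreover have "0 - lincomb B r (restrict c B) \<in> J"
        using that is_ideal_minus[OF J] lincomb_cong[of B "restrict c B" c r] by simp
      moreover have "0 - lincomb B r (restrict (\<lambda>_. 0) B) \<in> J"
        using is_ideal_0[OF J] lincomb_cong[of B "restrict (\<lambda>_. 0) B" "\<lambda>_. 0" r] by (simp add: lincomb_0)
      moreover have "restrict c B \<in> B \<rightarrow>\<^sub>E UNIV" "restrict (\<lambda>_. 0) B \<in> B \<rightarrow>\<^sub>E (UNIV :: complex set)" by auto
      ultimately have "restrict c B = restrict (\<lambda>_. 0) B" by blast
      thus ?thesis using that(2) by (metis restrict_apply')
    qed
    moreover have "\<exists>c. f - lincomb B r c \<in> J" if "homogeneous d f" for f
      using L[unfolded ex, rule_format, OF that] by blast
    moreover have "r ` B \<subseteq> {f. homogeneous d f}" using r(2) by auto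
    ultimately show "quot_basis J {f. homogeneous d f} B r" using assms(1) unfolding quot_basis_def by simp
  next
    assume R: "quot_basis J {f. homogeneous d f} B r"
    show "is_basis ?V (grade ?V d) B"
      unfolding ex
    proof (intro allI impI)
      fix f :: "('n, complex) mpoly" assume f: "homogeneous d f"
      then obtain c where c: "f - lincomb B r c \<in> J" using R by (auto simp: quot_basis_def)
      show "\<exists>!c. c \<in> B \<rightarrow>\<^sub>E UNIV \<and> f - lincomb B r c \<in> J"
      proof (rule ex1I[of _ "restrict c B"])
        show "restrict c B \<in> B \<rightarrow>\<^sub>E UNIV \<and> f - lincomb B r (restrict c B) \<in> J"
          using c lincomb_cong[of B "restrict c B" c r] by simp
        fix c' assume c': "c' \<in> B \<rightarrow>\<^sub>E UNIV \<and> f - lincomb B r c' \<in> J"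
        have "c' b = c b" if "b \<in> B" for b
          using quot_coeff_eqI[OF J R _ that, of f c'] quot_coeff_eqI[OF J R c that] c' by simp
        thus "c' = restrict c B" using c' by (auto simp: fun_eq_iff PiE_def extensional_def)
      qed
    qed
  qed
qed

lemma coords_eq:
  assumes B: "finite B" and r: "\<And>b. b \<in> B \<Longrightarrow> coset J (r b) = b" "\<And>b. b \<in> B \<Longrightarrow> homogeneous d (r b)"
    and R: "quot_basis J {f. homogeneous d f} B r" and f: "homogeneous d f" and b: "b \<in> B"
  shows "coords (quotient_rep J) B (coset J f) b = quot_coeff J B r f b"
proof -
  have "\<exists>!c. c \<in> B \<rightarrow>\<^sub>E UNIV \<and> coset J f = (\<Oplus>\<^bsub>quotient_rep J\<^esub>b\<in>B. c b \<odot>\<^bsub>quotient_rep J\<^esub> b)"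
  proof -
    have "is_basis (quotient_rep J) (grade (quotient_rep J) d) B" using is_basis_iff[OF B r] R by simp
    moreover have "coset J f \<in> grade (quotient_rep J) d" using f by (auto simp: quotient_rep_simps)
    ultimately show ?thesis unfolding is_basis_def by blast
  qed
  from theI'[OF this] have "coset J f = (\<Oplus>\<^bsub>quotient_rep J\<^esub>b\<in>B. coords (quotient_rep J) B (coset J f) b \<odot>\<^bsub>quotient_rep J\<^esub> b)"
    unfolding coords_def by (rule conjunct2)
  also have "\<dots> = coset J (lincomb B r (coords (quotient_rep J) B (coset J f)))"
    by (rule finsum_basis) (use B r(1) in auto)
  finally have "f - lincomb B r (coords (quotient_rep J) B (coset J f)) \<in> J" by (simp only: coset_eq_iff)
  from quot_coeff_eqI[OF J R this b] show ?thesis by simp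
qed

context
  assumes stable: "\<And>\<pi> f. \<pi> permutes UNIV \<Longrightarrow> f \<in> J \<Longrightarrow> perm_poly \<pi> f \<in> J"
begin

lemma act_quotient_rep:
  assumes "\<pi> permutes UNIV"
  shows "act (quotient_rep J) \<pi> (coset J f) = coset J (perm_poly \<pi> f)"
proof -
  have "perm_poly \<pi> ` J = J"
  proof
    show "J \<subseteq> perm_poly \<pi> ` J"
    proof
      fix f assume "f \<in> J"
      hence "perm_poly (inv_into UNIV \<pi>) f \<in> J" using assms by (intro stable permutes_inv)
      thus "f \<in> perm_poly \<pi> ` J" using perm_poly_inv(1)[OF assms, of f] by (metis imageI)
    qed
  qed (use assms stable in auto)
  hence "perm_poly \<pi> ` coset J f = coset J (perm_poly \<pi> f)"
    unfolding coset_eq_image image_image perm_poly_add by (metis (no_types, lifting) image_cong image_image)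
  thus ?thesis by (simp add: quotient_rep_def Let_def)
qed

text \<open>\<open>trace_on\<close> picks a basis by choice. The cosets of g show that one exists,
  and \<open>quot_trace_cyclic\<close> with the same space on both sides gives independence of the
  basis.\<close>

lemma trace_on_eq_quot_trace:
  assumes E: "quot_basis J {f. homogeneous d f} E g" and \<pi>: "\<pi> permutes UNIV"
  shows "trace_on (quotient_rep J) (grade (quotient_rep J) d) (act (quotient_rep J) \<pi>) = quot_trace J E g (perm_poly \<pi>)"
proof -
  let ?V = "quotient_rep J" and ?W = "{f :: ('n, complex) mpoly. homogeneous d f}"
  define B0 where "B0 = (\<lambda>\<iota>. coset J (g \<iota>)) ` E"
  have inj: "inj_on (\<lambda>\<iota>. coset J (g \<iota>)) E"
  proof (rule inj_onI, rule ccontr)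
    fix \<iota> \<kappa> assume *: "\<iota> \<in> E" "\<kappa> \<in> E" "coset J (g \<iota>) = coset J (g \<kappa>)" "\<iota> \<noteq> \<kappa>"
    let ?c = "\<lambda>x. (if x = \<iota> then 1 else 0) - (if x = \<kappa> then 1 else (0::complex))"
    have sel: "lincomb E g (\<lambda>x. if x = y then 1 else 0) = g y" if "y \<in> E" for y
    proof -
      have "lincomb E g (\<lambda>x. if x = y then 1 else 0) = (\<Sum>x\<in>E. if x = y then g y else 0)"
        unfolding lincomb_def by (intro sum.cong) auto
      thus ?thesis using that E by (simp add: quot_basis_def)
    qed
    have "lincomb E g ?c = g \<iota> - g \<kappa>" unfolding lincomb_diff using sel * by simp
    hence "lincomb E g ?c \<in> J" using * by (simp add: coset_eq_iff)
    hence "?c \<iota> = 0" using E *(1) unfolding quot_basis_def by blast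
    thus False using *(4) by simp
  qed
  have "is_basis ?V (grade ?V d) B0"
  proof (subst is_basis_iff)
    let ?r = "\<lambda>b. g (the_inv_into E (\<lambda>\<iota>. coset J (g \<iota>)) b)"
    have r: "?r (coset J (g \<iota>)) = g \<iota>" if "\<iota> \<in> E" for \<iota> using the_inv_into_f_f[OF inj that] by simp
    show "finite B0" using E by (simp add: B0_def quot_basis_def)
    show "coset J (?r b) = b" "homogeneous d (?r b)" if "b \<in> B0" for b
      using that r E by (auto simp: B0_def quot_basis_def)
    have lin: "lincomb B0 ?r c = lincomb E g (\<lambda>\<iota>. c (coset J (g \<iota>)))" for c
      unfolding lincomb_def B0_def by (subst sum.reindex[OF inj]) (intro sum.cong, auto simp: r)
    show "quot_basis J ?W B0 ?r"
      unfolding quot_basis_def lin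
    proof (intro conjI ballI allI impI)
      show "finite B0" using E by (simp add: B0_def quot_basis_def)
      show "?r ` B0 \<subseteq> ?W" using r E by (auto simp: B0_def quot_basis_def)
    next
      fix f assume "f \<in> ?W"
      then obtain c where c: "f - lincomb E g c \<in> J" using E by (auto simp: quot_basis_def)
      have "lincomb E g (\<lambda>\<iota>. c (the_inv_into E (\<lambda>\<iota>. coset J (g \<iota>)) (coset J (g \<iota>)))) = lincomb E g c"
        by (intro lincomb_cong) (simp add: the_inv_into_f_f[OF inj])
      thus "\<exists>c. f - lincomb E g (\<lambda>\<iota>. c (coset J (g \<iota>))) \<in> J"
        using c by (intro exI[of _ "\<lambda>b. c (the_inv_into E (\<lambda>\<iota>. coset J (g \<iota>)) b)"]) simp
    next
      fix c b assume c: "lincomb E g (\<lambda>\<iota>. c (coset J (g \<iota>))) \<in> J" and "b \<in> B0"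
      then obtain \<iota> where "\<iota> \<in> E" "b = coset J (g \<iota>)" by (auto simp: B0_def)
      moreover have "\<forall>\<iota>\<in>E. c (coset J (g \<iota>)) = 0" using E c unfolding quot_basis_def by blast
      ultimately show "c b = 0" by simp
    qed
  qed
  define B where "B = (SOME B. is_basis ?V (grade ?V d) B)"
  have B: "is_basis ?V (grade ?V d) B" unfolding B_def using \<open>is_basis ?V (grade ?V d) B0\<close> by (rule someI)
  have finB: "finite B" and "B \<subseteq> grade ?V d" using B by (auto simp: is_basis_def)
  hence "\<forall>b\<in>B. \<exists>f. coset J f = b \<and> homogeneous d f" by (auto simp: quotient_rep_simps)
  then obtain r where r: "\<And>b. b \<in> B \<Longrightarrow> coset J (r b) = b" "\<And>b. b \<in> B \<Longrightarrow> homogeneous d (r b)" by metis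
  have R: "quot_basis J ?W B r" using is_basis_iff[OF finB r] B by simp
  have "trace_on ?V (grade ?V d) (act ?V \<pi>) = (\<Sum>b\<in>B. coords ?V B (act ?V \<pi> b) b)"
    by (simp add: trace_on_def Let_def B_def)
  also have "\<dots> = (\<Sum>b\<in>B. quot_coeff J B r (perm_poly \<pi> (r b)) b)"
  proof (intro sum.cong refl)
    fix b assume b: "b \<in> B"
    have "act ?V \<pi> b = coset J (perm_poly \<pi> (r b))" using act_quotient_rep[OF \<pi>, of "r b"] r(1)[OF b] by simp
    thus "coords ?V B (act ?V \<pi> b) b = quot_coeff J B r (perm_poly \<pi> (r b)) b"
      using coords_eq[OF finB r R homogeneous_perm_poly[OF r(2)[OF b]] b] by simp
  qed
  also have "\<dots> = quot_trace J B r (perm_poly \<pi>)" by (simp add: quot_trace_def)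
  also have "\<dots> = quot_trace J E g (perm_poly \<pi>)"
  proof (rule quot_trace_cyclic[OF J R E])
    fix f assume "f \<in> ?W"
    hence "perm_poly \<pi> f \<in> ?W" by (simp add: homogeneous_perm_poly)
    thus "\<exists>c. perm_poly \<pi> f - lincomb E g c \<in> J" using E by (auto simp: quot_basis_def)
  qed (use E \<pi> stable in \<open>auto simp: quot_basis_def perm_poly_add perm_poly_mult\<close>)
  finally show ?thesis .
qed

text \<open>The signed sum is the trace of the antisymmetrizer. Computed on its own image, where it
  acts as the order of the Young subgroup, this trace counts the basis of the antisymmetric
  part.\<close>

lemma sum_sign_quot_trace:
  assumes E: "quot_basis J {f. homogeneous d f} E g"
    and G: "quot_basis J (antisymmetrize kap ` {f. homogeneous d f}) G h"
  shows "(\<Sum>\<sigma>\<in>color_perms kap. of_int (sign \<sigma>) * quot_trace J E g (perm_poly \<sigma>)) = of_nat (card (color_perms kap) * card G)"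
proof -
  let ?W = "{f :: ('n, complex) mpoly. homogeneous d f}"
  let ?k = "of_nat (card (color_perms kap)) :: complex"
  have "(\<Sum>\<sigma>\<in>color_perms kap. of_int (sign \<sigma>) * quot_trace J E g (perm_poly \<sigma>)) = quot_trace J E g (antisymmetrize kap)"
    unfolding antisymmetrize_def[abs_def] using E
    by (intro quot_trace_sum[OF J E, symmetric]) (auto simp: quot_basis_def intro: homogeneous_perm_poly)
  also have "\<dots> = quot_trace J G h (antisymmetrize kap)"
  proof (rule quot_trace_cyclic[OF J E G])
    have "h ` G \<subseteq> antisymmetrize kap ` ?W" using G by (simp add: quot_basis_def)
    moreover have "antisymmetrize kap ` ?W \<subseteq> ?W" by (auto intro: homogeneous_antisym)
    ultimately show "h ` G \<subseteq> ?W" by (rule subset_trans)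
    show "\<exists>c. antisymmetrize kap f - lincomb G h c \<in> J" if "f \<in> ?W" for f
      using G that by (auto simp: quot_basis_def)
  qed (auto simp: antisym_add antisym_cnst_mult intro: antisym_mem[OF J stable])
  also have "\<dots> = (\<Sum>\<kappa>\<in>G. ?k * (if \<kappa> = \<kappa> then 1 else 0))"
  proof (rule quot_trace_eqI[OF J G, where M = "\<lambda>\<kappa> x. ?k * (if x = \<kappa> then 1 else 0)"])
    fix \<kappa> assume \<kappa>: "\<kappa> \<in> G"
    then obtain f where "h \<kappa> = antisymmetrize kap f" using G by (auto simp: quot_basis_def)
    hence "antisymmetrize kap (h \<kappa>) = cnst ?k * h \<kappa>" by (simp add: antisym_antisym)
    moreover have "lincomb G h (\<lambda>x. ?k * (if x = \<kappa> then 1 else 0)) = (\<Sum>x\<in>G. if x = \<kappa> then cnst ?k * h \<kappa> else 0)"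
      unfolding lincomb_def by (intro sum.cong) auto
    hence "lincomb G h (\<lambda>x. ?k * (if x = \<kappa> then 1 else 0)) = cnst ?k * h \<kappa>"
      using \<kappa> G by (simp add: quot_basis_def)
    ultimately show "antisymmetrize kap (h \<kappa>) - lincomb G h (\<lambda>x. ?k * (if x = \<kappa> then 1 else 0)) \<in> J"
      by (simp add: is_ideal_0[OF J])
  qed
  finally show ?thesis by simp
qed

text \<open>The factor n! clears the denominators of \<open>frob\<close>. Components that
  \<open>frob_q\<close> omits have an empty basis and would contribute 0, so the sum may run over
  all degrees up to D.\<close>

lemma frob_q_quotient_rep:
  assumes E: "\<And>d. quot_basis J {f. homogeneous d f} (E d) (g d)" and D: "\<And>d. d > D \<Longrightarrow> E d = {}"
  shows "of_nat (fact CARD('n)) * frob_q N (quotient_rep J)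
    = (\<Sum>\<pi> | \<pi> permutes (UNIV :: 'n set). cnst (\<Sum>d\<le>D. fls_X ^ d * fls_const (quot_trace J (E d) (g d) (perm_poly \<pi>)))
        * (\<Prod>C\<in>range (orbit \<pi>). power_sum N (card C)))"
proof -
  let ?V = "quotient_rep J"
  let ?p = "\<lambda>\<pi>. \<Prod>C\<in>range (orbit \<pi>). power_sum N (card C)"
  have zero: "frob N ?V d = 0" "E d = {}" if "grade ?V d = {\<zero>\<^bsub>?V\<^esub>}" for d
  proof -
    have "coset J f = coset J 0" if "homogeneous d f" for f
      using \<open>grade ?V d = {\<zero>\<^bsub>?V\<^esub>}\<close> that unfolding quotient_rep_simps by blast
    hence mem: "f \<in> J" if "homogeneous d f" for f using that by (simp add: coset_eq_iff)
    show "E d = {}"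
    proof (rule ccontr)
      assume "E d \<noteq> {}"
      then obtain \<iota> where \<iota>: "\<iota> \<in> E d" by blast
      have "lincomb (E d) (g d) (\<lambda>_. 1) \<in> J"
        unfolding lincomb_def using E[of d] mem by (intro is_ideal_sum[OF J] is_ideal_mult[OF J]) (auto simp: quot_basis_def)
      hence "(1::complex) = 0" using E[of d] \<iota> unfolding quot_basis_def by fast
      thus False by simp
    qed
    thus "frob N ?V d = 0"
      unfolding frob_def by (intro sum.neutral) (simp add: trace_on_eq_quot_trace[OF E] quot_trace_def)
  qed
  have "frob_q N ?V = (\<Sum>d\<le>D. cnst (fls_X ^ d) * frob N ?V d)"
    unfolding frob_q_def
  proof (rule sum.mono_neutral_left)
    show "{d. grade ?V d \<noteq> {\<zero>\<^bsub>?V\<^esub>}} \<subseteq> {..D}"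
    proof
      fix d assume d: "d \<in> {d. grade ?V d \<noteq> {\<zero>\<^bsub>?V\<^esub>}}"
      show "d \<in> {..D}"
      proof (rule ccontr)
        assume "d \<notin> {..D}"
        hence "E d = {}" using D by simp
        hence "f \<in> J" if "homogeneous d f" for f using E[of d] that by (auto simp: quot_basis_def lincomb_def)
        hence "coset J f = coset J 0" if "homogeneous d f" for f using that by (simp add: coset_eq_iff)
        hence "grade ?V d = {coset J 0}" unfolding quotient_rep_simps using homogeneous_0 by blast
        thus False using d by (simp add: quotient_rep_simps)
      qed
    qed
  qed (use zero in auto)
  hence "of_nat (fact CARD('n)) * frob_q N ?V = (\<Sum>d\<le>D. \<Sum>\<pi> | \<pi> permutes (UNIV :: 'n set).
      cnst (of_nat (fact CARD('n)) * (fls_X ^ d * fls_const (trace_on ?V (grade ?V d) (act ?V \<pi>) / fact CARD('n)))) * ?p \<pi>)"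
    by (simp add: frob_def sum_distrib_left of_nat_eq_cnst cnst_mult mult.assoc)
  also have "\<dots> = (\<Sum>d\<le>D. \<Sum>\<pi> | \<pi> permutes (UNIV :: 'n set). cnst (fls_X ^ d * fls_const (quot_trace J (E d) (g d) (perm_poly \<pi>))) * ?p \<pi>)"
  proof (intro sum.cong refl)
    fix d and \<pi> :: "'n \<Rightarrow> 'n" assume "\<pi> \<in> {\<pi>. \<pi> permutes UNIV}"
    hence tr: "trace_on ?V (grade ?V d) (act ?V \<pi>) = quot_trace J (E d) (g d) (perm_poly \<pi>)"
      by (simp add: trace_on_eq_quot_trace[OF E])
    have "of_nat (fact CARD('n)) * (fls_X ^ d * fls_const (x / fact CARD('n))) = fls_X ^ d * (fls_const x :: complex fls)" for x
    proof -
      have "(of_nat (fact CARD('n)) :: complex fls) * fls_const (x / fact CARD('n)) = fls_const (of_nat (fact CARD('n)) * (x / fact CARD('n)))"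
        by (simp only: fls_of_nat fls_const_mult_const)
      also have "\<dots> = fls_const x" by simp
      finally show ?thesis by (simp only: mult.left_commute)
    qed
    thus "cnst (of_nat (fact CARD('n)) * (fls_X ^ d * fls_const (trace_on ?V (grade ?V d) (act ?V \<pi>) / fact CARD('n)))) * ?p \<pi>
      = cnst (fls_X ^ d * fls_const (quot_trace J (E d) (g d) (perm_poly \<pi>))) * ?p \<pi>" by (simp only: tr)
  qed
  also have "\<dots> = (\<Sum>\<pi> | \<pi> permutes (UNIV :: 'n set). cnst (\<Sum>d\<le>D. fls_X ^ d * fls_const (quot_trace J (E d) (g d) (perm_poly \<pi>))) * ?p \<pi>)"
    by (subst sum.swap) (simp add: cnst_sum sum_distrib_right)
  finally show ?thesis .
qed

end

end

subsection \<open>The Frobenius characteristic of the Springer fibre ring\<close>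

definition standard_exps :: "complex ^ 'n::finite \<Rightarrow> ('n \<Rightarrow> nat) \<Rightarrow> 'n list \<Rightarrow> nat list set" where
  "standard_exps P kap bs = {es. admissible kap (coord_partition P) 0 (length (coord_partition P)) bs es}"

lemma finite_standard_exps [simp]: "finite (standard_exps P kap bs)"
  unfolding standard_exps_def by (rule finite_admissible)

lemma homogeneous_monl_standard: "es \<in> standard_exps P kap bs \<Longrightarrow> homogeneous (sum_list es) (monl bs es)"
  unfolding standard_exps_def by (intro homogeneous_monl) (auto dest: admissible_length)

lemma sum_list_standard:
  assumes "es \<in> standard_exps P kap bs"
  shows "sum_list es \<le> length bs * length (coord_partition P)"
proof -
  have "sum_list es \<le> length bs * length lam" if "admissible kap lam c b bs es" for lam c b
    using that by (induction kap lam c b bs es rule: admissible.induct) auto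
  thus ?thesis using assms by (simp add: standard_exps_def)
qed

text \<open>Through this, the results on antisymmetric parts specialize to ordinary bases of the
  whole quotient.\<close>

lemma antisymmetrize_inj:
  assumes "inj kap"
  shows "antisymmetrize kap f = f"
proof -
  have "color_perms kap = {id}"
    using assms color_perms_id[of kap] by (auto simp: color_perms_def fun_eq_iff inj_def)
  thus ?thesis by (simp add: antisymmetrize_def sign_id)
qed

lemma quot_basis_tanisaki:
  fixes P :: "complex ^ 'n::finite" and bs :: "'n list" and kap :: "'n \<Rightarrow> nat"
  assumes bs: "distinct bs" "set bs = UNIV" "sorted (map kap bs)"
  shows "quot_basis (tanisaki_ideal (coord_partition P)) (antisymmetrize kap ` {f. homogeneous d f})
    {es \<in> standard_exps P kap bs. sum_list es = d} (\<lambda>es. antisymmetrize kap (monl bs es))"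
  unfolding quot_basis_def
proof (intro conjI allI impI ballI)
  let ?E = "standard_exps P kap bs"
  let ?Ed = "{es \<in> ?E. sum_list es = d}" and ?g = "\<lambda>es. antisymmetrize kap (monl bs es)"
  show "?g ` ?Ed \<subseteq> antisymmetrize kap ` {f. homogeneous d f}" using homogeneous_monl_standard[where P = P and kap = kap and bs = bs] by (auto intro!: imageI)
  show "\<exists>c. f - lincomb ?Ed ?g c \<in> tanisaki_ideal (coord_partition P)" if f: "f \<in> antisymmetrize kap ` {f. homogeneous d f}" for f
    using f antisym_spanning_coeffs[OF bs(1,2) desc_coord_partition[of P] sum_coord_partition[of P],
        where kap = kap and c = 0 and d = d]
    by (auto simp: lincomb_def standard_exps_def)
  fix c es assume c: "lincomb ?Ed ?g c \<in> tanisaki_ideal (coord_partition P)" and es: "es \<in> ?Ed"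
  let ?c = "\<lambda>es. if sum_list es = d then c es else 0"
  have "(\<Sum>es\<in>?E. cnst (?c es) * ?g es) = lincomb ?Ed ?g c"
    unfolding lincomb_def by (rule sum.mono_neutral_cong_right) auto
  hence "(\<Sum>es\<in>?E. cnst (?c es) * ?g es) \<in> top_ideal (Sn_orbits {P})"
    using c tanisaki_subset_top[of P] by auto
  from admissible_independent[OF bs, of ?c P es, folded standard_exps_def, OF this] es show "c es = 0" by simp
qed simp

lemma ex_coloring:
  obtains kap :: "'n::finite \<Rightarrow> nat" and bs where "inj kap" "distinct bs" "set bs = UNIV" "sorted (map kap bs)"
proof -
  obtain kap :: "'n \<Rightarrow> nat" where kap: "inj kap" using finite_imp_inj_to_nat_seg[of "UNIV :: 'n set"] by auto
  obtain ys :: "'n list" where ys: "distinct ys" "set ys = UNIV" using finite_distinct_list[of "UNIV :: 'n set"] by auto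
  show ?thesis using that[OF kap, of "sort_key kap ys"] ys by simp
qed

context
  fixes kap0 :: "'n::finite \<Rightarrow> nat" and bs0 :: "'n list"
  assumes kap0: "inj kap0" and bs0: "distinct bs0" "set bs0 = UNIV" "sorted (map kap0 bs0)"
begin

definition std :: "complex ^ 'n \<Rightarrow> nat \<Rightarrow> nat list set" where
  "std P d = {es \<in> standard_exps P kap0 bs0. sum_list es = d}"

lemma finite_std [simp]: "finite (std P d)"
  by (simp add: std_def)

lemma quot_basis_std: "quot_basis (tanisaki_ideal (coord_partition P)) {f. homogeneous d f} (std P d) (monl bs0)"
  using quot_basis_tanisaki[OF bs0, of P d] by (simp add: antisymmetrize_inj[OF kap0] std_def)

definition character :: "complex ^ 'n \<Rightarrow> nat \<Rightarrow> ('n \<Rightarrow> 'n) \<Rightarrow> complex" where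
  "character P d \<pi> = quot_trace (tanisaki_ideal (coord_partition P)) (std P d) (monl bs0) (perm_poly \<pi>)"

lemma std_empty: "d > CARD('n) * length (coord_partition P) \<Longrightarrow> std P d = {}"
  using sum_list_standard[of _ P kap0 bs0] distinct_card[OF bs0(1)] bs0(2) by (force simp: std_def)

text \<open>In each degree the signed sum is the subgroup order times the number of standard
  exponent lists of that degree, and D bounds all degrees that occur.\<close>

lemma sum_sign_character:
  fixes kap :: "'n \<Rightarrow> nat"
  assumes bs: "distinct bs" "set bs = UNIV" "sorted (map kap bs)"
    and D: "D \<ge> CARD('n) * length (coord_partition P)"
  shows "(\<Sum>\<sigma>\<in>color_perms kap. of_int (sign \<sigma>) * (\<Sum>d\<le>D. fls_X ^ d * fls_const (character P d \<sigma>)))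
    = of_nat (card (color_perms kap)) * (\<Sum>es\<in>standard_exps P kap bs. fls_X ^ sum_list es :: complex fls)"
proof -
  let ?E = "standard_exps P kap bs" and ?m = "card (color_perms kap)"
  have pair: "(\<Sum>\<sigma>\<in>color_perms kap. of_int (sign \<sigma>) * character P d \<sigma>) = of_nat (?m * card {es\<in>?E. sum_list es = d})" for d
    unfolding character_def
    by (rule sum_sign_quot_trace[OF is_ideal_tanisaki perm_stable_tanisaki quot_basis_std quot_basis_tanisaki[OF bs]])
  have "(\<Sum>\<sigma>\<in>color_perms kap. of_int (sign \<sigma>) * (\<Sum>d\<le>D. fls_X ^ d * fls_const (character P d \<sigma>)))
      = (\<Sum>d\<le>D. fls_X ^ d * (\<Sum>\<sigma>\<in>color_perms kap. of_int (sign \<sigma>) * fls_const (character P d \<sigma>)))"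
    unfolding sum_distrib_left by (subst sum.swap) (simp add: mult.left_commute)
  also have "\<dots> = (\<Sum>d\<le>D. fls_X ^ d * fls_const (\<Sum>\<sigma>\<in>color_perms kap. of_int (sign \<sigma>) * character P d \<sigma>))"
  proof -
    have const_sum: "fls_const (sum u A) = (\<Sum>x\<in>A. fls_const (u x))" for u :: "('n \<Rightarrow> 'n) \<Rightarrow> complex" and A
      by (induction A rule: infinite_finite_induct) (simp_all add: fls_plus_const[symmetric])
    have "of_int k * fls_const x = fls_const (of_int k * x)" for k and x :: complex
      by (simp add: fls_of_int fls_const_mult_const)
    thus ?thesis by (simp add: const_sum)
  qed
  also have "\<dots> = of_nat ?m * (\<Sum>d\<le>D. fls_X ^ d * of_nat (card {es\<in>?E. sum_list es = d}))"
    unfolding pair fls_of_nat[symmetric] by (simp add: sum_distrib_left mult_ac)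
  also have "(\<Sum>d\<le>D. fls_X ^ d * of_nat (card {es\<in>?E. sum_list es = d})) = (\<Sum>d\<le>D. \<Sum>es\<in>{es\<in>?E. sum_list es = d}. fls_X ^ sum_list es :: complex fls)"
    by (intro sum.cong refl) (simp add: mult.commute)
  also have "\<dots> = (\<Sum>es\<in>?E. fls_X ^ sum_list es)"
  proof (rule sum.group)
    have "sum_list es \<le> D" if "es \<in> ?E" for es
      using sum_list_standard[OF that] distinct_card[OF bs(1)] bs(2) D by simp
    thus "sum_list ` ?E \<subseteq> {..D}" by auto
  qed simp_all
  finally show ?thesis .
qed

lemma sum_perms_character:
  assumes D: "D \<ge> CARD('n) * length (coord_partition P)"
  shows "(\<Sum>\<pi> | \<pi> permutes (UNIV :: 'n set). cnst (\<Sum>d\<le>D. fls_X ^ d * fls_const (character P d \<pi>)) * (\<Prod>C\<in>range (orbit \<pi>). power_sum N (card C)))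
    = of_nat (fact CARD('n)) * modified_HL N (coord_partition P)"
  by (rule modified_HL_eq_sum_perms[OF desc_coord_partition sum_coord_partition])
     (use sum_sign_character[OF _ _ _ D] in \<open>simp add: standard_exps_def\<close>)

end

section \<open>The union of two orbits and the splitting of its graded ring\<close>

subsection \<open>The union of two orbits\<close>

text \<open>Let m = n - k and let i be the number of parts of lambda exceeding m. The left side is
  the sum of the first i parts minus i m; dominance bounds it by the same expression for mu, which
  is at most the sum of the truncated differences.\<close>

lemma dominance_tanisaki_d:
  fixes P Q :: "complex ^ 'n::finite"
  assumes dom: "dominance_le (coord_partition P) (coord_partition Q)" and k: "k \<le> CARD('n)"
  shows "tanisaki_d CARD('n) (coord_partition P) k \<le> tanisaki_d CARD('n) (coord_partition Q) k"
proof -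
  let ?lam = "coord_partition P" and ?mu = "coord_partition Q" and ?m = "CARD('n) - k"
  let ?i = "length (filter (\<lambda>p. p > ?m) ?lam)"
  have dl: "desc ?lam" by (rule desc_coord_partition)
  have pref: "p \<le> ?m" if p: "p \<in> set (drop ?i ?lam)" for p
  proof (rule ccontr)
    assume "\<not> p \<le> ?m"
    obtain j where "j < length (drop ?i ?lam)" "p = drop ?i ?lam ! j"
      using p by (metis in_set_conv_nth)
    hence j: "?i + j < length ?lam" "?lam ! (?i + j) > ?m" using \<open>\<not> p \<le> ?m\<close> by auto
    have "{..?i + j} \<subseteq> {a. a < length ?lam \<and> ?lam ! a > ?m}"
      using j dl by (auto simp: desc_def intro: less_le_trans)
    hence "card {..?i + j} \<le> card {a. a < length ?lam \<and> ?lam ! a > ?m}" by (intro card_mono) auto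
    thus False by (simp add: length_filter_conv_card)
  qed
  have big: "p > ?m" if p: "p \<in> set (take ?i ?lam)" for p
  proof (rule ccontr)
    assume "\<not> p > ?m"
    obtain j where j0: "j < length (take ?i ?lam)" "p = take ?i ?lam ! j"
      using p by (metis in_set_conv_nth)
    hence j: "j < ?i" "j < length ?lam" by (simp_all only: length_take min_less_iff_conj)
    with j0 \<open>\<not> p > ?m\<close> have j3: "?lam ! j \<le> ?m" by simp
    have "{a. a < length ?lam \<and> ?lam ! a > ?m} \<subseteq> {..<j}"
    proof
      fix a assume a: "a \<in> {a. a < length ?lam \<and> ?lam ! a > ?m}"
      show "a \<in> {..<j}"
      proof (rule ccontr)
        assume "a \<notin> {..<j}"
        hence "?lam ! a \<le> ?lam ! j" using dl a by (auto simp: desc_def)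
        thus False using a j3 by auto
      qed
    qed
    hence "card {a. a < length ?lam \<and> ?lam ! a > ?m} \<le> card {..<j}" by (intro card_mono) auto
    thus False using j by (simp add: length_filter_conv_card)
  qed
  have lower: "sum_list xs \<le> (\<Sum>p\<leftarrow>xs. p - ?m) + length xs * ?m" for xs :: "nat list"
    by (induction xs) auto
  have exact: "(\<Sum>p\<leftarrow>xs. p - ?m) + length xs * ?m = sum_list xs" if "\<And>p. p \<in> set xs \<Longrightarrow> p > ?m" for xs :: "nat list"
    using that
  proof (induction xs)
    case (Cons a xs)
    have "a > ?m" using Cons.prems by simp
    moreover have "(\<Sum>p\<leftarrow>xs. p - ?m) + length xs * ?m = sum_list xs" using Cons by simp
    ultimately show ?case by simp
  qed simp
  have "(\<Sum>p\<leftarrow>?lam. p - ?m) = (\<Sum>p\<leftarrow>take ?i ?lam. p - ?m) + (\<Sum>p\<leftarrow>drop ?i ?lam. p - ?m)"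
    by (metis append_take_drop_id map_append sum_list_append)
  also have "(\<Sum>p\<leftarrow>drop ?i ?lam. p - ?m) = 0" using pref by simp
  finally have "(\<Sum>p\<leftarrow>?lam. p - ?m) + ?i * ?m = sum_list (take ?i ?lam)"
    using exact[of "take ?i ?lam", OF big] by simp
  also have "\<dots> \<le> sum_list (take ?i ?mu)" using dom by (simp add: dominance_le_def)
  also have "\<dots> \<le> (\<Sum>p\<leftarrow>take ?i ?mu. p - ?m) + length (take ?i ?mu) * ?m" by (rule lower)
  \<comment> \<open>mu may have fewer than i rows, so the prefix has length at most i.\<close>
  also have "\<dots> \<le> (\<Sum>p\<leftarrow>take ?i ?mu. p - ?m) + ?i * ?m" by simp
  also have "(\<Sum>p\<leftarrow>take ?i ?mu. p - ?m) \<le> (\<Sum>p\<leftarrow>?mu. p - ?m)"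
    by (metis append_take_drop_id le_add1 map_append sum_list_append)
  finally show ?thesis
    using k by (simp add: tanisaki_d_eq coord_partition_le)
qed

lemma Sn_orbits_insert: "Sn_orbits {P, Q} = Sn_orbits {P} \<union> Sn_orbits {Q}"
  by (auto simp: Sn_orbits_def)

lemma elem_sym_1: "elem_sym 1 S = (\<Sum>i\<in>S. var i)"
proof -
  have "{A. A \<subseteq> S \<and> card A = 1} = (\<lambda>i. {i}) ` S" by (auto simp: card_1_singleton_iff)
  thus ?thesis unfolding elem_sym_def by (simp add: sum.reindex)
qed

definition e1 :: "('n::finite, complex) mpoly" where
  "e1 = elem_sym 1 UNIV"

abbreviation tanisaki_of :: "complex ^ 'n::finite \<Rightarrow> ('n, complex) mpoly set" where
  "tanisaki_of P \<equiv> tanisaki_ideal (coord_partition P)"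

abbreviation pair_top :: "complex ^ 'n::finite \<Rightarrow> complex ^ 'n \<Rightarrow> ('n, complex) mpoly set" where
  "pair_top P Q \<equiv> top_ideal (Sn_orbits {P, Q})"

lemma eval_e1:
  fixes R :: "complex ^ 'n::finite"
  assumes "y \<in> Sn_orbits {R}"
  shows "eval_at e1 y = (\<Sum>i\<in>UNIV. R $ i)"
proof -
  from assms obtain \<pi> where \<pi>: "\<pi> permutes UNIV" "y = (\<chi> i. R $ \<pi> i)" by (auto simp: Sn_orbits_def)
  have "eval_at e1 y = (\<Sum>i\<in>UNIV. R $ \<pi> i)" by (simp only: e1_def elem_sym_1 eval_at_sum \<pi>(2) eval_at_var vec_lambda_beta)
  thus ?thesis using sum.permute[OF \<pi>(1), of "\<lambda>i. R $ i"] by (simp add: o_def)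
qed

lemma homogeneous_e1: "homogeneous 1 e1"
  unfolding e1_def by (rule homogeneous_elem_sym)

lemma hom_e1_mult: "hom_component d (e1 * f) = (if d = 0 then 0 else e1 * hom_component (d - 1) f)"
  by (cases d) (simp_all add: hom_component_mult_homogeneous[OF homogeneous_e1, simplified])

lemma perm_e1: "\<pi> permutes UNIV \<Longrightarrow> perm_poly \<pi> (e1 * f) = e1 * perm_poly \<pi> f"
  by (simp only: e1_def perm_poly_mult perm_poly_elem_sym permutes_image)

lemma top_ideal_hom: "f \<in> top_ideal Y \<Longrightarrow> hom_component d f \<in> top_ideal Y"
  using homogeneous_ideal_top[of Y] by (simp add: homogeneous_ideal_def)

text \<open>A lift h that vanishes on the orbit of Q, multiplied by e_1 minus the coordinate sum of
  P, vanishes on both orbits and has e_1 times the generator as its top component.\<close>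

lemma e1_mult_tanisaki:
  fixes P Q :: "complex ^ 'n::finite"
  assumes "t \<in> tanisaki_of Q"
  shows "e1 * t \<in> pair_top P Q"
proof -
  have "is_ideal {t. e1 * t \<in> pair_top P Q}"
    unfolding is_ideal_def using is_ideal_top[of "Sn_orbits {P, Q}"]
    by (auto simp: is_ideal_0 is_ideal_add distrib_left mult.left_commute[of e1] is_ideal_mult)
  moreover have "e1 * elem_sym r S \<in> pair_top P Q" if r: "card S < r + tanisaki_d CARD('n) (coord_partition Q) (card S)" "r \<le> card S" for r S
  proof -
    obtain h where h: "h \<in> vanishing_ideal (Sn_orbits {Q})" "hom_component r h = elem_sym r S"
      "\<And>d. d > r \<Longrightarrow> hom_component d h = 0" using elem_sym_lift[OF r(2,1)] by blast
    let ?k = "e1 * h - cnst (\<Sum>i\<in>UNIV. P $ i) * h"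
    have "?k \<in> vanishing_ideal (Sn_orbits {P, Q})"
      using h(1) by (auto simp: vanishing_ideal_def Sn_orbits_insert eval_at_diff eval_at_mult eval_e1)
    moreover have "hom_component e ?k = 0" if "e > Suc r" for e
      using that h(3) unfolding hom_component_diff hom_component_cnst_mult hom_e1_mult by simp
    ultimately have "hom_component (Suc r) ?k \<in> pair_top P Q" by (rule hom_component_in_top_ideal)
    moreover have "hom_component (Suc r) ?k = e1 * elem_sym r S"
      unfolding hom_component_diff hom_component_cnst_mult hom_e1_mult using h by simp
    ultimately show ?thesis by simp
  qed
  ultimately have "tanisaki_of Q \<subseteq> {t. e1 * t \<in> pair_top P Q}"
    unfolding tanisaki_ideal_def by (intro Idl_least) auto
  thus ?thesis using assms by blast
qed

text \<open>A generator \<open>e\<^sub>r(S)\<close> lifts to \<open>f\<close> vanishing on the orbit of \<open>P\<close> and to \<open>g\<close> vanishing on the orbit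
  of \<open>Q\<close>; interpolating with the affine function of \<open>e\<^sub>1\<close> that is 1 on the first and 0 on the
  second orbit changes the top form by a multiple of \<open>e\<^sub>1\<close> only.\<close>

lemma tanisaki_decomp:
  fixes P Q :: "complex ^ 'n::finite"
  assumes dom: "dominance_le (coord_partition P) (coord_partition Q)"
    and sums: "(\<Sum>i\<in>UNIV. P $ i) \<noteq> (\<Sum>i\<in>UNIV. Q $ i)"
    and "t \<in> tanisaki_of P"
  shows "\<exists>s\<in>pair_top P Q. \<exists>g. t = s + e1 * g"
proof -
  let ?K = "{t. \<exists>s\<in>pair_top P Q. \<exists>g. t = s + e1 * g}"
  have "is_ideal ?K"
    unfolding is_ideal_def
  proof (intro conjI ballI allI)
    have "(0 :: ('n, complex) mpoly) = 0 + e1 * 0" by simp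
    thus "0 \<in> ?K" using is_ideal_0[OF is_ideal_top] by blast
  next
    fix f g assume "f \<in> ?K" "g \<in> ?K"
    then obtain s1 g1 s2 g2 where "s1 \<in> pair_top P Q" "s2 \<in> pair_top P Q" "f = s1 + e1 * g1" "g = s2 + e1 * g2" by blast
    hence "s1 + s2 \<in> pair_top P Q" "f + g = (s1 + s2) + e1 * (g1 + g2)"
      by (auto simp: is_ideal_add[OF is_ideal_top] distrib_left)
    thus "f + g \<in> ?K" by blast
  next
    fix r f assume "f \<in> ?K"
    then obtain s g where s: "s \<in> pair_top P Q" "f = s + e1 * g" by blast
    have "r * f = r * s + e1 * (r * g)" unfolding s by (simp only: distrib_left mult.left_commute)
    thus "r * f \<in> ?K" using is_ideal_mult[OF is_ideal_top s(1)] by blast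
  qed
  moreover have "elem_sym r S \<in> ?K" if r: "card S < r + tanisaki_d CARD('n) (coord_partition P) (card S)" "r \<le> card S" for r S
  proof -
    have "card S \<le> CARD('n)" by (simp add: card_mono)
    hence "card S < r + tanisaki_d CARD('n) (coord_partition Q) (card S)"
      using r(1) dominance_tanisaki_d[OF dom, of "card S"] by simp
    then obtain g where g: "g \<in> vanishing_ideal (Sn_orbits {Q})" "hom_component r g = elem_sym r S"
      "\<And>d. d > r \<Longrightarrow> hom_component d g = 0" using elem_sym_lift[OF r(2)] by blast
    obtain f where f: "f \<in> vanishing_ideal (Sn_orbits {P})" "hom_component r f = elem_sym r S"
      "\<And>d. d > r \<Longrightarrow> hom_component d f = 0" using elem_sym_lift[OF r(2,1)] by blast
    define sP sQ where "sP = (\<Sum>i\<in>UNIV. P $ i)" and "sQ = (\<Sum>i\<in>UNIV. Q $ i)"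
    define a where "a = 1 / (sP - sQ)"
    have a: "a * (sP - sQ) = 1" using sums by (simp add: a_def sP_def sQ_def)
    \<comment> \<open>f and g share their component of degree r, so w has lower degree, and e_1 w
      reaches degree r only in a multiple of e_1.\<close>
    define w where "w = f - g"
    define k where "k = g + (cnst a * (e1 * w) - cnst (a * sQ) * w)"
    have ev: "eval_at k y = eval_at g y + (a * (eval_at e1 y - sQ)) * (eval_at f y - eval_at g y)" for y
      by (simp add: k_def w_def eval_at_add eval_at_diff eval_at_mult algebra_simps)
    have "eval_at k y = 0" if "y \<in> Sn_orbits {P, Q}" for y
      using that unfolding Sn_orbits_insert
    proof
      assume y: "y \<in> Sn_orbits {P}"
      hence "eval_at k y = eval_at g y + (a * (sP - sQ)) * (eval_at f y - eval_at g y)"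
        unfolding ev eval_e1[OF y] sP_def by simp
      thus ?thesis using f(1) y unfolding a by (simp add: vanishing_ideal_def)
    next
      assume y: "y \<in> Sn_orbits {Q}"
      hence "eval_at k y = eval_at g y" unfolding ev eval_e1[OF y] sQ_def by simp
      thus ?thesis using g(1) y by (simp add: vanishing_ideal_def)
    qed
    hence "k \<in> vanishing_ideal (Sn_orbits {P, Q})" by (simp add: vanishing_ideal_def)
    moreover have fg: "hom_component d w = 0" if "d \<ge> r" for d
      using that f(2) g(2) f(3)[of d] g(3)[of d] by (cases "d = r") (auto simp: w_def hom_component_diff)
    have "hom_component d k = 0" if "d > r" for d
      using that g(3)[of d] fg[of d] fg[of "d - 1"]
      unfolding k_def hom_component_add hom_component_diff hom_component_cnst_mult hom_e1_mult by simp
    ultimately have "hom_component r k \<in> pair_top P Q" by (intro hom_component_in_top_ideal)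
    moreover have "hom_component r k = elem_sym r S + e1 * (cnst a * (if r = 0 then 0 else hom_component (r - 1) w))"
      unfolding k_def hom_component_add hom_component_diff hom_component_cnst_mult hom_e1_mult
      using fg[of r] g(2) by (simp add: mult.left_commute)
    hence "elem_sym r S = hom_component r k + e1 * (- (cnst a * (if r = 0 then 0 else hom_component (r - 1) w)))"
      by simp
    ultimately show ?thesis by blast
  qed
  ultimately have "tanisaki_of P \<subseteq> ?K"
    unfolding tanisaki_ideal_def by (intro Idl_least) auto
  thus ?thesis using assms(3) by blast
qed

text \<open>For the set of all variables every box is counted, so the threshold for generators is 0.
  Multiples of e_1 therefore vanish in R_lambda.\<close>

lemma e1_in_tanisaki:
  fixes P :: "complex ^ 'n::finite"
  shows "e1 \<in> tanisaki_of P"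
proof -
  have "elem_sym 1 UNIV \<in> tanisaki_on (UNIV :: 'n set) (coord_partition P)"
    by (rule elem_sym_in_tanisaki_on) (simp_all add: tanisaki_d_full[OF sum_coord_partition])
  thus ?thesis by (simp only: tanisaki_on_UNIV e1_def)
qed

lemma top_ideal_mono:
  assumes "Y' \<subseteq> Y"
  shows "top_ideal Y \<subseteq> top_ideal Y'"
  unfolding top_ideal_def[of Y]
proof (rule Idl_least[OF is_ideal_top])
  have "{top_form f | f. f \<in> vanishing_ideal Y \<and> f \<noteq> 0} \<subseteq> {top_form f | f. f \<in> vanishing_ideal Y' \<and> f \<noteq> 0}"
    using assms by (auto simp: vanishing_ideal_def)
  also have "\<dots> \<subseteq> top_ideal Y'" unfolding top_ideal_def by (rule Idl_superset)
  finally show "{top_form f | f. f \<in> vanishing_ideal Y \<and> f \<noteq> 0} \<subseteq> top_ideal Y'" .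
qed

lemma mem_of_components:
  assumes "is_ideal J" "\<And>d. hom_component d f \<in> J"
  shows "f \<in> J"
proof -
  obtain D where D: "\<And>d. d > D \<Longrightarrow> hom_component d f = 0" using hom_component_bound by blast
  have "(\<Sum>d\<le>D. hom_component d f) \<in> J" using assms by (intro is_ideal_sum)
  thus ?thesis using sum_hom_components[OF D] by simp
qed

context
  fixes P Q :: "complex ^ 'n::finite" and kap0 :: "'n \<Rightarrow> nat" and bs0 :: "'n list"
  assumes dom: "dominance_le (coord_partition P) (coord_partition Q)"
    and sums: "(\<Sum>i\<in>UNIV. P $ i) \<noteq> (\<Sum>i\<in>UNIV. Q $ i)"
    and kap0: "inj kap0" and bs0: "distinct bs0" "set bs0 = UNIV" "sorted (map kap0 bs0)"
begin

abbreviation "stdP \<equiv> std kap0 bs0 P"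
abbreviation "stdQ \<equiv> std kap0 bs0 Q"
abbreviation "stdm \<equiv> monl bs0"

lemmas basisP = quot_basis_std[OF kap0 bs0, of P]
lemmas basisQ = quot_basis_std[OF kap0 bs0, of Q]

text \<open>The reverse of \<open>tanisaki_subset_top\<close>: reduce a homogeneous element to
  standard monomials modulo I_lambda; the remaining combination lies in the top degree ideal, so its
  coefficients vanish.\<close>

lemma top_ideal_orbit: "top_ideal (Sn_orbits {P}) \<subseteq> tanisaki_of P"
proof
  fix f assume f: "f \<in> top_ideal (Sn_orbits {P})"
  show "f \<in> tanisaki_of P"
  proof (rule mem_of_components[OF is_ideal_tanisaki])
    fix d
    let ?T = "top_ideal (Sn_orbits {P})"
    have fd: "hom_component d f \<in> ?T" using f homogeneous_ideal_top by (auto simp: homogeneous_ideal_def)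
    obtain c where c: "hom_component d f - lincomb (stdP d) stdm c \<in> tanisaki_of P"
      using basisP[of d] homogeneous_hom_component[of d f] unfolding quot_basis_def by blast
    hence "hom_component d f - (hom_component d f - lincomb (stdP d) stdm c) \<in> ?T"
      by (rule is_ideal_diff[OF is_ideal_top fd subsetD[OF tanisaki_subset_top]])
    hence lin: "lincomb (stdP d) stdm c \<in> ?T" by simp
    let ?c = "\<lambda>es. if sum_list es = d then c es else 0"
    have "(\<Sum>es\<in>standard_exps P kap0 bs0. cnst (?c es) * antisymmetrize kap0 (stdm es)) = lincomb (stdP d) stdm c"
      unfolding lincomb_def std_def[OF kap0 bs0] antisymmetrize_inj[OF kap0]
      by (rule sum.mono_neutral_cong_right) auto
    hence "(\<Sum>es\<in>standard_exps P kap0 bs0. cnst (?c es) * antisymmetrize kap0 (stdm es)) \<in> ?T" using lin by simp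
    from admissible_independent[OF bs0, of ?c P, folded standard_exps_def, OF this]
    have c0: "?c es = 0" if "es \<in> standard_exps P kap0 bs0" for es using that by blast
    have "c es = 0" if "es \<in> stdP d" for es using c0[of es] that by (simp add: std_def[OF kap0 bs0])
    hence "lincomb (stdP d) stdm c = 0" by (simp add: lincomb_def)
    thus "hom_component d f \<in> tanisaki_of P" using c by simp
  qed
qed

lemma TPQ_subset: "pair_top P Q \<subseteq> tanisaki_of P"
  using top_ideal_mono[of "Sn_orbits {P}" "Sn_orbits {P, Q}"] top_ideal_orbit by (auto simp: Sn_orbits_insert)

text \<open>A disjoint sum, because the same exponent list may be standard for both P and Q. The
  right summand, multiplied by e_1 in \<open>mon2\<close>, is shifted by one degree and absent in
  degree 0.\<close>

definition std2 :: "nat \<Rightarrow> (nat list + nat list) set" where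
  "std2 d = Inl ` stdP d \<union> (if d = 0 then {} else Inr ` stdQ (d - 1))"

definition mon2 :: "nat list + nat list \<Rightarrow> ('n, complex) mpoly" where
  "mon2 = case_sum stdm (\<lambda>es. e1 * stdm es)"

lemma finite_std2 [simp]: "finite (std2 d)"
  by (simp add: std2_def finite_std[OF kap0 bs0])

lemma sum_std2: "(\<Sum>\<iota>\<in>std2 d. F \<iota>) = (\<Sum>es\<in>stdP d. F (Inl es)) + (if d = 0 then 0 else \<Sum>es\<in>stdQ (d - 1). F (Inr es))"
proof -
  have "(\<Sum>\<iota>\<in>std2 d. F \<iota>) = (\<Sum>\<iota>\<in>Inl ` stdP d. F \<iota>) + (\<Sum>\<iota>\<in>(if d = 0 then {} else Inr ` stdQ (d - 1)). F \<iota>)"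
    unfolding std2_def by (rule sum.union_disjoint) (auto simp: finite_std[OF kap0 bs0])
  thus ?thesis by (simp add: sum.reindex)
qed

lemma lincomb_std2:
  "lincomb (std2 d) mon2 c = lincomb (stdP d) stdm (\<lambda>es. c (Inl es)) + (if d = 0 then 0 else e1 * lincomb (stdQ (d - 1)) stdm (\<lambda>es. c (Inr es)))"
  unfolding lincomb_def sum_std2 by (simp add: mon2_def sum_distrib_left mult.left_commute)

text \<open>This describes the kernel of A/T -> R_lambda in one degree: the cofactor of e_1 in
  \<open>tanisaki_decomp\<close> may be reduced to standard monomials for Q, since e_1 carries I_mu
  into T.\<close>

lemma JP_span:
  assumes "f \<in> tanisaki_of P" "homogeneous d f"
  shows "\<exists>b. f - (if d = 0 then 0 else e1 * lincomb (stdQ (d - 1)) stdm b) \<in> pair_top P Q"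
proof -
  obtain s g where s: "s \<in> pair_top P Q" "f = s + e1 * g" using tanisaki_decomp[OF dom sums assms(1)] by blast
  have "hom_component d f = hom_component d s + (if d = 0 then 0 else e1 * hom_component (d - 1) g)"
    unfolding s(2) hom_component_add hom_e1_mult ..
  hence f: "f = hom_component d s + (if d = 0 then 0 else e1 * hom_component (d - 1) g)"
    using assms(2) by (simp only: homogeneous_iff)
  have sd: "hom_component d s \<in> pair_top P Q" by (rule top_ideal_hom[OF s(1)])
  show ?thesis
  proof (cases "d = 0")
    case True
    thus ?thesis using f sd by simp
  next
    case False
    obtain b where "hom_component (d - 1) g - lincomb (stdQ (d - 1)) stdm b \<in> tanisaki_of Q"
      using basisQ[of "d - 1"] homogeneous_hom_component[of "d - 1" g] unfolding quot_basis_def by blast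
    hence "e1 * (hom_component (d - 1) g - lincomb (stdQ (d - 1)) stdm b) \<in> pair_top P Q" by (rule e1_mult_tanisaki)
    with sd have "hom_component d s + e1 * (hom_component (d - 1) g - lincomb (stdQ (d - 1)) stdm b) \<in> pair_top P Q"
      by (rule is_ideal_add[OF is_ideal_top])
    also have "hom_component d s + e1 * (hom_component (d - 1) g - lincomb (stdQ (d - 1)) stdm b) = f - e1 * lincomb (stdQ (d - 1)) stdm b"
      using False by (subst f) (simp add: right_diff_distrib)
    finally have "f - e1 * lincomb (stdQ (d - 1)) stdm b \<in> pair_top P Q" .
    thus ?thesis using False by (intro exI[of _ b]) simp
  qed
qed

lemma std2_span:
  assumes "homogeneous d f"
  shows "\<exists>c. f - lincomb (std2 d) mon2 c \<in> pair_top P Q"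
proof -
  obtain a where a: "f - lincomb (stdP d) stdm a \<in> tanisaki_of P" using basisP[of d] assms by (auto simp: quot_basis_def)
  have "homogeneous d (f - lincomb (stdP d) stdm a)"
    using basisP[of d] assms unfolding lincomb_def quot_basis_def
    by (intro homogeneous_diff homogeneous_sum homogeneous_cnst_mult) auto
  from JP_span[OF a this] obtain b where b: "f - lincomb (stdP d) stdm a - (if d = 0 then 0 else e1 * lincomb (stdQ (d - 1)) stdm b) \<in> pair_top P Q" by blast
  show ?thesis
    by (rule exI[of _ "case_sum a b"]) (use b[unfolded diff_diff_eq] in \<open>simp only: lincomb_std2 sum.case\<close>)
qed

text \<open>Independence: the number of elements of the spanning set is the number of points.\<close>

lemma std2_independent:
  assumes "lincomb (std2 d) mon2 c \<in> pair_top P Q" "\<iota>0 \<in> std2 d"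
  shows "c \<iota>0 = 0"
proof -
  let ?EP = "standard_exps P kap0 bs0" and ?EQ = "standard_exps Q kap0 bs0"
  let ?E = "?EP <+> ?EQ" and ?dg = "case_sum sum_list (\<lambda>es. Suc (sum_list es))"
  have Ed: "{\<iota>\<in>?E. ?dg \<iota> = d} = std2 d" for d
    by (cases d) (auto simp: std2_def std_def[OF kap0 bs0])
  have len: "length bs0 = CARD('n)" using distinct_card[OF bs0(1)] bs0(2) by simp
  have reps: "\<exists>Z. finite Z \<and> Z \<subseteq> Sn_orbits {R} \<and> card Z = card (standard_exps R kap0 bs0)" for R :: "complex ^ 'n"
  proof -
    obtain Z where "finite Z" "Z \<subseteq> Sn_orbits {R}"
      "card Z = card (families_of kap0 (length (coord_partition R)) bs0 0 (length (coord_partition R)) (parts (coord_partition R)))"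
      using orbit_representatives[OF bs0(1,2), of R kap0 0] by metis
    moreover have "card (standard_exps R kap0 bs0) = card (families_of kap0 (length (coord_partition R)) bs0 0 (length (coord_partition R)) (parts (coord_partition R)))"
      unfolding standard_exps_def using bs0(3) len
      by (intro card_admissible) (auto simp: desc_coord_partition sum_coord_partition)
    ultimately show ?thesis by auto
  qed
  obtain ZP where ZP: "finite ZP" "ZP \<subseteq> Sn_orbits {P}" "card ZP = card ?EP" using reps by blast
  obtain ZQ where ZQ: "finite ZQ" "ZQ \<subseteq> Sn_orbits {Q}" "card ZQ = card ?EQ" using reps by blast
  \<comment> \<open>The value of e_1, the coordinate sum, tells the two orbits apart.\<close>
  have disj: "ZP \<inter> ZQ = {}"
  proof (rule equals0I)
    fix z assume "z \<in> ZP \<inter> ZQ"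
    hence "z \<in> Sn_orbits {P}" "z \<in> Sn_orbits {Q}" using ZP(2) ZQ(2) by auto
    thus False using eval_e1[of z P] eval_e1[of z Q] sums by simp
  qed
  let ?c = "\<lambda>\<iota>. if ?dg \<iota> = d then c \<iota> else 0"
  have "(\<Sum>\<iota>\<in>?E. cnst (?c \<iota>) * antisymmetrize kap0 (mon2 \<iota>)) = lincomb (std2 d) mon2 c"
    unfolding lincomb_def antisymmetrize_inj[OF kap0] Ed[symmetric]
    by (rule sum.mono_neutral_cong_right) auto
  hence rel: "(\<Sum>\<iota>\<in>?E. cnst (?c \<iota>) * antisymmetrize kap0 (mon2 \<iota>)) \<in> pair_top P Q" using assms(1) by simp
  have "?c \<iota>0 = 0"
  proof (rule independent_mod_top[where X = "{P, Q}" and kap = kap0 and h = mon2 and dg = ?dg and E = ?E and Z = "ZP \<union> ZQ" and c = ?c])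
    show "spans_mod_top {P, Q} kap0 mon2 ?dg ?E"
      unfolding spans_mod_top_def antisymmetrize_inj[OF kap0] Ed using std2_span by (simp add: lincomb_def)
    show "homogeneous (?dg \<iota>) (mon2 \<iota>)" if \<iota>: "\<iota> \<in> ?E" for \<iota>
    proof -
      consider es where "es \<in> ?EP" "\<iota> = Inl es" | es where "es \<in> ?EQ" "\<iota> = Inr es"
        using \<iota> by auto
      thus ?thesis
      proof cases
        case 1
        thus ?thesis using homogeneous_monl_standard[OF 1(1)] by (simp add: mon2_def)
      next
        case 2
        thus ?thesis using homogeneous_mult[OF homogeneous_e1 homogeneous_monl_standard[OF 2(1)]] by (simp add: mon2_def)
      qed
    qed
    show "ZP \<union> ZQ \<subseteq> Sn_orbits {P, Q}" using ZP ZQ by (auto simp: Sn_orbits_insert)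
    show "card ?E \<le> card (ZP \<union> ZQ)" using ZP ZQ disj by (simp add: card_Plus card_Un_disjoint)
    show "\<exists>p. \<forall>z'\<in>ZP \<union> ZQ. eval_at (antisymmetrize kap0 p) z' = (if z' = z then 1 else 0)" if "z \<in> ZP \<union> ZQ" for z
      using interpolation[of "ZP \<union> ZQ" z] ZP(1) ZQ(1) unfolding antisymmetrize_inj[OF kap0] by (metis finite_UnI)
    show "\<iota>0 \<in> ?E" using assms(2) Ed[of d] by blast
  qed (use rel ZP ZQ in auto)
  moreover have "?dg \<iota>0 = d" using assms(2) Ed[of d] by blast
  ultimately show ?thesis by simp
qed

lemma quot_basis_std2: "quot_basis (pair_top P Q) {f. homogeneous d f} (std2 d) mon2"
  unfolding quot_basis_def
proof (intro conjI allI impI ballI)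
  show "mon2 ` std2 d \<subseteq> {f. homogeneous d f}"
  proof
    fix f assume "f \<in> mon2 ` std2 d"
    then consider es where "es \<in> stdP d" "f = stdm es" | es where "d \<noteq> 0" "es \<in> stdQ (d - 1)" "f = e1 * stdm es"
      by (auto simp: std2_def mon2_def split: if_splits)
    thus "f \<in> {f. homogeneous d f}"
    proof cases
      case 1
      thus ?thesis using basisP[of d] by (auto simp: quot_basis_def)
    next
      case 2
      hence "homogeneous (d - 1) (stdm es)" using basisQ[of "d - 1"] by (auto simp: quot_basis_def)
      from homogeneous_mult[OF homogeneous_e1 this] show ?thesis using 2 by simp
    qed
  qed
qed (use std2_span std2_independent in auto)

text \<open>The action is block triangular: multiples of e_1 stay multiples of e_1, and a monomial
  of the first kind has arbitrary coefficients b in the second block. Only the diagonal blocks,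
  those of R_lambda and R_mu, enter the trace.\<close>

lemma trace_std2:
  assumes \<pi>: "\<pi> permutes UNIV"
  shows "quot_trace (pair_top P Q) (std2 d) mon2 (perm_poly \<pi>)
    = character kap0 bs0 P d \<pi> + (if d = 0 then 0 else character kap0 bs0 Q (d - 1) \<pi>)"
proof -
  define cP where "cP = (\<lambda>es. quot_coeff (tanisaki_of P) (stdP d) stdm (perm_poly \<pi> (stdm es)))"
  define cQ where "cQ = (\<lambda>es. quot_coeff (tanisaki_of Q) (stdQ (d - 1)) stdm (perm_poly \<pi> (stdm es)))"
  have homP: "homogeneous d (stdm es)" if "es \<in> stdP d" for es
    using that basisP[of d] by (auto simp: quot_basis_def)
  have homQ: "homogeneous (d - 1) (stdm es)" if "es \<in> stdQ (d - 1)" for es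
    using that basisQ[of "d - 1"] by (auto simp: quot_basis_def)
  have "\<exists>b. perm_poly \<pi> (stdm es) - lincomb (stdP d) stdm (cP es) - (if d = 0 then 0 else e1 * lincomb (stdQ (d - 1)) stdm b) \<in> pair_top P Q"
    if es: "es \<in> stdP d" for es
  proof (rule JP_span)
    have h: "homogeneous d (perm_poly \<pi> (stdm es))" using homP[OF es] by (rule homogeneous_perm_poly)
    thus "perm_poly \<pi> (stdm es) - lincomb (stdP d) stdm (cP es) \<in> tanisaki_of P"
      unfolding cP_def by (intro quot_coeff[OF is_ideal_tanisaki basisP]) simp
    show "homogeneous d (perm_poly \<pi> (stdm es) - lincomb (stdP d) stdm (cP es))"
      using h homP unfolding lincomb_def by (intro homogeneous_diff homogeneous_sum homogeneous_cnst_mult) auto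
  qed
  then obtain b where b: "\<And>es. es \<in> stdP d \<Longrightarrow>
    perm_poly \<pi> (stdm es) - lincomb (stdP d) stdm (cP es) - (if d = 0 then 0 else e1 * lincomb (stdQ (d - 1)) stdm (b es)) \<in> pair_top P Q"
    by metis
  have Q: "e1 * (perm_poly \<pi> (stdm es) - lincomb (stdQ (d - 1)) stdm (cQ es)) \<in> pair_top P Q" if es: "es \<in> stdQ (d - 1)" for es
    unfolding cQ_def using homQ[OF es]
    by (intro e1_mult_tanisaki quot_coeff[OF is_ideal_tanisaki basisQ]) (simp add: homogeneous_perm_poly)
  have "quot_trace (pair_top P Q) (std2 d) mon2 (perm_poly \<pi>)
      = (\<Sum>\<iota>\<in>std2 d. case_sum (\<lambda>es. case_sum (cP es) (b es)) (\<lambda>es. case_sum (\<lambda>_. 0) (cQ es)) \<iota> \<iota>)"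
  proof (rule quot_trace_eqI[OF is_ideal_top quot_basis_std2,
        where M = "case_sum (\<lambda>es. case_sum (cP es) (b es)) (\<lambda>es. case_sum (\<lambda>_. 0) (cQ es))"])
    fix \<iota> assume "\<iota> \<in> std2 d"
    then consider es where "es \<in> stdP d" "\<iota> = Inl es" | es where "d \<noteq> 0" "es \<in> stdQ (d - 1)" "\<iota> = Inr es"
      by (auto simp: std2_def split: if_splits)
    thus "perm_poly \<pi> (mon2 \<iota>) - lincomb (std2 d) mon2 (case_sum (\<lambda>es. case_sum (cP es) (b es)) (\<lambda>es. case_sum (\<lambda>_. 0) (cQ es)) \<iota>) \<in> pair_top P Q"
    proof cases
      case 1
      thus ?thesis using b[OF 1(1)] unfolding lincomb_std2 diff_diff_eq 1(2) by (simp only: sum.case mon2_def)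
    next
      case 2
      thus ?thesis using Q[OF 2(2)] unfolding lincomb_std2
        by (simp add: mon2_def lincomb_0 perm_e1[OF \<pi>] right_diff_distrib)
    qed
  qed
  thus ?thesis
    by (simp add: sum_std2 character_def[OF kap0 bs0] quot_trace_def cP_def cQ_def)
qed

lemma frob_q_TPQ: "frob_q N (quotient_rep (pair_top P Q)) = modified_HL N (coord_partition P) + cnst fls_X * modified_HL N (coord_partition Q)"
proof -
  \<comment> \<open>It bounds the degrees of both standard sets; the sums run to
    \<open>Suc D\<close> because of the factor e_1.\<close>
  define D where "D = CARD('n) * length (coord_partition P) + CARD('n) * length (coord_partition Q)"
  let ?F = "\<lambda>R D \<pi>. \<Sum>d\<le>D. fls_X ^ d * fls_const (character kap0 bs0 R d \<pi>) :: complex fls"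
  let ?p = "\<lambda>\<pi> :: 'n \<Rightarrow> 'n. \<Prod>C\<in>range (orbit \<pi>). power_sum N (card C)"
  have "of_nat (fact CARD('n)) * frob_q N (quotient_rep (pair_top P Q))
      = (\<Sum>\<pi> | \<pi> permutes (UNIV :: 'n set). cnst (\<Sum>d\<le>Suc D. fls_X ^ d * fls_const (quot_trace (pair_top P Q) (std2 d) mon2 (perm_poly \<pi>))) * ?p \<pi>)"
  proof (rule frob_q_quotient_rep[OF is_ideal_top perm_stable_top quot_basis_std2])
    fix d assume "d > Suc D"
    hence "stdP d = {}" "stdQ (d - 1) = {}" by (auto simp: D_def intro!: std_empty[OF kap0 bs0])
    thus "std2 d = {}" by (simp add: std2_def)
  qed
  also have "\<dots> = (\<Sum>\<pi> | \<pi> permutes (UNIV :: 'n set). (cnst (?F P (Suc D) \<pi>) * ?p \<pi> + cnst fls_X * (cnst (?F Q D \<pi>) * ?p \<pi>)))"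
  proof (intro sum.cong refl)
    fix \<pi> :: "'n \<Rightarrow> 'n" assume "\<pi> \<in> {\<pi>. \<pi> permutes UNIV}"
    hence \<pi>: "\<pi> permutes UNIV" by simp
    have "(\<Sum>d\<le>Suc D. fls_X ^ d * fls_const (quot_trace (pair_top P Q) (std2 d) mon2 (perm_poly \<pi>)))
        = ?F P (Suc D) \<pi> + (\<Sum>d\<le>Suc D. fls_X ^ d * fls_const (if d = 0 then 0 else character kap0 bs0 Q (d - 1) \<pi>))"
      unfolding trace_std2[OF \<pi>] sum.distrib[symmetric]
      by (intro sum.cong refl) (simp only: fls_plus_const[symmetric] distrib_left)
    also have "(\<Sum>d\<le>Suc D. fls_X ^ d * fls_const (if d = 0 then 0 else character kap0 bs0 Q (d - 1) \<pi>)) = fls_X * ?F Q D \<pi>"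
      by (subst sum.atMost_Suc_shift) (simp add: sum_distrib_left mult.assoc)
    finally show "cnst (\<Sum>d\<le>Suc D. fls_X ^ d * fls_const (quot_trace (pair_top P Q) (std2 d) mon2 (perm_poly \<pi>))) * ?p \<pi>
        = cnst (?F P (Suc D) \<pi>) * ?p \<pi> + cnst fls_X * (cnst (?F Q D \<pi>) * ?p \<pi>)"
      by (simp only: cnst_add cnst_mult distrib_right mult.assoc)
  qed
  also have "\<dots> = of_nat (fact CARD('n)) * (modified_HL N (coord_partition P) + cnst fls_X * modified_HL N (coord_partition Q))"
    unfolding sum.distrib sum_distrib_left[symmetric]
    by (subst (1 2) sum_perms_character[OF kap0 bs0]) (simp_all add: D_def algebra_simps)
  finally have "cnst (1 / of_nat (fact CARD('n))) * (of_nat (fact CARD('n)) * frob_q N (quotient_rep (pair_top P Q)))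
      = cnst (1 / of_nat (fact CARD('n))) * (of_nat (fact CARD('n)) * (modified_HL N (coord_partition P) + cnst fls_X * modified_HL N (coord_partition Q)))"
    by simp
  thus ?thesis
    unfolding of_nat_eq_cnst mult.assoc[symmetric] cnst_mult[symmetric] by simp
qed

end

subsection \<open>An equivariant splitting\<close>

lemma carrier_direct_sum: "carrier (direct_sum V W) = carrier V \<times> carrier W"
  by (simp add: direct_sum_def Let_def RDirProd_carrier)

lemma add_direct_sum: "add (direct_sum V W) (v, w) (v', w') = (add V v v', add W w w')"
  by (simp add: direct_sum_def Let_def RDirProd_def DirProd_def monoid.defs)

lemma direct_sum_simps:
  "smult (direct_sum V W) c (v, w) = (smult V c v, smult W c w)"
  "act (direct_sum V W) \<pi> (v, w) = (act V \<pi> v, act W \<pi> w)"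
  "grade (direct_sum V W) d = grade V d \<times> grade W d"
  by (simp_all add: direct_sum_def Let_def)

lemma shift_up_simps:
  "carrier (shift_up k V) = carrier V" "add (shift_up k V) = add V"
  "smult (shift_up k V) = smult V" "act (shift_up k V) = act V"
  "grade (shift_up k V) d = (if k \<le> d then grade V (d - k) else {zero V})"
  by (simp_all add: shift_up_def)

context
  fixes P Q :: "complex ^ 'n::finite" and kap0 :: "'n \<Rightarrow> nat" and bs0 :: "'n list"
  assumes dom: "dominance_le (coord_partition P) (coord_partition Q)"
    and sums: "(\<Sum>i\<in>UNIV. P $ i) \<noteq> (\<Sum>i\<in>UNIV. Q $ i)"
    and kap0: "inj kap0" and bs0: "distinct bs0" "set bs0 = UNIV" "sorted (map kap0 bs0)"
begin

abbreviation "stP \<equiv> std kap0 bs0 P"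
abbreviation "stQ \<equiv> std kap0 bs0 Q"
abbreviation "mn \<equiv> monl bs0"

lemmas bP = quot_basis_std[OF kap0 bs0, of P]
lemmas bQ = quot_basis_std[OF kap0 bs0, of Q]
lemmas IP = is_ideal_tanisaki[of "coord_partition P"]
lemmas IQ = is_ideal_tanisaki[of "coord_partition Q"]
lemmas IT = is_ideal_top[of "Sn_orbits {P, Q}"]
lemmas T_sub = TPQ_subset[OF dom sums kap0 bs0]

text \<open>Exactness on the left: modulo I_mu the polynomial is a combination of standard monomials
  for Q, whose products with e_1 are part of an independent family modulo T.\<close>

lemma colon_e1:
  assumes "e1 * g \<in> pair_top P Q"
  shows "g \<in> tanisaki_of Q"
proof (rule mem_of_components[OF IQ])
  fix d
  obtain b where b: "hom_component d g - lincomb (stQ d) mn b \<in> tanisaki_of Q"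
    using bQ[of d] homogeneous_hom_component[of d g] unfolding quot_basis_def by blast
  have "e1 * hom_component d g \<in> pair_top P Q"
    using top_ideal_hom[OF assms, of "Suc d"] by (simp add: hom_e1_mult)
  hence "e1 * hom_component d g - e1 * (hom_component d g - lincomb (stQ d) mn b) \<in> pair_top P Q"
    by (rule is_ideal_diff[OF IT _ e1_mult_tanisaki[OF b]])
  hence "e1 * lincomb (stQ d) mn b \<in> pair_top P Q" by (simp add: right_diff_distrib)
  hence "lincomb (std2 P Q kap0 bs0 (Suc d)) (mon2 bs0) (case_sum (\<lambda>_. 0) b) \<in> pair_top P Q"
    unfolding lincomb_std2[OF dom sums kap0 bs0] by (simp add: lincomb_0)
  from std2_independent[OF dom sums kap0 bs0 this] have "b es = 0" if "es \<in> stQ d" for es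
    using that by (force simp: std2_def[OF dom sums kap0 bs0])
  hence "lincomb (stQ d) mn b = 0" by (simp add: lincomb_def)
  thus "hom_component d g \<in> tanisaki_of Q" using b by simp
qed

text \<open>A linear graded section of the map to R_lambda by standard monomials, in general not
  equivariant. Beyond the upper bound of the sum there are no standard monomials.\<close>

definition normal_form :: "('n, complex) mpoly \<Rightarrow> ('n, complex) mpoly" where
  "normal_form f = (\<Sum>d\<le>CARD('n) * length (coord_partition P).
     lincomb (stP d) mn (quot_coeff (tanisaki_of P) (stP d) mn (hom_component d f)))"

lemma normal_form_add: "normal_form (f + g) = normal_form f + normal_form g"
  unfolding normal_form_def sum.distrib[symmetric] lincomb_add[symmetric]
proof (intro sum.cong refl lincomb_cong)
  fix d es assume es: "es \<in> stP d"
  let ?c = "\<lambda>f. quot_coeff (tanisaki_of P) (stP d) mn (hom_component d f)"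
  have "hom_component d f - lincomb (stP d) mn (?c f) \<in> tanisaki_of P" for f
    by (rule quot_coeff[OF IP bP]) simp
  from is_ideal_add[OF IP this[of f] this[of g]]
  have "hom_component d (f + g) - lincomb (stP d) mn (\<lambda>es. ?c f es + ?c g es) \<in> tanisaki_of P"
    by (simp add: lincomb_add hom_component_add algebra_simps)
  thus "?c (f + g) es = ?c f es + ?c g es" by (rule quot_coeff_eqI[OF IP bP _ es])
qed

lemma normal_form_scale: "normal_form (cnst a * f) = cnst a * normal_form f"
  unfolding normal_form_def sum_distrib_left lincomb_scale[symmetric]
proof (intro sum.cong refl lincomb_cong)
  fix d es assume es: "es \<in> stP d"
  let ?c = "\<lambda>f. quot_coeff (tanisaki_of P) (stP d) mn (hom_component d f)"
  have "hom_component d f - lincomb (stP d) mn (?c f) \<in> tanisaki_of P"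
    by (rule quot_coeff[OF IP bP]) simp
  from is_ideal_mult[OF IP this, of "cnst a"]
  have "hom_component d (cnst a * f) - lincomb (stP d) mn (\<lambda>es. a * ?c f es) \<in> tanisaki_of P"
    by (simp add: lincomb_scale hom_component_cnst_mult right_diff_distrib)
  thus "?c (cnst a * f) es = a * ?c f es" by (rule quot_coeff_eqI[OF IP bP _ es])
qed

lemma normal_form_mem: "f - normal_form f \<in> tanisaki_of P"
proof -
  let ?D = "CARD('n) * length (coord_partition P)"
  let ?l = "\<lambda>d. lincomb (stP d) mn (quot_coeff (tanisaki_of P) (stP d) mn (hom_component d f))"
  have mem: "hom_component d f - ?l d \<in> tanisaki_of P" for d
    by (rule quot_coeff[OF IP bP]) simp
  obtain D0 where D0: "\<And>d. d > D0 \<Longrightarrow> hom_component d f = 0" using hom_component_bound by blast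
  have empty: "?l d = 0" if "d > ?D" for d using std_empty[OF kap0 bs0 that] by (simp add: lincomb_def)
  have "normal_form f = (\<Sum>d\<le>max D0 ?D. ?l d)"
    unfolding normal_form_def by (rule sum.mono_neutral_left) (auto simp: empty)
  moreover have "f = (\<Sum>d\<le>max D0 ?D. hom_component d f)" by (rule sum_hom_components) (simp add: D0)
  ultimately have "f - normal_form f = (\<Sum>d\<le>max D0 ?D. hom_component d f - ?l d)"
    by (simp add: sum_subtractf)
  thus ?thesis using mem by (simp add: is_ideal_sum[OF IP])
qed

lemma lincomb_zero_coeff: "f \<in> tanisaki_of P \<Longrightarrow> lincomb (stP d) mn (quot_coeff (tanisaki_of P) (stP d) mn f) = 0"
proof -
  assume "f \<in> tanisaki_of P"
  hence "f - lincomb (stP d) mn (\<lambda>_. 0) \<in> tanisaki_of P" by (simp add: lincomb_0)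
  hence "quot_coeff (tanisaki_of P) (stP d) mn f es = 0" if "es \<in> stP d" for es
    using quot_coeff_eqI[OF IP bP _ that, of f "\<lambda>_. 0"] by simp
  thus ?thesis by (simp add: lincomb_def)
qed

lemma normal_form_zero: "f \<in> tanisaki_of P \<Longrightarrow> normal_form f = 0"
  using homogeneous_ideal_tanisaki[of "coord_partition P"]
  by (auto simp: normal_form_def homogeneous_ideal_def lincomb_zero_coeff)

lemma homogeneous_normal_form: "homogeneous d f \<Longrightarrow> homogeneous d (normal_form f)"
  unfolding normal_form_def
proof (intro homogeneous_sum)
  fix e assume f: "homogeneous d f"
  show "homogeneous d (lincomb (stP e) mn (quot_coeff (tanisaki_of P) (stP e) mn (hom_component e f)))"
  proof (cases "e = d")
    case True
    have "homogeneous d (mn es)" if "es \<in> stP d" for es using that bP[of d] by (auto simp: quot_basis_def)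
    thus ?thesis unfolding lincomb_def True by (intro homogeneous_sum homogeneous_cnst_mult)
  next
    case False
    thus ?thesis using lincomb_zero_coeff[OF is_ideal_0[OF IP]] by (simp add: hom_component_homogeneous[OF f])
  qed
qed

text \<open>Maschke averaging of \<open>normal_form\<close> over conjugation; the Young subgroup of
  a constant colouring is all of S_n. Since the result depends only on the class modulo I_lambda, it
  is an equivariant graded section.\<close>

definition sec :: "('n, complex) mpoly \<Rightarrow> ('n, complex) mpoly" where
  "sec f = (\<Sum>\<pi>\<in>color_perms (\<lambda>_ :: 'n. 0). cnst (1 / of_nat (card (color_perms (\<lambda>_ :: 'n. 0)))) *
     perm_poly \<pi> (normal_form (perm_poly (inv_into UNIV \<pi>) f)))"

lemma sec_add: "sec (f + g) = sec f + sec g"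
  by (simp add: sec_def perm_poly_add normal_form_add distrib_left sum.distrib)

lemma sec_scale: "sec (cnst a * f) = cnst a * sec f"
  by (simp add: sec_def perm_poly_mult normal_form_scale sum_distrib_left mult.left_commute)

lemma sec_diff: "sec (f - g) = sec f - sec g"
  using sec_add[of f "cnst (- 1) * g"] sec_scale[of "- 1" g] by (simp add: cnst_minus)

lemma perms_color: "\<pi> \<in> color_perms (\<lambda>_. 0) \<longleftrightarrow> \<pi> permutes UNIV"
  by (simp add: color_perms_def)

lemma sec_mem: "f - sec f \<in> tanisaki_of P"
proof -
  let ?S = "color_perms (\<lambda>_ :: 'n. 0)"
  let ?a = "cnst (1 / of_nat (card ?S)) :: ('n, complex) mpoly"
  have "(\<Sum>\<pi>\<in>?S. ?a * f) = cnst (of_nat (card ?S) * (1 / of_nat (card ?S))) * f"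
    by (simp only: sum_constant of_nat_eq_cnst cnst_mult mult.assoc)
  also have "of_nat (card ?S) * (1 / of_nat (card ?S)) = (1 :: complex)"
    using color_perms_id[of "\<lambda>_ :: 'n. 0"] by auto
  finally have avg: "f = (\<Sum>\<pi>\<in>?S. ?a * f)" by (simp only: cnst_simps mult_1)
  have "(\<Sum>\<pi>\<in>?S. ?a * f) - sec f = (\<Sum>\<pi>\<in>?S. ?a * perm_poly \<pi> (perm_poly (inv_into UNIV \<pi>) f - normal_form (perm_poly (inv_into UNIV \<pi>) f)))"
    unfolding sec_def sum_subtractf[symmetric] right_diff_distrib[symmetric]
    by (intro sum.cong refl) (simp add: perm_poly_diff perm_poly_inv perms_color)
  also have "\<dots> \<in> tanisaki_of P"
    by (intro is_ideal_sum[OF IP] is_ideal_mult[OF IP] perm_stable_tanisaki normal_form_mem) (simp add: perms_color)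
  finally show ?thesis using avg by simp
qed

lemma sec_zero: "f \<in> tanisaki_of P \<Longrightarrow> sec f = 0"
  unfolding sec_def
  by (intro sum.neutral) (simp add: normal_form_zero perm_stable_tanisaki perms_color permutes_inv)

lemma sec_eqI: "f - g \<in> tanisaki_of P \<Longrightarrow> sec f = sec g"
  using sec_zero[of "f - g"] by (simp add: sec_diff)

lemma homogeneous_sec: "homogeneous d f \<Longrightarrow> homogeneous d (sec f)"
  unfolding sec_def
  by (intro homogeneous_sum homogeneous_cnst_mult homogeneous_perm_poly homogeneous_normal_form)

lemma sec_perm:
  assumes "\<sigma> permutes UNIV"
  shows "sec (perm_poly \<sigma> f) = perm_poly \<sigma> (sec f)"
proof -
  let ?S = "color_perms (\<lambda>_ :: 'n. 0)"
  let ?F = "\<lambda>\<pi> f. cnst (1 / of_nat (card ?S)) * perm_poly \<pi> (normal_form (perm_poly (inv_into UNIV \<pi>) f))"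
  have \<sigma>: "\<sigma> \<in> ?S" using assms by (simp add: perms_color)
  have "sec (perm_poly \<sigma> f) = (\<Sum>\<pi>\<in>?S. ?F (\<sigma> \<circ> \<pi>) (perm_poly \<sigma> f))"
    unfolding sec_def by (rule sum.reindex_bij_betw[OF color_perms_comp_bij(2)[OF \<sigma>], symmetric])
  also have "\<dots> = (\<Sum>\<pi>\<in>?S. perm_poly \<sigma> (?F \<pi> f))"
  proof (intro sum.cong refl)
    fix \<pi> assume "\<pi> \<in> ?S"
    hence \<pi>: "\<pi> permutes UNIV" by (simp add: perms_color)
    have "inv_into UNIV (\<sigma> \<circ> \<pi>) \<circ> \<sigma> = inv_into UNIV \<pi> \<circ> (inv_into UNIV \<sigma> \<circ> \<sigma>)"
      using o_inv_distrib[OF permutes_bij[OF assms] permutes_bij[OF \<pi>]] by (simp add: comp_assoc)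
    also have "\<dots> = inv_into UNIV \<pi>" using assms by (simp add: permutes_inv_o)
    finally show "?F (\<sigma> \<circ> \<pi>) (perm_poly \<sigma> f) = perm_poly \<sigma> (?F \<pi> f)"
      by (simp add: perm_poly_comp perm_poly_mult)
  qed
  finally show ?thesis by (simp add: sec_def perm_poly_sum)
qed

text \<open>The second component of the splitting is determined only modulo I_mu; as a relation it
  can be added, scaled and permuted before any choice is made.\<close>

definition split_rel :: "('n, complex) mpoly \<Rightarrow> ('n, complex) mpoly \<Rightarrow> bool" where
  "split_rel f g \<longleftrightarrow> f - sec f - e1 * g \<in> pair_top P Q"

lemma split_rel_ex: "\<exists>g. split_rel f g"
proof -
  obtain s g where "s \<in> pair_top P Q" "f - sec f = s + e1 * g"
    using tanisaki_decomp[OF dom sums sec_mem] by blast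
  thus ?thesis unfolding split_rel_def by (intro exI[of _ g]) simp
qed

lemma split_rel_add: "split_rel f g \<Longrightarrow> split_rel f' g' \<Longrightarrow> split_rel (f + f') (g + g')"
  using is_ideal_add[OF IT, of "f - sec f - e1 * g" "f' - sec f' - e1 * g'"]
  by (simp add: split_rel_def sec_add algebra_simps)

lemma split_rel_scale: "split_rel f g \<Longrightarrow> split_rel (cnst a * f) (cnst a * g)"
  using is_ideal_mult[OF IT, of "f - sec f - e1 * g" "cnst a"]
  by (simp add: split_rel_def sec_scale right_diff_distrib mult.left_commute)

lemma split_rel_perm: "\<pi> permutes UNIV \<Longrightarrow> split_rel f g \<Longrightarrow> split_rel (perm_poly \<pi> f) (perm_poly \<pi> g)"
  using perm_stable_top[of \<pi> "f - sec f - e1 * g" "{P, Q}"]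
  by (simp add: split_rel_def sec_perm perm_poly_diff perm_e1)

text \<open>Since T is contained in I_lambda, the sections agree; hence e_1 (g - g') lies in T and
  \<open>colon_e1\<close> applies.\<close>

lemma split_rel_unique:
  assumes "split_rel f g" "split_rel f' g'" "f - f' \<in> pair_top P Q"
  shows "g - g' \<in> tanisaki_of Q"
proof (rule colon_e1)
  have "sec f = sec f'" using assms(3) T_sub by (intro sec_eqI) auto
  hence "e1 * (g - g') = (f - f') - ((f - sec f - e1 * g) - (f' - sec f' - e1 * g'))"
    by (simp add: algebra_simps)
  also have "\<dots> \<in> pair_top P Q"
    by (rule is_ideal_diff[OF IT assms(3) is_ideal_diff[OF IT assms(1)[unfolded split_rel_def] assms(2)[unfolded split_rel_def]]])
  finally show "e1 * (g - g') \<in> pair_top P Q" .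
qed

text \<open>The sections agree, so f - f' is e_1 (g - g') up to T, and e_1 carries I_mu into
  T.\<close>

lemma split_rel_kernel:
  assumes "split_rel f g" "split_rel f' g'" "f - f' \<in> tanisaki_of P" "g - g' \<in> tanisaki_of Q"
  shows "f - f' \<in> pair_top P Q"
proof -
  have "sec f = sec f'" using assms(3) by (rule sec_eqI)
  hence "f - f' = ((f - sec f - e1 * g) - (f' - sec f' - e1 * g')) + e1 * (g - g')"
    by (simp add: algebra_simps)
  also have "\<dots> \<in> pair_top P Q"
    by (rule is_ideal_add[OF IT is_ideal_diff[OF IT assms(1)[unfolded split_rel_def] assms(2)[unfolded split_rel_def]] e1_mult_tanisaki[OF assms(4)]])
  finally show ?thesis .
qed

text \<open>e_1 g lies in I_lambda, so adding it to sec f changes neither the class modulo I_lambda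
  nor the section.\<close>

lemma split_rel_surj:
  shows "split_rel (sec f + e1 * g) g" "sec f + e1 * g - f \<in> tanisaki_of P"
proof -
  have "e1 * g \<in> tanisaki_of P" using is_ideal_mult_right[OF IP e1_in_tanisaki] .
  hence "e1 * g - (f - sec f) \<in> tanisaki_of P" by (rule is_ideal_diff[OF IP _ sec_mem])
  thus *: "sec f + e1 * g - f \<in> tanisaki_of P" by (simp add: algebra_simps)
  show "split_rel (sec f + e1 * g) g"
    unfolding split_rel_def sec_eqI[OF *] using is_ideal_0[OF IT] by simp
qed

text \<open>Taking the component of degree d replaces g by its component of degree d - 1. In degree
  0 nothing is left of it, in accordance with the zero component of \<open>shift_up\<close>.\<close>

lemma split_rel_homogeneous:
  assumes f: "homogeneous d f"
  shows "\<exists>g. split_rel f g \<and> (if d = 0 then g = 0 else homogeneous (d - 1) g)"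
proof -
  obtain g where "split_rel f g" using split_rel_ex by blast
  hence "hom_component d (f - sec f - e1 * g) \<in> pair_top P Q"
    unfolding split_rel_def by (rule top_ideal_hom)
  hence "f - sec f - (if d = 0 then 0 else e1 * hom_component (d - 1) g) \<in> pair_top P Q"
    using f homogeneous_sec[OF f] by (simp add: hom_component_diff hom_e1_mult homogeneous_iff)
  thus ?thesis
    by (intro exI[of _ "if d = 0 then 0 else hom_component (d - 1) g"])
       (auto simp: split_rel_def split: if_splits)
qed

text \<open>Both choices are harmless: \<open>split_map_coset\<close> computes the value from any
  representative and any related g.\<close>

definition split_map :: "('n, complex) mpoly set \<Rightarrow> ('n, complex) mpoly set \<times> ('n, complex) mpoly set" where
  "split_map v = (let f = (SOME f. v = coset (pair_top P Q) f)
     in (coset (tanisaki_of P) f, coset (tanisaki_of Q) (SOME g. split_rel f g)))"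

lemma split_map_coset:
  assumes "split_rel f g"
  shows "split_map (coset (pair_top P Q) f) = (coset (tanisaki_of P) f, coset (tanisaki_of Q) g)"
proof -
  define f' where "f' = (SOME f'. coset (pair_top P Q) f = coset (pair_top P Q) f')"
  have "coset (pair_top P Q) f = coset (pair_top P Q) f'"
    unfolding f'_def by (rule someI[of _ f]) (rule refl)
  hence ff: "f - f' \<in> pair_top P Q" by (simp add: coset_eq_iff[OF IT])
  define g' where "g' = (SOME g. split_rel f' g)"
  have "split_rel f' g'" unfolding g'_def using split_rel_ex by (rule someI_ex)
  hence "g - g' \<in> tanisaki_of Q" using assms ff by (intro split_rel_unique)
  hence "coset (tanisaki_of Q) g = coset (tanisaki_of Q) g'" by (simp add: coset_eq_iff[OF IQ])
  moreover have "coset (tanisaki_of P) f = coset (tanisaki_of P) f'"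
    using ff T_sub by (auto simp: coset_eq_iff[OF IP])
  ultimately show ?thesis by (simp add: split_map_def Let_def f'_def[symmetric] g'_def[symmetric])
qed

lemma graded_iso_split:
  "graded_iso (quotient_rep (pair_top P Q)) (direct_sum (quotient_rep (tanisaki_of P)) (shift_up 1 (quotient_rep (tanisaki_of Q))))"
  (is "graded_iso ?V ?W")
proof -
  let ?cT = "coset (pair_top P Q)" and ?cP = "coset (tanisaki_of P)" and ?cQ = "coset (tanisaki_of Q)"
  note V = quotient_rep_simps[OF IT] and VP = quotient_rep_simps[OF IP] and VQ = quotient_rep_simps[OF IQ]
  note W = carrier_direct_sum add_direct_sum direct_sum_simps shift_up_simps
  obtain G where G: "\<And>f. split_rel f (G f)" using split_rel_ex by metis
  have sm: "split_map (?cT f) = (?cP f, ?cQ (G f))" for f by (rule split_map_coset[OF G])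
  have hom: "split_map \<in> hom (add_monoid ?V) (add_monoid ?W)"
  proof (rule homI)
    fix v w assume "v \<in> carrier (add_monoid ?V)" "w \<in> carrier (add_monoid ?V)"
    then obtain f f' where v: "v = ?cT f" "w = ?cT f'" by (auto simp: V)
    have "split_map (?cT (f + f')) = (?cP (f + f'), ?cQ (G f + G f'))"
      by (rule split_map_coset[OF split_rel_add[OF G G]])
    thus "split_map (v \<otimes>\<^bsub>add_monoid ?V\<^esub> w) = split_map v \<otimes>\<^bsub>add_monoid ?W\<^esub> split_map w"
      unfolding v by (simp add: V W VP VQ sm)
  qed (auto simp: V W VP VQ sm)
  have bij: "bij_betw split_map (carrier ?V) (carrier ?W)"
  proof (rule bij_betw_imageI)
    show "inj_on split_map (carrier ?V)"
    proof (rule inj_onI)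
      fix v w assume "v \<in> carrier ?V" "w \<in> carrier ?V" and eq: "split_map v = split_map w"
      then obtain f f' where v: "v = ?cT f" "w = ?cT f'" by (auto simp: V)
      have "f - f' \<in> tanisaki_of P" "G f - G f' \<in> tanisaki_of Q"
        using eq unfolding v sm by (simp_all add: coset_eq_iff[OF IP] coset_eq_iff[OF IQ])
      hence "f - f' \<in> pair_top P Q" by (rule split_rel_kernel[OF G G])
      thus "v = w" unfolding v by (simp add: coset_eq_iff[OF IT])
    qed
    show "split_map ` carrier ?V = carrier ?W"
    proof
      show "split_map ` carrier ?V \<subseteq> carrier ?W" by (auto simp: V W VP VQ sm)
      show "carrier ?W \<subseteq> split_map ` carrier ?V"
      proof
        fix x assume "x \<in> carrier ?W"
        then obtain f g where x: "x = (?cP f, ?cQ g)" by (auto simp: W VP VQ)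
        have "split_map (?cT (sec f + e1 * g)) = (?cP (sec f + e1 * g), ?cQ g)"
          by (rule split_map_coset[OF split_rel_surj(1)])
        also have "\<dots> = x" unfolding x using split_rel_surj(2) by (simp add: coset_eq_iff[OF IP])
        finally show "x \<in> split_map ` carrier ?V" by (auto simp: V intro!: image_eqI[of x])
      qed
    qed
  qed
  have smult: "split_map (c \<odot>\<^bsub>?V\<^esub> v) = c \<odot>\<^bsub>?W\<^esub> split_map v" if v0: "v \<in> carrier ?V" for c v
  proof -
    obtain f where v: "v = ?cT f" using v0 by (auto simp: V)
    have "split_map (?cT (cnst c * f)) = (?cP (cnst c * f), ?cQ (cnst c * G f))"
      by (rule split_map_coset[OF split_rel_scale[OF G]])
    thus ?thesis unfolding v by (simp add: V W VP VQ sm)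
  qed
  have act: "split_map (act ?V \<pi> v) = act ?W \<pi> (split_map v)" if \<pi>: "\<pi> permutes UNIV" and v0: "v \<in> carrier ?V" for \<pi> v
  proof -
    obtain f where v: "v = ?cT f" using v0 by (auto simp: V)
    have "split_map (?cT (perm_poly \<pi> f)) = (?cP (perm_poly \<pi> f), ?cQ (perm_poly \<pi> (G f)))"
      by (rule split_map_coset[OF split_rel_perm[OF \<pi> G]])
    thus ?thesis unfolding v
      by (simp add: W sm act_quotient_rep[OF IT perm_stable_top \<pi>] act_quotient_rep[OF IP perm_stable_tanisaki \<pi>]
          act_quotient_rep[OF IQ perm_stable_tanisaki \<pi>])
  qed
  have grade: "split_map ` grade ?V d = grade ?W d" for d
  proof
    show "split_map ` grade ?V d \<subseteq> grade ?W d"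
    proof
      fix x assume "x \<in> split_map ` grade ?V d"
      then obtain f where f: "homogeneous d f" "x = split_map (?cT f)" by (auto simp: V)
      obtain g where g: "split_rel f g" "if d = 0 then g = 0 else homogeneous (d - 1) g"
        using split_rel_homogeneous[OF f(1)] by blast
      have "x = (?cP f, ?cQ g)" unfolding f(2) by (rule split_map_coset[OF g(1)])
      thus "x \<in> grade ?W d" using f(1) g(2) by (auto simp: W VP VQ split: if_splits)
    qed
    show "grade ?W d \<subseteq> split_map ` grade ?V d"
    proof
      fix x assume "x \<in> grade ?W d"
      then obtain f g where f: "homogeneous d f" "if d = 0 then g = 0 else homogeneous (d - 1) g" and x: "x = (?cP f, ?cQ g)"
        by (cases "d = 0") (auto simp: W VP VQ)
      have "homogeneous d (e1 * g)"
        using f(2) homogeneous_mult[OF homogeneous_e1, of "d - 1" g] by (cases "d = 0") auto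
      hence "homogeneous d (sec f + e1 * g)" using homogeneous_sec[OF f(1)] by (intro homogeneous_add)
      moreover have "split_map (?cT (sec f + e1 * g)) = (?cP (sec f + e1 * g), ?cQ g)"
        by (rule split_map_coset[OF split_rel_surj(1)])
      moreover have "(?cP (sec f + e1 * g), ?cQ g) = x"
        unfolding x using split_rel_surj(2) by (simp add: coset_eq_iff[OF IP])
      ultimately show "x \<in> split_map ` grade ?V d" unfolding V by (metis (mono_tags, lifting) image_eqI mem_Collect_eq)
    qed
  qed
  have "split_map \<in> iso (add_monoid ?V) (add_monoid ?W)"
    using hom bij by (simp add: iso_def)
  thus ?thesis unfolding graded_iso_def using smult act grade by (intro bexI[of _ split_map]) auto
qed

end

theorem theorem2p2:
  fixes P Q :: "complex ^ 'n::finite"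
    and Y :: "(complex ^ 'n) set"
    and lam mu :: "nat list"
  assumes "lam = coord_partition P"
    and "mu = coord_partition Q"
    and "Y = Sn_orbits {P, Q}"
    and "dominance_le lam mu"
    and "(\<Sum>i\<in>UNIV. P $ i) \<noteq> (\<Sum>i\<in>UNIV. Q $ i)"
  shows "graded_iso (A_hat Y) (direct_sum (springer_R lam) (shift_up 1 (springer_R mu))) \<and>
    (\<forall>N. frob_q N (A_hat Y) = modified_HL N lam + cnst fls_X * modified_HL N mu)"
proof -
  \<comment> \<open>The injective colouring and the ordered list of variables only fix a monomial
    basis for the proof.\<close>
  obtain kap :: "'n \<Rightarrow> nat" and bs where kb: "inj kap" "distinct bs" "set bs = UNIV" "sorted (map kap bs)"
    by (rule ex_coloring)
  have dom: "dominance_le (coord_partition P) (coord_partition Q)" using assms by simp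
  show ?thesis
    unfolding A_hat_def springer_R_def assms(1-3)
    using graded_iso_split[OF dom assms(5) kb] frob_q_TPQ[OF dom assms(5) kb] by blast
qed

end
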